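(* Let $P\to M$ be a principal $\mathrm{T}^3$-bundle over a $3$-manifold $M$, and fix a basis $\{X_1,X_2,X_3\}$ of the Lie algebra $\mathfrak t^3$ of $\mathrm{T}^3$. Let $(\omega(t),\psi(t))$, $t\in(t_1,t_2)$, be a one-parameter family of $\mathrm{T}^3$-invariant sLag $\mathrm{SU}(3)$-structures on $P$, and let $(e(t),a(t),S(t))$ be the corresponding triples. Then the $G_2$-structure $$\omega(t)\wedge(\det S(t))^{1/2}dt+\psi(t)$$ on $P\times(t_1,t_2)$ is torsion-free if and only if, for every $t\in(t_1,t_2)$ and all $i,j\in\{1,2,3\}$, the following hold: (constraint conditions) $$de^i=0,\qquad \Omega_{ij}=\Omega_{ji},\qquad S_{i\alpha,\alpha}=0;$$ (equations of motion) $$\frac{\partial e^i}{\partial t}=0,\qquad \frac{\partial a^i}{\partial t}=-\epsilon_{i\alpha\beta}\tilde S_{k\alpha,\beta}\,e^k,\qquad \frac{\partial S_{ij}}{\partial t}=-\Omega_{ij}.$$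
   Context: All objects are $C^\infty$. Repeated indices are summed over $1,2,3$; $\epsilon_{ijk}$ is the Levi-Civita symbol; wedge signs are often omitted, $c^{ij}=c^i\wedge c^j$, $c^{123}=c^1\wedge c^2\wedge c^3$; for a triple of 1-forms $c^1,c^2,c^3$, $\hat c^i=\frac12\epsilon_{ijk}c^{jk}$. $\mathrm{SU}(3)$-structures: on $\mathbb{R}^6\cong\mathbb{C}^3$ with $z^k=x^k+\sqrt{-1}y^k$, let $\omega_0=\sum_k dx^k\wedge dy^k$ and $\psi_0=\mathrm{Im}(dz^1\wedge dz^2\wedge dz^3)$. An $\mathrm{SU}(3)$-structure on a 6-manifold is a pair $(\omega,\psi)$ of a real 2-form and a real 3-form that is pointwise isomorphic to $(\omega_0,\psi_0)$. $G_2$-structures: on $\mathbb{R}^7$ with coordinates $(x^0,x^1,y^1,x^2,y^2,x^3,y^3)$ let $\phi_0=\omega_0\wedge dx^0+\psi_0$. A $G_2$-structure on a 7-manifold is a 3-form $\phi$ pointwise isomorphic to $\phi_0$ (a definite 3-form); it determines a Riemannian metric and orientation (those corresponding to the Euclidean metric and to $dx^0dx^1dy^1dx^2dy^2dx^3dy^3$ for $\phi_0$), hence a Hodge star $\star_\phi$. It is torsion-free if $d\phi=0$ and $d\star_\phi\phi=0$. A $\mathrm{T}^3$-invariant sLag $\mathrm{SU}(3)$-structure on $P$ is an $\mathrm{SU}(3)$-structure $(\omega,\psi)$ on $P$ with $\omega,\psi$ invariant under the right $\mathrm{T}^3$-action and with $\omega|_F=0$, $\psi|_F=0$ on every fiber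 $F$ of $P\to M$. Triples: $e=e^kX_k$ is a solder 1-form, i.e. a $\mathrm{T}^3$-invariant horizontal $\mathfrak t^3$-valued 1-form with $e^{123}\ne0$ everywhere (so the $e^k$ are 1-forms on $M$); $a=a^kX_k$ is a connection 1-form on $P$; $S=(S_{ij})$ is a $\mathrm{T}^3$-invariant function with values in positive-definite symmetric $3\times3$ real matrices (a function on $M$). With $\tilde S=(\det S)S^{-1}$, the triple $(e,a,S)$ corresponds to $(\omega,\psi)$ when $$\omega=(\det S)^{-1/2}\tilde S_{ij}\,a^i e^j,\qquad \psi=-(\det S)e^{123}+e^k\hat a^k.$$ Curvature and derivatives: $da^i=\Omega_{ij}\hat e^j$; for a function $A$ on $M$ (in particular for entries $S_{ij}$, $\tilde S_{ij}$), $dA=A_{,k}e^k$, so $dS_{ij}=S_{ij,k}e^k$. Here $d$ is the exterior derivative on $P$ at fixed $t$. *)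

theory Defs
  imports "HOL-Analysis.Analysis" "HOL-Combinatorics.Permutations"
begin

section \<open>Smooth maps between Euclidean spaces\<close>

text \<open>
  \<open>Ck_on n S f\<close> and \<open>smooth_on S f\<close> are meant for open \<open>S\<close> in a finite-dimensional space;
  \<open>frechet_derivative f (at x)\<close> then only sees \<open>f\<close> near \<open>x\<close>.  In finite dimension a map is
  \<open>C\<^sup>n\<^sup>+\<^sup>1\<close> iff it is differentiable and all its directional derivatives are \<open>C\<^sup>n\<close>.
\<close>

fun Ck_on :: "nat \<Rightarrow> 'a::real_normed_vector set \<Rightarrow> ('a \<Rightarrow> 'b::real_normed_vector) \<Rightarrow> bool" where
  "Ck_on 0 S f \<longleftrightarrow> continuous_on S f"
| "Ck_on (Suc n) S f \<longleftrightarrow>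
     (\<forall>x\<in>S. f differentiable (at x)) \<and> (\<forall>v. Ck_on n S (\<lambda>x. frechet_derivative f (at x) v))"

definition smooth_on :: "'a::real_normed_vector set \<Rightarrow> ('a \<Rightarrow> 'b::real_normed_vector) \<Rightarrow> bool" where
  "smooth_on S f \<longleftrightarrow> (\<forall>n. Ck_on n S f)"


section \<open>Smooth manifolds\<close>

text \<open>
  A chart is a pair of its domain and its coordinate map; outside the domain the coordinate map
  is arbitrary.  A manifold is given by a topology and a (not necessarily maximal) smooth atlas;
  its dimension is that of the coordinate space \<open>'e\<close>.
\<close>

type_synonym ('a, 'e) chart = "'a set \<times> ('a \<Rightarrow> 'e)"

record ('a, 'e) mfd =
  mtop :: "'a topology"
  atlas :: "('a, 'e) chart set"

abbreviation points :: "('a, 'e) mfd \<Rightarrow> 'a set" where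
  "points M \<equiv> topspace (mtop M)"

definition chart_inv :: "('a, 'e) chart \<Rightarrow> 'e \<Rightarrow> 'a" where
  "chart_inv C = inv_into (fst C) (snd C)"

definition smooth_manifold :: "('a, 'e::euclidean_space) mfd \<Rightarrow> bool" where
  "smooth_manifold M \<longleftrightarrow>
     Hausdorff_space (mtop M) \<and> second_countable (mtop M) \<and>
     (\<forall>(D, c)\<in>atlas M. openin (mtop M) D \<and> open (c ` D) \<and>
        homeomorphic_map (subtopology (mtop M) D) (top_of_set (c ` D)) c) \<and>
     (\<Union>C\<in>atlas M. fst C) = points M \<and>
     (\<forall>C\<in>atlas M. \<forall>C'\<in>atlas M.
        smooth_on (snd C ` (fst C \<inter> fst C')) (snd C' \<circ> chart_inv C))"

definition smooth_map ::
  "('a, 'e::euclidean_space) mfd \<Rightarrow> ('b, 'f::euclidean_space) mfd \<Rightarrow> ('a \<Rightarrow> 'b) \<Rightarrow> bool" where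
  "smooth_map M N f \<longleftrightarrow>
     continuous_map (mtop M) (mtop N) f \<and>
     (\<forall>C\<in>atlas M. \<forall>C'\<in>atlas N.
        smooth_on (snd C ` {p \<in> fst C. f p \<in> fst C'}) (snd C' \<circ> f \<circ> chart_inv C))"

definition diffeomorphism ::
  "('a, 'e::euclidean_space) mfd \<Rightarrow> ('b, 'f::euclidean_space) mfd \<Rightarrow> ('a \<Rightarrow> 'b) \<Rightarrow> bool" where
  "diffeomorphism M N f \<longleftrightarrow>
     (\<exists>g. smooth_map M N f \<and> smooth_map N M g \<and>
          (\<forall>p\<in>points M. g (f p) = p) \<and> (\<forall>q\<in>points N. f (g q) = q))"

definition open_submfd :: "('a, 'e) mfd \<Rightarrow> 'a set \<Rightarrow> ('a, 'e) mfd" where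
  "open_submfd M U =
     \<lparr>mtop = subtopology (mtop M) U, atlas = {(D \<inter> U, c) | D c. (D, c) \<in> atlas M}\<rparr>"

definition prod_mfd :: "('a, 'e) mfd \<Rightarrow> ('b, 'f) mfd \<Rightarrow> ('a \<times> 'b, 'e \<times> 'f) mfd" where
  "prod_mfd M N =
     \<lparr>mtop = prod_topology (mtop M) (mtop N),
      atlas = {(D \<times> D', map_prod c c') | D c D' c'. (D, c) \<in> atlas M \<and> (D', c') \<in> atlas N}\<rparr>"

definition euclidean_open_mfd :: "'e::euclidean_space set \<Rightarrow> ('e, 'e) mfd" where
  "euclidean_open_mfd U = \<lparr>mtop = top_of_set U, atlas = {(U, id)}\<rparr>"

text \<open>The coordinate expression of the tangent map of \<open>f\<close> at \<open>p\<close> in the charts \<open>C\<close> and \<open>C'\<close>.\<close>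

definition tangent_map ::
  "('a \<Rightarrow> 'b) \<Rightarrow> ('a, 'e::euclidean_space) chart \<Rightarrow> ('b, 'f::euclidean_space) chart \<Rightarrow> 'a \<Rightarrow> 'e \<Rightarrow> 'f" where
  "tangent_map f C C' p = frechet_derivative (snd C' \<circ> f \<circ> chart_inv C) (at (snd C p))"


section \<open>Exterior algebra of a vector space\<close>

text \<open>
  A \<open>k\<close>-covector on \<open>'v\<close> is an alternating multilinear function of \<open>k\<close> vectors, taken as a function
  of sequences of vectors that only looks at the first \<open>k\<close> entries.
\<close>

type_synonym ('v, 'b) covector = "(nat \<Rightarrow> 'v) \<Rightarrow> 'b"

definition alternating :: "nat \<Rightarrow> ('v::real_vector, real) covector \<Rightarrow> bool" where
  "alternating k \<alpha> \<longleftrightarrow>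
     (\<forall>u v. (\<forall>i<k. u i = v i) \<longrightarrow> \<alpha> u = \<alpha> v) \<and>
     (\<forall>i<k. \<forall>v. linear (\<lambda>w. \<alpha> (v(i := w)))) \<and>
     (\<forall>i j v. i < j \<and> j < k \<and> v i = v j \<longrightarrow> \<alpha> v = 0)"

text \<open>
  The normalisation is the one for which \<open>(\<alpha> \<and> \<beta>)(u, v) = \<alpha>(u) \<beta>(v) - \<alpha>(v) \<beta>(u)\<close> for
  1-covectors.
\<close>

definition wedge ::
  "nat \<Rightarrow> nat \<Rightarrow> ('v, 'b) covector \<Rightarrow> ('v, 'b) covector \<Rightarrow> ('v, 'b::field_char_0) covector" where
  "wedge k l \<alpha> \<beta> v =
     (\<Sum>\<sigma> | \<sigma> permutes {..<k + l}.
        of_int (sign \<sigma>) * \<alpha> (\<lambda>i. v (\<sigma> i)) * \<beta> (\<lambda>i. v (\<sigma> (k + i)))) / (fact k * fact l)"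

text \<open>The wedge product of a list of 1-covectors.\<close>

fun wedge_list :: "('v, 'b) covector list \<Rightarrow> ('v, 'b::field_char_0) covector" where
  "wedge_list [] = (\<lambda>v. 1)"
| "wedge_list (\<alpha> # \<alpha>s) = wedge 1 (length \<alpha>s) \<alpha> (wedge_list \<alpha>s)"

definition levi_civita :: "3 \<Rightarrow> 3 \<Rightarrow> 3 \<Rightarrow> real" where
  "levi_civita i j k =
     (if (i, j, k) \<in> {(1, 2, 3), (2, 3, 1), (3, 1, 2)} then 1
      else if (i, j, k) \<in> {(1, 3, 2), (2, 1, 3), (3, 2, 1)} then - 1
      else 0)"

definition hat :: "(3 \<Rightarrow> ('v, real) covector) \<Rightarrow> 3 \<Rightarrow> ('v, real) covector" where
  "hat c i v = 1 / 2 * (\<Sum>j\<in>UNIV. \<Sum>k\<in>UNIV. levi_civita i j k * wedge 1 1 (c j) (c k) v)"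


section \<open>Differential forms\<close>

text \<open>
  A differential form on \<open>M\<close> is the family of its coordinate expressions: \<open>F C x\<close> is the covector
  expressing \<open>F\<close> in the chart \<open>C\<close> at the point with coordinates \<open>x\<close>.  The coordinate expressions
  have to be related by the tangent maps of the coordinate changes; what \<open>F C x\<close> is for \<open>C\<close> outside
  the atlas or \<open>x\<close> outside the image of \<open>C\<close> is irrelevant, and \<open>form_eq\<close> is equality of forms.
\<close>

type_synonym ('a, 'e) form = "('a, 'e) chart \<Rightarrow> 'e \<Rightarrow> ('e, real) covector"

definition form_on :: "('a, 'e::euclidean_space) mfd \<Rightarrow> nat \<Rightarrow> ('a, 'e) form \<Rightarrow> bool" where
  "form_on M k F \<longleftrightarrow>
     (\<forall>C\<in>atlas M. (\<forall>x\<in>snd C ` fst C. alternating k (F C x)) \<and>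
        (\<forall>v. smooth_on (snd C ` fst C) (\<lambda>x. F C x v))) \<and>
     (\<forall>C\<in>atlas M. \<forall>C'\<in>atlas M. \<forall>p\<in>fst C \<inter> fst C'. \<forall>v.
        F C (snd C p) v = F C' (snd C' p) (\<lambda>i. tangent_map id C C' p (v i)))"

definition form_eq :: "('a, 'e) mfd \<Rightarrow> ('a, 'e) form \<Rightarrow> ('a, 'e) form \<Rightarrow> bool" where
  "form_eq M F G \<longleftrightarrow> (\<forall>C\<in>atlas M. \<forall>p\<in>fst C. \<forall>v. F C (snd C p) v = G C (snd C p) v)"

abbreviation zero_form :: "('a, 'e) form" where
  "zero_form \<equiv> (\<lambda>C x v. 0)"

definition fun_form :: "('a \<Rightarrow> real) \<Rightarrow> ('a, 'e) form" where
  "fun_form f C x v = f (chart_inv C x)"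

text \<open>
  Exterior derivative of a \<open>k\<close>-form:
  \<open>dF(v\<^sub>0, \<dots>, v\<^sub>k) = \<Sum>\<^sub>i (-1)\<^sup>i D\<^bsub>v\<^sub>i\<^esub> F(v\<^sub>0, \<dots>, v\<^sub>k without v\<^sub>i)\<close> for constant coordinate vectors \<open>v\<^sub>i\<close>.
\<close>

definition ext_deriv :: "nat \<Rightarrow> ('a, 'e::euclidean_space) form \<Rightarrow> ('a, 'e) form" where
  "ext_deriv k F C x v =
     (\<Sum>i\<le>k. (-1) ^ i *
        frechet_derivative (\<lambda>y. F C y (\<lambda>j. if j < i then v j else v (Suc j))) (at x) (v i))"

text \<open>
  Pullback of a form on \<open>N\<close> along \<open>f\<close>; for a form in the sense of \<open>form_on\<close> the choice of the chart
  \<open>C'\<close> of \<open>N\<close> does not matter.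
\<close>

definition pullback ::
  "('b, 'f) mfd \<Rightarrow> ('a \<Rightarrow> 'b) \<Rightarrow> ('b, 'f::euclidean_space) form \<Rightarrow> ('a, 'e::euclidean_space) form" where
  "pullback N f F C x v =
     (let p = chart_inv C x; C' = (SOME C'. C' \<in> atlas N \<and> f p \<in> fst C')
      in F C' (snd C' (f p)) (\<lambda>i. tangent_map f C C' p (v i)))"

text \<open>Families of forms and functions depending smoothly on \<open>(p, t)\<close>, and their \<open>t\<close>-derivatives.\<close>

definition smooth_form_family ::
  "('a, 'e::euclidean_space) mfd \<Rightarrow> real set \<Rightarrow> nat \<Rightarrow> (real \<Rightarrow> ('a, 'e) form) \<Rightarrow> bool" where
  "smooth_form_family M I k F \<longleftrightarrow>
     (\<forall>t\<in>I. form_on M k (F t)) \<and>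
     (\<forall>C\<in>atlas M. \<forall>v. smooth_on ((snd C ` fst C) \<times> I) (\<lambda>(x, t). F t C x v))"

definition smooth_fun_family ::
  "('a, 'e::euclidean_space) mfd \<Rightarrow> real set \<Rightarrow> (real \<Rightarrow> 'a \<Rightarrow> 'b::real_normed_vector) \<Rightarrow> bool" where
  "smooth_fun_family M I f \<longleftrightarrow>
     (\<forall>C\<in>atlas M. smooth_on ((snd C ` fst C) \<times> I) (\<lambda>(x, t). f t (chart_inv C x)))"

definition form_dt :: "(real \<Rightarrow> ('a, 'e) form) \<Rightarrow> real \<Rightarrow> ('a, 'e) form" where
  "form_dt F t C x v = vector_derivative (\<lambda>s. F s C x v) (at t)"


section \<open>Principal torus bundles\<close>

text \<open>
  The torus is \<open>U(1)\<^sup>3\<close> with componentwise multiplication.  Its Lie algebra is identified with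
  \<open>\<real>\<^sup>3\<close> so that \<open>torus_exp\<close> is the exponential map; the branches of its inverse are the charts.
\<close>

definition torus :: "(complex^3) set" where
  "torus = {g. \<forall>i. cmod (g $ i) = 1}"

definition torus_exp :: "real^3 \<Rightarrow> complex^3" where
  "torus_exp \<xi> = (\<chi> k. cis (2 * pi * \<xi> $ k))"

definition torus_mfd :: "(complex^3, real^3) mfd" where
  "torus_mfd =
     \<lparr>mtop = top_of_set torus,
      atlas = {(torus_exp ` box u (u + 1), inv_into (box u (u + 1)) torus_exp) | u. True}\<rparr>"

definition principal_T3_bundle ::
  "('p, real^6) mfd \<Rightarrow> ('m, real^3) mfd \<Rightarrow> ('p \<Rightarrow> 'm) \<Rightarrow> ('p \<Rightarrow> complex^3 \<Rightarrow> 'p) \<Rightarrow> bool" where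
  "principal_T3_bundle P M pr act \<longleftrightarrow>
     smooth_manifold P \<and> smooth_manifold M \<and> smooth_map P M pr \<and>
     smooth_map (prod_mfd P torus_mfd) P (\<lambda>(p, g). act p g) \<and>
     (\<forall>p\<in>points P. act p 1 = p \<and>
        (\<forall>g\<in>torus. \<forall>h\<in>torus. act (act p g) h = act p (g * h))) \<and>
     (\<forall>m\<in>points M. \<exists>U h. openin (mtop M) U \<and> m \<in> U \<and>
        diffeomorphism (open_submfd P {p \<in> points P. pr p \<in> U})
          (prod_mfd (open_submfd M U) torus_mfd) h \<and>
        (\<forall>p\<in>points P. pr p \<in> U \<longrightarrow>
           fst (h p) = pr p \<and> (\<forall>g\<in>torus. h (act p g) = (pr p, snd (h p) * g))))"

text \<open>Vectors tangent to the fibres, in the chart \<open>C\<close> at \<open>p\<close>.\<close>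

definition vertical ::
  "('m, real^3) mfd \<Rightarrow> ('p \<Rightarrow> 'm) \<Rightarrow> ('p, real^6) chart \<Rightarrow> 'p \<Rightarrow> real^6 \<Rightarrow> bool" where
  "vertical M pr C p w \<longleftrightarrow>
     (\<forall>C'\<in>atlas M. pr p \<in> fst C' \<longrightarrow> tangent_map pr C C' p w = 0)"

text \<open>The fundamental vector field of the Lie algebra element \<open>\<xi>\<close>, in the chart \<open>C\<close> at \<open>p\<close>.\<close>

definition fundamental_vector ::
  "('p \<Rightarrow> complex^3 \<Rightarrow> 'p) \<Rightarrow> real^3 \<Rightarrow> ('p, real^6) chart \<Rightarrow> 'p \<Rightarrow> real^6" where
  "fundamental_vector act \<xi> C p =
     vector_derivative (\<lambda>s. snd C (act p (torus_exp (s *\<^sub>R \<xi>)))) (at 0)"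

definition invariant_form ::
  "('p, real^6) mfd \<Rightarrow> ('p \<Rightarrow> complex^3 \<Rightarrow> 'p) \<Rightarrow> ('p, real^6) form \<Rightarrow> bool" where
  "invariant_form P act F \<longleftrightarrow> (\<forall>g\<in>torus. form_eq P (pullback P (\<lambda>p. act p g) F) F)"

definition invariant_fun ::
  "('p, real^6) mfd \<Rightarrow> ('p \<Rightarrow> complex^3 \<Rightarrow> 'p) \<Rightarrow> ('p \<Rightarrow> 'b) \<Rightarrow> bool" where
  "invariant_fun P act f \<longleftrightarrow> (\<forall>g\<in>torus. \<forall>p\<in>points P. f (act p g) = f p)"

text \<open>The restriction of a \<open>k\<close>-form to every fibre vanishes.\<close>

definition vanishes_on_fibres ::
  "('p, real^6) mfd \<Rightarrow> ('m, real^3) mfd \<Rightarrow> ('p \<Rightarrow> 'm) \<Rightarrow> nat \<Rightarrow> ('p, real^6) form \<Rightarrow> bool" where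
  "vanishes_on_fibres P M pr k F \<longleftrightarrow>
     (\<forall>C\<in>atlas P. \<forall>p\<in>fst C. \<forall>v. (\<forall>i<k. vertical M pr C p (v i)) \<longrightarrow> F C (snd C p) v = 0)"

definition horizontal_1form ::
  "('p, real^6) mfd \<Rightarrow> ('m, real^3) mfd \<Rightarrow> ('p \<Rightarrow> 'm) \<Rightarrow> ('p, real^6) form \<Rightarrow> bool" where
  "horizontal_1form P M pr F \<longleftrightarrow> vanishes_on_fibres P M pr 1 F"


section \<open>SU(3)-structures\<close>

definition dz :: "3 \<Rightarrow> (complex^3, complex) covector" where
  "dz k v = v 0 $ k"

definition dx :: "3 \<Rightarrow> (complex^3, real) covector" where
  "dx k v = Re (v 0 $ k)"

definition dy :: "3 \<Rightarrow> (complex^3, real) covector" where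
  "dy k v = Im (v 0 $ k)"

definition omega0 :: "(complex^3, real) covector" where
  "omega0 v = (\<Sum>k\<in>UNIV. wedge 1 1 (dx k) (dy k) v)"

definition psi0 :: "(complex^3, real) covector" where
  "psi0 v = Im (wedge_list [dz 1, dz 2, dz 3] v)"

definition SU3_structure ::
  "('p, real^6) mfd \<Rightarrow> ('p, real^6) form \<Rightarrow> ('p, real^6) form \<Rightarrow> bool" where
  "SU3_structure P \<omega> \<psi> \<longleftrightarrow>
     form_on P 2 \<omega> \<and> form_on P 3 \<psi> \<and>
     (\<forall>C\<in>atlas P. \<forall>p\<in>fst C. \<exists>L :: real^6 \<Rightarrow> complex^3. linear L \<and> bij L \<and>
        (\<forall>v. \<omega> C (snd C p) v = omega0 (L \<circ> v)) \<and> (\<forall>v. \<psi> C (snd C p) v = psi0 (L \<circ> v)))"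

definition invariant_sLag_SU3_structure ::
  "('p, real^6) mfd \<Rightarrow> ('m, real^3) mfd \<Rightarrow> ('p \<Rightarrow> 'm) \<Rightarrow> ('p \<Rightarrow> complex^3 \<Rightarrow> 'p) \<Rightarrow>
   ('p, real^6) form \<Rightarrow> ('p, real^6) form \<Rightarrow> bool" where
  "invariant_sLag_SU3_structure P M pr act \<omega> \<psi> \<longleftrightarrow>
     SU3_structure P \<omega> \<psi> \<and>
     invariant_form P act \<omega> \<and> invariant_form P act \<psi> \<and>
     vanishes_on_fibres P M pr 2 \<omega> \<and> vanishes_on_fibres P M pr 3 \<psi>"


section \<open>\<open>G\<^sub>2\<close>-structures\<close>

text \<open>
  \<open>\<real>\<^sup>7\<close> with coordinates \<open>(x\<^sup>0, x\<^sup>1, y\<^sup>1, x\<^sup>2, y\<^sup>2, x\<^sup>3, y\<^sup>3)\<close> is \<open>real \<times> (complex^3)\<close>, whose inner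
  product is the Euclidean one.
\<close>

definition dx0 :: "(real \<times> (complex^3), real) covector" where
  "dx0 v = fst (v 0)"

definition dx7 :: "3 \<Rightarrow> (real \<times> (complex^3), real) covector" where
  "dx7 k v = dx k (snd \<circ> v)"

definition dy7 :: "3 \<Rightarrow> (real \<times> (complex^3), real) covector" where
  "dy7 k v = dy k (snd \<circ> v)"

definition phi0 :: "(real \<times> (complex^3), real) covector" where
  "phi0 v = wedge 2 1 (\<lambda>u. omega0 (snd \<circ> u)) dx0 v + psi0 (snd \<circ> v)"

definition vol0 :: "(real \<times> (complex^3), real) covector" where
  "vol0 = wedge_list [dx0, dx7 1, dy7 1, dx7 2, dy7 2, dx7 3, dy7 3]"

definition g2_frame ::
  "('v::euclidean_space, real) covector \<Rightarrow> ('v \<Rightarrow> real \<times> (complex^3)) \<Rightarrow> bool" where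
  "g2_frame \<phi> L \<longleftrightarrow> linear L \<and> bij L \<and> (\<forall>v. \<phi> v = phi0 (L \<circ> v))"

text \<open>
  The metric and the volume form of a definite 3-covector; they do not depend on \<open>L\<close> because the
  stabiliser of \<open>phi0\<close> lies in \<open>SO(7)\<close>.
\<close>

definition g2_metric :: "('v::euclidean_space, real) covector \<Rightarrow> 'v \<Rightarrow> 'v \<Rightarrow> real" where
  "g2_metric \<phi> u w = (THE r. \<exists>L. g2_frame \<phi> L \<and> r = L u \<bullet> L w)"

definition g2_vol :: "('v::euclidean_space, real) covector \<Rightarrow> ('v, real) covector" where
  "g2_vol \<phi> v = (THE r. \<exists>L. g2_frame \<phi> L \<and> r = vol0 (L \<circ> v))"

definition orthonormal_basis :: "('v::euclidean_space \<Rightarrow> 'v \<Rightarrow> real) \<Rightarrow> (nat \<Rightarrow> 'v) \<Rightarrow> bool" where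
  "orthonormal_basis g b \<longleftrightarrow>
     (\<forall>i<DIM('v). \<forall>j<DIM('v). g (b i) (b j) = (if i = j then 1 else 0))"

text \<open>
  Hodge star of a \<open>k\<close>-covector \<open>\<beta>\<close> for the metric \<open>g\<close> and the volume form \<open>vol\<close>, by the component
  formula
  \<open>(\<star>\<beta>)(v\<^sub>1, \<dots>) = 1/k! \<Sum> \<beta>(b\<^bsub>i\<^sub>1\<^esub>, \<dots>, b\<^bsub>i\<^sub>k\<^esub>) vol(b\<^bsub>i\<^sub>1\<^esub>, \<dots>, b\<^bsub>i\<^sub>k\<^esub>, v\<^sub>1, \<dots>)\<close>,
  which is independent of the \<open>g\<close>-orthonormal basis \<open>b\<close>.  The convention is
  \<open>\<alpha> \<and> \<star>\<beta> = \<langle>\<alpha>, \<beta>\<rangle> vol\<close>.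
\<close>

definition hodge_star ::
  "('v::euclidean_space \<Rightarrow> 'v \<Rightarrow> real) \<Rightarrow> ('v, real) covector \<Rightarrow> nat \<Rightarrow>
   ('v, real) covector \<Rightarrow> ('v, real) covector" where
  "hodge_star g vol k \<beta> v =
     (let b = (SOME b. orthonormal_basis g b)
      in (\<Sum>s \<in> {..<k} \<rightarrow>\<^sub>E {..<DIM('v)}.
            \<beta> (\<lambda>i. b (s i)) * vol (\<lambda>i. if i < k then b (s i) else v (i - k))) / fact k)"

definition G2_structure :: "('a, 'e::euclidean_space) mfd \<Rightarrow> ('a, 'e) form \<Rightarrow> bool" where
  "G2_structure N \<phi> \<longleftrightarrow>
     form_on N 3 \<phi> \<and> (\<forall>C\<in>atlas N. \<forall>p\<in>fst C. \<exists>L. g2_frame (\<phi> C (snd C p)) L)"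

definition star_phi :: "('a, 'e::euclidean_space) form \<Rightarrow> ('a, 'e) form" where
  "star_phi \<phi> C x = hodge_star (g2_metric (\<phi> C x)) (g2_vol (\<phi> C x)) 3 (\<phi> C x)"

definition torsion_free :: "('a, 'e::euclidean_space) mfd \<Rightarrow> ('a, 'e) form \<Rightarrow> bool" where
  "torsion_free N \<phi> \<longleftrightarrow>
     form_eq N (ext_deriv 3 \<phi>) zero_form \<and> form_eq N (ext_deriv 4 (star_phi \<phi>)) zero_form"


section \<open>Triples\<close>

text \<open>
  Forms with values in the Lie algebra are given by their components \<open>e i\<close>, \<open>a i\<close> with respect to a
  basis \<open>X\<close>.  As the torus is abelian, equivariance is invariance of the components.
\<close>

definition solder_form ::
  "('p, real^6) mfd \<Rightarrow> ('m, real^3) mfd \<Rightarrow> ('p \<Rightarrow> 'm) \<Rightarrow> ('p \<Rightarrow> complex^3 \<Rightarrow> 'p) \<Rightarrow>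
   (3 \<Rightarrow> ('p, real^6) form) \<Rightarrow> bool" where
  "solder_form P M pr act e \<longleftrightarrow>
     (\<forall>k. form_on P 1 (e k) \<and> invariant_form P act (e k) \<and> horizontal_1form P M pr (e k)) \<and>
     (\<forall>C\<in>atlas P. \<forall>p\<in>fst C. \<exists>v.
        wedge_list [e 1 C (snd C p), e 2 C (snd C p), e 3 C (snd C p)] v \<noteq> 0)"

definition connection_form ::
  "('p, real^6) mfd \<Rightarrow> ('p \<Rightarrow> complex^3 \<Rightarrow> 'p) \<Rightarrow> (3 \<Rightarrow> real^3) \<Rightarrow>
   (3 \<Rightarrow> ('p, real^6) form) \<Rightarrow> bool" where
  "connection_form P act X a \<longleftrightarrow>
     (\<forall>k. form_on P 1 (a k) \<and> invariant_form P act (a k)) \<and>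
     (\<forall>C\<in>atlas P. \<forall>p\<in>fst C. \<forall>\<xi>.
        (\<Sum>k\<in>UNIV. a k C (snd C p) (\<lambda>i. fundamental_vector act \<xi> C p) *\<^sub>R X k) = \<xi>)"

definition posdef_symmetric :: "real^3^3 \<Rightarrow> bool" where
  "posdef_symmetric A \<longleftrightarrow> transpose A = A \<and> (\<forall>x. x \<noteq> 0 \<longrightarrow> x \<bullet> (A *v x) > 0)"

definition tilde :: "real^3^3 \<Rightarrow> real^3^3" where
  "tilde A = det A *\<^sub>R matrix_inv A"

definition triple_corresponds ::
  "('p, real^6) mfd \<Rightarrow> (3 \<Rightarrow> ('p, real^6) form) \<Rightarrow> (3 \<Rightarrow> ('p, real^6) form) \<Rightarrow> ('p \<Rightarrow> real^3^3) \<Rightarrow>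
   ('p, real^6) form \<Rightarrow> ('p, real^6) form \<Rightarrow> bool" where
  "triple_corresponds P e a S \<omega> \<psi> \<longleftrightarrow>
     form_eq P \<omega> (\<lambda>C x v. let A = S (chart_inv C x) in
       det A powr (- 1 / 2) *
       (\<Sum>i\<in>UNIV. \<Sum>j\<in>UNIV. tilde A $ i $ j * wedge 1 1 (a i C x) (e j C x) v)) \<and>
     form_eq P \<psi> (\<lambda>C x v. let A = S (chart_inv C x) in
       - det A * wedge_list [e 1 C x, e 2 C x, e 3 C x] v +
       (\<Sum>k\<in>UNIV. wedge 1 2 (e k C x) (hat (\<lambda>i. a i C x) k) v))"

text \<open>\<open>curvature_coeff P e a p $ i $ j\<close> is \<open>\<Omega>\<^sub>i\<^sub>j\<close> at \<open>p\<close>, where \<open>da\<^sup>i = \<Omega>\<^sub>i\<^sub>j \<hat>e\<^sup>j\<close>.\<close>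

definition curvature_coeff ::
  "('p, real^6) mfd \<Rightarrow> (3 \<Rightarrow> ('p, real^6) form) \<Rightarrow> (3 \<Rightarrow> ('p, real^6) form) \<Rightarrow> 'p \<Rightarrow> real^3^3" where
  "curvature_coeff P e a p =
     (THE W. \<forall>C\<in>atlas P. p \<in> fst C \<longrightarrow> (\<forall>i v.
        ext_deriv 1 (a i) C (snd C p) v =
        (\<Sum>j\<in>UNIV. W $ i $ j * hat (\<lambda>k. e k C (snd C p)) j v)))"

text \<open>\<open>frame_deriv P e A k p\<close> is \<open>A\<^sub>,\<^sub>k\<close> at \<open>p\<close>, where \<open>dA = A\<^sub>,\<^sub>k e\<^sup>k\<close>.\<close>

definition frame_deriv ::
  "('p, real^6) mfd \<Rightarrow> (3 \<Rightarrow> ('p, real^6) form) \<Rightarrow> ('p \<Rightarrow> real) \<Rightarrow> 3 \<Rightarrow> 'p \<Rightarrow> real" where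
  "frame_deriv P e A k p =
     (THE B :: real^3. \<forall>C\<in>atlas P. p \<in> fst C \<longrightarrow> (\<forall>v.
        ext_deriv 0 (fun_form A) C (snd C p) v = (\<Sum>l\<in>UNIV. B $ l * e l C (snd C p) v))) $ k"


section \<open>The 3-form on \<open>P \<times> I\<close>\<close>

text \<open>
  A family of forms \<open>F t\<close> on \<open>P\<close> as a form on \<open>P \<times> I\<close>: at \<open>(p, t)\<close> it is the pullback of \<open>F t\<close>
  along the projection to \<open>P\<close>.
\<close>

definition family_form ::
  "('p, real^6) mfd \<Rightarrow> (real \<Rightarrow> ('p, real^6) form) \<Rightarrow> ('p \<times> real, (real^6) \<times> real) form" where
  "family_form P F C y = pullback P fst (F (snd (chart_inv C y))) C y"

definition dt_form :: "('p \<times> real, (real^6) \<times> real) form" where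
  "dt_form = ext_deriv 0 (fun_form snd)"

definition evolution_3form ::
  "('p, real^6) mfd \<Rightarrow> (real \<Rightarrow> 'p \<Rightarrow> real^3^3) \<Rightarrow> (real \<Rightarrow> ('p, real^6) form) \<Rightarrow>
   (real \<Rightarrow> ('p, real^6) form) \<Rightarrow> ('p \<times> real, (real^6) \<times> real) form" where
  "evolution_3form P S \<omega> \<psi> C y v =
     (let (p, t) = chart_inv C y in
        wedge 2 1 (family_form P \<omega> C y) (\<lambda>u. det (S t p) powr (1 / 2) * dt_form C y u) v +
        family_form P \<psi> C y v)"

end

theory Submission
  imports Defs
begin

text \<open>
  Over a chart of \<open>P\<close> the forms \<open>dt\<close>, \<open>e\<^sup>i\<close>, \<open>a\<^sup>i\<close> form a coframe of \<open>P \<times> I\<close>: at each point they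
  give a linear bijection \<open>theta\<close> onto \<open>\<real> \<times> \<real>\<^sup>3 \<times> \<real>\<^sup>3\<close>.  In this coframe the 3-form of the theorem
  has coefficients that depend on \<open>S\<close> alone.  With \<open>S~\<close> for the adjugate of \<open>S\<close> and
  \<open>^c\<^sup>i = 1/2 \<epsilon>\<^sub>i\<^sub>j\<^sub>k c\<^sup>j\<^sup>k\<close> it is \<open>S~\<^sub>i\<^sub>j a\<^sup>i e\<^sup>j dt - det S e\<^sup>1\<^sup>2\<^sup>3 + e\<^sup>k ^a\<^sup>k\<close>, written \<open>Phi3 (det S) (tilde S)\<close>; the
  factors \<open>(det S)\<^sup>-\<^sup>1\<^sup>/\<^sup>2\<close> in \<open>\<omega>\<close> and \<open>(det S)\<^sup>1\<^sup>/\<^sup>2\<close> in front of \<open>dt\<close> cancel.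

  If \<open>S = G G\<^sup>T\<close> is a Cholesky factorisation, a linear change of coframe built from \<open>G\<close> turns this form
  into the model form, so that it is definite (\<open>g2_frame_Phi3\<close>).  The same change of coframe
  computes the dual 4-form, \<open>- S\<^sub>i\<^sub>j ^a\<^sup>i ^e\<^sup>j - (a\<^sup>1\<^sup>2\<^sup>3 - det S a\<^sup>k ^e\<^sup>k) dt\<close>, written \<open>Psi4 (det S) S\<close>.  For
  this the Hodge star must be independent of the frame that identifies a definite form with the
  model, that is, the stabiliser of the model form must lie in \<open>SO(7)\<close> (\<open>stabiliser_phi0\<close>).

  Exterior derivatives of forms with such coefficients involve only \<open>dS\<close> and the differentials of the
  coframe.  As \<open>e\<close>, \<open>a\<close> and \<open>S\<close> are invariant, \<open>e\<close> is horizontal and \<open>a\<close> takes constant values on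
  fundamental vector fields, Cartan's formula (\<open>d1_fundamental\<close>) makes these differentials horizontal,
  so that there are matrices \<open>T\<close>, \<open>P\<close>, \<open>\<Omega>\<close>, \<open>Q\<close> with
  \<open>de\<^sup>i = T\<^sub>i\<^sub>j ^e\<^sup>j + P\<^sub>i\<^sub>k dt e\<^sup>k\<close>,  \<open>da\<^sup>i = \<Omega>\<^sub>i\<^sub>j ^e\<^sup>j + Q\<^sub>i\<^sub>k dt e\<^sup>k\<close>,  \<open>dS = S\<^sub>,\<^sub>k e\<^sup>k + S' dt\<close>.

  At a point, closedness of the two forms is thereby a system of algebraic equations in \<open>T\<close>, \<open>P\<close>, \<open>\<Omega>\<close>,
  \<open>Q\<close>, \<open>S\<^sub>,\<^sub>k\<close> and \<open>S'\<close> (\<open>structure_equations_iff\<close>).  Sorted by the types of the components, closedness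
  of the 3-form says \<open>T = 0\<close> (type \<open>e e a a\<close>), \<open>P = 0\<close> (type \<open>dt e a a\<close>), \<open>\<Omega>\<close> symmetric (type \<open>e e e a\<close>),
  the formula for \<open>Q\<close> (type \<open>dt e e a\<close>) and the trace of \<open>S' = - \<Omega>\<close> against \<open>S~\<close> (type \<open>dt e e e\<close>).
  Closedness of the 4-form then adds \<open>S\<^sub>i\<^sub>\<alpha>\<^sub>,\<^sub>\<alpha> = 0\<close> (type \<open>e e e a a\<close>) and \<open>S' = - \<Omega>\<close> (type
  \<open>dt e e a a\<close>); its remaining component, of type \<open>dt e e e a\<close>, is a consequence of \<open>S\<^sub>i\<^sub>\<alpha>\<^sub>,\<^sub>\<alpha> = 0\<close> and the
  formula for \<open>Q\<close>.  Here \<open>P = 0\<close> is \<open>\<partial>e/\<partial>t = 0\<close>, and \<open>Q\<close> holds the components of \<open>\<partial>a/\<partial>t\<close>.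
\<close>

section \<open>Alternating forms and wedge products\<close>

lemma sign_comp_transpose:
  assumes "p permutes S" "finite S" "a \<noteq> b"
  shows "sign (p \<circ> Transposition.transpose a b) = - sign p"
    and "sign (Transposition.transpose a b \<circ> p) = - sign p"
proof -
  have "permutation p" using assms permutation_permutes by blast
  then show "sign (p \<circ> Transposition.transpose a b) = - sign p"
    "sign (Transposition.transpose a b \<circ> p) = - sign p"
    using assms by (simp_all add: sign_compose permutation_swap_id sign_swap_id)
qed

lemma alternating_cong: "alternating k F \<Longrightarrow> (\<And>i. i < k \<Longrightarrow> u i = v i) \<Longrightarrow> F u = F v"
  unfolding alternating_def by blast

lemma alternating_linear: "alternating k F \<Longrightarrow> i < k \<Longrightarrow> linear (\<lambda>w. F (v(i := w)))"
  unfolding alternating_def by blast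

lemma alternating_eq_0:
  assumes "alternating k F" "i < k" "j < k" "i \<noteq> j" "v i = v j"
  shows "F v = 0"
proof (cases "i < j")
  case True
  then show ?thesis using assms unfolding alternating_def by blast
next
  case False
  then have "j < i" using assms by simp
  then show ?thesis using assms unfolding alternating_def by metis
qed

text \<open>
  Polarisation: expand \<open>F\<close> at the sum of the two arguments in both slots.
\<close>

lemma alternating_transpose:
  assumes F: "alternating k F" and ij: "i < k" "j < k" "i \<noteq> j"
  shows "F (\<lambda>m. v (Transposition.transpose i j m)) = - F v"
proof -
  define G where "G x y = F (v(i := x, j := y))" for x y
  have lin_y: "linear (G x)" for x
    unfolding G_def by (rule alternating_linear[OF F ij(2)])
  have lin_x: "linear (\<lambda>x. G x y)" for y
  proof -
    have "(\<lambda>x. G x y) = (\<lambda>x. F ((v(j := y))(i := x)))"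
      unfolding G_def using ij by (simp add: fun_upd_twist)
    then show ?thesis using alternating_linear[OF F ij(1)] by simp
  qed
  have diag: "G x x = 0" for x
    unfolding G_def using ij by (intro alternating_eq_0[OF F ij]) auto
  have "0 = G (v i + v j) (v i + v j)" by (simp only: diag)
  also have "\<dots> = G (v i) (v j) + G (v j) (v i)"
    using diag[of "v i"] diag[of "v j"]
    by (simp only: linear_add[OF lin_x] linear_add[OF lin_y] add_0_left add_0_right)
  finally have "G (v j) (v i) = - G (v i) (v j)" by simp
  moreover have "G (v i) (v j) = F v" unfolding G_def by simp
  moreover have "v(i := v j, j := v i) = (\<lambda>m. v (Transposition.transpose i j m))"
    using ij by (auto simp: fun_eq_iff transpose_def)
  ultimately show ?thesis unfolding G_def by simp
qed

lemma alternating_permute: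
  assumes "alternating k F" "\<sigma> permutes {..<k}"
  shows "F (\<lambda>i. v (\<sigma> i)) = of_int (sign \<sigma>) * F v"
  using finite_lessThan assms(2)
proof (induction rule: permutes_rev_induct)
  case id
  then show ?case by simp
next
  case (swap a b p)
  have "F (\<lambda>i. v ((p \<circ> Transposition.transpose a b) i)) = - F (\<lambda>i. v (p i))"
    using alternating_transpose[OF assms(1), of a b "\<lambda>i. v (p i)"] swap by simp
  moreover have "sign (p \<circ> Transposition.transpose a b) = - sign p"
    using swap by (intro sign_comp_transpose) auto
  ultimately show ?case using swap by (simp add: o_def)
qed

lemma alternating_eq_0_on_span:
  fixes b :: "nat \<Rightarrow> 'v::real_vector"
  assumes F: "alternating k F" and span: "span (b ` {..<n}) = UNIV"
    and zero: "\<And>s. (\<And>i. i < k \<Longrightarrow> s i < n) \<Longrightarrow> F (\<lambda>i. b (s i)) = 0"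
  shows "F v = 0"
proof -
  have "\<forall>v. (\<forall>i. m \<le> i \<and> i < k \<longrightarrow> v i \<in> b ` {..<n}) \<longrightarrow> F v = 0" if "m \<le> k" for m
    using that
  proof (induction m)
    case 0
    show ?case
    proof safe
      fix v assume *: "\<forall>i. 0 \<le> i \<and> i < k \<longrightarrow> v i \<in> b ` {..<n}"
      then have "\<forall>i. \<exists>s. i < k \<longrightarrow> s < n \<and> v i = b s" by blast
      then obtain s where s: "\<And>i. i < k \<Longrightarrow> s i < n \<and> v i = b (s i)" by metis
      have "F v = F (\<lambda>i. b (s i))" by (rule alternating_cong[OF F]) (use s in auto)
      then show "F v = 0" using zero[of s] s by auto
    qed
  next
    case (Suc m)
    show ?case
    proof safe
      fix v assume *: "\<forall>i. Suc m \<le> i \<and> i < k \<longrightarrow> v i \<in> b ` {..<n}"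
      have lin: "linear (\<lambda>w. F (v(m := w)))" using alternating_linear[OF F] Suc by simp
      have "F (v(m := w)) = 0" if "w \<in> b ` {..<n}" for w
        using Suc * that by (auto simp: Suc_le_eq)
      then have "F (v(m := v m)) = 0"
        using linear_eq_0_on_span[OF lin, of "b ` {..<n}" "v m"] span by blast
      then show "F v = 0" by simp
    qed
  qed
  from this[of k] show ?thesis by (meson le_refl not_le)
qed

text \<open>
  An identity between alternating forms only has to be checked on increasing tuples of basis
  vectors.  These are the subsequences of \<open>[0..<n]\<close>, which the simplifier can enumerate when \<open>n\<close> is a
  numeral.
\<close>

lemma alternating_eq_0_basis:
  fixes b :: "nat \<Rightarrow> 'v::real_vector"
  assumes F: "alternating k F" and span: "span (b ` {..<n}) = UNIV"
    and zero: "\<forall>xs\<in>set (subseqs [0..<n]). length xs = k \<longrightarrow> F (\<lambda>i. b (xs ! i)) = 0"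
  shows "F v = 0"
proof (rule alternating_eq_0_on_span[OF F span])
  fix s assume s: "\<And>i. i < k \<Longrightarrow> s i < n"
  show "F (\<lambda>i. b (s i)) = 0"
  proof (cases "inj_on s {..<k}")
    case False
    then obtain i j where "i < k" "j < k" "i \<noteq> j" "s i = s j" by (auto simp: inj_on_def)
    then show ?thesis using alternating_eq_0[OF F, of i j] by auto
  next
    case True
    have "s ` {..<k} \<in> Pow (set [0..<n])" using s by auto
    then obtain ys where ys: "ys \<in> set (subseqs [0..<n])" "set ys = s ` {..<k}"
      unfolding subseqs_powset[symmetric] by blast
    have dist: "distinct ys" using ys(1) subseqs_distinctD distinct_upt by metis
    have len: "length ys = k"
      using distinct_card[OF dist] ys(2) card_image[OF True] by simp
    have bij: "bij_betw ((!) ys) {..<k} (s ` {..<k})"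
      using bij_betw_nth[OF dist] len ys(2) by blast
    (* The permutation that sorts the injective tuple \<open>s\<close>. *)
    define \<sigma> where "\<sigma> i = (if i < k then inv_into {..<k} ((!) ys) (s i) else i)" for i
    have \<sigma>: "\<sigma> i < k \<and> ys ! (\<sigma> i) = s i" if "i < k" for i
    proof -
      have "s i \<in> (!) ys ` {..<k}" using bij that by (simp add: bij_betw_def)
      then have "inv_into {..<k} ((!) ys) (s i) \<in> {..<k}"
        "ys ! inv_into {..<k} ((!) ys) (s i) = s i"
        by (rule inv_into_into, rule f_inv_into_f)
      then show ?thesis unfolding \<sigma>_def using that by simp
    qed
    have inj: "inj_on \<sigma> {..<k}"
      by (rule inj_onI) (metis True \<sigma> inj_onD lessThan_iff)
    have "\<sigma> ` {..<k} = {..<k}"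
      by (intro endo_inj_surj inj) (use \<sigma> in auto)
    then have "\<sigma> permutes {..<k}"
      using inj by (intro bij_imp_permutes) (auto simp: bij_betw_def \<sigma>_def)
    then have "F (\<lambda>i. b (ys ! (\<sigma> i))) = of_int (sign \<sigma>) * F (\<lambda>i. b (ys ! i))"
      by (rule alternating_permute[OF F])
    moreover have "F (\<lambda>i. b (ys ! (\<sigma> i))) = F (\<lambda>i. b (s i))"
      by (rule alternating_cong[OF F]) (use \<sigma> in auto)
    ultimately show ?thesis using zero ys(1) len by auto
  qed
qed

text \<open>
  For multilinear functions of a few separate arguments it is enough to have linearity in the first
  one and the sign change under swaps of neighbours.
\<close>

lemma alternating_3:
  assumes lin: "\<And>y z. linear (\<lambda>x. F x y z)"
    and skew: "\<And>x y z. F y x z = - F x y z" "\<And>x y z. F x z y = - F x y z"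
  shows "alternating 3 (\<lambda>v. F (v 0) (v 1) (v 2) :: real)"
proof -
  have lin2: "linear (\<lambda>y. F x y z)" for x z
  proof -
    have "(\<lambda>y. F x y z) = (\<lambda>y. - F y x z)" using skew(1) by blast
    then show ?thesis using linear_compose_neg[OF lin] by simp
  qed
  have lin3: "linear (\<lambda>z. F x y z)" for x y
  proof -
    have "(\<lambda>z. F x y z) = (\<lambda>z. - F x z y)" using skew(2) by blast
    then show ?thesis using linear_compose_neg[OF lin2] by simp
  qed
  have less3: "i < 3 \<longleftrightarrow> i = 0 \<or> i = 1 \<or> i = 2" for i :: nat by auto
  have z: "F x x z = 0" "F x y y = 0" for x y z
    using skew(1)[of x x z] skew(2)[of x y y] by simp_all
  have z2: "F x y x = 0" for x y using skew(1)[of x y x] z by simp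
  show ?thesis unfolding alternating_def
  proof (intro conjI allI impI)
    fix i :: nat and v :: "nat \<Rightarrow> 'a" assume "i < 3"
    then show "linear (\<lambda>w. F ((v(i := w)) 0) ((v(i := w)) 1) ((v(i := w)) 2))"
      unfolding less3 using lin lin2 lin3 by (elim disjE) simp_all
  next
    fix i j :: nat and v :: "nat \<Rightarrow> 'a" assume *: "i < j \<and> j < 3 \<and> v i = v j"
    then have "i < 3" "j < 3" by auto
    then show "F (v 0) (v 1) (v 2) = 0"
      using * z z2 unfolding less3 by (elim disjE) simp_all
  qed simp
qed

lemma alternating_4:
  assumes lin: "\<And>y z w. linear (\<lambda>x. F x y z w)"
    and skew: "\<And>x y z w. F y x z w = - F x y z w" "\<And>x y z w. F x z y w = - F x y z w"
      "\<And>x y z w. F x y w z = - F x y z w"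
  shows "alternating 4 (\<lambda>v. F (v 0) (v 1) (v 2) (v 3) :: real)"
proof -
  have lin2: "linear (\<lambda>y. F x y z w)" for x z w
  proof -
    have "(\<lambda>y. F x y z w) = (\<lambda>y. - F y x z w)" using skew(1) by blast
    then show ?thesis using linear_compose_neg[OF lin] by simp
  qed
  have lin3: "linear (\<lambda>z. F x y z w)" for x y w
  proof -
    have "(\<lambda>z. F x y z w) = (\<lambda>z. - F x z y w)" using skew(2) by blast
    then show ?thesis using linear_compose_neg[OF lin2] by simp
  qed
  have lin4: "linear (\<lambda>w. F x y z w)" for x y z
  proof -
    have "(\<lambda>w. F x y z w) = (\<lambda>w. - F x y w z)" using skew(3) by blast
    then show ?thesis using linear_compose_neg[OF lin3] by simp
  qed
  have less4: "i < 4 \<longleftrightarrow> i = 0 \<or> i = 1 \<or> i = 2 \<or> i = 3" for i :: nat by auto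
  have z: "F x x z w = 0" "F x y y w = 0" "F x y z z = 0" for x y z w
    using skew(1)[of x x z w] skew(2)[of x y y w] skew(3)[of x y z z] by simp_all
  have z2: "F x y x w = 0" "F x y z y = 0" for x y z w
    using skew(1)[of x y x w] skew(3)[of x y y z] z by simp_all
  have z3: "F x y z x = 0" for x y z using skew(1)[of x y z x] z2 by simp
  show ?thesis unfolding alternating_def
  proof (intro conjI allI impI)
    fix i :: nat and v :: "nat \<Rightarrow> 'a" assume "i < 4"
    then show "linear (\<lambda>w. F ((v(i := w)) 0) ((v(i := w)) 1) ((v(i := w)) 2) ((v(i := w)) 3))"
      unfolding less4 using lin lin2 lin3 lin4 by (elim disjE) simp_all
  next
    fix i j :: nat and v :: "nat \<Rightarrow> 'a" assume *: "i < j \<and> j < 4 \<and> v i = v j"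
    then have "i < 4" "j < 4" by auto
    then show "F (v 0) (v 1) (v 2) (v 3) = 0"
      using * z z2 z3 unfolding less4 by (elim disjE) simp_all
  qed simp
qed

lemma alternating_5:
  assumes lin: "\<And>y z w s. linear (\<lambda>x. F x y z w s)"
    and skew: "\<And>x y z w s. F y x z w s = - F x y z w s" "\<And>x y z w s. F x z y w s = - F x y z w s"
      "\<And>x y z w s. F x y w z s = - F x y z w s" "\<And>x y z w s. F x y z s w = - F x y z w s"
  shows "alternating 5 (\<lambda>v. F (v 0) (v 1) (v 2) (v 3) (v 4) :: real)"
proof -
  have lin2: "linear (\<lambda>y. F x y z w s)" for x z w s
  proof -
    have "(\<lambda>y. F x y z w s) = (\<lambda>y. - F y x z w s)" using skew(1) by blast
    then show ?thesis using linear_compose_neg[OF lin] by simp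
  qed
  have lin3: "linear (\<lambda>z. F x y z w s)" for x y w s
  proof -
    have "(\<lambda>z. F x y z w s) = (\<lambda>z. - F x z y w s)" using skew(2) by blast
    then show ?thesis using linear_compose_neg[OF lin2] by simp
  qed
  have lin4: "linear (\<lambda>w. F x y z w s)" for x y z s
  proof -
    have "(\<lambda>w. F x y z w s) = (\<lambda>w. - F x y w z s)" using skew(3) by blast
    then show ?thesis using linear_compose_neg[OF lin3] by simp
  qed
  have lin5: "linear (\<lambda>s. F x y z w s)" for x y z w
  proof -
    have "(\<lambda>s. F x y z w s) = (\<lambda>s. - F x y z s w)" using skew(4) by blast
    then show ?thesis using linear_compose_neg[OF lin4] by simp
  qed
  have less5: "i < 5 \<longleftrightarrow> i = 0 \<or> i = 1 \<or> i = 2 \<or> i = 3 \<or> i = 4" for i :: nat by auto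
  have z: "F x x z w s = 0" "F x y y w s = 0" "F x y z z s = 0" "F x y z w w = 0" for x y z w s
    using skew(1)[of x x z w s] skew(2)[of x y y w s] skew(3)[of x y z z s] skew(4)[of x y z w w] by simp_all
  have z2: "F x y x w s = 0" "F x y z y s = 0" "F x y z w z = 0" for x y z w s
    using skew(1)[of x y x w s] skew(3)[of x y y z s] skew(4)[of x y z z w] z by simp_all
  have z3: "F x y z x s = 0" "F x y z w y = 0" for x y z w s
    using skew(1)[of x y z x s] skew(2)[of x y z w y] z2 by simp_all
  have z4: "F x y z w x = 0" for x y z w using skew(1)[of x y z w x] z3 by simp
  show ?thesis unfolding alternating_def
  proof (intro conjI allI impI)
    fix i :: nat and v :: "nat \<Rightarrow> 'a" assume "i < 5"
    then show "linear (\<lambda>w. F ((v(i := w)) 0) ((v(i := w)) 1) ((v(i := w)) 2) ((v(i := w)) 3) ((v(i := w)) 4))"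
      unfolding less5 using lin lin2 lin3 lin4 lin5 by (elim disjE) simp_all
  next
    fix i j :: nat and v :: "nat \<Rightarrow> 'a" assume *: "i < j \<and> j < 5 \<and> v i = v j"
    then have "i < 5" "j < 5" by auto
    then show "F (v 0) (v 1) (v 2) (v 3) (v 4) = 0"
      using * z z2 z3 z4 unfolding less5 by (elim disjE) simp_all
  qed simp
qed

lemma alternating_wedge:
  assumes a: "alternating k \<alpha>" and b: "alternating l \<beta>"
  shows "alternating (k + l) (wedge k l \<alpha> \<beta>)"
proof -
  define T where "T u = \<alpha> u * \<beta> (\<lambda>i. u (k + i))" for u
  have Tcong: "T u = T v" if "\<And>i. i < k + l \<Longrightarrow> u i = v i" for u v
  proof -
    have "\<alpha> u = \<alpha> v" by (rule alternating_cong[OF a]) (use that in auto)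
    moreover have "\<beta> (\<lambda>i. u (k + i)) = \<beta> (\<lambda>i. v (k + i))"
      by (rule alternating_cong[OF b]) (use that in auto)
    ultimately show ?thesis by (simp add: T_def)
  qed
  have Tlin: "linear (\<lambda>w. T (v(i := w)))" if "i < k + l" for v i
  proof (cases "i < k")
    case True
    have "(\<lambda>w. T (v(i := w))) = (\<lambda>w. \<beta> (\<lambda>j. v (k + j)) *\<^sub>R \<alpha> (v(i := w)))"
      using True by (auto simp: T_def fun_eq_iff)
    then show ?thesis using linear_compose_scale_right[OF alternating_linear[OF a True]] by simp
  next
    case False
    have "\<alpha> (v(i := w)) = \<alpha> v" for w
      by (rule alternating_cong[OF a]) (use False in auto)
    moreover have "(\<lambda>j. (v(i := w)) (k + j)) = (\<lambda>j. v (k + j))(i - k := w)" for w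
      using False by (auto simp: fun_eq_iff)
    ultimately have "(\<lambda>w. T (v(i := w))) = (\<lambda>w. \<alpha> v *\<^sub>R \<beta> ((\<lambda>j. v (k + j))(i - k := w)))"
      by (simp add: T_def)
    moreover have "linear (\<lambda>w. \<beta> ((\<lambda>j. v (k + j))(i - k := w)))"
      using False that by (intro alternating_linear[OF b]) auto
    ultimately show ?thesis by (metis linear_compose_scale_right)
  qed
  have W: "wedge k l \<alpha> \<beta> v
      = (\<Sum>\<sigma> | \<sigma> permutes {..<k + l}. of_int (sign \<sigma>) * T (\<lambda>i. v (\<sigma> i))) / (fact k * fact l)" for v
    unfolding wedge_def T_def by (simp add: mult.assoc)
  show ?thesis unfolding alternating_def
  proof (intro conjI allI impI)
    fix u v :: "nat \<Rightarrow> 'a" assume uv: "\<forall>i<k + l. u i = v i"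
    show "wedge k l \<alpha> \<beta> u = wedge k l \<alpha> \<beta> v"
      unfolding W
    proof (intro arg_cong2[where f="(/)"] sum.cong refl)
      fix \<sigma> assume "\<sigma> \<in> {\<sigma>. \<sigma> permutes {..<k + l}}"
      then have "T (\<lambda>i. u (\<sigma> i)) = T (\<lambda>i. v (\<sigma> i))"
        using uv permutes_in_image[of \<sigma> "{..<k+l}"] by (intro Tcong) auto
      then show "of_int (sign \<sigma>) * T (\<lambda>i. u (\<sigma> i)) = of_int (sign \<sigma>) * T (\<lambda>i. v (\<sigma> i))" by simp
    qed
  next
    fix i and v :: "nat \<Rightarrow> 'a" assume i: "i < k + l"
    have "linear (\<lambda>w. T (\<lambda>j. (v(i := w)) (\<sigma> j)))" if "\<sigma> permutes {..<k + l}" for \<sigma>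
    proof -
      have *: "(\<lambda>j. (v(i := w)) (\<sigma> j)) = (\<lambda>j. v (\<sigma> j))(inv \<sigma> i := w)" for w
        using permutes_inverses[OF that] by (auto simp: fun_eq_iff)
      have "inv \<sigma> i < k + l"
        using i permutes_in_image[OF permutes_inv[OF that], of i] by simp
      then show ?thesis unfolding * by (rule Tlin)
    qed
    then have "linear (\<lambda>w. inverse (fact k * fact l) *\<^sub>R (\<Sum>\<sigma> | \<sigma> permutes {..<k + l}.
        of_int (sign \<sigma>) *\<^sub>R T (\<lambda>j. (v(i := w)) (\<sigma> j))))"
      by (intro linear_compose_scale_right linear_compose_sum ballI) blast
    then show "linear (\<lambda>w. wedge k l \<alpha> \<beta> (v(i := w)))"
      unfolding W by (simp add: divide_inverse mult.commute)
  next
    fix i j and v :: "nat \<Rightarrow> 'a" assume *: "i < j \<and> j < k + l \<and> v i = v j"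
    let ?t = "Transposition.transpose i j"
    have t: "?t permutes {..<k + l}" using * by (intro permutes_swap_id) auto
    let ?f = "\<lambda>\<sigma>. of_int (sign \<sigma>) * T (\<lambda>i. v (\<sigma> i))"
    have "sum ?f {\<sigma>. \<sigma> permutes {..<k + l}} = (\<Sum>\<sigma> | \<sigma> permutes {..<k + l}. ?f (?t \<circ> \<sigma>))"
      by (rule setum_permutations_compose_left[OF t])
    also have "\<dots> = (\<Sum>\<sigma> | \<sigma> permutes {..<k + l}. - ?f \<sigma>)"
    proof (intro sum.cong refl)
      fix \<sigma> assume "\<sigma> \<in> {\<sigma>. \<sigma> permutes {..<k + l}}"
      then have "sign (?t \<circ> \<sigma>) = - sign \<sigma>"
        using * by (intro sign_comp_transpose) auto
      moreover have "v (?t x) = v x" for x using * by (simp add: Transposition.transpose_def)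
      ultimately show "?f (?t \<circ> \<sigma>) = - ?f \<sigma>" by simp
    qed
    also have "\<dots> = - sum ?f {\<sigma>. \<sigma> permutes {..<k + l}}" by (rule sum_negf)
    finally have "sum ?f {\<sigma>. \<sigma> permutes {..<k + l}} = 0" by simp
    then show "wedge k l \<alpha> \<beta> v = 0" unfolding W by simp
  qed
qed

lemma alternating_wedge_list:
  assumes "\<And>\<alpha>. \<alpha> \<in> set \<alpha>s \<Longrightarrow> alternating 1 \<alpha>"
  shows "alternating (length \<alpha>s) (wedge_list \<alpha>s)"
  using assms
proof (induction \<alpha>s)
  case Nil
  then show ?case by (simp add: alternating_def)
next
  case (Cons a \<alpha>s)
  then have "alternating (1 + length \<alpha>s) (wedge 1 (length \<alpha>s) a (wedge_list \<alpha>s))"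
    by (intro alternating_wedge) auto
  then show ?case by simp
qed

lemma transpose_Suc:
  "Transposition.transpose (Suc a) (Suc b) (Suc i) = Suc (Transposition.transpose a b i)"
  unfolding Transposition.transpose_def by simp

text \<open>
  A permutation that does not fix \<open>0\<close> feeds some \<open>v i\<close> with \<open>i \<ge> 1\<close> to \<open>\<alpha>\<close> and contributes nothing;
  the \<open>k!\<close> others all contribute \<open>\<beta> (v\<^sub>1, \<dots>, v\<^sub>k)\<close> and cancel the normalisation of the wedge product.
\<close>

lemma wedge_one_dual:
  fixes \<alpha> :: "('v::real_vector, real) covector"
  assumes b: "alternating k \<beta>" and a: "\<And>u. \<alpha> u = A (u 0)"
    and v0: "A (v 0) = 1" and v: "\<And>i. 1 \<le> i \<Longrightarrow> i \<le> k \<Longrightarrow> A (v i) = 0"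
  shows "wedge 1 k \<alpha> \<beta> v = \<beta> (\<lambda>i. v (Suc i))"
proof -
  let ?f = "\<lambda>\<sigma>. of_int (sign \<sigma>) * \<alpha> (\<lambda>i. v (\<sigma> i)) * \<beta> (\<lambda>i. v (\<sigma> (1 + i)))"
  have set: "{..<1 + k} = insert 0 {1..k}" by auto
  have perm: "of_int (sign q) * \<beta> (\<lambda>i. v (q (Suc i))) = \<beta> (\<lambda>i. v (Suc i))"
    if "q permutes {1..k}" for q
    using finite_atLeastAtMost that
  proof (induction rule: permutes_rev_induct)
    case id
    then show ?case by simp
  next
    case (swap x y p)
    obtain x' y' where xy: "x = Suc x'" "y = Suc y'" "x' < k" "y' < k"
      using swap by (metis One_nat_def Suc_le_D Suc_le_lessD atLeastAtMost_iff)
    have "\<beta> (\<lambda>i. v ((p \<circ> Transposition.transpose x y) (Suc i))) = \<beta> (\<lambda>i. (\<lambda>i. v (p (Suc i))) (Transposition.transpose x' y' i))"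
      by (intro arg_cong[where f=\<beta>]) (simp add: fun_eq_iff xy transpose_Suc)
    also have "\<dots> = - \<beta> (\<lambda>i. v (p (Suc i)))"
      using xy swap by (intro alternating_transpose[OF b]) auto
    finally have 1: "\<beta> (\<lambda>i. v ((p \<circ> Transposition.transpose x y) (Suc i))) = - \<beta> (\<lambda>i. v (p (Suc i)))" .
    have "sign (p \<circ> Transposition.transpose x y) = - sign p"
      using swap by (intro sign_comp_transpose) auto
    with 1 swap show ?case by (simp add: o_def)
  qed
  have "sum ?f {p. p permutes insert 0 {1..k}}
      = (\<Sum>c\<in>insert 0 {1..k}. \<Sum>q | q permutes {1..k}. ?f (Transposition.transpose 0 c \<circ> q))"
    by (rule sum_over_permutations_insert) auto
  also have "\<dots> = (\<Sum>c\<in>insert 0 {1..k}. if c = 0 then fact k * \<beta> (\<lambda>i. v (Suc i)) else 0)"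
  proof (intro sum.cong refl)
    fix c assume c: "c \<in> insert 0 {1..k}"
    have q0: "q 0 = 0" if "q permutes {1..k}" for q
      using permutes_not_in[OF that, of 0] by simp
    show "(\<Sum>q | q permutes {1..k}. ?f (Transposition.transpose 0 c \<circ> q))
        = (if c = 0 then fact k * \<beta> (\<lambda>i. v (Suc i)) else 0)"
    proof (cases "c = 0")
      case True
      have "(\<Sum>q | q permutes {1..k}. ?f (Transposition.transpose 0 c \<circ> q))
          = (\<Sum>q | q permutes {1..k}. \<beta> (\<lambda>i. v (Suc i)))"
      proof (intro sum.cong refl)
        fix q assume "q \<in> {q. q permutes {1..k}}"
        then have q: "q permutes {1..k}" by simp
        have "?f (Transposition.transpose 0 c \<circ> q) = of_int (sign q) * \<beta> (\<lambda>i. v (q (Suc i)))"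
          using True by (simp add: a q0[OF q] v0)
        then show "?f (Transposition.transpose 0 c \<circ> q) = \<beta> (\<lambda>i. v (Suc i))"
          using perm[OF q] by simp
      qed
      also have "\<dots> = fact k * \<beta> (\<lambda>i. v (Suc i))"
        using card_permutations[of "{1..k}" k] by simp
      finally show ?thesis using True by simp
    next
      case False
      then have "A (v c) = 0" using c v by simp
      then have "(\<Sum>q | q permutes {1..k}. ?f (Transposition.transpose 0 c \<circ> q)) = 0"
      proof (intro sum.neutral ballI)
        fix q assume "q \<in> {q. q permutes {1..k}}"
        then have q: "q permutes {1..k}" by simp
        show "?f (Transposition.transpose 0 c \<circ> q) = 0"
          using \<open>A (v c) = 0\<close> by (simp add: a q0[OF q])
      qed
      then show ?thesis using False by simp
    qed
  qed
  also have "\<dots> = fact k * \<beta> (\<lambda>i. v (Suc i))" by simp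
  finally show ?thesis unfolding wedge_def set by simp
qed

text \<open>
  The normalisation of the volume form: a wedge product of covectors is \<open>1\<close> on the dual basis.
\<close>

lemma wedge_list_dual:
  assumes "\<And>i. i < length As \<Longrightarrow> (As ! i) (v i) = 1"
    and "\<And>i j. i < length As \<Longrightarrow> j < length As \<Longrightarrow> i \<noteq> j \<Longrightarrow> (As ! i) (v j) = 0"
    and "\<And>A. A \<in> set As \<Longrightarrow> linear A"
  shows "wedge_list (map (\<lambda>A u. A (u 0)) As) v = (1::real)"
  using assms
proof (induction As arbitrary: v)
  case Nil
  then show ?case by simp
next
  case (Cons A As)
  have alt1: "alternating 1 (\<lambda>u. B (u 0))" if "linear B" for B :: "'a \<Rightarrow> real"
    using that by (auto simp: alternating_def)
  have alt: "alternating (length As) (wedge_list (map (\<lambda>A u. A (u 0)) As))"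
    using alternating_wedge_list[of "map (\<lambda>A u. A (u 0)) As"] Cons.prems(3) alt1 by auto
  have "wedge_list (map (\<lambda>A u. A (u 0)) (A # As)) v
      = wedge_list (map (\<lambda>A u. A (u 0)) As) (\<lambda>i. v (Suc i))"
    unfolding list.map wedge_list.simps length_map
    by (rule wedge_one_dual[OF alt, where A = A])
       (use Cons.prems(1)[of 0] Cons.prems(2)[of 0] in auto)
  also have "\<dots> = 1"
  proof (rule Cons.IH)
    show "(As ! i) (v (Suc i)) = 1" if "i < length As" for i
      using Cons.prems(1)[of "Suc i"] that by simp
    show "(As ! i) (v (Suc j)) = 0" if "i < length As" "j < length As" "i \<noteq> j" for i j
      using Cons.prems(2)[of "Suc i" "Suc j"] that by simp
  qed (use Cons.prems(3) in auto)
  finally show ?case .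
qed

lemma sum_permutes_1: "(\<Sum>\<sigma> | \<sigma> permutes {..<Suc 0}. f \<sigma>) = f id"
  by (simp add: lessThan_Suc permutes_sing)

lemma sum_permutes_2: "(\<Sum>\<sigma> | \<sigma> permutes {..<2::nat}. f \<sigma>) = f id + f (Transposition.transpose 0 1)"
proof -
  have "{..<2::nat} = insert 0 {1}" by auto
  then show ?thesis by (simp add: sum_over_permutations_insert permutes_sing)
qed

lemma sum_permutes_3: "(\<Sum>\<sigma> | \<sigma> permutes {..<3::nat}. f \<sigma>)
   = f id + f (Transposition.transpose 1 2) + (f (Transposition.transpose 0 1) + f (Transposition.transpose 0 1 \<circ> Transposition.transpose 1 2))
     + (f (Transposition.transpose 0 2) + f (Transposition.transpose 0 2 \<circ> Transposition.transpose 1 2))"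
proof -
  have "{..<3::nat} = insert 0 (insert 1 {2})" by auto
  then show ?thesis by (simp add: sum_over_permutations_insert permutes_sing add.assoc)
qed

lemmas sign_transposes = sign_compose sign_swap_id permutation_swap_id transpose_def

lemma three: "(1::nat) + 2 = 3" "(2::nat) + 1 = 3" "(1::nat) + 1 = 2" by simp_all

lemma wedge_1_0:
  assumes "\<And>u. \<alpha> u = A (u 0)" shows "wedge 1 0 \<alpha> (\<lambda>v. 1) v = A (v 0)"
  by (simp add: wedge_def sum_permutes_1 assms)

lemma wedge_1_1:
  assumes "\<And>u. \<alpha> u = A (u 0)" "\<And>u. \<beta> u = B (u 0)"
  shows "wedge 1 1 \<alpha> \<beta> v = A (v 0) * B (v 1) - A (v 1) * B (v 0)"
  unfolding wedge_def three sum_permutes_2 by (simp add: assms sign_transposes)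

lemma wedge_1_2:
  assumes "\<And>u. \<alpha> u = A (u 0)" "\<And>u. \<beta> u = B (u 0) (u 1)" "\<And>x y. B x y = - B y x"
  shows "wedge 1 2 \<alpha> \<beta> v = A (v 0) * B (v 1) (v 2) - A (v 1) * B (v 0) (v 2) + A (v 2) * B (v 0) (v 1)"
proof -
  have [simp]: "B (v 2) (v 0) = - B (v 0) (v 2)"
    "B (v (Suc 0)) (v 0) = - B (v 0) (v (Suc 0))"
    "B (v 2) (v (Suc 0)) = - B (v (Suc 0)) (v 2)"
    by (rule assms(3))+
  show ?thesis
    unfolding wedge_def three sum_permutes_3
    by (simp add: assms(1,2) sign_transposes fact_numeral numeral_2_eq_2[symmetric] field_simps)
qed

lemma wedge_2_1:
  assumes "\<And>u. \<beta> u = B (u 0)" "\<And>u. \<alpha> u = A (u 0) (u 1)" "\<And>x y. A x y = - A y x"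
  shows "wedge 2 1 \<alpha> \<beta> v = A (v 0) (v 1) * B (v 2) - A (v 0) (v 2) * B (v 1) + A (v 1) (v 2) * B (v 0)"
proof -
  have [simp]: "A (v 2) (v 0) = - A (v 0) (v 2)"
    "A (v (Suc 0)) (v 0) = - A (v 0) (v (Suc 0))"
    "A (v 2) (v (Suc 0)) = - A (v (Suc 0)) (v 2)"
    by (rule assms(3))+
  show ?thesis
    unfolding wedge_def three sum_permutes_3
    by (simp add: assms(1,2) sign_transposes fact_numeral numeral_2_eq_2[symmetric] field_simps)
qed

lemma wedge_list_3:
  assumes "\<And>u. \<alpha> u = A (u 0)" "\<And>u. \<beta> u = B (u 0)" "\<And>u. \<gamma> u = C (u 0)"
  shows "wedge_list [\<alpha>, \<beta>, \<gamma>] v = A (v 0) * (B (v 1) * C (v 2) - B (v 2) * C (v 1))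
    - A (v 1) * (B (v 0) * C (v 2) - B (v 2) * C (v 0))
    + A (v 2) * (B (v 0) * C (v 1) - B (v 1) * C (v 0))"
proof -
  have 0: "wedge 1 0 \<gamma> (\<lambda>v. 1) = (\<lambda>v. C (v 0))"
    by (rule ext) (rule wedge_1_0[OF assms(3)])
  have 1: "wedge 1 1 \<beta> (\<lambda>v. C (v 0)) u = B (u 0) * C (u 1) - B (u 1) * C (u 0)" for u
    by (rule wedge_1_1) (auto simp: assms)
  have 2: "wedge 1 2 \<alpha> (wedge 1 1 \<beta> (\<lambda>v. C (v 0))) v
      = A (v 0) * (B (v 1) * C (v 2) - B (v 2) * C (v 1))
    - A (v 1) * (B (v 0) * C (v 2) - B (v 2) * C (v 0))
    + A (v 2) * (B (v 0) * C (v 1) - B (v 1) * C (v 0))"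
    by (rule wedge_1_2[where B = "\<lambda>x y. B x * C y - B y * C x"])
       (auto simp: assms 1[simplified] mult.commute)
  show ?thesis using 2 by (simp add: 0[simplified] numeral_2_eq_2)
qed

text \<open>
  The component formula of the Hodge star sums over index functions; for a 3-form this is a triple
  sum.
\<close>

lemma sum_PiE_3:
  "(\<Sum>s\<in>{..<3::nat} \<rightarrow>\<^sub>E A. F (s 0) (s 1) (s 2)) = (\<Sum>i\<in>A. \<Sum>j\<in>A. \<Sum>k\<in>A. F i j k)"
proof -
  have three: "i < 3 \<longleftrightarrow> i = 0 \<or> i = 1 \<or> i = 2" for i :: nat by auto
  let ?i = "\<lambda>(a,b,c). \<lambda>i\<in>{..<3::nat}. if i = 0 then a else if i = 1 then b else c"
  have "(\<Sum>s\<in>{..<3::nat} \<rightarrow>\<^sub>E A. F (s 0) (s 1) (s 2)) = (\<Sum>(i,j,k)\<in>A \<times> A \<times> A. F i j k)"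
  proof (rule sum.reindex_bij_witness[where i = ?i and j = "\<lambda>s. (s 0, s 1, s 2)"])
    fix s assume s: "s \<in> {..<3::nat} \<rightarrow>\<^sub>E A"
    show "?i (s 0, s 1, s 2) = s"
    proof
      fix x show "?i (s 0, s 1, s 2) x = s x"
        using PiE_arb[OF s, of x] three[of x] by (cases "x < 3") auto
    qed
    show "(s 0, s 1, s 2) \<in> A \<times> A \<times> A"
      using PiE_mem[OF s] by simp
  next
    fix b assume b: "b \<in> A \<times> A \<times> A"
    then show "(?i b 0, ?i b 1, ?i b 2) = b" by (cases b) simp
    from b show "?i b \<in> {..<3::nat} \<rightarrow>\<^sub>E A" by (cases b) simp
  qed simp
  then show ?thesis by (simp add: sum.cartesian_product)
qed

section \<open>The model forms on seven-dimensional space\<close>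

text \<open>
  The constants below are polynomials in the coordinates \<open>(dt, e, a)\<close> of their arguments, where
  \<open>tc\<close>, \<open>ec\<close> and \<open>ac\<close> are the values of \<open>dt\<close>, \<open>(e\<^sup>1, e\<^sup>2, e\<^sup>3)\<close> and \<open>(a\<^sup>1, a\<^sup>2, a\<^sup>3)\<close>.  Wedge products of
  three-component forms become dot and cross products, since \<open>u \<bullet> (v \<times> w)\<close> for \<open>e\<close>-parts is
  \<open>e\<^sup>1\<^sup>2\<^sup>3\<close> and the components of \<open>ac u \<times> ac v\<close> are those of \<open>1/2 \<epsilon>\<^sub>i\<^sub>j\<^sub>k a\<^sup>j\<^sup>k\<close>.
\<close>

unbundle cross3_syntax

type_synonym r7 = "real \<times> (real^3) \<times> (real^3)"

abbreviation tc :: "r7 \<Rightarrow> real" where "tc u \<equiv> fst u"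
abbreviation ec :: "r7 \<Rightarrow> real^3" where "ec u \<equiv> fst (snd u)"
abbreviation ac :: "r7 \<Rightarrow> real^3" where "ac u \<equiv> snd (snd u)"

text \<open>
  The 2-form \<open>A\<^sub>i\<^sub>j a\<^sup>i e\<^sup>j\<close>.
\<close>

definition mixed2 :: "real^3^3 \<Rightarrow> r7 \<Rightarrow> r7 \<Rightarrow> real" where
  "mixed2 A u v = ac u \<bullet> (A *v ec v) - ac v \<bullet> (A *v ec u)"

text \<open>
  \<open>A\<^sub>i\<^sub>j a\<^sup>i e\<^sup>j dt - D e\<^sup>1\<^sup>2\<^sup>3 + e\<^sup>k ^a\<^sup>k\<close>, where \<open>^a\<^sup>k = 1/2 \<epsilon>\<^sub>k\<^sub>i\<^sub>j a\<^sup>i\<^sup>j\<close>.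
\<close>

definition Phi3 :: "real \<Rightarrow> real^3^3 \<Rightarrow> r7 \<Rightarrow> r7 \<Rightarrow> r7 \<Rightarrow> real" where
  "Phi3 D A u v w =
     mixed2 A u v * tc w - mixed2 A u w * tc v + mixed2 A v w * tc u
     - D * (ec u \<bullet> (ec v \<times> ec w))
     + (ec u \<bullet> (ac v \<times> ac w) - ec v \<bullet> (ac u \<times> ac w) + ec w \<bullet> (ac u \<times> ac v))"

text \<open>
  \<open>a\<^sup>1\<^sup>2\<^sup>3 - D a\<^sup>k ^e\<^sup>k\<close>, for \<open>D = 1\<close> the real part of \<open>dz\<^sup>1\<^sup>2\<^sup>3\<close> with \<open>dz\<^sup>k = a\<^sup>k + i e\<^sup>k\<close>.
\<close>

definition Re3 :: "real \<Rightarrow> r7 \<Rightarrow> r7 \<Rightarrow> r7 \<Rightarrow> real" where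
  "Re3 D u v w = ac u \<bullet> (ac v \<times> ac w)
     - D * (ac u \<bullet> (ec v \<times> ec w) - ac v \<bullet> (ec u \<times> ec w) + ac w \<bullet> (ec u \<times> ec v))"

text \<open>
  \<open>- S\<^sub>i\<^sub>j ^a\<^sup>i ^e\<^sup>j - (a\<^sup>1\<^sup>2\<^sup>3 - D a\<^sup>k ^e\<^sup>k) dt\<close>, the candidate for the dual 4-form.
\<close>

definition Psi4 :: "real \<Rightarrow> real^3^3 \<Rightarrow> r7 \<Rightarrow> r7 \<Rightarrow> r7 \<Rightarrow> r7 \<Rightarrow> real" where
  "Psi4 D S u v w z =
     - ((ac u \<times> ac v) \<bullet> (S *v (ec w \<times> ec z)) - (ac u \<times> ac w) \<bullet> (S *v (ec v \<times> ec z))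
        + (ac u \<times> ac z) \<bullet> (S *v (ec v \<times> ec w)) + (ac v \<times> ac w) \<bullet> (S *v (ec u \<times> ec z))
        - (ac v \<times> ac z) \<bullet> (S *v (ec u \<times> ec w)) + (ac w \<times> ac z) \<bullet> (S *v (ec u \<times> ec v)))
     - (Re3 D u v w * tc z - Re3 D u v z * tc w + Re3 D u w z * tc v - Re3 D v w z * tc u)"

text \<open>
  In the model the coordinates \<open>x\<^sup>k\<close> play the part of \<open>a\<^sup>k\<close> and \<open>y\<^sup>k\<close> that of \<open>e\<^sup>k\<close>, because
  \<open>\<omega>\<^sub>0 = dx\<^sup>k dy\<^sup>k\<close> and \<open>a\<^sup>k e\<^sup>k\<close> have the factors in this order.
\<close>

definition J7 :: "real \<times> (complex^3) \<Rightarrow> r7" where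
  "J7 u = (fst u, \<chi> k. Im (snd u $ k), \<chi> k. Re (snd u $ k))"

lemma linear_J7: "linear J7"
  by (rule linearI) (auto simp: J7_def vec_eq_iff)

lemma phi0_eq: "phi0 v = Phi3 1 (mat 1) (J7 (v 0)) (J7 (v 1)) (J7 (v 2))"
proof -
  have om: "omega0 u = (\<Sum>k\<in>UNIV. Re (u 0 $ k) * Im (u 1 $ k) - Re (u 1 $ k) * Im (u 0 $ k))" for u
    unfolding omega0_def
    by (intro sum.cong refl wedge_1_1) (auto simp: dx_def dy_def)
  have om2: "wedge 2 1 (\<lambda>u. omega0 (snd \<circ> u)) dx0 v =
    mixed2 (mat 1) (J7 (v 0)) (J7 (v 1)) * fst (v 2) - mixed2 (mat 1) (J7 (v 0)) (J7 (v 2)) * fst (v 1)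
    + mixed2 (mat 1) (J7 (v 1)) (J7 (v 2)) * fst (v 0)"
    by (rule wedge_2_1)
      (auto simp: om dx0_def mixed2_def J7_def inner_vec_def sum_subtractf)
  have ps: "wedge_list [dz 1, dz 2, dz 3] u =
    u 0 $ 1 * (u 1 $ 2 * u 2 $ 3 - u 2 $ 2 * u 1 $ 3)
    - u 1 $ 1 * (u 0 $ 2 * u 2 $ 3 - u 2 $ 2 * u 0 $ 3)
    + u 2 $ 1 * (u 0 $ 2 * u 1 $ 3 - u 1 $ 2 * u 0 $ 3)" for u
    by (rule wedge_list_3) (auto simp: dz_def)
  show ?thesis
    unfolding phi0_def om2 psi0_def ps Phi3_def
    by (simp add: J7_def inner_vec_def sum_3 cross3_def vector_3 algebra_simps)
qed

text \<open>
  The standard basis in the order of the coordinates \<open>(x\<^sup>0, x\<^sup>1, y\<^sup>1, x\<^sup>2, y\<^sup>2, x\<^sup>3, y\<^sup>3)\<close>, and below the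
  coordinates themselves.
\<close>

definition e7 :: "nat \<Rightarrow> real \<times> (complex^3)" where
  "e7 i = [(1, 0), (0, axis 1 1), (0, axis 1 \<i>), (0, axis 2 1), (0, axis 2 \<i>),
           (0, axis 3 1), (0, axis 3 \<i>)] ! i"

definition c7 :: "nat \<Rightarrow> real \<times> (complex^3) \<Rightarrow> real" where
  "c7 i u = [fst u, Re (snd u $ 1), Im (snd u $ 1), Re (snd u $ 2), Im (snd u $ 2),
           Re (snd u $ 3), Im (snd u $ 3)] ! i"

lemma sum_lessThan_7: "(\<Sum>i<7::nat. f i) = f 0 + f 1 + f 2 + f 3 + f 4 + f 5 + f 6"
proof -
  have "{..<7::nat} = {0,1,2,3,4,5,6}" by auto
  then show ?thesis by (simp add: add.assoc)
qed

lemma less_7: "i < 7 \<longleftrightarrow> i \<in> {0,1,2,3,4,5,6::nat}" by auto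

lemma expand7: "u = (\<Sum>i<7. c7 i u *\<^sub>R e7 i)"
  by (simp add: sum_lessThan_7 c7_def e7_def prod_eq_iff vec_eq_iff forall_3 axis_def
      complex_eq_iff numeral_nat)

lemma span_e7: "span (e7 ` {..<7}) = UNIV"
proof -
  have "u \<in> span (e7 ` {..<7})" for u
    by (subst expand7) (intro span_sum span_scale span_base imageI)
  then show ?thesis by auto
qed

lemma inner_e7: "i < 7 \<Longrightarrow> j < 7 \<Longrightarrow> e7 i \<bullet> e7 j = (if i = j then 1 else 0)"
  unfolding less_7
  by (auto simp: e7_def numeral_nat inner_axis_axis inner_axis' inner_axis inner_vec_def sum_3 axis_def)

lemma inner_7: "u \<bullet> w = (\<Sum>i<7. c7 i u * c7 i w)"
  by (simp add: sum_lessThan_7 c7_def inner_prod_def inner_vec_def sum_3 inner_complex_def numeral_nat)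

lemma linear_c7: "i < 7 \<Longrightarrow> linear (c7 i)"
  unfolding less_7 by (auto intro!: linearI simp: c7_def numeral_nat)

lemma vol0_eq: "vol0 = wedge_list (map (\<lambda>A u. A (u 0)) (map c7 [0,1,2,3,4,5,6]))"
  unfolding vol0_def by (simp add: dx0_def[abs_def] dx7_def[abs_def] dy7_def[abs_def] dx_def dy_def
      c7_def[abs_def] numeral_nat)

lemma alternating_1:
  assumes "linear B" shows "alternating 1 (\<lambda>u. B (u 0))"
  using assms by (auto simp: alternating_def)

lemma alternating_vol0: "alternating 7 vol0"
proof -
  have "alternating (length (map (\<lambda>A u. A (u 0)) (map c7 [0,1,2,3,4,5,6]) :: (real \<times> (complex^3), real) covector list)) vol0"
    unfolding vol0_eq
  proof (rule alternating_wedge_list)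
    fix \<alpha> :: "(real \<times> (complex^3), real) covector"
    assume "\<alpha> \<in> set (map (\<lambda>A u. A (u 0)) (map c7 [0,1,2,3,4,5,6]))"
    then obtain A where "A \<in> set (map c7 [0,1,2,3,4,5,6])" "\<alpha> = (\<lambda>u. A (u 0))" by auto
    moreover then have "linear A" by (auto intro: linear_c7)
    ultimately show "alternating 1 \<alpha>" using alternating_1 by simp
  qed
  then show ?thesis by (simp add: numeral_nat)
qed

lemma c7_e7: "i < 7 \<Longrightarrow> j < 7 \<Longrightarrow> c7 i (e7 j) = (if i = j then 1 else 0)"
  unfolding less_7 by (auto simp: c7_def e7_def numeral_nat axis_def)

lemma vol0_e7: "vol0 e7 = 1"
  unfolding vol0_eq
proof (rule wedge_list_dual)
  have nth: "map c7 [0,1,2,3,4,5,6] ! i = c7 i" if "i < 7" for i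
    using that unfolding less_7 by (auto simp: numeral_nat)
  show "(map c7 [0,1,2,3,4,5,6] ! i) (e7 i) = 1" if "i < length (map c7 [0,1,2,3,4,5,6])" for i
    using that nth[of i] c7_e7[of i i] by simp
  show "(map c7 [0,1,2,3,4,5,6] ! i) (e7 j) = 0" if "i < length (map c7 [0,1,2,3,4,5,6])"
    "j < length (map c7 [0,1,2,3,4,5,6])" "i \<noteq> j" for i j
    using that nth[of i] c7_e7[of i j] by simp
qed (use linear_c7 in \<open>auto simp: less_7\<close>)


lemma alternating_fix_first:
  assumes "alternating (Suc k) F"
  shows "alternating k (\<lambda>v. F (case_nat u v))"
  unfolding alternating_def
proof (intro conjI allI impI)
  fix v w :: "nat \<Rightarrow> 'a" assume "\<forall>i<k. v i = w i"
  then show "F (case_nat u v) = F (case_nat u w)"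
    by (intro alternating_cong[OF assms]) (auto split: nat.split)
next
  fix i and v :: "nat \<Rightarrow> 'a" assume "i < k"
  then have "linear (\<lambda>w. F ((case_nat u v)(Suc i := w)))"
    by (intro alternating_linear[OF assms]) auto
  moreover have "(case_nat u v)(Suc i := w) = case_nat u (v(i := w))" for w
    by (auto simp: fun_eq_iff split: nat.split)
  ultimately show "linear (\<lambda>w. F (case_nat u (v(i := w))))" by simp
next
  fix i j and v :: "nat \<Rightarrow> 'a" assume "i < j \<and> j < k \<and> v i = v j"
  then show "F (case_nat u v) = 0"
    by (intro alternating_eq_0[OF assms, of "Suc i" "Suc j"]) auto
qed

lemma alternating_diff:
  assumes "alternating k F" "alternating k G"
  shows "alternating k (\<lambda>v. F v - c * G v)"
proof -
  have "linear (\<lambda>w. F (v(i := w)) - c * G (v(i := w)))" if "i < k" for i v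
    using linear_compose_sub[OF alternating_linear[OF assms(1) that]
      linear_compose_scale_right[OF alternating_linear[OF assms(2) that], of c], of v v] by simp
  moreover have "F u - c * G u = F v - c * G v" if "\<forall>i<k. u i = v i" for u v
    using alternating_cong[OF assms(1), of u v] alternating_cong[OF assms(2), of u v] that by simp
  moreover have "F v - c * G v = 0" if "i < j \<and> j < k \<and> v i = v j" for i j v
    using alternating_eq_0[OF assms(1), of i j v] alternating_eq_0[OF assms(2), of i j v] that by simp
  ultimately show ?thesis unfolding alternating_def by (intro conjI allI impI) blast+
qed

section \<open>Components of the model forms\<close>

definition vol0_comp :: "nat list \<Rightarrow> real" where "vol0_comp xs = vol0 (\<lambda>i. e7 (xs ! i))"

lemma vol0_comp_swap: "length xs = 7 \<Longrightarrow> Suc i < 7 \<Longrightarrow> vol0_comp (xs[i := xs ! Suc i, Suc i := xs ! i]) = - vol0_comp xs"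
proof -
  assume *: "length xs = 7" "Suc i < 7"
  have "vol0 (\<lambda>m. e7 (xs ! (Transposition.transpose i (Suc i) m))) = - vol0_comp xs"
    unfolding vol0_comp_def using alternating_transpose[OF alternating_vol0, of i "Suc i" "\<lambda>i. e7 (xs ! i)"] * by simp
  moreover have "vol0 (\<lambda>m. e7 (xs ! (Transposition.transpose i (Suc i) m))) = vol0_comp (xs[i := xs ! Suc i, Suc i := xs ! i])"
    unfolding vol0_comp_def by (rule alternating_cong[OF alternating_vol0])
      (use * in \<open>auto simp: Transposition.transpose_def nth_list_update\<close>)
  ultimately show ?thesis by simp
qed

lemma vol0_comp_eq_0: "length xs = 7 \<Longrightarrow> Suc i < 7 \<Longrightarrow> xs ! i = xs ! Suc i \<Longrightarrow> vol0_comp xs = 0"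
  unfolding vol0_comp_def by (rule alternating_eq_0[OF alternating_vol0, of i "Suc i"]) auto

text \<open>
  The guards make these usable as rewrite rules: together they sort the indices by adjacent
  transpositions.
\<close>

lemma vol0_comp_sort:
  "b < a \<Longrightarrow> vol0_comp [a,b,c,d,e,f,g] = - vol0_comp [b,a,c,d,e,f,g]"
  "c < b \<Longrightarrow> vol0_comp [a,b,c,d,e,f,g] = - vol0_comp [a,c,b,d,e,f,g]"
  "d < c \<Longrightarrow> vol0_comp [a,b,c,d,e,f,g] = - vol0_comp [a,b,d,c,e,f,g]"
  "e < d \<Longrightarrow> vol0_comp [a,b,c,d,e,f,g] = - vol0_comp [a,b,c,e,d,f,g]"
  "f < e \<Longrightarrow> vol0_comp [a,b,c,d,e,f,g] = - vol0_comp [a,b,c,d,f,e,g]"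
  "g < f \<Longrightarrow> vol0_comp [a,b,c,d,e,f,g] = - vol0_comp [a,b,c,d,e,g,f]"
  using vol0_comp_swap[of "[a,b,c,d,e,f,g]" 0] vol0_comp_swap[of "[a,b,c,d,e,f,g]" 1]
    vol0_comp_swap[of "[a,b,c,d,e,f,g]" 2] vol0_comp_swap[of "[a,b,c,d,e,f,g]" 3]
    vol0_comp_swap[of "[a,b,c,d,e,f,g]" 4] vol0_comp_swap[of "[a,b,c,d,e,f,g]" 5]
  by (simp_all add: numeral_nat)

lemma vol0_comp_repeat:
  "vol0_comp [a,a,c,d,e,f,g] = 0" "vol0_comp [a,c,c,d,e,f,g] = 0" "vol0_comp [a,c,d,d,e,f,g] = 0"
  "vol0_comp [a,c,d,e,e,f,g] = 0" "vol0_comp [a,c,d,e,f,f,g] = 0" "vol0_comp [a,c,d,e,f,g,g] = 0"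
  by (rule vol0_comp_eq_0[of _ 0], simp_all) (rule vol0_comp_eq_0[of _ 1], simp_all,
    rule vol0_comp_eq_0[of _ 2], simp_all, rule vol0_comp_eq_0[of _ 3], simp_all, rule vol0_comp_eq_0[of _ 4], simp_all,
    rule vol0_comp_eq_0[of _ 5], simp_all)

lemma nth7: "i < 7 \<Longrightarrow> [0,1,2,3,4,5,6] ! i = (i::nat)"
proof -
  assume "i < 7"
  have "[0,1,2,3,4,5,6] = [0..<7]" by (simp add: upt_conv_Cons)
  then show "[0,1,2,3,4,5,6] ! i = i" using \<open>i < 7\<close> by simp
qed

lemma vol0_comp_base: "vol0_comp [0,1,2,3,4,5,6] = 1"
proof -
  have "vol0_comp [0,1,2,3,4,5,6] = vol0 e7"
    unfolding vol0_comp_def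
    by (rule alternating_cong[OF alternating_vol0]) (simp add: nth7[simplified])
  then show ?thesis by (simp add: vol0_e7)
qed

lemmas vol0_comp_simps = vol0_comp_sort vol0_comp_repeat vol0_comp_base vol0_comp_base[simplified]

lemma vol0_Cons: "vol0 (case_nat (e7 j) (\<lambda>i. e7 (xs ! i))) = vol0_comp (j # xs)"
  unfolding vol0_comp_def by (intro arg_cong[where f=vol0]) (auto simp: fun_eq_iff split: nat.split)

lemma vol0_expand: "vol0 (case_nat u w) = (\<Sum>j<7. c7 j u * vol0 (case_nat (e7 j) w))"
proof -
  have "linear (\<lambda>x. vol0 ((case_nat u w)(0 := x)))"
    by (rule alternating_linear[OF alternating_vol0]) simp
  moreover have "(case_nat u w)(0 := x) = case_nat x w" for x
    by (auto simp: fun_eq_iff split: nat.split)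
  ultimately have lin: "linear (\<lambda>x. vol0 (case_nat x w))" by simp
  show ?thesis
    by (subst expand7[of u], subst linear_sum[OF lin]) (simp add: linear_scale[OF lin])
qed

definition phi0_tri :: "real \<times> (complex^3) \<Rightarrow> real \<times> (complex^3) \<Rightarrow> real \<times> (complex^3) \<Rightarrow> real" where
  "phi0_tri u v w = Phi3 1 (mat 1) (J7 u) (J7 v) (J7 w)"

lemma mixed2_skew: "mixed2 A v u = - mixed2 A u v" by (simp add: mixed2_def)

lemma Phi3_skew: "Phi3 D A v u w = - Phi3 D A u v w" "Phi3 D A u w v = - Phi3 D A u v w"
proof -
  have *: "x \<bullet> (y \<times> z) = - (x \<bullet> (z \<times> y))" for x y z :: "real^3"
    by (subst cross_skew) simp
  have **: "x \<bullet> (y \<times> z) = - (y \<bullet> (x \<times> z))" for x y z :: "real^3"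
    by (simp add: cross3_simps)
  show "Phi3 D A v u w = - Phi3 D A u v w"
    unfolding Phi3_def using mixed2_skew[of A u v] *[of "ec w" "ac v" "ac u"] **[of "ec v" "ec u" "ec w"]
    by (simp add: algebra_simps)
  show "Phi3 D A u w v = - Phi3 D A u v w"
    unfolding Phi3_def using mixed2_skew[of A v w] *[of "ec u" "ac w" "ac v"] *[of "ec u" "ec w" "ec v"]
    by (simp add: algebra_simps)
qed

lemma mixed2_linear: "linear (\<lambda>u. mixed2 A u v)"
  by (rule linearI) (simp_all add: mixed2_def inner_simps matrix_vector_right_distrib
      matrix_vector_mult_scaleR algebra_simps)

lemma Phi3_linear: "linear (\<lambda>u. Phi3 D A u v w)"
  by (rule linearI)
    (simp_all add: Phi3_def linear_add[OF mixed2_linear] linear_scale[OF mixed2_linear] inner_simps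
      cross_add_left cross_add_right cross_mult_left cross_mult_right algebra_simps)

lemma phi0_tri_linear: "linear (\<lambda>u. phi0_tri u v w)"
  unfolding phi0_tri_def using linear_compose[OF linear_J7 Phi3_linear] by (simp add: o_def)

lemma phi0_tri_skew: "phi0_tri v u w = - phi0_tri u v w" "phi0_tri u w v = - phi0_tri u v w"
  unfolding phi0_tri_def by (rule Phi3_skew)+

definition phi0_comp :: "nat \<Rightarrow> nat \<Rightarrow> nat \<Rightarrow> real" where "phi0_comp i j k = phi0_tri (e7 i) (e7 j) (e7 k)"

lemma phi0_comp_sort: "j < i \<Longrightarrow> phi0_comp i j k = - phi0_comp j i k" "k < j \<Longrightarrow> phi0_comp i j k = - phi0_comp i k j"
  "phi0_comp i i k = 0" "phi0_comp i k k = 0"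
proof -
  show "phi0_comp i j k = - phi0_comp j i k" unfolding phi0_comp_def by (rule phi0_tri_skew)
  show "phi0_comp i j k = - phi0_comp i k j" unfolding phi0_comp_def by (rule phi0_tri_skew)
  show "phi0_comp i i k = 0" unfolding phi0_comp_def using phi0_tri_skew(1)[of "e7 i" "e7 i" "e7 k"] by simp
  show "phi0_comp i k k = 0" unfolding phi0_comp_def using phi0_tri_skew(2)[of "e7 i" "e7 k" "e7 k"] by simp
qed

lemma phi0_comp_base:
  "phi0_comp 0 1 2 = 1" "phi0_comp 0 1 3 = 0" "phi0_comp 0 1 4 = 0" "phi0_comp 0 1 5 = 0" "phi0_comp 0 1 6 = 0"
  "phi0_comp 0 2 3 = 0" "phi0_comp 0 2 4 = 0" "phi0_comp 0 2 5 = 0" "phi0_comp 0 2 6 = 0"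
  "phi0_comp 0 3 4 = 1" "phi0_comp 0 3 5 = 0" "phi0_comp 0 3 6 = 0" "phi0_comp 0 4 5 = 0" "phi0_comp 0 4 6 = 0" "phi0_comp 0 5 6 = 1"
  "phi0_comp 1 2 3 = 0" "phi0_comp 1 2 4 = 0" "phi0_comp 1 2 5 = 0" "phi0_comp 1 2 6 = 0"
  "phi0_comp 1 3 4 = 0" "phi0_comp 1 3 5 = 0" "phi0_comp 1 3 6 = 1" "phi0_comp 1 4 5 = 1" "phi0_comp 1 4 6 = 0" "phi0_comp 1 5 6 = 0"
  "phi0_comp 2 3 4 = 0" "phi0_comp 2 3 5 = 1" "phi0_comp 2 3 6 = 0" "phi0_comp 2 4 5 = 0" "phi0_comp 2 4 6 = -1" "phi0_comp 2 5 6 = 0"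
  "phi0_comp 3 4 5 = 0" "phi0_comp 3 4 6 = 0" "phi0_comp 3 5 6 = 0" "phi0_comp 4 5 6 = 0"
  by (simp_all add: phi0_comp_def phi0_tri_def Phi3_def mixed2_def J7_def e7_def inner_vec_def sum_3 cross3_def
      axis_def numeral_nat)

lemmas phi0_comp_simps = phi0_comp_sort phi0_comp_base phi0_comp_base[simplified]

section \<open>The stabiliser of the model 3-form\<close>

text \<open>
  The metric is recovered from \<open>\<phi>\<^sub>0\<close> by \<open>(\<iota>\<^sub>u \<phi>\<^sub>0)\<^sup>3 = 6 |u|\<^sup>2 \<iota>\<^sub>u vol\<close>.  A linear map preserving \<open>\<phi>\<^sub>0\<close> therefore
  preserves the metric up to its determinant, and the determinant is \<open>1\<close> because it also preserves
  the norm of \<open>\<phi>\<^sub>0\<close>.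
\<close>

text \<open>
  The Pfaffian of the Gram matrix of \<open>w\<close> on six vectors, that is, \<open>w\<^sup>3/3!\<close>.
\<close>

definition pf6 :: "('v \<Rightarrow> 'v \<Rightarrow> real) \<Rightarrow> (nat \<Rightarrow> 'v) \<Rightarrow> real" where
  "pf6 w v =
     w (v 0) (v 1) * (w (v 2) (v 3) * w (v 4) (v 5) - w (v 2) (v 4) * w (v 3) (v 5) + w (v 2) (v 5) * w (v 3) (v 4))
   - w (v 0) (v 2) * (w (v 1) (v 3) * w (v 4) (v 5) - w (v 1) (v 4) * w (v 3) (v 5) + w (v 1) (v 5) * w (v 3) (v 4))
   + w (v 0) (v 3) * (w (v 1) (v 2) * w (v 4) (v 5) - w (v 1) (v 4) * w (v 2) (v 5) + w (v 1) (v 5) * w (v 2) (v 4))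
   - w (v 0) (v 4) * (w (v 1) (v 2) * w (v 3) (v 5) - w (v 1) (v 3) * w (v 2) (v 5) + w (v 1) (v 5) * w (v 2) (v 3))
   + w (v 0) (v 5) * (w (v 1) (v 2) * w (v 3) (v 4) - w (v 1) (v 3) * w (v 2) (v 4) + w (v 1) (v 4) * w (v 2) (v 3))"

lemma less_6: "i < 6 \<longleftrightarrow> i \<in> {0,1,2,3,4,5::nat}" by auto

lemma alternating_pf6:
  assumes lin: "\<And>y. linear (\<lambda>x. w x y)" and skew: "\<And>x y. w x y = - w y x"
  shows "alternating 6 (pf6 w)"
proof -
  have linr: "linear (w x)" for x
  proof -
    have "w x = (\<lambda>y. - w y x)" using skew by (intro ext) blast
    then show ?thesis using linear_compose_neg[OF lin[of x]] by simp
  qed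
  note l = linear_add[OF lin] linear_scale[OF lin] linear_add[OF linr] linear_scale[OF linr]
  have self: "w x x = 0" for x using skew[of x x] by simp
  show ?thesis unfolding alternating_def
  proof (intro conjI allI impI)
    fix u v :: "nat \<Rightarrow> 'a" assume "\<forall>i<6. u i = v i"
    then show "pf6 w u = pf6 w v" by (simp add: pf6_def)
  next
    fix i :: nat and v :: "nat \<Rightarrow> 'a" assume "i < 6"
    then show "linear (\<lambda>x. pf6 w (v(i := x)))"
      unfolding less_6 by (intro linearI) (auto simp: pf6_def l algebra_simps)
  next
    fix i j :: nat and v :: "nat \<Rightarrow> 'a" assume *: "i < j \<and> j < 6 \<and> v i = v j"
    have sk: "w (v 1) x = - w x (v 1)" "w (v 0) x = - w x (v 0)" for x
      using skew by blast+
    have "i < 6" "j < 6" using * by auto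
    then consider "i = 0 \<and> j \<in> {1,2,3,4,5}" | "i = 1 \<and> j \<in> {2,3,4,5}" | "i = 2 \<and> j \<in> {3,4,5}"
      | "i = 3 \<and> j \<in> {4,5}" | "i = 4 \<and> j = 5" using * unfolding less_6 by auto
    then show "pf6 w v = 0"
    proof cases
      case 1
      then have "v 0 = v 1 \<or> v 0 = v 2 \<or> v 0 = v 3 \<or> v 0 = v 4 \<or> v 0 = v 5" using * by auto
      then show ?thesis
        using skew[of "v 2" "v 1"] skew[of "v 3" "v 1"] skew[of "v 4" "v 1"] skew[of "v 5" "v 1"]
          skew[of "v 3" "v 2"] skew[of "v 4" "v 2"] skew[of "v 5" "v 2"]
          skew[of "v 4" "v 3"] skew[of "v 5" "v 3"] skew[of "v 5" "v 4"]
        by (elim disjE) (simp_all add: pf6_def self algebra_simps)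
    next
      case 2
      then have "v 1 = v 2 \<or> v 1 = v 3 \<or> v 1 = v 4 \<or> v 1 = v 5" using * by auto
      then show ?thesis
        using skew[of "v 3" "v 2"] skew[of "v 4" "v 2"] skew[of "v 5" "v 2"]
          skew[of "v 4" "v 3"] skew[of "v 5" "v 3"] skew[of "v 5" "v 4"]
        by (elim disjE) (simp_all add: pf6_def self algebra_simps)
    next
      case 3
      then have "v 2 = v 3 \<or> v 2 = v 4 \<or> v 2 = v 5" using * by auto
      then show ?thesis
        using skew[of "v 4" "v 3"] skew[of "v 5" "v 3"] skew[of "v 5" "v 4"]
        by (elim disjE) (simp_all add: pf6_def self algebra_simps)
    next
      case 4
      then have "v 3 = v 4 \<or> v 3 = v 5" using * by auto
      then show ?thesis
        using skew[of "v 5" "v 4"]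
        by (elim disjE) (simp_all add: pf6_def self algebra_simps)
    next
      case 5
      then have "v 4 = v 5" using * by auto
      then show ?thesis by (simp add: pf6_def self algebra_simps)
    qed
  qed
qed

lemma phi0_tri_expand: "phi0_tri u v w = (\<Sum>i<7. c7 i u * phi0_tri (e7 i) v w)"
  by (subst expand7[of u], subst linear_sum[OF phi0_tri_linear]) (simp add: linear_scale[OF phi0_tri_linear])

lemma upt_7: "[0..<7] = [0,1,2,3,4,5,6]" by (simp add: upt_conv_Cons)

lemma subseqs_6: "(\<forall>xs\<in>set (subseqs [0..<7]). length xs = 6 \<longrightarrow> Q xs) \<longleftrightarrow>
   Q [1,2,3,4,5,6] \<and> Q [0,2,3,4,5,6] \<and> Q [0,1,3,4,5,6] \<and> Q [0,1,2,4,5,6] \<and> Q [0,1,2,3,5,6]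
   \<and> Q [0,1,2,3,4,6] \<and> Q [0,1,2,3,4,5]"
  unfolding upt_7 by (simp add: Let_def ball_Un) blast

text \<open>
  Both sides are alternating in the six vectors, so that seven tuples of basis vectors decide the
  identity.
\<close>

lemma pf6_phi0: "pf6 (phi0_tri u) v = (u \<bullet> u) * vol0 (case_nat u v)"
proof -
  let ?F = "\<lambda>v. pf6 (phi0_tri u) v - (u \<bullet> u) * vol0 (case_nat u v)"
  have lin2: "linear (\<lambda>x. phi0_tri u x y)" for y
  proof -
    have "(\<lambda>x. phi0_tri u x y) = (\<lambda>x. - phi0_tri x u y)" using phi0_tri_skew(1) by blast
    then show ?thesis using linear_compose_neg[OF phi0_tri_linear[of u y]] by simp
  qed
  have alt: "alternating 6 ?F"
  proof (rule alternating_diff)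
    show "alternating 6 (pf6 (phi0_tri u))"
      by (rule alternating_pf6[OF lin2]) (rule phi0_tri_skew)
    show "alternating 6 (\<lambda>v. vol0 (case_nat u v))"
      by (rule alternating_fix_first) (use alternating_vol0 in \<open>simp add: numeral_nat\<close>)
  qed
  have P: "phi0_tri u (e7 i) (e7 j) = (\<Sum>k<7. c7 k u * phi0_comp k i j)" for i j
    by (subst phi0_tri_expand) (simp add: phi0_comp_def)
  have "?F v = 0"
    apply (rule alternating_eq_0_basis[OF alt span_e7])
    unfolding subseqs_6 vol0_expand[of u] vol0_Cons
    by (simp add: pf6_def P inner_7 sum_lessThan_7 vol0_comp_simps phi0_comp_simps; simp add: algebra_simps)
  then show ?thesis by simp
qed

definition orthofam :: "(nat \<Rightarrow> 'v::euclidean_space) \<Rightarrow> bool" where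
  "orthofam b \<longleftrightarrow> orthonormal_basis (\<bullet>) b"

lemma orthofam_inner: "orthofam b \<Longrightarrow> i < DIM('v) \<Longrightarrow> j < DIM('v) \<Longrightarrow> b i \<bullet> b j = (if i = j then 1 else 0)"
  for b :: "nat \<Rightarrow> 'v::euclidean_space"
  by (simp add: orthofam_def orthonormal_basis_def)

lemma orthofam_expand:
  fixes b :: "nat \<Rightarrow> 'v::euclidean_space"
  assumes b: "orthofam b"
  shows "x = (\<Sum>i<DIM('v). (x \<bullet> b i) *\<^sub>R b i)"
proof -
  let ?B = "b ` {..<DIM('v)}"
  have inj: "inj_on b {..<DIM('v)}"
    by (rule inj_onI) (metis b lessThan_iff orthofam_inner zero_neq_one)
  have nz: "b i \<noteq> 0" if "i < DIM('v)" for i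
    using orthofam_inner[OF b that that] by auto
  have ind: "independent ?B"
  proof (rule pairwise_orthogonal_independent)
    show "pairwise orthogonal ?B"
      using orthofam_inner[OF b] by (auto simp: pairwise_def orthogonal_def)
    show "0 \<notin> ?B" using nz by auto
  qed
  have "card ?B = DIM('v)" using card_image[OF inj] by simp
  then have span: "UNIV \<subseteq> span ?B"
    using card_ge_dim_independent[of ?B UNIV] ind by simp
  let ?y = "x - (\<Sum>i<DIM('v). (x \<bullet> b i) *\<^sub>R b i)"
  have "?y \<bullet> b j = 0" if "j < DIM('v)" for j
    using that by (simp add: inner_diff_left inner_sum_left orthofam_inner[OF b] sum.delta' if_distrib cong: if_cong)
  then have "orthogonal ?y z" if "z \<in> ?B" for z using that by (auto simp: orthogonal_def)
  then have "orthogonal ?y ?y" using orthogonal_to_span[of ?y ?B ?y] span by blast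
  then show ?thesis by (simp add: orthogonal_def)
qed

text \<open>
  The sum is the trace of \<open>f\<close> with respect to the inner product: expand in the family \<open>c\<close> and use
  Parseval's identity for \<open>b\<close>.
\<close>

lemma orthofam_trace:
  fixes b c :: "nat \<Rightarrow> 'v::euclidean_space"
  assumes b: "orthofam b" and c: "orthofam c"
    and l: "\<And>y. linear (\<lambda>x. f x y)" "\<And>x. linear (f x :: 'v \<Rightarrow> real)"
  shows "(\<Sum>i<DIM('v). f (b i) (b i)) = (\<Sum>i<DIM('v). f (c i) (c i))"
proof -
  let ?I = "{..<DIM('v)}"
  have f: "f x y = (\<Sum>j\<in>?I. \<Sum>k\<in>?I. (x \<bullet> c j) * (y \<bullet> c k) * f (c j) (c k))" for x y
  proof -
    have "f x y = f (\<Sum>j\<in>?I. (x \<bullet> c j) *\<^sub>R c j) (\<Sum>k\<in>?I. (y \<bullet> c k) *\<^sub>R c k)"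
      using orthofam_expand[OF c, of x] orthofam_expand[OF c, of y] by simp
    also have "\<dots> = (\<Sum>j\<in>?I. (x \<bullet> c j) * f (c j) (\<Sum>k\<in>?I. (y \<bullet> c k) *\<^sub>R c k))"
      by (simp only: linear_sum[OF l(1)] linear_scale[OF l(1)] real_scaleR_def)
    also have "\<dots> = (\<Sum>j\<in>?I. \<Sum>k\<in>?I. (x \<bullet> c j) * (y \<bullet> c k) * f (c j) (c k))"
      by (simp only: linear_sum[OF l(2)] linear_scale[OF l(2)] real_scaleR_def sum_distrib_left mult.assoc)
    finally show ?thesis .
  qed
  have pars: "(\<Sum>i\<in>?I. (b i \<bullet> x) * (b i \<bullet> y)) = x \<bullet> y" for x y
  proof -
    have "x \<bullet> y = (\<Sum>i\<in>?I. (x \<bullet> b i) *\<^sub>R b i) \<bullet> y" using orthofam_expand[OF b, of x] by simp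
    also have "\<dots> = (\<Sum>i\<in>?I. (b i \<bullet> x) * (b i \<bullet> y))"
      by (simp only: inner_sum_left inner_scaleR_left inner_commute[of x])
    finally show ?thesis by simp
  qed
  have "(\<Sum>i\<in>?I. f (b i) (b i)) = (\<Sum>i\<in>?I. \<Sum>j\<in>?I. \<Sum>k\<in>?I. (b i \<bullet> c j) * (b i \<bullet> c k) * f (c j) (c k))"
    by (intro sum.cong refl f)
  also have "\<dots> = (\<Sum>j\<in>?I. \<Sum>i\<in>?I. \<Sum>k\<in>?I. (b i \<bullet> c j) * (b i \<bullet> c k) * f (c j) (c k))"
    by (rule sum.swap)
  also have "\<dots> = (\<Sum>j\<in>?I. \<Sum>k\<in>?I. \<Sum>i\<in>?I. (b i \<bullet> c j) * (b i \<bullet> c k) * f (c j) (c k))"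
    by (intro sum.cong refl sum.swap)
  also have "\<dots> = (\<Sum>j\<in>?I. \<Sum>k\<in>?I. (c j \<bullet> c k) * f (c j) (c k))"
    by (simp only: sum_distrib_right[symmetric] pars)
  also have "\<dots> = (\<Sum>j\<in>?I. \<Sum>k\<in>?I. if j = k then f (c j) (c k) else 0)"
    by (intro sum.cong refl) (simp add: orthofam_inner[OF c])
  also have "\<dots> = (\<Sum>i\<in>?I. f (c i) (c i))" by simp
  finally show ?thesis .
qed

lemma orthofam_trace3:
  fixes b c :: "nat \<Rightarrow> 'v::euclidean_space"
  assumes b: "orthofam b" and c: "orthofam c"
    and f: "\<And>y z. linear (\<lambda>x. f x y z)" "\<And>x z. linear (\<lambda>y. f x y z)" "\<And>x y. linear (\<lambda>z. f x y z :: real)"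
    and g: "\<And>y z. linear (\<lambda>x. g x y z)" "\<And>x z. linear (\<lambda>y. g x y z)" "\<And>x y. linear (\<lambda>z. g x y z :: real)"
  shows "(\<Sum>i<DIM('v). \<Sum>j<DIM('v). \<Sum>k<DIM('v). f (b i) (b j) (b k) * g (b i) (b j) (b k))
       = (\<Sum>i<DIM('v). \<Sum>j<DIM('v). \<Sum>k<DIM('v). f (c i) (c j) (c k) * g (c i) (c j) (c k))"
proof -
  let ?I = "{..<DIM('v)}"
  have m: "linear (\<lambda>x. c * h x)" if "linear h" for c and h :: "'v \<Rightarrow> real"
    using linear_compose_scale_right[OF that, of c] by simp
  have m': "linear (\<lambda>x. h x * c)" if "linear h" for c and h :: "'v \<Rightarrow> real"
    using m[OF that, of c] by (simp add: mult.commute)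
  have "(\<Sum>i\<in>?I. \<Sum>j\<in>?I. \<Sum>k\<in>?I. f (b i) (b j) (b k) * g (b i) (b j) (b k))
      = (\<Sum>i\<in>?I. \<Sum>j\<in>?I. \<Sum>k\<in>?I. f (b i) (b j) (c k) * g (b i) (b j) (c k))"
    by (intro sum.cong refl orthofam_trace[OF b c, where f = "\<lambda>x y. f _ _ x * g _ _ y"] m m' f g)
  also have "\<dots> = (\<Sum>i\<in>?I. \<Sum>k\<in>?I. \<Sum>j\<in>?I. f (b i) (b j) (c k) * g (b i) (b j) (c k))"
    by (intro sum.cong refl sum.swap)
  also have "\<dots> = (\<Sum>i\<in>?I. \<Sum>k\<in>?I. \<Sum>j\<in>?I. f (b i) (c j) (c k) * g (b i) (c j) (c k))"
    by (intro sum.cong refl orthofam_trace[OF b c, where f = "\<lambda>x y. f _ x _ * g _ y _"] m m' f g)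
  also have "\<dots> = (\<Sum>i\<in>?I. \<Sum>j\<in>?I. \<Sum>k\<in>?I. f (b i) (c j) (c k) * g (b i) (c j) (c k))"
    by (intro sum.cong refl sum.swap)
  also have "\<dots> = (\<Sum>j\<in>?I. \<Sum>i\<in>?I. \<Sum>k\<in>?I. f (b i) (c j) (c k) * g (b i) (c j) (c k))"
    by (rule sum.swap)
  also have "\<dots> = (\<Sum>j\<in>?I. \<Sum>k\<in>?I. \<Sum>i\<in>?I. f (b i) (c j) (c k) * g (b i) (c j) (c k))"
    by (intro sum.cong refl sum.swap)
  also have "\<dots> = (\<Sum>j\<in>?I. \<Sum>k\<in>?I. \<Sum>i\<in>?I. f (c i) (c j) (c k) * g (c i) (c j) (c k))"
    by (intro sum.cong refl orthofam_trace[OF b c, where f = "\<lambda>x y. f x _ _ * g y _ _"] m m' f g)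
  also have "\<dots> = (\<Sum>j\<in>?I. \<Sum>i\<in>?I. \<Sum>k\<in>?I. f (c i) (c j) (c k) * g (c i) (c j) (c k))"
    by (intro sum.cong refl sum.swap)
  also have "\<dots> = (\<Sum>i\<in>?I. \<Sum>j\<in>?I. \<Sum>k\<in>?I. f (c i) (c j) (c k) * g (c i) (c j) (c k))"
    by (rule sum.swap)
  finally show ?thesis .
qed

lemma DIM_W: "DIM(real \<times> (complex^3)) = 7" by simp

lemma orthofam_e7: "orthofam e7"
  unfolding orthofam_def orthonormal_basis_def DIM_W by (simp add: inner_e7)

lemma phi0_tri_linear2: "linear (\<lambda>v. phi0_tri u v w)"
proof -
  have "(\<lambda>v. phi0_tri u v w) = (\<lambda>v. - phi0_tri v u w)" using phi0_tri_skew(1) by blast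
  then show ?thesis using linear_compose_neg[OF phi0_tri_linear[of u w]] by simp
qed

lemma phi0_tri_linear3: "linear (\<lambda>w. phi0_tri u v w)"
proof -
  have "(\<lambda>w. phi0_tri u v w) = (\<lambda>w. - phi0_tri u w v)" using phi0_tri_skew(2) by blast
  then show ?thesis using linear_compose_neg[OF phi0_tri_linear2[of u v]] by simp
qed

lemma subseqs_7: "(\<forall>xs\<in>set (subseqs [0..<7]). length xs = 7 \<longrightarrow> Q xs) \<longleftrightarrow> Q [0,1,2,3,4,5,6]"
  unfolding upt_7 by (simp add: Let_def ball_Un)

lemma alternating_compose:
  fixes L :: "'v::real_vector \<Rightarrow> 'w::real_vector"
  assumes "alternating k F" "linear L" shows "alternating k (\<lambda>v. F (L \<circ> v))"
  unfolding alternating_def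
proof (intro conjI allI impI)
  fix u v :: "nat \<Rightarrow> 'v" assume "\<forall>i<k. u i = v i"
  then show "F (L \<circ> u) = F (L \<circ> v)" by (intro alternating_cong[OF assms(1)]) auto
next
  fix i :: nat and v :: "nat \<Rightarrow> 'v" assume "i < k"
  then have "linear ((\<lambda>x. F ((L \<circ> v)(i := x))) \<circ> L)"
    by (intro linear_compose[OF assms(2)] alternating_linear[OF assms(1)])
  moreover have "(L \<circ> v)(i := L w) = L \<circ> v(i := w)" for w by (auto simp: fun_eq_iff)
  ultimately show "linear (\<lambda>w. F (L \<circ> v(i := w)))" by (simp add: o_def)
next
  fix i j :: nat and v :: "nat \<Rightarrow> 'v" assume "i < j \<and> j < k \<and> v i = v j"
  then show "F (L \<circ> v) = 0" by (intro alternating_eq_0[OF assms(1), of i j]) auto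
qed

lemma vol0_compose:
  assumes L: "linear L" shows "vol0 (L \<circ> v) = vol0 (L \<circ> e7) * vol0 v"
proof -
  have "vol0 (L \<circ> v) - vol0 (L \<circ> e7) * vol0 v = 0"
  proof (rule alternating_eq_0_basis[OF alternating_diff[OF alternating_compose[OF alternating_vol0 L] alternating_vol0] span_e7])
    have "vol0 (L \<circ> (\<lambda>i. e7 ([0,1,2,3,4,5,6] ! i))) = vol0 (L \<circ> e7)"
      by (rule alternating_cong[OF alternating_vol0]) (simp add: nth7[simplified])
    then show "\<forall>xs\<in>set (subseqs [0..<7]). length xs = 7 \<longrightarrow>
       vol0 (L \<circ> (\<lambda>i. e7 (xs ! i))) - vol0 (L \<circ> e7) * vol0 (\<lambda>i. e7 (xs ! i)) = 0"
      unfolding subseqs_7 using vol0_comp_base by (simp add: vol0_comp_def)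
  qed
  then show ?thesis by simp
qed

lemma exists_vol0: "u \<noteq> 0 \<Longrightarrow> \<exists>v. vol0 (case_nat u v) \<noteq> 0"
proof (rule ccontr)
  assume u: "u \<noteq> 0" and "\<not> (\<exists>v. vol0 (case_nat u v) \<noteq> 0)"
  then have z: "vol0 (case_nat u v) = 0" for v by blast
  have "c7 0 u = 0" using z[of "\<lambda>i. e7 ([1,2,3,4,5,6] ! i)"] unfolding vol0_expand[of u] vol0_Cons
    by (simp add: sum_lessThan_7 vol0_comp_simps)
  moreover have "c7 1 u = 0" using z[of "\<lambda>i. e7 ([0,2,3,4,5,6] ! i)"] unfolding vol0_expand[of u] vol0_Cons
    by (simp add: sum_lessThan_7 vol0_comp_simps)
  moreover have "c7 2 u = 0" using z[of "\<lambda>i. e7 ([0,1,3,4,5,6] ! i)"] unfolding vol0_expand[of u] vol0_Cons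
    by (simp add: sum_lessThan_7 vol0_comp_simps)
  moreover have "c7 3 u = 0" using z[of "\<lambda>i. e7 ([0,1,2,4,5,6] ! i)"] unfolding vol0_expand[of u] vol0_Cons
    by (simp add: sum_lessThan_7 vol0_comp_simps)
  moreover have "c7 4 u = 0" using z[of "\<lambda>i. e7 ([0,1,2,3,5,6] ! i)"] unfolding vol0_expand[of u] vol0_Cons
    by (simp add: sum_lessThan_7 vol0_comp_simps)
  moreover have "c7 5 u = 0" using z[of "\<lambda>i. e7 ([0,1,2,3,4,6] ! i)"] unfolding vol0_expand[of u] vol0_Cons
    by (simp add: sum_lessThan_7 vol0_comp_simps)
  moreover have "c7 6 u = 0" using z[of "\<lambda>i. e7 ([0,1,2,3,4,5] ! i)"] unfolding vol0_expand[of u] vol0_Cons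
    by (simp add: sum_lessThan_7 vol0_comp_simps)
  ultimately have "u = 0" by (subst expand7[of u]) (simp add: sum_lessThan_7)
  then show False using u by simp
qed

lemma phi0_tri_norm: "(\<Sum>i<7. \<Sum>j<7. \<Sum>k<7. phi0_tri (e7 i) (e7 j) (e7 k) * phi0_tri (e7 i) (e7 j) (e7 k)) = 42"
  unfolding phi0_comp_def[symmetric] by (simp add: sum_lessThan_7 phi0_comp_simps)

text \<open>
  Let \<open>d\<close> be the determinant of \<open>L\<close>.  The Pfaffian identity gives \<open>|L u|\<^sup>2 d = |u|\<^sup>2\<close>, whence \<open>d > 0\<close> and
  \<open>sqrt d L\<close> is orthogonal.  The sum of the squares of all components of \<open>\<phi>\<^sub>0\<close>, being the same in all
  orthonormal bases, is thus multiplied by \<open>d\<^sup>3\<close>, so that \<open>d = 1\<close>.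
\<close>

lemma stabiliser_phi0:
  assumes L: "linear L" "bij L" and P: "\<And>u v w. phi0_tri (L u) (L v) (L w) = phi0_tri u v w"
  shows "L u \<bullet> L w = u \<bullet> w" "vol0 (L \<circ> v) = vol0 v"
proof -
  define d where "d = vol0 (L \<circ> e7)"
  have vol: "vol0 (L \<circ> v) = d * vol0 v" for v unfolding d_def by (rule vol0_compose[OF L(1)])
  have nn: "(L u \<bullet> L u) * d = u \<bullet> u" for u
  proof (cases "u = 0")
    case True
    then show ?thesis using linear_0[OF L(1)] by simp
  next
    case False
    then obtain v where v: "vol0 (case_nat u v) \<noteq> 0" using exists_vol0 by blast
    have "pf6 (phi0_tri (L u)) (L \<circ> v) = pf6 (phi0_tri u) v"
      by (simp add: pf6_def P)
    moreover have "case_nat (L u) (L \<circ> v) = L \<circ> case_nat u v"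
      by (auto simp: fun_eq_iff split: nat.split)
    ultimately have "(L u \<bullet> L u) * (d * vol0 (case_nat u v)) = (u \<bullet> u) * vol0 (case_nat u v)"
      using vol by (simp add: pf6_phi0)
    then show ?thesis using v by simp
  qed
  have ip: "(L u \<bullet> L w) * d = u \<bullet> w" for u w
    using nn[of "u + w"] nn[of u] nn[of w]
    by (simp add: linear_add[OF L(1)] inner_add_left inner_add_right inner_commute algebra_simps)
  have "d * (L (e7 0) \<bullet> L (e7 0)) = 1" using nn[of "e7 0"] inner_e7[of 0 0] by (simp add: mult.commute)
  then have d: "d > 0"
    by (metis inner_ge_zero mult_le_0_iff not_le zero_less_one)
  define b where "b i = sqrt d *\<^sub>R L (e7 i)" for i
  have b: "orthofam b"
    unfolding orthofam_def orthonormal_basis_def DIM_W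
  proof (intro allI impI)
    fix i j :: nat assume ij: "i < 7" "j < 7"
    have "b i \<bullet> b j = (sqrt d * sqrt d) * (L (e7 i) \<bullet> L (e7 j))" by (simp add: b_def)
    also have "\<dots> = e7 i \<bullet> e7 j" using d ip[of "e7 i" "e7 j"] by (simp add: mult.commute)
    finally show "b i \<bullet> b j = (if i = j then 1 else 0)" using inner_e7[OF ij] by simp
  qed
  have Pb: "phi0_tri (b i) (b j) (b k) = sqrt d ^ 3 * phi0_tri (e7 i) (e7 j) (e7 k)" for i j k
    unfolding b_def linear_scale[OF phi0_tri_linear] linear_scale[OF phi0_tri_linear2] linear_scale[OF phi0_tri_linear3] P
    by (simp add: power3_eq_cube)
  have "(\<Sum>i<7. \<Sum>j<7. \<Sum>k<7. phi0_tri (b i) (b j) (b k) * phi0_tri (b i) (b j) (b k)) = 42"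
    using orthofam_trace3[OF b orthofam_e7 phi0_tri_linear phi0_tri_linear2 phi0_tri_linear3 phi0_tri_linear phi0_tri_linear2 phi0_tri_linear3]
      phi0_tri_norm unfolding DIM_W by simp
  moreover have "(\<Sum>i<7. \<Sum>j<7. \<Sum>k<7. phi0_tri (b i) (b j) (b k) * phi0_tri (b i) (b j) (b k))
     = (sqrt d ^ 3 * sqrt d ^ 3) * (\<Sum>i<7. \<Sum>j<7. \<Sum>k<7. phi0_tri (e7 i) (e7 j) (e7 k) * phi0_tri (e7 i) (e7 j) (e7 k))"
    unfolding Pb sum_distrib_left by (intro sum.cong refl) (simp add: algebra_simps)
  moreover have "sqrt d ^ 3 * sqrt d ^ 3 = d ^ 3"
    using d by (metis less_imp_le power_mult_distrib real_sqrt_mult_self abs_of_pos)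
  ultimately have "d ^ 3 = 1" using phi0_tri_norm by simp
  then have "d = 1" using d power_inject_base[of d 2 1] by simp
  then show "L u \<bullet> L w = u \<bullet> w" "vol0 (L \<circ> v) = vol0 v"
    using ip[of u w] vol[of v] by simp_all
qed

lemma phi0_eq_tri: "phi0 v = phi0_tri (v 0) (v 1) (v 2)"
  by (simp add: phi0_eq phi0_tri_def)

lemma linear_inv:
  assumes L: "linear L" "bij L" shows "linear (inv L)"
proof (rule linearI)
  have s: "L (inv L x) = x" and i: "inv L (L y) = y" for x y
    using L(2) by (simp_all add: bij_is_surj surj_f_inv_f bij_is_inj)
  show "inv L (x + y) = inv L x + inv L y" for x y
    using i[of "inv L x + inv L y"] by (simp add: linear_add[OF L(1)] s)
  show "inv L (c *\<^sub>R x) = c *\<^sub>R inv L x" for c x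
    using i[of "c *\<^sub>R inv L x"] by (simp add: linear_scale[OF L(1)] s)
qed

lemma g2_frames:
  assumes "g2_frame \<phi> L" "g2_frame \<phi> L'"
  shows "L' u \<bullet> L' w = L u \<bullet> L w" "vol0 (L' \<circ> v) = vol0 (L \<circ> v)"
proof -
  have L: "linear L" "bij L" "\<And>v. \<phi> v = phi0 (L \<circ> v)" and L': "linear L'" "bij L'" "\<And>v. \<phi> v = phi0 (L' \<circ> v)"
    using assms by (auto simp: g2_frame_def)
  let ?K = "L' \<circ> inv L"
  have lin: "linear (inv L)"
    by (rule linear_inv[OF L(1,2)])
  have K: "linear ?K" by (rule linear_compose[OF lin L'(1)])
  have bij: "bij ?K" using L(2) L'(2) by (simp add: bij_comp bij_imp_bij_inv)
  have P: "phi0_tri (?K x) (?K y) (?K z) = phi0_tri x y z" for x y z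
  proof -
    have "phi0_tri (?K x) (?K y) (?K z) = phi0 (L' \<circ> (inv L \<circ> (\<lambda>i. [x,y,z] ! i)))"
      by (simp add: phi0_eq_tri numeral_nat)
    also have "\<dots> = phi0 (L \<circ> (inv L \<circ> (\<lambda>i. [x,y,z] ! i)))" using L(3) L'(3) by metis
    also have "\<dots> = phi0_tri x y z"
      using L(2) by (simp add: phi0_eq_tri numeral_nat bij_is_surj surj_f_inv_f)
    finally show ?thesis .
  qed
  have inv: "inv L (L x) = x" for x using L(2) by (simp add: bij_is_inj)
  show "L' u \<bullet> L' w = L u \<bullet> L w"
    using stabiliser_phi0(1)[OF K bij P, of "L u" "L w"] by (simp add: inv)
  have eq: "?K \<circ> (L \<circ> v) = L' \<circ> v" by (auto simp: fun_eq_iff inv)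
  show "vol0 (L' \<circ> v) = vol0 (L \<circ> v)"
    using stabiliser_phi0(2)[OF K bij P, of "L \<circ> v"] by (simp only: eq)
qed

text \<open>
  By uniqueness, the definite descriptions in the metric and the volume form can be evaluated with
  any frame.
\<close>

lemma g2_metric_frame: "g2_frame \<phi> L \<Longrightarrow> g2_metric \<phi> u w = L u \<bullet> L w"
  unfolding g2_metric_def using g2_frames(1) by (intro the_equality) blast+

lemma g2_vol_frame: "g2_frame \<phi> L \<Longrightarrow> g2_vol \<phi> v = vol0 (L \<circ> v)"
  unfolding g2_vol_def using g2_frames(2) by (intro the_equality) blast+

section \<open>The Hodge star of the model 3-form\<close>

definition vol0_contract :: "nat \<Rightarrow> nat \<Rightarrow> nat \<Rightarrow> (nat \<Rightarrow> real \<times> (complex^3)) \<Rightarrow> real" where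
  "vol0_contract i j k v = vol0 (case_nat (e7 i) (case_nat (e7 j) (case_nat (e7 k) v)))"

definition star0 :: "(nat \<Rightarrow> real \<times> (complex^3)) \<Rightarrow> real" where
  "star0 v = (\<Sum>i<7. \<Sum>j<7. \<Sum>k<7. phi0_comp i j k * vol0_contract i j k v) / 6"

lemma vol0_linear0: "linear (\<lambda>x. vol0 (case_nat x v))"
proof -
  have "linear (\<lambda>x. vol0 ((case_nat 0 v)(0 := x)))"
    by (rule alternating_linear[OF alternating_vol0]) simp
  moreover have "(case_nat 0 v)(0 := x) = case_nat x v" for x
    by (auto simp: fun_eq_iff split: nat.split)
  ultimately show ?thesis by simp
qed

lemma vol0_skew:
  "vol0 (case_nat y (case_nat x v)) = - vol0 (case_nat x (case_nat y v))"
  "vol0 (case_nat x (case_nat z (case_nat y v))) = - vol0 (case_nat x (case_nat y (case_nat z v)))"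
proof -
  have "vol0 (\<lambda>m. case_nat x (case_nat y v) (Transposition.transpose 0 1 m)) = - vol0 (case_nat x (case_nat y v))"
    by (rule alternating_transpose[OF alternating_vol0]) auto
  moreover have "(\<lambda>m. case_nat x (case_nat y v) (Transposition.transpose 0 1 m)) = case_nat y (case_nat x v)"
    by (auto simp: fun_eq_iff Transposition.transpose_def split: nat.split)
  ultimately show "vol0 (case_nat y (case_nat x v)) = - vol0 (case_nat x (case_nat y v))" by simp
  have "vol0 (\<lambda>m. case_nat x (case_nat y (case_nat z v)) (Transposition.transpose 1 2 m)) = - vol0 (case_nat x (case_nat y (case_nat z v)))"
    by (rule alternating_transpose[OF alternating_vol0]) auto
  moreover have "(\<lambda>m. case_nat x (case_nat y (case_nat z v)) (Transposition.transpose 1 2 m)) = case_nat x (case_nat z (case_nat y v))"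
    by (auto simp: fun_eq_iff Transposition.transpose_def numeral_2_eq_2 split: nat.split)
  ultimately show "vol0 (case_nat x (case_nat z (case_nat y v))) = - vol0 (case_nat x (case_nat y (case_nat z v)))" by simp
qed

lemma vol0_linear1: "linear (\<lambda>y. vol0 (case_nat x (case_nat y v)))"
proof -
  have "(\<lambda>y. vol0 (case_nat x (case_nat y v))) = (\<lambda>y. - vol0 (case_nat y (case_nat x v)))"
    using vol0_skew(1) by blast
  then show ?thesis using linear_compose_neg[OF vol0_linear0] by simp
qed

lemma vol0_linear2: "linear (\<lambda>z. vol0 (case_nat x (case_nat y (case_nat z v))))"
proof -
  have "(\<lambda>z. vol0 (case_nat x (case_nat y (case_nat z v)))) = (\<lambda>z. - vol0 (case_nat x (case_nat z (case_nat y v))))"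
    using vol0_skew(2) by blast
  then show ?thesis using linear_compose_neg[OF vol0_linear1] by simp
qed

text \<open>
  The basis chosen in the component formula is mapped by \<open>L\<close> to some orthonormal family, and the
  formula is a trace in three index pairs; hence the standard basis gives the same value.
\<close>

lemma hodge_star_frame:
  fixes \<phi> :: "('v::euclidean_space, real) covector"
  assumes dim: "DIM('v) = 7" and fr: "g2_frame \<phi> L"
  shows "hodge_star (g2_metric \<phi>) (g2_vol \<phi>) 3 \<phi> v = star0 (L \<circ> v)"
proof -
  have L: "linear L" "bij L" "\<And>v. \<phi> v = phi0 (L \<circ> v)" using fr by (auto simp: g2_frame_def)
  have s: "L (inv L x) = x" for x using L(2) by (simp add: bij_is_surj surj_f_inv_f)
  define b where "b = (SOME b. orthonormal_basis (g2_metric \<phi>) b)"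
  have "orthonormal_basis (g2_metric \<phi>) (inv L \<circ> e7)"
    unfolding orthonormal_basis_def dim by (simp add: g2_metric_frame[OF fr] s inner_e7)
  from someI[of "orthonormal_basis (g2_metric \<phi>)", OF this]
  have "orthonormal_basis (g2_metric \<phi>) b" unfolding b_def .
  then have ob: "orthofam (L \<circ> b)"
    unfolding orthofam_def orthonormal_basis_def dim DIM_W by (simp add: g2_metric_frame[OF fr])
  have summand: "\<phi> (\<lambda>i. b (s i)) * g2_vol \<phi> (\<lambda>i. if i < 3 then b (s i) else v (i - 3))
     = phi0_tri ((L \<circ> b) (s 0)) ((L \<circ> b) (s 1)) ((L \<circ> b) (s 2))
       * vol0 (case_nat ((L \<circ> b) (s 0)) (case_nat ((L \<circ> b) (s 1)) (case_nat ((L \<circ> b) (s 2)) (L \<circ> v))))" for s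
  proof -
    have "L \<circ> (\<lambda>i. if i < 3 then b (s i) else v (i - 3))
      = case_nat ((L \<circ> b) (s 0)) (case_nat ((L \<circ> b) (s 1)) (case_nat ((L \<circ> b) (s 2)) (L \<circ> v)))"
      by (auto simp: fun_eq_iff numeral_3_eq_3 numeral_2_eq_2 split: nat.split)
    then show ?thesis by (simp add: L(3) phi0_eq_tri g2_vol_frame[OF fr])
  qed
  have "hodge_star (g2_metric \<phi>) (g2_vol \<phi>) 3 \<phi> v = (\<Sum>s\<in>{..<3} \<rightarrow>\<^sub>E {..<7}.
      \<phi> (\<lambda>i. b (s i)) * g2_vol \<phi> (\<lambda>i. if i < 3 then b (s i) else v (i - 3))) / fact 3"
    unfolding hodge_star_def Let_def b_def dim ..
  also have "\<dots> = (\<Sum>i<7. \<Sum>j<7. \<Sum>k<7. phi0_tri ((L \<circ> b) i) ((L \<circ> b) j) ((L \<circ> b) k)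
     * vol0 (case_nat ((L \<circ> b) i) (case_nat ((L \<circ> b) j) (case_nat ((L \<circ> b) k) (L \<circ> v))))) / fact 3"
    unfolding summand by (subst sum_PiE_3) (rule refl)
  also have "\<dots> = (\<Sum>i<7. \<Sum>j<7. \<Sum>k<7. phi0_tri (e7 i) (e7 j) (e7 k)
     * vol0 (case_nat (e7 i) (case_nat (e7 j) (case_nat (e7 k) (L \<circ> v))))) / fact 3"
    using orthofam_trace3[OF ob orthofam_e7 phi0_tri_linear phi0_tri_linear2 phi0_tri_linear3, where g =
        "\<lambda>x y z. vol0 (case_nat x (case_nat y (case_nat z (L \<circ> v))))",
        OF vol0_linear0 vol0_linear1 vol0_linear2]
    unfolding DIM_W by simp
  also have "\<dots> = star0 (L \<circ> v)"
    by (simp add: star0_def phi0_comp_def vol0_contract_def fact_numeral)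
  finally show ?thesis .
qed

lemma vol0_contract_sort: "j < i \<Longrightarrow> vol0_contract i j k v = - vol0_contract j i k v" "k < j \<Longrightarrow> vol0_contract i j k v = - vol0_contract i k j v"
  unfolding vol0_contract_def by (rule vol0_skew)+

text \<open>
  The seven lines of the Fano plane, which are the nonzero components of \<open>\<phi>\<^sub>0\<close>.
\<close>

lemma star0_lines: "star0 v = vol0_contract 0 1 2 v + vol0_contract 0 3 4 v + vol0_contract 0 5 6 v + vol0_contract 1 3 6 v + vol0_contract 1 4 5 v
    + vol0_contract 2 3 5 v - vol0_contract 2 4 6 v"
  unfolding star0_def by (simp add: sum_lessThan_7 phi0_comp_simps vol0_contract_sort)

lemma vol0_contract_e7: "vol0_contract i j k (\<lambda>m. e7 (xs ! m)) = vol0_comp (i # j # k # xs)"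
  unfolding vol0_contract_def vol0_comp_def by (intro arg_cong[where f=vol0]) (auto simp: fun_eq_iff split: nat.split)

lemma alternating_vol0_contract: "alternating 4 (vol0_contract i j k)"
proof -
  have "alternating (Suc (Suc (Suc 4))) vol0" using alternating_vol0 by (simp add: numeral_nat)
  from alternating_fix_first[OF alternating_fix_first[OF alternating_fix_first[OF this]]]
  show ?thesis unfolding vol0_contract_def[abs_def] .
qed

lemma alternating_add: "alternating k F \<Longrightarrow> alternating k G \<Longrightarrow> alternating k (\<lambda>v. F v + G v)"
  using alternating_diff[of k F G "- 1"] by simp

lemma alternating_sub: "alternating k F \<Longrightarrow> alternating k G \<Longrightarrow> alternating k (\<lambda>v. F v - G v)"
  using alternating_diff[of k F G 1] by simp

lemma cross_skew_dot: "x \<bullet> (y \<times> z) = - (x \<bullet> (z \<times> y))" "x \<bullet> (y \<times> z) = - (y \<bullet> (x \<times> z))"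
  for x y z :: "real^3"
  by (simp_all add: cross3_simps)

lemma Re3_skew: "Re3 D v u w = - Re3 D u v w" "Re3 D u w v = - Re3 D u v w"
proof -
  show "Re3 D v u w = - Re3 D u v w"
    unfolding Re3_def using cross_skew_dot(2)[of "ac v" "ac u" "ac w"] cross_skew_dot(1)[of "ac w" "ec v" "ec u"]
    by (simp add: algebra_simps)
  show "Re3 D u w v = - Re3 D u v w"
    unfolding Re3_def using cross_skew_dot(1)[of "ac u" "ac w" "ac v"] cross_skew_dot(1)[of "ac u" "ec w" "ec v"]
    by (simp add: algebra_simps)
qed

lemma Re3_linear: "linear (\<lambda>u. Re3 D u v w)"
  by (rule linearI) (simp_all add: Re3_def inner_simps cross_add_left cross_add_right
      cross_mult_left cross_mult_right algebra_simps)

lemma Psi4_linear: "linear (\<lambda>u. Psi4 D S u v w z)"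
  by (rule linearI)
    (simp_all add: Psi4_def linear_add[OF Re3_linear] linear_scale[OF Re3_linear] inner_simps
      cross_add_left cross_add_right cross_mult_left cross_mult_right
      matrix_vector_right_distrib matrix_vector_mult_scaleR algebra_simps)

lemma Psi4_skew: "Psi4 D S v u w z = - Psi4 D S u v w z" "Psi4 D S u w v z = - Psi4 D S u v w z"
  "Psi4 D S u v z w = - Psi4 D S u v w z"
proof -
  have m: "S *v (- x) = - (S *v x)" for x
    using matrix_vector_mult_scaleR[of S "-1" x] by simp
  show "Psi4 D S v u w z = - Psi4 D S u v w z"
    unfolding Psi4_def cross_skew[of "ac v" "ac u"] cross_skew[of "ec v" "ec u"] Re3_skew(1)[of D v u] m
    by (simp add: algebra_simps)
  show "Psi4 D S u w v z = - Psi4 D S u v w z"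
    unfolding Psi4_def cross_skew[of "ac w" "ac v"] cross_skew[of "ec w" "ec v"] Re3_skew(2)[of D u w v]
      Re3_skew(1)[of D w v] m
    by (simp add: algebra_simps)
  show "Psi4 D S u v z w = - Psi4 D S u v w z"
    unfolding Psi4_def cross_skew[of "ac z" "ac w"] cross_skew[of "ec z" "ec w"] Re3_skew(2)[of D _ z w] m
    by (simp add: algebra_simps)
qed

lemma subseqs_4: "(\<forall>xs\<in>set (subseqs [0..<7]). length xs = 4 \<longrightarrow> Q xs) \<longleftrightarrow>
   Q [0,1,2,3] \<and> Q [0,1,2,4] \<and> Q [0,1,2,5] \<and> Q [0,1,2,6] \<and> Q [0,1,3,4] \<and> Q [0,1,3,5] \<and> Q [0,1,3,6]
   \<and> Q [0,1,4,5] \<and> Q [0,1,4,6] \<and> Q [0,1,5,6] \<and> Q [0,2,3,4] \<and> Q [0,2,3,5] \<and> Q [0,2,3,6] \<and> Q [0,2,4,5]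
   \<and> Q [0,2,4,6] \<and> Q [0,2,5,6] \<and> Q [0,3,4,5] \<and> Q [0,3,4,6] \<and> Q [0,3,5,6] \<and> Q [0,4,5,6] \<and> Q [1,2,3,4]
   \<and> Q [1,2,3,5] \<and> Q [1,2,3,6] \<and> Q [1,2,4,5] \<and> Q [1,2,4,6] \<and> Q [1,2,5,6] \<and> Q [1,3,4,5] \<and> Q [1,3,4,6]
   \<and> Q [1,3,5,6] \<and> Q [1,4,5,6] \<and> Q [2,3,4,5] \<and> Q [2,3,4,6] \<and> Q [2,3,5,6] \<and> Q [2,4,5,6] \<and> Q [3,4,5,6]"
  unfolding upt_7 by (simp add: Let_def ball_Un conj_ac)

lemma J7_e7:
  "J7 (e7 0) = (1, 0, 0)" "J7 (e7 1) = (0, 0, axis 1 1)" "J7 (e7 2) = (0, axis 1 1, 0)"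
  "J7 (e7 3) = (0, 0, axis 2 1)" "J7 (e7 4) = (0, axis 2 1, 0)"
  "J7 (e7 5) = (0, 0, axis 3 1)" "J7 (e7 6) = (0, axis 3 1, 0)"
  by (simp_all add: J7_def e7_def numeral_nat vec_eq_iff axis_def)

text \<open>
  Both sides are alternating; the 35 increasing quadruples of basis vectors are compared.
\<close>

lemma star0_eq: "star0 v = Psi4 1 (mat 1) (J7 (v 0)) (J7 (v 1)) (J7 (v 2)) (J7 (v 3))"
proof -
  let ?G = "\<lambda>v. Psi4 1 (mat 1) (J7 (v 0)) (J7 (v 1)) (J7 (v 2)) (J7 (v 3))"
  have "linear (\<lambda>x. Psi4 1 (mat 1) (J7 x) y z w)" for y z w
    using linear_compose[OF linear_J7 Psi4_linear] by (simp add: o_def)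
  then have altG: "alternating 4 ?G"
    by (rule alternating_4) (rule Psi4_skew)+
  have alt: "alternating 4 (\<lambda>v. star0 v - ?G v)"
    unfolding star0_lines by (intro alternating_sub alternating_add alternating_vol0_contract altG)
  have cb: "axis 1 1 \<times> axis 2 1 = (axis 3 1 :: real^3)" "axis 2 1 \<times> axis 1 1 = (- axis 3 1 :: real^3)"
    "axis 2 1 \<times> axis 3 1 = (axis 1 1 :: real^3)" "axis 3 1 \<times> axis 2 1 = (- axis 1 1 :: real^3)"
    "axis 3 1 \<times> axis 1 1 = (axis 2 1 :: real^3)" "axis 1 1 \<times> axis 3 1 = (- axis 2 1 :: real^3)"
    by (fact cross_basis)+
  have "star0 v - ?G v = 0"
    apply (rule alternating_eq_0_basis[OF alt span_e7])
    unfolding subseqs_4 star0_lines vol0_contract_e7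
    by (intro conjI; simp add: vol0_comp_simps J7_e7 J7_e7[simplified] Psi4_def Re3_def cb inner_axis_axis)
  then show ?thesis by simp
qed

section \<open>Reduction of the coefficients to the identity matrix\<close>

text \<open>
  The adjugate.  Unlike \<open>tilde\<close> it is polynomial in the entries, so it can be differentiated without
  regard to invertibility.
\<close>

definition adj3 :: "real^3^3 \<Rightarrow> real^3^3" where
  "adj3 A = vector [
     vector [A$2$2 * A$3$3 - A$2$3 * A$3$2, A$1$3 * A$3$2 - A$1$2 * A$3$3, A$1$2 * A$2$3 - A$1$3 * A$2$2],
     vector [A$2$3 * A$3$1 - A$2$1 * A$3$3, A$1$1 * A$3$3 - A$1$3 * A$3$1, A$1$3 * A$2$1 - A$1$1 * A$2$3],
     vector [A$2$1 * A$3$2 - A$2$2 * A$3$1, A$1$2 * A$3$1 - A$1$1 * A$3$2, A$1$1 * A$2$2 - A$1$2 * A$2$1]]"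

lemma adj3_mult: "A ** adj3 A = det A *\<^sub>R mat 1" "adj3 A ** A = det A *\<^sub>R mat 1"
  by (simp_all add: vec_eq_iff forall_3 matrix_matrix_mult_def sum_3 adj3_def det_3 mat_def algebra_simps)

lemma matrix_inv_mult:
  fixes A :: "real^'n^'n"
  assumes "det A \<noteq> 0" shows "A ** matrix_inv A = mat 1" "matrix_inv A ** A = mat 1"
proof -
  have "\<exists>B. A ** B = mat 1 \<and> B ** A = mat 1"
    using assms unfolding invertible_det_nz[symmetric] invertible_def .
  from someI_ex[OF this] show "A ** matrix_inv A = mat 1" "matrix_inv A ** A = mat 1"
    by (simp_all add: matrix_inv_def)
qed

lemma tilde_adj3: "det A \<noteq> 0 \<Longrightarrow> tilde A = adj3 A"
proof -
  assume "det A \<noteq> 0"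
  then have "A ** matrix_inv A = mat 1" by (rule matrix_inv_mult)
  then have "adj3 A = adj3 A ** (A ** matrix_inv A)" by simp
  also have "\<dots> = (det A *\<^sub>R mat 1) ** matrix_inv A"
    unfolding matrix_mul_assoc adj3_mult ..
  also have "\<dots> = tilde A" unfolding tilde_def scalar_matrix_assoc[symmetric] by simp
  finally show ?thesis ..
qed

lemma symmetric_entries:
  fixes A :: "real^3^3"
  assumes "transpose A = A" shows "A$2$1 = A$1$2" "A$3$1 = A$1$3" "A$3$2 = A$2$3"
proof -
  have "transpose A $ i $ j = A $ i $ j" for i j using assms by simp
  from this[of 1 2] this[of 1 3] this[of 2 3]
  show "A$2$1 = A$1$2" "A$3$1 = A$1$3" "A$3$2 = A$2$3" by (simp_all add: transpose_def)
qed

lemma transpose_adj3: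
  assumes "transpose A = A" shows "transpose (adj3 A) = adj3 A"
  using symmetric_entries[OF assms]
  by (simp add: vec_eq_iff forall_3 transpose_def adj3_def algebra_simps)

lemma quad_form_3:
  "x \<bullet> (A *v x) = (\<Sum>i\<in>UNIV. \<Sum>j\<in>UNIV. x$i * A$i$j * x$j)" for A :: "real^3^3"
  by (simp add: inner_vec_def matrix_vector_mult_def sum_distrib_left mult.assoc)

text \<open>
  Completing squares one variable at a time.  The Schur complements are positive because they are
  values of the quadratic form at the minimisers used below.
\<close>

lemma cholesky_3:
  assumes S: "posdef_symmetric S"
  obtains G :: "real^3^3" where "S = G ** transpose G" "det G > 0"
proof -
  have sym: "S$2$1 = S$1$2" "S$3$1 = S$1$3" "S$3$2 = S$2$3"
    using S by (auto simp: posdef_symmetric_def dest: symmetric_entries)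
  have pos: "x \<noteq> 0 \<Longrightarrow> (\<Sum>i\<in>UNIV. \<Sum>j\<in>UNIV. x$i * S$i$j * x$j) > 0" for x
    using S unfolding posdef_symmetric_def quad_form_3 by blast
  have p1: "S$1$1 > 0"
    using pos[of "vector [1,0,0]"] by (simp add: sum_3 vec_eq_iff forall_3)
  define g11 where "g11 = sqrt (S$1$1)"
  have g11: "g11 > 0" "S$1$1 = g11 * g11" using p1 by (simp_all add: g11_def)
  define g21 where "g21 = S$1$2 / g11"
  define g31 where "g31 = S$1$3 / g11"
  have s1: "S$1$2 = g11 * g21" "S$1$3 = g11 * g31" using g11 by (simp_all add: g21_def g31_def)
  define m2 where "m2 = S$2$2 - g21 * g21"
  (* This vector, scaled to avoid division, minimises the form over the first coordinate. *)
  have q: "(\<Sum>i\<in>UNIV. \<Sum>j\<in>UNIV. vector [- g21, g11, 0]$i * S$i$j * vector [- g21, g11, 0]$j) = g11 * g11 * m2"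
    by (simp add: sum_3 sym s1 g11 m2_def algebra_simps)
  have nz: "vector [- g21, g11, 0] \<noteq> (0 :: real^3)" using g11 by (simp add: vec_eq_iff forall_3)
  have "g11 * g11 * m2 > 0" using pos[OF nz] unfolding q .
  then have m2: "m2 > 0" using g11 by (simp add: zero_less_mult_iff)
  define g22 where "g22 = sqrt m2"
  have g22: "g22 > 0" "m2 = g22 * g22" using m2 by (simp_all add: g22_def)
  define g32 where "g32 = (S$2$3 - g21 * g31) / g22"
  have s2: "S$2$2 = g21 * g21 + g22 * g22" "S$2$3 = g21 * g31 + g22 * g32"
    using g22 by (simp_all add: g32_def m2_def)
  define m3 where "m3 = S$3$3 - g31 * g31 - g32 * g32"
  (* \<open>(x1, x2)\<close> makes both linear factors vanish, so that only the last pivot remains. *)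
  define x2 where "x2 = - g32 / g22"
  define x1 where "x1 = - (g21 * x2 + g31) / g11"
  have x: "g22 * x2 = - g32" "g11 * x1 = - (g21 * x2 + g31)" using g11 g22 by (simp_all add: x1_def x2_def)
  have "(\<Sum>i\<in>UNIV. \<Sum>j\<in>UNIV. vector [x1, x2, 1]$i * S$i$j * vector [x1, x2, 1]$j)
      = (g11 * x1 + g21 * x2 + g31)\<^sup>2 + (g22 * x2 + g32)\<^sup>2 + m3"
    by (simp add: sum_3 sym s1 s2 g11 m3_def power2_eq_square algebra_simps)
  also have "\<dots> = m3" by (simp add: x)
  finally have "m3 > 0"
    using pos[of "vector [x1, x2, 1]"] by (simp add: vec_eq_iff forall_3)
  define g33 where "g33 = sqrt m3"
  have g33: "g33 > 0" "m3 = g33 * g33" using \<open>m3 > 0\<close> by (simp_all add: g33_def)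
  have s3: "S$3$3 = g31 * g31 + g32 * g32 + g33 * g33" using g33 by (simp add: m3_def)
  let ?G = "vector [vector [g11, 0, 0], vector [g21, g22, 0], vector [g31, g32, g33]] :: real^3^3"
  have "S = ?G ** transpose ?G"
    by (simp add: vec_eq_iff forall_3 matrix_matrix_mult_def transpose_def sum_3 sym s1 s2 s3 g11 algebra_simps)
  moreover have "det ?G > 0" using g11 g22 g33 by (simp add: det_3)
  ultimately show thesis by (rule that)
qed

lemma posdef_det_pos: "posdef_symmetric S \<Longrightarrow> det S > 0"
  by (metis cholesky_3 det_mul det_transpose mult_pos_pos)

lemma inner_matvec: "x \<bullet> (A *v y) = (transpose A *v x) \<bullet> y" for A :: "real^3^3"
  by (simp add: dot_lmul_matrix[symmetric])

text \<open>
  In terms of the coframe: \<open>dt\<close>, \<open>e\<close> and \<open>a\<close> of a triple with \<open>S = G G\<^sup>T\<close> are \<open>dt/det G\<close>, \<open>G e/det G\<close> and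
  \<open>G a\<close> of one with the identity matrix.  The powers of \<open>det G\<close> are forced by the three terms of
  \<open>Phi3\<close>.
\<close>

definition unscale :: "real^3^3 \<Rightarrow> r7 \<Rightarrow> r7" where
  "unscale G u = (tc u / det G, (1 / det G) *\<^sub>R (G *v ec u), G *v ac u)"

lemma triple_matvec: "(G *v x) \<bullet> ((G *v y) \<times> (G *v z)) = det G * (x \<bullet> (y \<times> z))"
proof -
  have "((G *v y) \<times> (G *v z)) \<bullet> (G *v x) = (transpose G *v ((G *v y) \<times> (G *v z))) \<bullet> x"
    by (rule inner_matvec)
  then show ?thesis unfolding cross_matrix_mult by (simp add: inner_commute)
qed

context
  fixes S G :: "real^3^3"
  assumes SG: "S = G ** transpose G" and G: "det G > 0"
begin

lemma det_SG: "det S = det G * det G"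
  by (simp add: SG det_mul)

text \<open>
  From \<open>S~ = det S (G G\<^sup>T)\<^sup>-\<^sup>1\<close>; computed with the adjugate and cancelling \<open>G\<close> on the left.
\<close>

lemma tilde_SG: "transpose G ** tilde S ** G = det S *\<^sub>R mat 1"
proof -
  have d: "det S \<noteq> 0" using G by (simp add: det_SG)
  have inv: "matrix_inv G ** G = mat 1" using G by (intro matrix_inv_mult) simp
  have "G ** (transpose G ** tilde S ** G) = S ** adj3 S ** G"
    by (simp add: SG matrix_mul_assoc tilde_adj3[OF d, unfolded SG])
  also have "\<dots> = G ** (det S *\<^sub>R mat 1)"
    by (simp add: adj3_mult scalar_matrix_assoc[symmetric] matrix_scalar_ac)
  finally have "matrix_inv G ** (G ** (transpose G ** tilde S ** G)) = matrix_inv G ** (G ** (det S *\<^sub>R mat 1))"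
    by simp
  then show ?thesis unfolding matrix_mul_assoc inv matrix_mul_lid .
qed

lemma mixed2_unscale: "mixed2 (tilde S) (unscale G u) (unscale G v) = det G * mixed2 (mat 1) u v"
proof -
  have "(G *v a) \<bullet> (tilde S *v (G *v e)) = det S * (a \<bullet> e)" for a e
  proof -
    have "(G *v a) \<bullet> (tilde S *v (G *v e)) = a \<bullet> (transpose G *v (tilde S *v (G *v e)))"
      by (subst inner_matvec[of a "transpose G"]) simp
    also have "transpose G *v (tilde S *v (G *v e)) = det S *\<^sub>R e"
      unfolding matrix_vector_mul_assoc matrix_mul_assoc tilde_SG scaleR_matrix_vector_assoc[symmetric]
      by simp
    finally show ?thesis by simp
  qed
  then show ?thesis
    using G by (simp add: mixed2_def unscale_def matrix_vector_mult_scaleR det_SG field_simps)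
qed

lemma Phi3_unscale:
  "Phi3 (det S) (tilde S) (unscale G u) (unscale G v) (unscale G w) = Phi3 1 (mat 1) u v w"
  unfolding Phi3_def mixed2_unscale
  using G by (simp add: unscale_def cross_mult_left cross_mult_right triple_matvec det_SG)

lemma Re3_unscale: "Re3 (det S) (unscale G u) (unscale G v) (unscale G w) = det G * Re3 1 u v w"
  unfolding Re3_def
  using G by (simp add: unscale_def cross_mult_left cross_mult_right triple_matvec det_SG algebra_simps)

lemma Psi4_unscale:
  "Psi4 (det S) S (unscale G u) (unscale G v) (unscale G w) (unscale G z) = Psi4 1 (mat 1) u v w z"
proof -
  have "((G *v x) \<times> (G *v y)) \<bullet> (S *v ((G *v p) \<times> (G *v q))) = (det G * det G) * ((x \<times> y) \<bullet> (p \<times> q))"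
    for x y p q
    unfolding SG matrix_vector_mul_assoc[symmetric] inner_matvec[of _ G] cross_matrix_mult by simp
  then show ?thesis
    unfolding Psi4_def Re3_unscale
    using G by (simp add: unscale_def cross_mult_left cross_mult_right matrix_vector_mult_scaleR)
qed

end

lemma J7_bij: "bij J7"
proof (rule bijI)
  show "inj J7" by (rule injI) (auto simp: J7_def prod_eq_iff vec_eq_iff complex_eq_iff)
  show "surj J7"
  proof (rule surjI)
    fix u show "J7 (tc u, \<chi> k. Complex (ac u $ k) (ec u $ k)) = u"
      by (simp add: J7_def prod_eq_iff vec_eq_iff)
  qed
qed

lemma unscale_linear: "linear (unscale G)"
  by (rule linearI) (simp_all add: unscale_def matrix_vector_right_distrib matrix_vector_mult_scaleR
      scaleR_add_right add_divide_distrib)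

lemma unscale_bij: assumes "det G \<noteq> 0" shows "bij (unscale G)"
proof -
  have i: "G *v (matrix_inv G *v x) = x" "matrix_inv G *v (G *v x) = x" for x
    using matrix_inv_mult[OF assms] by (simp_all add: matrix_vector_mul_assoc)
  show ?thesis
  proof (rule bijI)
    show "inj (unscale G)"
    proof (rule injI)
      fix u v assume "unscale G u = unscale G v"
      then have *: "tc u = tc v" "G *v ec u = G *v ec v" "G *v ac u = G *v ac v"
        using assms by (auto simp: unscale_def)
      have "ec u = ec v" "ac u = ac v" using *(2,3) i(2) by metis+
      then show "u = v" using *(1) by (simp add: prod_eq_iff)
    qed
    show "surj (unscale G)"
    proof (rule surjI)
      fix u show "unscale G (det G * tc u, det G *\<^sub>R (matrix_inv G *v ec u), matrix_inv G *v ac u) = u"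
        using assms by (simp add: unscale_def matrix_vector_mult_scaleR i prod_eq_iff)
    qed
  qed
qed

text \<open>
  Undoing the scaling by the Cholesky factor turns the coframe \<open>\<kappa>\<close> into one in which the 3-form is
  the model form and, simultaneously, the 4-form is the model dual.
\<close>

lemma g2_frame_Phi3:
  fixes \<kappa> :: "'v::euclidean_space \<Rightarrow> r7"
  assumes S: "posdef_symmetric S" and \<kappa>: "linear \<kappa>" "bij \<kappa>"
    and \<phi>: "\<And>v. \<phi> v = Phi3 (det S) (tilde S) (\<kappa> (v 0)) (\<kappa> (v 1)) (\<kappa> (v 2))"
  obtains L where "g2_frame \<phi> L"
    "\<And>v. star0 (L \<circ> v) = Psi4 (det S) S (\<kappa> (v 0)) (\<kappa> (v 1)) (\<kappa> (v 2)) (\<kappa> (v 3))"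
proof -
  obtain G where G: "S = G ** transpose G" "det G > 0" using cholesky_3[OF S] by blast
  have b: "bij (unscale G)" using G(2) by (intro unscale_bij) simp
  let ?L = "inv J7 \<circ> (inv (unscale G) \<circ> \<kappa>)"
  have lin: "linear ?L"
    by (intro linear_compose \<kappa> linear_inv linear_J7 J7_bij unscale_linear b)
  have bij: "bij ?L" by (intro bij_comp \<kappa> bij_imp_bij_inv b J7_bij)
  have J: "J7 (?L x) = inv (unscale G) (\<kappa> x)" for x
    using J7_bij by (simp add: bij_is_surj surj_f_inv_f)
  have u: "unscale G (inv (unscale G) x) = x" for x
    using b by (simp add: bij_is_surj surj_f_inv_f)
  show thesis
  proof
    show "g2_frame \<phi> ?L"
      unfolding g2_frame_def
    proof (intro conjI lin bij allI)
      fix v show "\<phi> v = phi0 (?L \<circ> v)"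
        unfolding phi0_eq \<phi> comp_apply[of ?L] J Phi3_unscale[OF G, symmetric] u ..
    qed
    show "star0 (?L \<circ> v) = Psi4 (det S) S (\<kappa> (v 0)) (\<kappa> (v 1)) (\<kappa> (v 2)) (\<kappa> (v 3))" for v
      unfolding star0_eq comp_apply[of ?L] J Psi4_unscale[OF G, symmetric] u ..
  qed
qed

section \<open>Exterior derivatives in a moving coframe\<close>

text \<open>
  For a form whose value is a fixed multilinear expression in a coframe \<open>\<theta>\<close> with variable
  coefficients, the exterior derivative consists of the derivative of the coefficients in the
  direction of one argument and of terms in which \<open>d\<theta>\<close> fills one slot.
\<close>

text \<open>
  The antisymmetrisations that occur in \<open>d\<close> of a 3-form and, below, of a 4-form: \<open>c x\<close> is the
  derivative of the coefficients along \<open>x\<close>, and \<open>k x y\<close> is the form with \<open>d\<theta>(x, y)\<close> in its first slot.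
\<close>

definition ext4 where
  "ext4 c k x y z w = c x y z w - c y x z w + c z x y w - c w x y z
     + (k x y z w - k x z y w + k x w y z + k y z x w - k y w x z + k z w x y :: real)"

definition ext5 where
  "ext5 c k x y z w s = c x y z w s - c y x z w s + c z x y w s - c w x y z s + c s x y z w
     + (k x y z w s - k x z y w s + k x w y z s - k x s y z w + k y z x w s - k y w x z s + k y s x z w
        + k z w x y s - k z s x y w + k w s x y z :: real)"

lemma linear_ops:
  fixes f g :: "'a::real_vector \<Rightarrow> real"
  shows "linear f \<Longrightarrow> linear g \<Longrightarrow> linear (\<lambda>x. f x + g x)"
    "linear f \<Longrightarrow> linear g \<Longrightarrow> linear (\<lambda>x. f x - g x)"
  by (rule linear_compose_add, assumption+) (rule linear_compose_sub, assumption+)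

lemma alternating_ext4:
  assumes c: "\<And>y z w. linear (\<lambda>x. c x y z w)" "\<And>x z w. linear (\<lambda>y. c x y z w)"
    and k: "\<And>y z w. linear (\<lambda>x. k x y z w)" "\<And>x y w. linear (\<lambda>z. k x y z w)"
    and cs: "\<And>x y z w. c x z y w = - c x y z w" "\<And>x y z w. c x y w z = - c x y z w"
    and ks: "\<And>x y z w. k y x z w = - k x y z w" "\<And>x y z w. k x y w z = - k x y z w"
  shows "alternating 4 (\<lambda>v. ext4 c k (v 0) (v 1) (v 2) (v 3))"
proof (rule alternating_4)
  show "linear (\<lambda>x. ext4 c k x y z w)" for y z w
    unfolding ext4_def by (intro linear_ops c k)
  fix x y z w
  show "ext4 c k y x z w = - ext4 c k x y z w"
    unfolding ext4_def using cs(1)[of z x y w] cs(1)[of w x y z] ks(1)[of x y z w] ks(2)[of z w x y] by simp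
  show "ext4 c k x z y w = - ext4 c k x y z w"
    unfolding ext4_def using cs(1)[of x y z w] cs(2)[of w x y z] ks(1)[of y z x w] ks(2)[of x w y z] by simp
  show "ext4 c k x y w z = - ext4 c k x y z w"
    unfolding ext4_def using cs(2)[of x y z w] cs(2)[of y x z w] ks(2)[of x y z w] ks(1)[of z w x y] by simp
qed

lemma alternating_ext5:
  assumes c: "\<And>y z w s. linear (\<lambda>x. c x y z w s)" "\<And>x z w s. linear (\<lambda>y. c x y z w s)"
    and k: "\<And>y z w s. linear (\<lambda>x. k x y z w s)" "\<And>x y w s. linear (\<lambda>z. k x y z w s)"
    and cs: "\<And>x y z w s. c x z y w s = - c x y z w s" "\<And>x y z w s. c x y w z s = - c x y z w s"
      "\<And>x y z w s. c x y z s w = - c x y z w s"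
    and ks: "\<And>x y z w s. k y x z w s = - k x y z w s" "\<And>x y z w s. k x y w z s = - k x y z w s"
      "\<And>x y z w s. k x y z s w = - k x y z w s"
  shows "alternating 5 (\<lambda>v. ext5 c k (v 0) (v 1) (v 2) (v 3) (v 4))"
proof (rule alternating_5)
  show "linear (\<lambda>x. ext5 c k x y z w s)" for y z w s
    unfolding ext5_def by (intro linear_ops c k)
  fix x y z w s
  show "ext5 c k y x z w s = - ext5 c k x y z w s"
    unfolding ext5_def using cs(1)[of z x y w s] cs(1)[of w x y z s] cs(1)[of s x y z w]
      ks(1)[of x y z w s] ks(2)[of z w x y s] ks(2)[of z s x y w] ks(2)[of w s x y z] by simp
  show "ext5 c k x z y w s = - ext5 c k x y z w s"
    unfolding ext5_def using cs(1)[of x y z w s] cs(2)[of w x y z s] cs(2)[of s x y z w]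
      ks(1)[of y z x w s] ks(2)[of x w y z s] ks(2)[of x s y z w] ks(3)[of w s x y z] by simp
  show "ext5 c k x y w z s = - ext5 c k x y z w s"
    unfolding ext5_def using cs(2)[of x y z w s] cs(2)[of y x z w s] cs(3)[of s x y z w]
      ks(1)[of z w x y s] ks(2)[of x y z w s] ks(3)[of x s y z w] ks(3)[of y s x z w] by simp
  show "ext5 c k x y z s w = - ext5 c k x y z w s"
    unfolding ext5_def using cs(3)[of x y z w s] cs(3)[of y x z w s] cs(3)[of z x y w s]
      ks(1)[of w s x y z] ks(3)[of x y z w s] ks(3)[of x z y w s] ks(3)[of y z x w s] by simp
qed

text \<open>
  The forms are affine in their coefficients; these are the homogeneous parts, which occur when the
  coefficients are differentiated.
\<close>

definition Phi3_lin where "Phi3_lin D A u v w = Phi3 D A u v w - Phi3 0 0 u v w"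
definition Psi4_lin where "Psi4_lin D S u v w z = Psi4 D S u v w z - Psi4 0 0 u v w z"

lemma bounded_bilinear_cross3: "bounded_bilinear (cross3 :: real^3 \<Rightarrow> real^3 \<Rightarrow> real^3)"
  using bilinear_cross bilinear_conv_bounded_bilinear by blast

lemma bounded_bilinear_matvec: "bounded_bilinear (\<lambda>(A::real^3^3) x. A *v x)"
proof -
  have "bilinear (\<lambda>(A::real^3^3) x. A *v x)"
    unfolding bilinear_def
    by (auto intro!: linearI simp: matrix_vector_mult_add_rdistrib matrix_vector_right_distrib
        matrix_vector_mult_scaleR scaleR_matrix_vector_assoc)
  then show ?thesis using bilinear_conv_bounded_bilinear by blast
qed

lemmas has_derivative_cross3 = bounded_bilinear.FDERIV[OF bounded_bilinear_cross3]
lemmas has_derivative_matvec = bounded_bilinear.FDERIV[OF bounded_bilinear_matvec]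

lemmas form_derivs = has_derivative_cross3 has_derivative_matvec has_derivative_inner has_derivative_mult
  has_derivative_add has_derivative_diff has_derivative_minus has_derivative_fst has_derivative_snd

lemma has_derivative_triple:
  assumes "(p has_derivative p') (at y)" "(q has_derivative q') (at y)" "(r has_derivative r') (at y)"
  shows "((\<lambda>z. p z \<bullet> (q z \<times> r z)) has_derivative
     (\<lambda>w. p' w \<bullet> (q y \<times> r y) + p y \<bullet> (q' w \<times> r y) + p y \<bullet> (q y \<times> r' w))) (at y)"
  by (rule has_derivative_eq_rhs, (rule form_derivs assms)+) (auto simp: fun_eq_iff inner_simps)

lemma has_derivative_mixed2:
  assumes "(A has_derivative A') (at y)" "(p has_derivative p') (at y)" "(q has_derivative q') (at y)"
  shows "((\<lambda>z. mixed2 (A z) (p z) (q z)) has_derivative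
     (\<lambda>w. mixed2 (A' w) (p y) (q y) + mixed2 (A y) (p' w) (q y) + mixed2 (A y) (p y) (q' w))) (at y)"
  unfolding mixed2_def
  by (rule has_derivative_eq_rhs, (rule form_derivs assms)+) (auto simp: fun_eq_iff inner_simps)

lemma has_derivative_Phi3:
  assumes "(D has_derivative D') (at y)" "(A has_derivative A') (at y)"
    "(p has_derivative p') (at y)" "(q has_derivative q') (at y)" "(r has_derivative r') (at y)"
  shows "((\<lambda>z. Phi3 (D z) (A z) (p z) (q z) (r z)) has_derivative
     (\<lambda>w. Phi3_lin (D' w) (A' w) (p y) (q y) (r y) + Phi3 (D y) (A y) (p' w) (q y) (r y)
        + Phi3 (D y) (A y) (p y) (q' w) (r y) + Phi3 (D y) (A y) (p y) (q y) (r' w))) (at y)"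
  unfolding Phi3_def
  by (rule has_derivative_eq_rhs, (rule has_derivative_triple has_derivative_mixed2 form_derivs assms)+)
     (simp add: fun_eq_iff Phi3_lin_def Phi3_def mixed2_def algebra_simps)

lemma has_derivative_Re3:
  assumes "(D has_derivative D') (at y)"
    "(p has_derivative p') (at y)" "(q has_derivative q') (at y)" "(r has_derivative r') (at y)"
  shows "((\<lambda>z. Re3 (D z) (p z) (q z) (r z)) has_derivative
     (\<lambda>w. (Re3 (D' w) (p y) (q y) (r y) - Re3 0 (p y) (q y) (r y)) + Re3 (D y) (p' w) (q y) (r y)
        + Re3 (D y) (p y) (q' w) (r y) + Re3 (D y) (p y) (q y) (r' w))) (at y)"
  unfolding Re3_def
  by (rule has_derivative_eq_rhs, (rule has_derivative_triple form_derivs assms)+)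
     (simp add: fun_eq_iff algebra_simps)

lemma has_derivative_quad:
  assumes "(S has_derivative S') (at y)"
    "(p has_derivative p') (at y)" "(q has_derivative q') (at y)" "(r has_derivative r') (at y)" "(s has_derivative s') (at y)"
  shows "((\<lambda>z. (p z \<times> q z) \<bullet> (S z *v (r z \<times> s z))) has_derivative
     (\<lambda>w. (p y \<times> q y) \<bullet> (S' w *v (r y \<times> s y)) + (p' w \<times> q y) \<bullet> (S y *v (r y \<times> s y))
        + (p y \<times> q' w) \<bullet> (S y *v (r y \<times> s y)) + (p y \<times> q y) \<bullet> (S y *v (r' w \<times> s y))
        + (p y \<times> q y) \<bullet> (S y *v (r y \<times> s' w)))) (at y)"
  by (rule has_derivative_eq_rhs, (rule form_derivs assms)+)
     (simp add: fun_eq_iff inner_simps matrix_vector_right_distrib)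

lemma has_derivative_Psi4:
  assumes "(D has_derivative D') (at y)" "(S has_derivative S') (at y)"
    "(p has_derivative p') (at y)" "(q has_derivative q') (at y)" "(r has_derivative r') (at y)" "(s has_derivative s') (at y)"
  shows "((\<lambda>z. Psi4 (D z) (S z) (p z) (q z) (r z) (s z)) has_derivative
     (\<lambda>w. Psi4_lin (D' w) (S' w) (p y) (q y) (r y) (s y) + Psi4 (D y) (S y) (p' w) (q y) (r y) (s y)
        + Psi4 (D y) (S y) (p y) (q' w) (r y) (s y) + Psi4 (D y) (S y) (p y) (q y) (r' w) (s y)
        + Psi4 (D y) (S y) (p y) (q y) (r y) (s' w))) (at y)"
  unfolding Psi4_def
  by (rule has_derivative_eq_rhs, (rule has_derivative_quad has_derivative_Re3 form_derivs assms)+)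
     (simp add: fun_eq_iff Psi4_lin_def Psi4_def algebra_simps)

lemma frechet_derivative_eq_on:
  assumes "open U" "y \<in> U" "\<And>z. z \<in> U \<Longrightarrow> f z = g z" "(g has_derivative g') (at y)"
  shows "frechet_derivative f (at y) = g'" "f differentiable (at y)"
proof -
  have "(f has_derivative g') (at y)"
    using has_derivative_transform_within_open[OF assms(4,1,2)] assms(3) by metis
  then show "frechet_derivative f (at y) = g'" "f differentiable (at y)"
    using frechet_derivative_at differentiable_def by (metis, blast)
qed

text \<open>
  Each partial derivative is given by the product rule; the terms in which \<open>\<theta>\<close> is differentiated pair
  up to the skew differences \<open>\<theta>' p q - \<theta>' q p\<close>, which are the values of \<open>d\<theta>\<close>.
\<close>

lemma ext_deriv_Phi3:
  fixes F :: "('a, 'e::euclidean_space) form" and \<theta> :: "'e \<Rightarrow> 'e \<Rightarrow> r7"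
  assumes U: "open U" "y \<in> U"
    and F: "\<And>z v. z \<in> U \<Longrightarrow> F C z v = Phi3 (D z) (A z) (\<theta> z (v 0)) (\<theta> z (v 1)) (\<theta> z (v 2))"
    and D: "(D has_derivative D') (at y)" and A: "(A has_derivative A') (at y)"
    and \<theta>: "\<And>v. ((\<lambda>z. \<theta> z v) has_derivative (\<lambda>w. \<theta>' w v)) (at y)"
  shows "ext_deriv 3 F C y v =
    ext4 (\<lambda>x p q r. Phi3_lin (D' x) (A' x) (\<theta> y p) (\<theta> y q) (\<theta> y r))
       (\<lambda>p q r s. Phi3 (D y) (A y) (\<theta>' p q - \<theta>' q p) (\<theta> y r) (\<theta> y s)) (v 0) (v 1) (v 2) (v 3)"
proof -
  let ?P = "Phi3 (D y) (A y)" and ?t = "\<theta> y"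
  have fr: "frechet_derivative (\<lambda>z. F C z u) (at y) w = Phi3_lin (D' w) (A' w) (?t (u 0)) (?t (u 1)) (?t (u 2))
      + ?P (\<theta>' w (u 0)) (?t (u 1)) (?t (u 2)) + ?P (?t (u 0)) (\<theta>' w (u 1)) (?t (u 2))
      + ?P (?t (u 0)) (?t (u 1)) (\<theta>' w (u 2))" for u w
    using frechet_derivative_eq_on(1)[OF U F has_derivative_Phi3[OF D A \<theta> \<theta> \<theta>]] by simp
  have d: "?P (p - q) r s = ?P p r s - ?P q r s" for p q r s
    by (rule linear_diff[OF Phi3_linear])
  have s1: "?P p x q = - ?P x p q" and s2: "?P p q x = ?P x p q" for p q x
    using Phi3_skew(1)[of "D y" "A y" x p q] Phi3_skew(1)[of "D y" "A y" x p q] Phi3_skew(2)[of "D y" "A y" p x q]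
    by simp_all
  have "{..3::nat} = {0,1,2,3}" by auto
  then show ?thesis
    unfolding ext_deriv_def
    by (simp add: fr ext4_def d numeral_2_eq_2 numeral_3_eq_3 s1[of _ "\<theta>' _ _"] s2[of _ _ "\<theta>' _ _"])
qed

lemma ext_deriv_Psi4:
  fixes F :: "('a, 'e::euclidean_space) form" and \<theta> :: "'e \<Rightarrow> 'e \<Rightarrow> r7"
  assumes U: "open U" "y \<in> U"
    and F: "\<And>z v. z \<in> U \<Longrightarrow> F C z v = Psi4 (D z) (S z) (\<theta> z (v 0)) (\<theta> z (v 1)) (\<theta> z (v 2)) (\<theta> z (v 3))"
    and D: "(D has_derivative D') (at y)" and S: "(S has_derivative S') (at y)"
    and \<theta>: "\<And>v. ((\<lambda>z. \<theta> z v) has_derivative (\<lambda>w. \<theta>' w v)) (at y)"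
  shows "ext_deriv 4 F C y v =
    ext5 (\<lambda>x p q r s. Psi4_lin (D' x) (S' x) (\<theta> y p) (\<theta> y q) (\<theta> y r) (\<theta> y s))
       (\<lambda>p q r s u. Psi4 (D y) (S y) (\<theta>' p q - \<theta>' q p) (\<theta> y r) (\<theta> y s) (\<theta> y u))
       (v 0) (v 1) (v 2) (v 3) (v 4)"
proof -
  let ?P = "Psi4 (D y) (S y)" and ?t = "\<theta> y"
  have fr: "frechet_derivative (\<lambda>z. F C z u) (at y) w = Psi4_lin (D' w) (S' w) (?t (u 0)) (?t (u 1)) (?t (u 2)) (?t (u 3))
      + ?P (\<theta>' w (u 0)) (?t (u 1)) (?t (u 2)) (?t (u 3)) + ?P (?t (u 0)) (\<theta>' w (u 1)) (?t (u 2)) (?t (u 3))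
      + ?P (?t (u 0)) (?t (u 1)) (\<theta>' w (u 2)) (?t (u 3)) + ?P (?t (u 0)) (?t (u 1)) (?t (u 2)) (\<theta>' w (u 3))" for u w
    using frechet_derivative_eq_on(1)[OF U F has_derivative_Psi4[OF D S \<theta> \<theta> \<theta> \<theta>]] by simp
  have d: "?P (p - q) r s u = ?P p r s u - ?P q r s u" for p q r s u
    by (rule linear_diff[OF Psi4_linear])
  have s1: "?P p x q r = - ?P x p q r" and s2: "?P p q x r = ?P x p q r" and s3: "?P p q r x = - ?P x p q r" for p q r x
    using Psi4_skew(1)[of "D y" "S y" x p q r] Psi4_skew(2)[of "D y" "S y" p x q r] Psi4_skew(3)[of "D y" "S y" p q x r]
    by simp_all
  have "{..4::nat} = {0,1,2,3,4}" by auto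
  moreover have four: "(4::nat) = Suc (Suc (Suc (Suc 0)))" by simp
  ultimately show ?thesis
    unfolding ext_deriv_def
    by (simp add: fr ext5_def d numeral_2_eq_2 numeral_3_eq_3 four s1[of _ "\<theta>' _ _"] s2[of _ _ "\<theta>' _ _"] s3[of _ _ _ "\<theta>' _ _"])
qed

section \<open>The structure equations as matrix equations\<close>

text \<open>
  The adjugate of a 3 by 3 matrix is quadratic, so that its derivative is its polarisation.
\<close>

definition dadj :: "real^3^3 \<Rightarrow> real^3^3 \<Rightarrow> real^3^3" where
  "dadj S H = adj3 (S + H) - adj3 S - adj3 H"

text \<open>
  Jacobi's formula for the derivative of the determinant.
\<close>

definition ddet :: "real^3^3 \<Rightarrow> real^3^3 \<Rightarrow> real" where
  "ddet S H = (\<Sum>i\<in>UNIV. \<Sum>j\<in>UNIV. adj3 S $ j $ i * H $ i $ j)"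

lemma dadj_zero: "dadj S 0 = 0" by (simp add: dadj_def adj3_def vec_eq_iff forall_3)
lemma ddet_zero: "ddet S 0 = 0" by (simp add: ddet_def)

lemma linear_dadj: "linear (dadj S)"
  by (rule linearI) (simp_all add: dadj_def adj3_def vec_eq_iff forall_3 algebra_simps)

lemma has_derivative_adj3:
  assumes "(S has_derivative S') (at y)"
  shows "((\<lambda>z. adj3 (S z)) has_derivative (\<lambda>w. dadj (S y) (S' w))) (at y)"
proof -
  let ?B = "\<lambda>X Y. (1 / 2) *\<^sub>R dadj X Y"
  have "(\<lambda>X. dadj X Y) = dadj Y" for Y by (simp add: fun_eq_iff dadj_def add.commute)
  then have "linear (\<lambda>X. dadj X Y)" for Y using linear_dadj[of Y] by simp
  then have "bilinear ?B"
    unfolding bilinear_def by (intro conjI allI linear_compose_scale_right linear_dadj)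
  then have bb: "bounded_bilinear ?B" using bilinear_conv_bounded_bilinear by blast
  have "((\<lambda>z. ?B (S z) (S z)) has_derivative (\<lambda>w. ?B (S y) (S' w) + ?B (S' w) (S y))) (at y)"
    by (rule bounded_bilinear.FDERIV[OF bb assms assms])
  moreover have "?B X X = adj3 X" for X
    by (simp add: dadj_def adj3_def vec_eq_iff forall_3 algebra_simps)
  moreover have "?B X Y + ?B Y X = dadj X Y" for X Y
    by (simp add: dadj_def vec_eq_iff add.commute[of Y X] field_simps)
  ultimately show ?thesis by simp
qed

lemma has_derivative_det3:
  fixes S :: "'a::real_normed_vector \<Rightarrow> real^3^3"
  assumes "(S has_derivative S') (at y)"
  shows "((\<lambda>z. det (S z)) has_derivative (\<lambda>w. ddet (S y) (S' w))) (at y)"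
proof -
  have e: "((\<lambda>z. S z $ i $ j) has_derivative (\<lambda>w. S' w $ i $ j)) (at y)" for i j
    by (intro bounded_linear.has_derivative[OF bounded_linear_vec_nth] assms)
  show ?thesis
    unfolding det_3
    by (rule has_derivative_eq_rhs, (rule has_derivative_add has_derivative_diff has_derivative_mult e)+)
       (simp add: fun_eq_iff ddet_def adj3_def sum_3 algebra_simps)
qed

abbreviation Uv :: r7 where "Uv \<equiv> (1, 0, 0)"
abbreviation Ev :: "real^3 \<Rightarrow> r7" where "Ev x \<equiv> (0, x, 0)"
abbreviation Av :: "real^3 \<Rightarrow> r7" where "Av x \<equiv> (0, 0, x)"

text \<open>
  The basis dual to the coframe \<open>(dt, e\<^sup>1, e\<^sup>2, e\<^sup>3, a\<^sup>1, a\<^sup>2, a\<^sup>3)\<close>.  It is sorted by type, so that the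
  components of a form group into \<open>dt\<close>-, \<open>e\<close>- and \<open>a\<close>-degrees.
\<close>

definition frame7 :: "nat \<Rightarrow> r7" where
  "frame7 i = [Uv, Ev (axis 1 1), Ev (axis 2 1), Ev (axis 3 1), Av (axis 1 1), Av (axis 2 1), Av (axis 3 1)] ! i"

lemma span_frame7: "span (frame7 ` {..<7}) = UNIV"
proof -
  have "u \<in> span (frame7 ` {..<7})" for u
  proof -
    have "u = (\<Sum>i<7. ([tc u, ec u $ 1, ec u $ 2, ec u $ 3, ac u $ 1, ac u $ 2, ac u $ 3] ! i) *\<^sub>R frame7 i)"
      by (simp add: sum_lessThan_7 frame7_def prod_eq_iff vec_eq_iff forall_3 axis_def numeral_nat)
    then show ?thesis by (metis (no_types, lifting) imageI span_base span_scale span_sum)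
  qed
  then show ?thesis by auto
qed

lemma frame7_simps: "frame7 0 = Uv" "frame7 1 = Ev (axis 1 1)" "frame7 2 = Ev (axis 2 1)" "frame7 3 = Ev (axis 3 1)"
  "frame7 4 = Av (axis 1 1)" "frame7 5 = Av (axis 2 1)" "frame7 6 = Av (axis 3 1)"
  by (simp_all add: frame7_def numeral_nat)

text \<open>
  \<open>dS = S0 dt + Sk\<^sub>k e\<^sup>k\<close>.
\<close>

definition d_coeff :: "real^3^3 \<Rightarrow> (3 \<Rightarrow> real^3^3) \<Rightarrow> r7 \<Rightarrow> real^3^3" where
  "d_coeff S0 Sk x = tc x *\<^sub>R S0 + (\<Sum>k\<in>UNIV. (ec x $ k) *\<^sub>R Sk k)"

text \<open>
  The differentials of \<open>dt\<close>, \<open>e\<close> and \<open>a\<close>: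
  \<open>0\<close>, \<open>de\<^sup>i = T\<^sub>i\<^sub>j ^e\<^sup>j + P\<^sub>i\<^sub>k dt e\<^sup>k\<close> and \<open>da\<^sup>i = Om\<^sub>i\<^sub>j ^e\<^sup>j + Q\<^sub>i\<^sub>k dt e\<^sup>k\<close>.
\<close>

definition d_coframe :: "real^3^3 \<Rightarrow> real^3^3 \<Rightarrow> real^3^3 \<Rightarrow> real^3^3 \<Rightarrow> r7 \<Rightarrow> r7 \<Rightarrow> r7" where
  "d_coframe T P Om Q x y = (0,
      T *v (ec x \<times> ec y) + P *v (tc x *\<^sub>R ec y - tc y *\<^sub>R ec x),
      Om *v (ec x \<times> ec y) + Q *v (tc x *\<^sub>R ec y - tc y *\<^sub>R ec x))"

lemma d_coeff_simps: "d_coeff S0 Sk Uv = S0" "d_coeff S0 Sk (Av p) = 0"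
  "d_coeff S0 Sk (Ev (axis k 1)) = Sk k"
proof -
  show "d_coeff S0 Sk (Ev (axis k 1)) = Sk k"
    by (simp add: d_coeff_def axis_def if_distrib[of "\<lambda>c. c *\<^sub>R _"] cong: if_cong)
qed (simp_all add: d_coeff_def)

lemma d_coeff_linear: "linear (d_coeff S0 Sk)"
  by (rule linearI) (simp_all add: d_coeff_def scaleR_add_left sum.distrib scaleR_sum_right algebra_simps)

lemma d_coframe_linear: "linear (\<lambda>x. d_coframe T P Om Q x y)"
  by (rule linearI) (simp_all add: d_coframe_def cross_add_left cross_mult_left matrix_vector_right_distrib
    matrix_vector_mult_scaleR matrix_vector_mult_diff_distrib algebra_simps)

lemma matvec_minus: "A *v (- x) = - (A *v x)" for A :: "real^3^3"
  using matrix_vector_mult_scaleR[of A "-1" x] by simp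

lemma d_coframe_skew: "d_coframe T P Om Q y x = - d_coframe T P Om Q x y"
proof -
  have "tc y *\<^sub>R ec x - tc x *\<^sub>R ec y = - (tc x *\<^sub>R ec y - tc y *\<^sub>R ec x)" by simp
  then show ?thesis
    unfolding d_coframe_def cross_skew[of "ec y" "ec x"] by (simp only: matvec_minus) simp
qed

lemma linear_ddet: "linear (ddet S)"
  by (rule linearI) (simp_all add: ddet_def sum.distrib sum_distrib_left algebra_simps)

lemma linear_mixed2_coeff: "mixed2 (A + B) u v = mixed2 A u v + mixed2 B u v"
  "mixed2 (r *\<^sub>R A) u v = r * mixed2 A u v"
  by (simp_all add: mixed2_def matrix_vector_mult_add_rdistrib scaleR_matrix_vector_assoc[symmetric]
      inner_simps algebra_simps)

definition coeff3 where "coeff3 S S0 Sk x y z w = Phi3_lin (ddet S (d_coeff S0 Sk x)) (dadj S (d_coeff S0 Sk x)) y z w"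
definition frame3 where "frame3 S T P Om Q x y z w = Phi3 (det S) (adj3 S) (d_coframe T P Om Q x y) z w"
definition coeff4 where "coeff4 S S0 Sk x y z w s = Psi4_lin (ddet S (d_coeff S0 Sk x)) (d_coeff S0 Sk x) y z w s"
definition frame4 where "frame4 S T P Om Q x y z w s = Psi4 (det S) S (d_coframe T P Om Q x y) z w s"

lemma Phi3_lin_eq: "Phi3_lin D A u v w =
   mixed2 A u v * tc w - mixed2 A u w * tc v + mixed2 A v w * tc u - D * (ec u \<bullet> (ec v \<times> ec w))"
  by (simp add: Phi3_lin_def Phi3_def mixed2_def)

lemma Psi4_lin_eq: "Psi4_lin D S u v w z =
     - ((ac u \<times> ac v) \<bullet> (S *v (ec w \<times> ec z)) - (ac u \<times> ac w) \<bullet> (S *v (ec v \<times> ec z))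
        + (ac u \<times> ac z) \<bullet> (S *v (ec v \<times> ec w)) + (ac v \<times> ac w) \<bullet> (S *v (ec u \<times> ec z))
        - (ac v \<times> ac z) \<bullet> (S *v (ec u \<times> ec w)) + (ac w \<times> ac z) \<bullet> (S *v (ec u \<times> ec v)))
     - ((Re3 D u v w - Re3 0 u v w) * tc z - (Re3 D u v z - Re3 0 u v z) * tc w
        + (Re3 D u w z - Re3 0 u w z) * tc v - (Re3 D v w z - Re3 0 v w z) * tc u)"
  by (simp add: Psi4_lin_def Psi4_def algebra_simps)

lemma Phi3_lin_coeff_linear: "linear (\<lambda>x. Phi3_lin (ddet S (d_coeff S0 Sk x)) (dadj S (d_coeff S0 Sk x)) y z w)"
  unfolding Phi3_lin_eq
  by (rule linearI) (simp_all add: linear_add[OF d_coeff_linear] linear_scale[OF d_coeff_linear]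
    linear_add[OF linear_ddet] linear_scale[OF linear_ddet] linear_add[OF linear_dadj] linear_scale[OF linear_dadj]
    linear_mixed2_coeff algebra_simps)

lemma Psi4_lin_coeff_linear: "linear (\<lambda>x. Psi4_lin (ddet S (d_coeff S0 Sk x)) (d_coeff S0 Sk x) y z w s)"
  unfolding Psi4_lin_eq Re3_def
  by (rule linearI) (simp_all add: linear_add[OF d_coeff_linear] linear_scale[OF d_coeff_linear]
    linear_add[OF linear_ddet] linear_scale[OF linear_ddet] matrix_vector_mult_add_rdistrib
    scaleR_matrix_vector_assoc[symmetric] inner_simps algebra_simps)

lemma Phi3_lin_linear: "linear (\<lambda>u. Phi3_lin D A u v w)"
  unfolding Phi3_lin_def by (intro linear_ops Phi3_linear)

lemma Psi4_lin_linear: "linear (\<lambda>u. Psi4_lin D S u v w z)"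
  unfolding Psi4_lin_def by (intro linear_ops Psi4_linear)

lemma Phi3_lin_skew: "Phi3_lin D A v u w = - Phi3_lin D A u v w" "Phi3_lin D A u w v = - Phi3_lin D A u v w"
  unfolding Phi3_lin_def using Phi3_skew[of D A u v w] Phi3_skew[of 0 0 u v w]
    Phi3_skew(1)[of D A v u w] Phi3_skew(1)[of 0 0 v u w] by simp_all

lemma Psi4_lin_skew: "Psi4_lin D S v u w z = - Psi4_lin D S u v w z" "Psi4_lin D S u w v z = - Psi4_lin D S u v w z"
  "Psi4_lin D S u v z w = - Psi4_lin D S u v w z"
  unfolding Psi4_lin_def using Psi4_skew(1)[of D S v u w z] Psi4_skew(1)[of 0 0 v u w z]
    Psi4_skew(2)[of D S u w v z] Psi4_skew(2)[of 0 0 u w v z]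
    Psi4_skew(3)[of D S u v z w] Psi4_skew(3)[of 0 0 u v z w] by simp_all

lemma Phi3_linear2: "linear (\<lambda>v. Phi3 D A u v w)"
proof -
  have "(\<lambda>v. Phi3 D A u v w) = (\<lambda>v. - Phi3 D A v u w)" using Phi3_skew(1) by blast
  then show ?thesis using linear_compose_neg[OF Phi3_linear] by simp
qed

lemma Psi4_linear2: "linear (\<lambda>v. Psi4 D S u v w z)"
proof -
  have "(\<lambda>v. Psi4 D S u v w z) = (\<lambda>v. - Psi4 D S v u w z)" using Psi4_skew(1) by blast
  then show ?thesis using linear_compose_neg[OF Psi4_linear] by simp
qed

lemma alternating_ext4_3: "alternating 4 (\<lambda>v. ext4 (coeff3 S S0 Sk) (frame3 S T P Om Q) (v 0) (v 1) (v 2) (v 3))"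
proof (rule alternating_ext4)
  show "linear (\<lambda>x. coeff3 S S0 Sk x y z w)" "linear (\<lambda>y. coeff3 S S0 Sk x y z w)" for x y z w
    unfolding coeff3_def by (rule Phi3_lin_coeff_linear Phi3_lin_linear)+
  show "linear (\<lambda>x. frame3 S T P Om Q x y z w)" for y z w
    unfolding frame3_def using linear_compose[OF d_coframe_linear Phi3_linear] by (simp add: o_def)
  show "linear (\<lambda>z. frame3 S T P Om Q x y z w)" for x y w
    unfolding frame3_def by (rule Phi3_linear2)
  show "coeff3 S S0 Sk x z y w = - coeff3 S S0 Sk x y z w" "coeff3 S S0 Sk x y w z = - coeff3 S S0 Sk x y z w" for x y z w
    unfolding coeff3_def by (rule Phi3_lin_skew)+
  show "frame3 S T P Om Q y x z w = - frame3 S T P Om Q x y z w" for x y z w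
    unfolding frame3_def d_coframe_skew[of _ _ _ _ y x] by (rule linear_neg[OF Phi3_linear])
  show "frame3 S T P Om Q x y w z = - frame3 S T P Om Q x y z w" for x y z w
    unfolding frame3_def by (rule Phi3_skew)
qed

lemma alternating_ext5_4: "alternating 5 (\<lambda>v. ext5 (coeff4 S S0 Sk) (frame4 S T P Om Q) (v 0) (v 1) (v 2) (v 3) (v 4))"
proof (rule alternating_ext5)
  show "linear (\<lambda>x. coeff4 S S0 Sk x y z w s)" "linear (\<lambda>y. coeff4 S S0 Sk x y z w s)" for x y z w s
    unfolding coeff4_def by (rule Psi4_lin_coeff_linear Psi4_lin_linear)+
  show "linear (\<lambda>x. frame4 S T P Om Q x y z w s)" for y z w s
    unfolding frame4_def using linear_compose[OF d_coframe_linear Psi4_linear] by (simp add: o_def)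
  show "linear (\<lambda>z. frame4 S T P Om Q x y z w s)" for x y w s
    unfolding frame4_def by (rule Psi4_linear2)
  show "coeff4 S S0 Sk x z y w s = - coeff4 S S0 Sk x y z w s" "coeff4 S S0 Sk x y w z s = - coeff4 S S0 Sk x y z w s"
    "coeff4 S S0 Sk x y z s w = - coeff4 S S0 Sk x y z w s" for x y z w s
    unfolding coeff4_def by (rule Psi4_lin_skew)+
  show "frame4 S T P Om Q y x z w s = - frame4 S T P Om Q x y z w s" for x y z w s
    unfolding frame4_def d_coframe_skew[of _ _ _ _ y x] by (rule linear_neg[OF Psi4_linear])
  show "frame4 S T P Om Q x y w z s = - frame4 S T P Om Q x y z w s" "frame4 S T P Om Q x y z s w = - frame4 S T P Om Q x y z w s" for x y z w s
    unfolding frame4_def by (rule Psi4_skew)+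
qed

lemmas ext_simps = ext4_def ext5_def coeff3_def frame3_def coeff4_def frame4_def d_coeff_simps dadj_zero ddet_zero d_coframe_def
  Phi3_lin_eq Phi3_def mixed2_def Psi4_lin_eq Psi4_def Re3_def

text \<open>
  Components of \<open>d\<close> of the 3-form on arguments of pure type; in the names that follow, \<open>T\<close>, \<open>E\<close> and
  \<open>A\<close> stand for arguments dual to \<open>dt\<close>, \<open>e\<close> and \<open>a\<close>.
\<close>

lemma ext4_types:
  "ext4 (coeff3 S S0 Sk) (frame3 S T P Om Q) (Ev x) (Ev y) (Av p) (Av q) = (T *v (x \<times> y)) \<bullet> (p \<times> q)"
  "ext4 (coeff3 S S0 Sk) (frame3 S T P Om Q) (Ev x) (Av p) (Av q) (Av r) = 0"
  "ext4 (coeff3 S S0 Sk) (frame3 S T P Om Q) Uv (Ev x) (Av p) (Av q) = (P *v x) \<bullet> (p \<times> q)"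
  "ext4 (coeff3 S S0 Sk) (frame3 S T P Om Q) Uv (Av p) (Av q) (Av r) = 0"
  by (simp_all add: ext_simps)

lemma ext4_EEEA: "ext4 (coeff3 S S0 Sk) (frame3 S T P Om Q) (Ev x) (Ev y) (Ev z) (Av p) =
   - (z \<bullet> ((Om *v (x \<times> y)) \<times> p)) + y \<bullet> ((Om *v (x \<times> z)) \<times> p) - x \<bullet> ((Om *v (y \<times> z)) \<times> p)"
  by (simp add: ext_simps)

lemma ext4_TEEE: "ext4 (coeff3 S S0 Sk) (frame3 S T P Om Q) Uv (Ev x) (Ev y) (Ev z) =
   - ddet S S0 * (x \<bullet> (y \<times> z)) - det S * ((P *v x) \<bullet> (y \<times> z)) + det S * ((P *v y) \<bullet> (x \<times> z))
   - det S * ((P *v z) \<bullet> (x \<times> y))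
   - (Om *v (x \<times> y)) \<bullet> (adj3 S *v z) + (Om *v (x \<times> z)) \<bullet> (adj3 S *v y) - (Om *v (y \<times> z)) \<bullet> (adj3 S *v x)"
  by (simp add: ext_simps)

lemma ext4_TEEA: "ext4 (coeff3 S S0 Sk) (frame3 S T P Om Q) Uv (Ev (axis i 1)) (Ev (axis j 1)) (Av p) =
   p \<bullet> (dadj S (Sk i) *v axis j 1) - p \<bullet> (dadj S (Sk j) *v axis i 1)
   - axis j 1 \<bullet> ((Q *v axis i 1) \<times> p) + axis i 1 \<bullet> ((Q *v axis j 1) \<times> p)
   + p \<bullet> (adj3 S *v (T *v (axis i 1 \<times> axis j 1)))"
  by (simp add: ext_simps)

text \<open>
  For the 4-form the components are needed once \<open>T = P = 0\<close> is known.
\<close>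

lemma ext5_types:
  "ext5 (coeff4 S S0 Sk) (frame4 S 0 0 Om Q) (Ev x) (Ev y) (Av p) (Av q) (Av r) = 0"
  "ext5 (coeff4 S S0 Sk) (frame4 S 0 0 Om Q) Uv (Ev x) (Av p) (Av q) (Av r) = 0"
  "ext5 (coeff4 S S0 Sk) (frame4 S 0 0 Om Q) Uv (Ev x) (Ev y) (Av p) (Av q) =
     - (p \<times> q) \<bullet> (S0 *v (x \<times> y)) - (Om *v (x \<times> y)) \<bullet> (p \<times> q)"
  by (simp_all add: ext_simps)

lemma ext5_EEEAA: "ext5 (coeff4 S S0 Sk) (frame4 S 0 0 Om Q) (Ev (axis i 1)) (Ev (axis j 1)) (Ev (axis k 1)) (Av p) (Av q) =
     - (p \<times> q) \<bullet> (Sk i *v (axis j 1 \<times> axis k 1)) + (p \<times> q) \<bullet> (Sk j *v (axis i 1 \<times> axis k 1))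
     - (p \<times> q) \<bullet> (Sk k *v (axis i 1 \<times> axis j 1))"
  by (simp add: ext_simps)

lemma ext5_TEEEA: "ext5 (coeff4 S S0 Sk) (frame4 S 0 0 Om Q) Uv (Ev (axis i 1)) (Ev (axis j 1)) (Ev (axis k 1)) (Av p) =
     ddet S (Sk i) * (p \<bullet> (axis j 1 \<times> axis k 1)) - ddet S (Sk j) * (p \<bullet> (axis i 1 \<times> axis k 1))
     + ddet S (Sk k) * (p \<bullet> (axis i 1 \<times> axis j 1))
     - ((Q *v axis i 1) \<times> p) \<bullet> (S *v (axis j 1 \<times> axis k 1))
     + ((Q *v axis j 1) \<times> p) \<bullet> (S *v (axis i 1 \<times> axis k 1))
     - ((Q *v axis k 1) \<times> p) \<bullet> (S *v (axis i 1 \<times> axis j 1))"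
  by (simp add: ext_simps)

lemma subseqs_5: "(\<forall>xs\<in>set (subseqs [0..<7]). length xs = 5 \<longrightarrow> R xs) \<longleftrightarrow>
   R [0,1,2,3,4] \<and> R [0,1,2,3,5] \<and> R [0,1,2,3,6] \<and> R [0,1,2,4,5] \<and> R [0,1,2,4,6] \<and> R [0,1,2,5,6]
   \<and> R [0,1,3,4,5] \<and> R [0,1,3,4,6] \<and> R [0,1,3,5,6] \<and> R [0,1,4,5,6] \<and> R [0,2,3,4,5] \<and> R [0,2,3,4,6]
   \<and> R [0,2,3,5,6] \<and> R [0,2,4,5,6] \<and> R [0,3,4,5,6] \<and> R [1,2,3,4,5] \<and> R [1,2,3,4,6] \<and> R [1,2,3,5,6]
   \<and> R [1,2,4,5,6] \<and> R [1,3,4,5,6] \<and> R [2,3,4,5,6]"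
  unfolding upt_7 by (simp add: Let_def ball_Un conj_ac)

lemmas vec3_simps = inner_vec_def sum_3 cross3_def vector_3 axis_def matrix_vector_mult_def

text \<open>
  Each component type determines one of the conditions: \<open>EEAA\<close> the matrix \<open>T\<close>, \<open>TEAA\<close> the matrix \<open>P\<close>,
  \<open>EEEA\<close> the skew part of \<open>Om\<close>, \<open>TEEA\<close> the matrix \<open>Q\<close>, and \<open>TEEE\<close> one scalar equation.
\<close>

lemma ext4_zero_iff:
  assumes S: "transpose S = S" and Sk: "\<And>k. transpose (Sk k) = Sk k"
  shows "(\<forall>x y z w. ext4 (coeff3 S S0 Sk) (frame3 S T P Om Q) x y z w = 0) \<longleftrightarrow>
    T = 0 \<and> P = 0 \<and> (\<forall>i j. Om $ i $ j = Om $ j $ i) \<and>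
    (\<forall>i k. Q $ i $ k = - (\<Sum>\<alpha>\<in>UNIV. \<Sum>\<beta>\<in>UNIV. levi_civita i \<alpha> \<beta> * dadj S (Sk \<beta>) $ k $ \<alpha>))
    \<and> ddet S S0 = - (\<Sum>i\<in>UNIV. \<Sum>j\<in>UNIV. adj3 S $ j $ i * Om $ i $ j)" (is "?L \<longleftrightarrow> ?R")
proof -
  have symA: "transpose (dadj S (Sk k)) = dadj S (Sk k)" for k
    using transpose_adj3[of "S + Sk k"] transpose_adj3[OF S] transpose_adj3[OF Sk[of k]] S Sk[of k]
    by (simp add: dadj_def transpose_def vec_eq_iff)
  note sA = symmetric_entries[OF symA[of 1]] symmetric_entries[OF symA[of 2]] symmetric_entries[OF symA[of 3]]
  note sS = symmetric_entries[OF transpose_adj3[OF S]]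
  let ?A = "\<lambda>k. dadj S (Sk k)"
  have Q_iff: "(\<forall>i k. Q $ i $ k = - (\<Sum>\<alpha>\<in>UNIV. \<Sum>\<beta>\<in>UNIV. levi_civita i \<alpha> \<beta> * ?A \<beta> $ k $ \<alpha>)) \<longleftrightarrow>
    (\<forall>k. Q $ 1 $ k = ?A 2 $ k $ 3 - ?A 3 $ k $ 2) \<and> (\<forall>k. Q $ 2 $ k = ?A 3 $ k $ 1 - ?A 1 $ k $ 3)
    \<and> (\<forall>k. Q $ 3 $ k = ?A 1 $ k $ 2 - ?A 2 $ k $ 1)"
    by (simp add: forall_3 sum_3 levi_civita_def)
  have Om_iff: "(\<forall>i j. Om $ i $ j = Om $ j $ i) \<longleftrightarrow> Om$2$1 = Om$1$2 \<and> Om$3$1 = Om$1$3 \<and> Om$3$2 = Om$2$3"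
    by (auto simp: forall_3)
  show ?thesis
  proof
    assume L: ?L
    have T: "(T *v (x \<times> y)) \<bullet> (p \<times> q) = 0" for x y p q using L ext4_types(1) by metis
    have "T = 0"
      using T[of "axis 1 1" "axis 2 1" "axis 1 1" "axis 2 1"] T[of "axis 1 1" "axis 2 1" "axis 2 1" "axis 3 1"] T[of "axis 1 1" "axis 2 1" "axis 3 1" "axis 1 1"]
        T[of "axis 2 1" "axis 3 1" "axis 1 1" "axis 2 1"] T[of "axis 2 1" "axis 3 1" "axis 2 1" "axis 3 1"] T[of "axis 2 1" "axis 3 1" "axis 3 1" "axis 1 1"]
        T[of "axis 3 1" "axis 1 1" "axis 1 1" "axis 2 1"] T[of "axis 3 1" "axis 1 1" "axis 2 1" "axis 3 1"] T[of "axis 3 1" "axis 1 1" "axis 3 1" "axis 1 1"]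
      by (simp add: vec3_simps vec_eq_iff[of T] vec_eq_iff[of "T $ _"] forall_3)
    moreover have P: "(P *v x) \<bullet> (p \<times> q) = 0" for x p q using L ext4_types(3) by metis
    have "P = 0"
      using P[of "axis 1 1" "axis 1 1" "axis 2 1"] P[of "axis 1 1" "axis 2 1" "axis 3 1"] P[of "axis 1 1" "axis 3 1" "axis 1 1"]
        P[of "axis 2 1" "axis 1 1" "axis 2 1"] P[of "axis 2 1" "axis 2 1" "axis 3 1"] P[of "axis 2 1" "axis 3 1" "axis 1 1"]
        P[of "axis 3 1" "axis 1 1" "axis 2 1"] P[of "axis 3 1" "axis 2 1" "axis 3 1"] P[of "axis 3 1" "axis 3 1" "axis 1 1"]
      by (simp add: vec3_simps vec_eq_iff[of P] vec_eq_iff[of "P $ _"] forall_3)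
    moreover have O: "- (z \<bullet> ((Om *v (x \<times> y)) \<times> p)) + y \<bullet> ((Om *v (x \<times> z)) \<times> p) - x \<bullet> ((Om *v (y \<times> z)) \<times> p) = 0"
      for x y z p using L ext4_EEEA by metis
    have "Om$2$1 = Om$1$2 \<and> Om$3$1 = Om$1$3 \<and> Om$3$2 = Om$2$3"
      using O[of "axis 3 1" "axis 1 1" "axis 2 1" "axis 1 1"] O[of "axis 3 1" "axis 1 1" "axis 2 1" "axis 2 1"]
        O[of "axis 3 1" "axis 1 1" "axis 2 1" "axis 3 1"]
      by (simp add: vec3_simps)
    moreover have q: "p \<bullet> (?A i *v axis j 1) - p \<bullet> (?A j *v axis i 1)
       - axis j 1 \<bullet> ((Q *v axis i 1) \<times> p) + axis i 1 \<bullet> ((Q *v axis j 1) \<times> p) = 0" for i j p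
      using L ext4_TEEA[of S S0 Sk T P Om Q i j p] \<open>T = 0\<close> by simp
    have "(\<forall>k. Q $ 1 $ k = ?A 2 $ k $ 3 - ?A 3 $ k $ 2) \<and> (\<forall>k. Q $ 2 $ k = ?A 3 $ k $ 1 - ?A 1 $ k $ 3)
    \<and> (\<forall>k. Q $ 3 $ k = ?A 1 $ k $ 2 - ?A 2 $ k $ 1)"
      using q[of "axis 1 1" 1 2] q[of "axis 2 1" 1 2] q[of "axis 3 1" 1 2]
        q[of "axis 1 1" 1 3] q[of "axis 2 1" 1 3] q[of "axis 3 1" 1 3]
        q[of "axis 1 1" 2 3] q[of "axis 2 1" 2 3] q[of "axis 3 1" 2 3]
      by (simp add: vec3_simps sA forall_3)
    moreover have "ddet S S0 = - (\<Sum>i\<in>UNIV. \<Sum>j\<in>UNIV. adj3 S $ j $ i * Om $ i $ j)"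
      using L[rule_format, of Uv "Ev (axis 1 1)" "Ev (axis 2 1)" "Ev (axis 3 1)"] \<open>P = 0\<close>
      unfolding ext4_TEEE by (simp add: vec3_simps sS algebra_simps)
    ultimately show ?R unfolding Q_iff Om_iff by blast
  next
    assume R: ?R
    then have T: "T = 0" "P = 0" and O: "Om$2$1 = Om$1$2" "Om$3$1 = Om$1$3" "Om$3$2 = Om$2$3"
      and D: "ddet S S0 = - (\<Sum>i\<in>UNIV. \<Sum>j\<in>UNIV. adj3 S $ j $ i * Om $ i $ j)"
      unfolding Om_iff by blast+
    have q: "(\<forall>k. Q $ 1 $ k = ?A 2 $ k $ 3 - ?A 3 $ k $ 2) \<and> (\<forall>k. Q $ 2 $ k = ?A 3 $ k $ 1 - ?A 1 $ k $ 3)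
    \<and> (\<forall>k. Q $ 3 $ k = ?A 1 $ k $ 2 - ?A 2 $ k $ 1)" using R unfolding Q_iff by blast
    have "ext4 (coeff3 S S0 Sk) (frame3 S T P Om Q) (v 0) (v 1) (v 2) (v 3) = 0" for v :: "nat \<Rightarrow> r7"
      apply (rule alternating_eq_0_basis[OF alternating_ext4_3 span_frame7])
      unfolding subseqs_4
      by (intro conjI; simp add: frame7_simps frame7_simps[simplified] ext4_types T ext4_EEEA ext4_TEEE ext4_TEEA D;
        (simp add: vec3_simps O sA sS q forall_3 algebra_simps)?)
    from this[of "\<lambda>i. [_,_,_,_] ! i"] show ?L by (auto simp: numeral_nat)
  qed
qed

text \<open>
  \<open>EEEAA\<close> gives the divergence condition and \<open>TEEAA\<close> the equation for \<open>S0\<close>.  The component \<open>TEEEA\<close>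
  holds automatically: after substitution of \<open>Q\<close> it is linear in the divergences.
\<close>

lemma ext5_zero_iff:
  assumes S: "transpose S = S" and Sk: "\<And>k. transpose (Sk k) = Sk k"
    and Q: "\<And>i k. Q $ i $ k = - (\<Sum>\<alpha>\<in>UNIV. \<Sum>\<beta>\<in>UNIV. levi_civita i \<alpha> \<beta> * dadj S (Sk \<beta>) $ k $ \<alpha>)"
  shows "(\<forall>x y z w s. ext5 (coeff4 S S0 Sk) (frame4 S 0 0 Om Q) x y z w s = 0) \<longleftrightarrow>
    (\<forall>i. (\<Sum>\<alpha>\<in>UNIV. Sk \<alpha> $ i $ \<alpha>) = 0) \<and> (\<forall>i j. S0 $ i $ j = - Om $ i $ j)" (is "?L \<longleftrightarrow> ?R")
proof -
  note sK = symmetric_entries[OF Sk[of 1]] symmetric_entries[OF Sk[of 2]] symmetric_entries[OF Sk[of 3]]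
  note sS = symmetric_entries[OF S]
  let ?A = "\<lambda>k. dadj S (Sk k)"
  have q: "(\<forall>k. Q $ 1 $ k = ?A 2 $ k $ 3 - ?A 3 $ k $ 2) \<and> (\<forall>k. Q $ 2 $ k = ?A 3 $ k $ 1 - ?A 1 $ k $ 3)
    \<and> (\<forall>k. Q $ 3 $ k = ?A 1 $ k $ 2 - ?A 2 $ k $ 1)"
    using Q by (simp add: forall_3 sum_3 levi_civita_def)
  show ?thesis
  proof
    assume L: ?L
    have O: "- (p \<times> q) \<bullet> (S0 *v (x \<times> y)) - (Om *v (x \<times> y)) \<bullet> (p \<times> q) = 0" for x y p q
      using L ext5_types(3) by metis
    have "\<forall>i j. S0 $ i $ j = - Om $ i $ j"
      using O[of "axis 1 1" "axis 2 1" "axis 1 1" "axis 2 1"] O[of "axis 1 1" "axis 2 1" "axis 2 1" "axis 3 1"] O[of "axis 1 1" "axis 2 1" "axis 3 1" "axis 1 1"]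
        O[of "axis 2 1" "axis 3 1" "axis 1 1" "axis 2 1"] O[of "axis 2 1" "axis 3 1" "axis 2 1" "axis 3 1"] O[of "axis 2 1" "axis 3 1" "axis 3 1" "axis 1 1"]
        O[of "axis 3 1" "axis 1 1" "axis 1 1" "axis 2 1"] O[of "axis 3 1" "axis 1 1" "axis 2 1" "axis 3 1"] O[of "axis 3 1" "axis 1 1" "axis 3 1" "axis 1 1"]
      by (simp add: vec3_simps forall_3)
    moreover have "- (p \<times> q) \<bullet> (Sk 1 *v (axis 2 1 \<times> axis 3 1)) + (p \<times> q) \<bullet> (Sk 2 *v (axis 1 1 \<times> axis 3 1))
     - (p \<times> q) \<bullet> (Sk 3 *v (axis 1 1 \<times> axis 2 1)) = 0" for p q
      using L ext5_EEEAA[of S S0 Sk Om Q 1 2 3 p q] by simp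
    from this[of "axis 1 1" "axis 2 1"] this[of "axis 2 1" "axis 3 1"] this[of "axis 3 1" "axis 1 1"]
    have "\<forall>i. (\<Sum>\<alpha>\<in>UNIV. Sk \<alpha> $ i $ \<alpha>) = 0"
      by (simp add: vec3_simps forall_3 sK algebra_simps)
    ultimately show ?R by blast
  next
    assume ?R
    then have S0: "S0 = - Om" and K: "(\<Sum>\<alpha>\<in>UNIV. Sk \<alpha> $ i $ \<alpha>) = 0" for i
      by (auto simp: vec_eq_iff)
    (* The divergence conditions, solved for one entry each so that they can serve as rewrite rules. *)
    have K1: "Sk 1 $ 1 $ 1 = - Sk 2 $ 1 $ 2 - Sk 3 $ 1 $ 3" "Sk 2 $ 2 $ 2 = - Sk 1 $ 1 $ 2 - Sk 3 $ 2 $ 3"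
      "Sk 3 $ 3 $ 3 = - Sk 1 $ 1 $ 3 - Sk 2 $ 2 $ 3"
      using K[of 1] K[of 2] K[of 3] by (simp_all add: sum_3 sK)
    have divfree: "\<And>p. ddet S (Sk 1) * (p \<bullet> (axis 2 1 \<times> axis 3 1)) - ddet S (Sk 2) * (p \<bullet> (axis 1 1 \<times> axis 3 1))
     + ddet S (Sk 3) * (p \<bullet> (axis 1 1 \<times> axis 2 1))
     - ((Q *v axis 1 1) \<times> p) \<bullet> (S *v (axis 2 1 \<times> axis 3 1))
     + ((Q *v axis 2 1) \<times> p) \<bullet> (S *v (axis 1 1 \<times> axis 3 1))
     - ((Q *v axis 3 1) \<times> p) \<bullet> (S *v (axis 1 1 \<times> axis 2 1)) = 0"
      by (simp add: vec3_simps q dadj_def adj3_def ddet_def sK sS K1 algebra_simps)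
    have "ext5 (coeff4 S S0 Sk) (frame4 S 0 0 Om Q) (v 0) (v 1) (v 2) (v 3) (v 4) = 0" for v :: "nat \<Rightarrow> r7"
      apply (rule alternating_eq_0_basis[OF alternating_ext5_4 span_frame7])
      unfolding subseqs_5
      by (intro conjI; simp add: frame7_simps frame7_simps[simplified] ext5_types ext5_EEEAA ext5_TEEEA S0 divfree;
        (simp add: vec3_simps sK K1 algebra_simps)?)
    from this[of "\<lambda>i. [_,_,_,_,_] ! i"] show ?L by (auto simp: numeral_nat)
  qed
qed

text \<open>
  The scalar equation left over from the 3-form is the trace of \<open>S0 = - Om\<close> against the adjugate of \<open>S\<close>,
  so that it is implied by the 4-form.
\<close>

theorem structure_equations_iff:
  assumes S: "transpose S = S" and Sk: "\<And>k. transpose (Sk k) = Sk k"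
  shows "(\<forall>x y z w. ext4 (coeff3 S S0 Sk) (frame3 S T P Om Q) x y z w = 0) \<and>
    (\<forall>x y z w s. ext5 (coeff4 S S0 Sk) (frame4 S T P Om Q) x y z w s = 0) \<longleftrightarrow>
    T = 0 \<and> (\<forall>i j. Om $ i $ j = Om $ j $ i) \<and> (\<forall>i. (\<Sum>\<alpha>\<in>UNIV. Sk \<alpha> $ i $ \<alpha>) = 0) \<and> P = 0 \<and>
    (\<forall>i k. Q $ i $ k = - (\<Sum>\<alpha>\<in>UNIV. \<Sum>\<beta>\<in>UNIV. levi_civita i \<alpha> \<beta> * dadj S (Sk \<beta>) $ k $ \<alpha>)) \<and>
    (\<forall>i j. S0 $ i $ j = - Om $ i $ j)" (is "?L4 \<and> ?L5 \<longleftrightarrow> ?R")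
proof
  assume L: "?L4 \<and> ?L5"
  then have 4: "T = 0" "P = 0" "\<forall>i j. Om $ i $ j = Om $ j $ i"
    "\<forall>i k. Q $ i $ k = - (\<Sum>\<alpha>\<in>UNIV. \<Sum>\<beta>\<in>UNIV. levi_civita i \<alpha> \<beta> * dadj S (Sk \<beta>) $ k $ \<alpha>)"
    unfolding ext4_zero_iff[OF S Sk] by blast+
  then show ?R using L ext5_zero_iff[OF S Sk, where Q = Q and Om = Om and ?S0.0 = S0] by simp
next
  assume R: ?R
  have "ddet S S0 = - (\<Sum>i\<in>UNIV. \<Sum>j\<in>UNIV. adj3 S $ j $ i * Om $ i $ j)"
    using R by (simp add: ddet_def sum_negf)
  then show "?L4 \<and> ?L5"
    unfolding ext4_zero_iff[OF S Sk] using R ext5_zero_iff[OF S Sk, where Q = Q and Om = Om and ?S0.0 = S0] by simp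
qed

section \<open>Smooth functions on open sets\<close>

lemma Ck_on_cong:
  assumes "open S" "\<And>x. x \<in> S \<Longrightarrow> f x = g x"
  shows "Ck_on n S f \<longleftrightarrow> Ck_on n S g"
  using assms(2)
proof (induction n arbitrary: f g)
  case 0
  then show ?case by (simp cong: continuous_on_cong)
next
  case (Suc n)
  have diff: "f differentiable (at x) \<longleftrightarrow> g differentiable (at x)" if "x \<in> S" for x
    using Suc.prems that assms(1) unfolding differentiable_def
    by (metis has_derivative_transform_within_open)
  show ?case
  proof (cases "\<forall>x\<in>S. f differentiable (at x)")
    case True
    have "frechet_derivative f (at x) v = frechet_derivative g (at x) v" if "x \<in> S" for x v
      using frechet_derivative_transform_within_open[OF _ assms(1) that, of f g] True Suc.prems that by metis
    then have "Ck_on n S (\<lambda>x. frechet_derivative f (at x) v) \<longleftrightarrow> Ck_on n S (\<lambda>x. frechet_derivative g (at x) v)" for v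
      by (rule Suc.IH)
    then show ?thesis using diff by auto
  qed (use diff in auto)
qed

lemma Ck_on_pred: "Ck_on (Suc n) S f \<Longrightarrow> Ck_on n S f"
proof (induction n arbitrary: f)
  case 0
  then show ?case
    by (auto intro!: continuous_at_imp_continuous_on differentiable_imp_continuous_within)
qed auto

lemma frechet_derivative_has: "f differentiable (at x) \<Longrightarrow> (f has_derivative frechet_derivative f (at x)) (at x)"
  by (simp add: frechet_derivative_works)

lemma Ck_on_bounded_linear:
  assumes L: "bounded_linear L" and "open S" "Ck_on n S f"
  shows "Ck_on n S (\<lambda>x. L (f x))"
  using assms(3)
proof (induction n arbitrary: f)
  case 0
  then show ?case using bounded_linear.continuous_on[OF L] by simp
next
  case (Suc n)
  have h: "((\<lambda>x. L (f x)) has_derivative (\<lambda>v. L (frechet_derivative f (at x) v))) (at x)" if "x \<in> S" for x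
    using Suc.prems that by (intro bounded_linear.has_derivative[OF L] frechet_derivative_has) auto
  have eq: "frechet_derivative (\<lambda>x. L (f x)) (at x) v = L (frechet_derivative f (at x) v)" if "x \<in> S" for x v
    using frechet_derivative_at[OF h[OF that]] by metis
  have "Ck_on n S (\<lambda>x. frechet_derivative (\<lambda>x. L (f x)) (at x) v)" for v
    using Ck_on_cong[OF assms(2) eq] Suc by simp
  then show ?case using h by (auto simp: differentiable_def)
qed

lemma Ck_on_add:
  assumes "open S" "Ck_on n S f" "Ck_on n S g"
  shows "Ck_on n S (\<lambda>x. f x + g x)"
  using assms(2,3)
proof (induction n arbitrary: f g)
  case 0
  then show ?case by (simp add: continuous_on_add)
next
  case (Suc n)
  have h: "((\<lambda>x. f x + g x) has_derivative (\<lambda>v. frechet_derivative f (at x) v + frechet_derivative g (at x) v)) (at x)" if "x \<in> S" for x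
    using Suc.prems that by (intro has_derivative_add frechet_derivative_has) auto
  have eq: "frechet_derivative (\<lambda>x. f x + g x) (at x) v = frechet_derivative f (at x) v + frechet_derivative g (at x) v" if "x \<in> S" for x v
    using frechet_derivative_at[OF h[OF that]] by metis
  have "Ck_on n S (\<lambda>x. frechet_derivative (\<lambda>x. f x + g x) (at x) v)" for v
    using Ck_on_cong[OF assms(1) eq] Suc by simp
  then show ?case using h by (auto simp: differentiable_def)
qed

lemma Ck_on_mult:
  fixes f g :: "'a::real_normed_vector \<Rightarrow> real"
  assumes "open S" "Ck_on n S f" "Ck_on n S g"
  shows "Ck_on n S (\<lambda>x. f x * g x)"
  using assms(2,3)
proof (induction n arbitrary: f g)
  case 0
  then show ?case by (simp add: continuous_on_mult)
next
  case (Suc n)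
  have h: "((\<lambda>x. f x * g x) has_derivative (\<lambda>v. f x * frechet_derivative g (at x) v + frechet_derivative f (at x) v * g x)) (at x)" if "x \<in> S" for x
    using Suc.prems that by (intro has_derivative_mult frechet_derivative_has) auto
  have eq: "frechet_derivative (\<lambda>x. f x * g x) (at x) v = f x * frechet_derivative g (at x) v + frechet_derivative f (at x) v * g x" if "x \<in> S" for x v
    using frechet_derivative_at[OF h[OF that]] by metis
  have "Ck_on n S (\<lambda>x. frechet_derivative (\<lambda>x. f x * g x) (at x) v)" for v
  proof -
    have "Ck_on n S (\<lambda>x. f x * frechet_derivative g (at x) v + frechet_derivative f (at x) v * g x)"
      using Suc.prems Ck_on_pred[OF Suc.prems(1)] Ck_on_pred[OF Suc.prems(2)]
      by (intro Ck_on_add assms(1) Suc.IH) auto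
    then show ?thesis using Ck_on_cong[OF assms(1) eq] by simp
  qed
  then show ?case using h by (auto simp: differentiable_def)
qed

lemma Ck_on_const: "Ck_on n S (\<lambda>x. c)"
  by (induction n arbitrary: c) auto

lemma smooth_on_cong: "open S \<Longrightarrow> (\<And>x. x \<in> S \<Longrightarrow> f x = g x) \<Longrightarrow> smooth_on S f \<Longrightarrow> smooth_on S g"
  using Ck_on_cong unfolding smooth_on_def by blast

lemma smooth_on_const: "smooth_on S (\<lambda>x. c)"
  by (simp add: smooth_on_def Ck_on_const)

lemma smooth_on_add: "open S \<Longrightarrow> smooth_on S f \<Longrightarrow> smooth_on S g \<Longrightarrow> smooth_on S (\<lambda>x. f x + g x)"
  by (simp add: smooth_on_def Ck_on_add)

lemma smooth_on_mult:
  fixes f g :: "'a::real_normed_vector \<Rightarrow> real"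
  shows "open S \<Longrightarrow> smooth_on S f \<Longrightarrow> smooth_on S g \<Longrightarrow> smooth_on S (\<lambda>x. f x * g x)"
  by (simp add: smooth_on_def Ck_on_mult)

lemma smooth_on_bounded_linear: "bounded_linear L \<Longrightarrow> open S \<Longrightarrow> smooth_on S f \<Longrightarrow> smooth_on S (\<lambda>x. L (f x))"
  by (simp add: smooth_on_def Ck_on_bounded_linear)

lemma smooth_on_diff:
  fixes f g :: "'a::real_normed_vector \<Rightarrow> real"
  assumes "open S" "smooth_on S f" "smooth_on S g" shows "smooth_on S (\<lambda>x. f x - g x)"
  using smooth_on_add[OF assms(1,2) smooth_on_mult[OF assms(1) smooth_on_const[of S "- 1"] assms(3)]] by simp

lemma smooth_on_sum:
  assumes "open S" "\<And>i. i \<in> I \<Longrightarrow> smooth_on S (f i)"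
  shows "smooth_on S (\<lambda>x. \<Sum>i\<in>I. f i x)"
  using assms(2)
  by (induction I rule: infinite_finite_induct) (auto intro: smooth_on_const smooth_on_add assms(1))

lemma smooth_on_differentiable: "smooth_on S f \<Longrightarrow> x \<in> S \<Longrightarrow> f differentiable (at x)"
  unfolding smooth_on_def using Ck_on.simps(2) by blast

lemma smooth_on_has_derivative: "smooth_on S f \<Longrightarrow> x \<in> S \<Longrightarrow> (f has_derivative frechet_derivative f (at x)) (at x)"
  by (simp add: frechet_derivative_has smooth_on_differentiable)

lemma smooth_on_frechet: "smooth_on S f \<Longrightarrow> smooth_on S (\<lambda>x. frechet_derivative f (at x) v)"
  unfolding smooth_on_def using Ck_on.simps(2) by blast

lemma smooth_on_continuous: "smooth_on S f \<Longrightarrow> continuous_on S f"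
  unfolding smooth_on_def using Ck_on.simps(1) by blast

text \<open>
  Two applications of the mean value theorem to the second difference over a parallelogram.
\<close>

lemma second_difference_mvt:
  fixes f :: "'a::real_normed_vector \<Rightarrow> real"
  assumes h: "0 < h" and f: "smooth_on S f"
    and S: "\<And>s t. 0 \<le> s \<Longrightarrow> s \<le> h \<Longrightarrow> 0 \<le> t \<Longrightarrow> t \<le> h \<Longrightarrow> x + s *\<^sub>R v + t *\<^sub>R w \<in> S"
  obtains s t where "0 \<le> s" "s \<le> h" "0 \<le> t" "t \<le> h"
    "f (x + h *\<^sub>R v + h *\<^sub>R w) - f (x + h *\<^sub>R v) - f (x + h *\<^sub>R w) + f x
      = h * h * frechet_derivative (\<lambda>y. frechet_derivative f (at y) v) (at (x + s *\<^sub>R v + t *\<^sub>R w)) w"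
proof -
  let ?F = "\<lambda>y. frechet_derivative f (at y) v"
  have line: "DERIV (\<lambda>s. g (p + s *\<^sub>R u)) s :> frechet_derivative g (at (p + s *\<^sub>R u)) u"
    if "smooth_on S g" "p + s *\<^sub>R u \<in> S" for g :: "'a \<Rightarrow> real" and p u s
  proof -
    have d: "(g has_derivative frechet_derivative g (at (p + s *\<^sub>R u))) (at (p + s *\<^sub>R u))"
      by (rule smooth_on_has_derivative[OF that])
    have "((\<lambda>s. p + s *\<^sub>R u) has_derivative (\<lambda>r. r *\<^sub>R u)) (at s)"
      by (auto intro!: derivative_eq_intros)
    from has_derivative_compose[OF this d]
    have "((\<lambda>s. g (p + s *\<^sub>R u)) has_derivative (\<lambda>r. frechet_derivative g (at (p + s *\<^sub>R u)) (r *\<^sub>R u))) (at s)" .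
    moreover have "frechet_derivative g (at (p + s *\<^sub>R u)) (r *\<^sub>R u) = frechet_derivative g (at (p + s *\<^sub>R u)) u * r" for r
      using linear_scale[OF linear_frechet_derivative[OF smooth_on_differentiable[OF that]]] by simp
    ultimately show ?thesis by (simp add: has_field_derivative_def)
  qed
  have "\<exists>z>0. z < h \<and> (f (x + h *\<^sub>R w + h *\<^sub>R v) - f (x + h *\<^sub>R v)) - (f (x + h *\<^sub>R w + 0 *\<^sub>R v) - f (x + 0 *\<^sub>R v))
      = (h - 0) * (?F (x + h *\<^sub>R w + z *\<^sub>R v) - ?F (x + z *\<^sub>R v))"
  proof (rule MVT2[OF h])
    fix s assume s: "0 \<le> s" "s \<le> h"
    have "x + h *\<^sub>R w + s *\<^sub>R v \<in> S" "x + s *\<^sub>R v \<in> S"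
      using S[of s h] S[of s 0] s h by (simp_all add: algebra_simps)
    then show "DERIV (\<lambda>s. f (x + h *\<^sub>R w + s *\<^sub>R v) - f (x + s *\<^sub>R v)) s :> ?F (x + h *\<^sub>R w + s *\<^sub>R v) - ?F (x + s *\<^sub>R v)"
      by (intro DERIV_diff line f)
  qed
  then obtain s where s: "0 < s" "s < h" "(f (x + h *\<^sub>R w + h *\<^sub>R v) - f (x + h *\<^sub>R v)) - (f (x + h *\<^sub>R w) - f x)
      = h * (?F (x + h *\<^sub>R w + s *\<^sub>R v) - ?F (x + s *\<^sub>R v))" by auto
  have "\<exists>z>0. z < h \<and> ?F (x + s *\<^sub>R v + h *\<^sub>R w) - ?F (x + s *\<^sub>R v + 0 *\<^sub>R w)
      = (h - 0) * frechet_derivative ?F (at (x + s *\<^sub>R v + z *\<^sub>R w)) w"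
  proof (rule MVT2[OF h])
    fix t assume "0 \<le> t" "t \<le> h"
    then show "DERIV (\<lambda>t. ?F (x + s *\<^sub>R v + t *\<^sub>R w)) t :> frechet_derivative ?F (at (x + s *\<^sub>R v + t *\<^sub>R w)) w"
      using S[of s t] s by (intro line smooth_on_frechet f) auto
  qed
  then obtain t where t: "0 < t" "t < h" "?F (x + s *\<^sub>R v + h *\<^sub>R w) - ?F (x + s *\<^sub>R v)
      = h * frechet_derivative ?F (at (x + s *\<^sub>R v + t *\<^sub>R w)) w" by auto
  show thesis
  proof (rule that[of s t])
    have "f (x + h *\<^sub>R v + h *\<^sub>R w) - f (x + h *\<^sub>R v) - f (x + h *\<^sub>R w) + f x
       = h * (?F (x + s *\<^sub>R v + h *\<^sub>R w) - ?F (x + s *\<^sub>R v))"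
    proof -
      have c: "x + h *\<^sub>R v + h *\<^sub>R w = x + h *\<^sub>R w + h *\<^sub>R v"
        "x + s *\<^sub>R v + h *\<^sub>R w = x + h *\<^sub>R w + s *\<^sub>R v" by (simp_all add: ac_simps)
      show ?thesis unfolding c using s(3) by linarith
    qed
    then show "f (x + h *\<^sub>R v + h *\<^sub>R w) - f (x + h *\<^sub>R v) - f (x + h *\<^sub>R w) + f x
      = h * h * frechet_derivative ?F (at (x + s *\<^sub>R v + t *\<^sub>R w)) w"
      using t(3) by simp
  qed (use s t in auto)
qed

text \<open>
  The second difference is symmetric in \<open>v\<close> and \<open>w\<close>, and by the preceding lemma each of the two mixed
  derivatives takes its value (divided by \<open>h\<^sup>2\<close>) arbitrarily near to \<open>x\<close>.
\<close>

lemma symmetric_second_derivative_real: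
  fixes f :: "'a::real_normed_vector \<Rightarrow> real"
  assumes S: "open S" "x \<in> S" and f: "smooth_on S f"
  shows "frechet_derivative (\<lambda>y. frechet_derivative f (at y) v) (at x) w
       = frechet_derivative (\<lambda>y. frechet_derivative f (at y) w) (at x) v"
proof (rule ccontr)
  let ?A = "\<lambda>y. frechet_derivative (\<lambda>y. frechet_derivative f (at y) v) (at y) w"
  let ?B = "\<lambda>y. frechet_derivative (\<lambda>y. frechet_derivative f (at y) w) (at y) v"
  assume ne: "?A x \<noteq> ?B x"
  define \<epsilon> where "\<epsilon> = \<bar>?A x - ?B x\<bar> / 2"
  have e: "\<epsilon> > 0" using ne by (simp add: \<epsilon>_def)
  have "continuous_on S ?A" "continuous_on S ?B"
    by (intro smooth_on_continuous smooth_on_frechet f)+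
  then have "isCont ?A x" "isCont ?B x" using S by (simp_all add: continuous_on_eq_continuous_at)
  then obtain d1 d2 where d: "d1 > 0" "\<And>y. dist y x < d1 \<Longrightarrow> dist (?A y) (?A x) < \<epsilon>"
      "d2 > 0" "\<And>y. dist y x < d2 \<Longrightarrow> dist (?B y) (?B x) < \<epsilon>"
    using e unfolding continuous_at_eps_delta dist_norm real_norm_def by metis
  obtain d3 where d3: "d3 > 0" "ball x d3 \<subseteq> S" using S openE by blast
  define d where "d = Min {d1, d2, d3}"
  have dp: "d > 0" "d \<le> d1" "d \<le> d2" "d \<le> d3" using d d3 by (auto simp: d_def)
  (* Small enough for the parallelogram with sides \<open>h v\<close>, \<open>h w\<close> to lie in the ball of radius \<open>d\<close>. *)
  define h where "h = d / (2 * (norm v + norm w + 1))"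
  have hp: "h > 0" using dp by (simp add: h_def add_nonneg_pos)
  have near: "dist (x + s *\<^sub>R v + t *\<^sub>R w) x < d" if "0 \<le> s" "s \<le> h" "0 \<le> t" "t \<le> h" for s t
  proof -
    have "norm (s *\<^sub>R v + t *\<^sub>R w) \<le> s * norm v + t * norm w"
      using norm_triangle_ineq[of "s *\<^sub>R v" "t *\<^sub>R w"] that by simp
    also have "\<dots> \<le> h * norm v + h * norm w"
      using that by (intro add_mono mult_right_mono) auto
    also have "\<dots> < h * (2 * (norm v + norm w + 1))"
    proof -
      have "0 < h * norm v + h * norm w + 2 * h" using hp by (intro add_nonneg_pos) auto
      then show ?thesis by (simp add: algebra_simps)
    qed
    also have "\<dots> = d" by (simp add: h_def add_nonneg_pos[THEN less_imp_neq[THEN not_sym]])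
    finally show ?thesis by (simp add: dist_norm add.assoc)
  qed
  have inS: "x + s *\<^sub>R v + t *\<^sub>R w \<in> S" if "0 \<le> s" "s \<le> h" "0 \<le> t" "t \<le> h" for s t
    using near[OF that] d3 dp by (auto simp: subset_iff dist_commute)
  have inS': "x + s *\<^sub>R w + t *\<^sub>R v \<in> S" if "0 \<le> s" "s \<le> h" "0 \<le> t" "t \<le> h" for s t
    using inS[OF that(3,4,1,2)] by (simp add: algebra_simps)
  obtain s t where st: "0 \<le> s" "s \<le> h" "0 \<le> t" "t \<le> h"
     "f (x + h *\<^sub>R v + h *\<^sub>R w) - f (x + h *\<^sub>R v) - f (x + h *\<^sub>R w) + f x = h * h * ?A (x + s *\<^sub>R v + t *\<^sub>R w)"
    using second_difference_mvt[OF hp f inS] by blast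
  obtain s' t' where st': "0 \<le> s'" "s' \<le> h" "0 \<le> t'" "t' \<le> h"
     "f (x + h *\<^sub>R w + h *\<^sub>R v) - f (x + h *\<^sub>R w) - f (x + h *\<^sub>R v) + f x = h * h * ?B (x + s' *\<^sub>R w + t' *\<^sub>R v)"
    using second_difference_mvt[OF hp f inS'] by blast
  have "f (x + h *\<^sub>R w + h *\<^sub>R v) = f (x + h *\<^sub>R v + h *\<^sub>R w)" by (simp add: algebra_simps)
  then have "h * h * ?A (x + s *\<^sub>R v + t *\<^sub>R w) = h * h * ?B (x + s' *\<^sub>R w + t' *\<^sub>R v)"
    using st(5) st'(5) by linarith
  then have eq: "?A (x + s *\<^sub>R v + t *\<^sub>R w) = ?B (x + s' *\<^sub>R w + t' *\<^sub>R v)" using hp by simp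
  have "dist (x + s' *\<^sub>R w + t' *\<^sub>R v) x < d"
    using near[OF st'(3,4,1,2)] by (simp add: algebra_simps)
  then have "dist (?B (x + s' *\<^sub>R w + t' *\<^sub>R v)) (?B x) < \<epsilon>" using d(4) dp by simp
  moreover have "dist (?A (x + s *\<^sub>R v + t *\<^sub>R w)) (?A x) < \<epsilon>" using near[OF st(1-4)] d(2) dp by simp
  moreover have "\<not> (\<bar>z - b\<bar> < \<bar>a - b\<bar> / 2 \<and> \<bar>z - a\<bar> < \<bar>a - b\<bar> / 2)" for a b z :: real
    by (auto simp: abs_if field_simps split: if_splits)
  ultimately show False using eq unfolding \<epsilon>_def dist_real_def by metis
qed

lemma symmetric_second_derivative:
  fixes f :: "'a::real_normed_vector \<Rightarrow> 'b::euclidean_space"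
  assumes S: "open S" "x \<in> S" and f: "smooth_on S f"
  shows "frechet_derivative (\<lambda>y. frechet_derivative f (at y) v) (at x) w
       = frechet_derivative (\<lambda>y. frechet_derivative f (at y) w) (at x) v"
proof (rule euclidean_eqI)
  fix b :: 'b assume "b \<in> Basis"
  have comp: "frechet_derivative (\<lambda>y. g y \<bullet> b) (at y) u = frechet_derivative g (at y) u \<bullet> b"
    if "smooth_on S g" "y \<in> S" for g :: "'a \<Rightarrow> 'b" and y u
    using frechet_derivative_at[OF has_derivative_inner_left[OF smooth_on_has_derivative[OF that], of b]] by metis
  have sm: "smooth_on S (\<lambda>y. f y \<bullet> b)"
    by (rule smooth_on_bounded_linear[OF bounded_linear_inner_left S(1) f])
  have fv: "frechet_derivative (\<lambda>y. frechet_derivative f (at y) v) (at x) w \<bullet> b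
     = frechet_derivative (\<lambda>y. frechet_derivative (\<lambda>y. f y \<bullet> b) (at y) v) (at x) w" for v w
  proof -
    have "frechet_derivative (\<lambda>y. frechet_derivative f (at y) v) (at x) w \<bullet> b
        = frechet_derivative (\<lambda>y. frechet_derivative f (at y) v \<bullet> b) (at x) w"
      using comp[OF smooth_on_frechet[OF f] S(2)] by simp
    also have "\<dots> = frechet_derivative (\<lambda>y. frechet_derivative (\<lambda>y. f y \<bullet> b) (at y) v) (at x) w"
    proof -
      have "frechet_derivative (\<lambda>y. frechet_derivative f (at y) v \<bullet> b) (at x)
         = frechet_derivative (\<lambda>y. frechet_derivative (\<lambda>y. f y \<bullet> b) (at y) v) (at x)"
      proof (rule sym, rule frechet_derivative_transform_within_open[OF _ S])
        show "(\<lambda>y. frechet_derivative (\<lambda>y. f y \<bullet> b) (at y) v) differentiable at x"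
          by (rule smooth_on_differentiable[OF smooth_on_frechet[OF sm] S(2)])
      qed (use comp[OF f] in auto)
      then show ?thesis by simp
    qed
    finally show ?thesis .
  qed
  show "frechet_derivative (\<lambda>y. frechet_derivative f (at y) v) (at x) w \<bullet> b
       = frechet_derivative (\<lambda>y. frechet_derivative f (at y) w) (at x) v \<bullet> b"
    unfolding fv by (rule symmetric_second_derivative_real[OF S sm])
qed

section \<open>Exterior derivatives of one-forms\<close>

text \<open>
  The exterior derivative of a one-form, with the one-form written as a function of a point and a
  single vector.
\<close>

definition d1 :: "('e::euclidean_space \<Rightarrow> 'e \<Rightarrow> real) \<Rightarrow> 'e \<Rightarrow> 'e \<Rightarrow> 'e \<Rightarrow> real" where
  "d1 A x v w = frechet_derivative (\<lambda>y. A y w) (at x) v - frechet_derivative (\<lambda>y. A y v) (at x) w"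

text \<open>
  The product rule for a one-form evaluated on a moving vector along a map.  Only the components
  \<open>A z v\<close> are known to be differentiable, so the proof expands in a basis.
\<close>

lemma has_derivative_oneform_apply:
  fixes A :: "'f::euclidean_space \<Rightarrow> 'f \<Rightarrow> real" and \<rho> :: "'e::euclidean_space \<Rightarrow> 'f"
  assumes U: "open U" "\<rho> x \<in> U" and lin: "\<And>z. z \<in> U \<Longrightarrow> linear (A z)"
    and A: "\<And>v. (\<lambda>z. A z v) differentiable (at (\<rho> x))"
    and r: "(\<rho> has_derivative \<rho>') (at x)" and k: "(k has_derivative k') (at x)"
  shows "((\<lambda>y. A (\<rho> y) (k y)) has_derivative
     (\<lambda>w. A (\<rho> x) (k' w) + frechet_derivative (\<lambda>z. A z (k x)) (at (\<rho> x)) (\<rho>' w))) (at x)"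
proof -
  have dA: "((\<lambda>z. A z v) has_derivative frechet_derivative (\<lambda>z. A z v) (at (\<rho> x))) (at (\<rho> x))" for v
    by (rule frechet_derivative_has[OF A])
  have expand: "A z v = (\<Sum>b\<in>Basis. (v \<bullet> b) * A z b)" if "z \<in> U" for z v
  proof -
    have "A z v = A z (\<Sum>b\<in>Basis. (v \<bullet> b) *\<^sub>R b)" by (simp add: euclidean_representation)
    then show ?thesis by (simp add: linear_sum[OF lin[OF that]] linear_scale[OF lin[OF that]])
  qed
  have fexp: "frechet_derivative (\<lambda>z. A z v) (at (\<rho> x)) u = (\<Sum>b\<in>Basis. (v \<bullet> b) * frechet_derivative (\<lambda>z. A z b) (at (\<rho> x)) u)" for v u
  proof -
    have "((\<lambda>z. \<Sum>b\<in>Basis. (v \<bullet> b) * A z b) has_derivative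
        (\<lambda>u. \<Sum>b\<in>Basis. (v \<bullet> b) * frechet_derivative (\<lambda>z. A z b) (at (\<rho> x)) u)) (at (\<rho> x))"
      by (intro has_derivative_sum has_derivative_mult_right dA)
    from frechet_derivative_eq_on(1)[OF U expand this] show ?thesis by simp
  qed
  have "((\<lambda>y. \<Sum>b\<in>Basis. (k y \<bullet> b) * A (\<rho> y) b) has_derivative
     (\<lambda>w. \<Sum>b\<in>Basis. (k x \<bullet> b) * frechet_derivative (\<lambda>z. A z b) (at (\<rho> x)) (\<rho>' w) + (k' w \<bullet> b) * A (\<rho> x) b)) (at x)"
    by (intro has_derivative_sum has_derivative_mult has_derivative_inner_left k has_derivative_compose[OF r dA])
  moreover have "(\<Sum>b\<in>Basis. (k x \<bullet> b) * frechet_derivative (\<lambda>z. A z b) (at (\<rho> x)) (\<rho>' w) + (k' w \<bullet> b) * A (\<rho> x) b)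
     = A (\<rho> x) (k' w) + frechet_derivative (\<lambda>z. A z (k x)) (at (\<rho> x)) (\<rho>' w)" for w
    unfolding sum.distrib expand[OF U(2), of "k' w", symmetric] fexp[of "k x", symmetric] by simp
  ultimately have main: "((\<lambda>y. \<Sum>b\<in>Basis. (k y \<bullet> b) * A (\<rho> y) b) has_derivative
     (\<lambda>w. A (\<rho> x) (k' w) + frechet_derivative (\<lambda>z. A z (k x)) (at (\<rho> x)) (\<rho>' w))) (at x)"
    by simp
  have "isCont \<rho> x" using has_derivative_continuous[OF r] .
  then have "\<forall>\<^sub>F y in at x. \<rho> y \<in> U"
    using U by (metis continuous_at topological_tendstoD)
  then have ev: "\<forall>\<^sub>F y in at x. (\<Sum>b\<in>Basis. (k y \<bullet> b) * A (\<rho> y) b) = A (\<rho> y) (k y)"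
    by eventually_elim (rule expand[symmetric])
  show ?thesis
    by (rule has_derivative_transform_eventually[OF main ev])
      (use expand[OF U(2), of "k x"] in auto)
qed

text \<open>
  Naturality of the exterior derivative: the terms with second derivatives of \<open>\<rho>\<close> cancel by their
  symmetry.
\<close>

lemma d1_pullback:
  fixes A :: "'f::euclidean_space \<Rightarrow> 'f \<Rightarrow> real" and \<rho> :: "'e::euclidean_space \<Rightarrow> 'f"
  assumes V: "open V" "x \<in> V" and rho: "smooth_on V \<rho>"
    and U: "open U" "\<rho> x \<in> U" and lin: "\<And>z. z \<in> U \<Longrightarrow> linear (A z)"
    and A: "\<And>v. (\<lambda>z. A z v) differentiable (at (\<rho> x))"
  shows "d1 A (\<rho> x) (frechet_derivative \<rho> (at x) v) (frechet_derivative \<rho> (at x) w)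
       = d1 (\<lambda>y u. A (\<rho> y) (frechet_derivative \<rho> (at y) u)) x v w"
proof -
  have "((\<lambda>y. A (\<rho> y) (frechet_derivative \<rho> (at y) u)) has_derivative
     (\<lambda>w. A (\<rho> x) (frechet_derivative (\<lambda>y. frechet_derivative \<rho> (at y) u) (at x) w)
       + frechet_derivative (\<lambda>z. A z (frechet_derivative \<rho> (at x) u)) (at (\<rho> x)) (frechet_derivative \<rho> (at x) w))) (at x)" for u
    by (rule has_derivative_oneform_apply[where A = A and \<rho> = \<rho> and U = U, OF U lin A])
      (auto intro: smooth_on_has_derivative[OF rho V(2)] smooth_on_has_derivative[OF smooth_on_frechet[OF rho] V(2)])
  note fr = frechet_derivative_at[OF this, symmetric]
  show ?thesis
    unfolding d1_def fr by (simp add: symmetric_second_derivative[OF V rho, of v w])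
qed

lemma ext_deriv_1:
  assumes U: "open U" "x \<in> U" and F: "\<And>y v. y \<in> U \<Longrightarrow> F C y v = A y (v 0)"
    and A: "\<And>v. (\<lambda>y. A y v) differentiable (at x)"
  shows "ext_deriv 1 F C x v = d1 A x (v 0) (v 1)"
proof -
  have "frechet_derivative (\<lambda>y. F C y u) (at x) = frechet_derivative (\<lambda>y. A y (u 0)) (at x)" for u
    using frechet_derivative_eq_on(1)[OF U F frechet_derivative_has[OF A]] .
  moreover have "{..1::nat} = {0, 1}" by auto
  ultimately show ?thesis by (simp add: ext_deriv_def d1_def)
qed

lemma d1_cong:
  assumes U: "open U" "x \<in> U" and eq: "\<And>y v. y \<in> U \<Longrightarrow> A y v = B y v"
    and B: "\<And>v. (\<lambda>y. B y v) differentiable (at x)"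
  shows "d1 A x = d1 B x"
proof -
  have "frechet_derivative (\<lambda>y. A y u) (at x) = frechet_derivative (\<lambda>y. B y u) (at x)" for u
    using frechet_derivative_eq_on(1)[OF U eq frechet_derivative_has[OF B]] .
  then show ?thesis by (simp add: d1_def[abs_def])
qed

section \<open>Charts\<close>

lemma chart_facts:
  assumes M: "smooth_manifold M" and C: "(D, c) \<in> atlas M"
  shows "openin (mtop M) D" "D \<subseteq> points M" "open (c ` D)"
    "homeomorphic_map (subtopology (mtop M) D) (top_of_set (c ` D)) c" "inj_on c D"
proof -
  show 1: "openin (mtop M) D" "open (c ` D)"
    and h: "homeomorphic_map (subtopology (mtop M) D) (top_of_set (c ` D)) c"
    using M C unfolding smooth_manifold_def by auto
  show "D \<subseteq> points M" using 1 openin_subset by blast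
  then have "topspace (subtopology (mtop M) D) = D" by auto
  then show "inj_on c D" using homeomorphic_imp_injective_map[OF h] by simp
qed

lemma chart_inv_chart: "inj_on c D \<Longrightarrow> p \<in> D \<Longrightarrow> chart_inv (D, c) (c p) = p"
  by (simp add: chart_inv_def)

lemma chart_inv_eq: "inj_on c D \<Longrightarrow> p \<in> D \<Longrightarrow> c p = x \<Longrightarrow> chart_inv (D, c) x = p"
  using chart_inv_chart by metis

lemma chart_chart_inv: "x \<in> c ` D \<Longrightarrow> c (chart_inv (D, c) x) = x"
  by (simp add: chart_inv_def f_inv_into_f)

lemma chart_inv_in: "x \<in> c ` D \<Longrightarrow> chart_inv (D, c) x \<in> D"
  unfolding chart_inv_def fst_conv snd_conv by (rule inv_into_into)

lemma chart_image_open: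
  assumes M: "smooth_manifold M" and C: "(D, c) \<in> atlas M" and V: "openin (mtop M) V" "V \<subseteq> D"
  shows "open (c ` V)"
proof -
  note f = chart_facts[OF M C]
  have "openin (subtopology (mtop M) D) V"
    using V by (metis openin_subset_topspace_eq openin_subtopology_Int2 inf.absorb_iff2 inf.orderE openin_open_subtopology f(1))
  then have "openin (top_of_set (c ` D)) (c ` V)"
    using homeomorphic_imp_open_map[OF f(4)] unfolding open_map_def by blast
  then show ?thesis using f(3) openin_open_trans by blast
qed

lemma chart_inv_continuous:
  assumes M: "smooth_manifold M" and C: "(D, c) \<in> atlas M"
  shows "continuous_map (top_of_set (c ` D)) (mtop M) (chart_inv (D, c))"
proof -
  note f = chart_facts[OF M C]
  show ?thesis unfolding continuous_map_def
  proof (intro conjI allI impI)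
    show "chart_inv (D, c) \<in> topspace (top_of_set (c ` D)) \<rightarrow> topspace (mtop M)"
      using chart_inv_in[of _ c D] f(2) by auto
    fix U assume U: "openin (mtop M) U"
    have "{x \<in> topspace (top_of_set (c ` D)). chart_inv (D, c) x \<in> U} = c ` (U \<inter> D)"
      using chart_chart_inv[of _ c D] chart_inv_in[of _ c D] chart_inv_chart[OF f(5)] by (auto intro!: rev_image_eqI)
    moreover have "open (c ` (U \<inter> D))"
      using U f(1) by (intro chart_image_open[OF M C] openin_Int) auto
    ultimately show "openin (top_of_set (c ` D)) {x \<in> topspace (top_of_set (c ` D)). chart_inv (D, c) x \<in> U}"
      using open_subset[of "c ` (U \<inter> D)" "c ` D"] by auto
  qed
qed

lemma chart_cover: "smooth_manifold M \<Longrightarrow> p \<in> points M \<Longrightarrow> \<exists>C\<in>atlas M. p \<in> fst C"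
  unfolding smooth_manifold_def by blast

definition chart_change :: "('a, 'e) chart \<Rightarrow> ('a, 'f) chart \<Rightarrow> 'e \<Rightarrow> 'f" where
  "chart_change C C' = snd C' \<circ> chart_inv C"

text \<open>
  Form transformation laws are stated with the tangent map of the identity, which is the derivative
  of the transition map.
\<close>

lemma tangent_map_id: "tangent_map id C C' p = frechet_derivative (chart_change C C') (at (snd C p))"
  by (simp add: tangent_map_def chart_change_def)

lemma chart_change_facts:
  assumes M: "smooth_manifold M" and C: "(D, c) \<in> atlas M" and C': "(D', c') \<in> atlas M"
  shows "open (c ` (D \<inter> D'))" "smooth_on (c ` (D \<inter> D')) (chart_change (D, c) (D', c'))"
    "p \<in> D \<Longrightarrow> chart_change (D, c) (D', c') (c p) = c' p"
proof -
  note f = chart_facts[OF M C] and f' = chart_facts[OF M C']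
  show "open (c ` (D \<inter> D'))" by (rule chart_image_open[OF M C]) (use f f' in auto)
  show "smooth_on (c ` (D \<inter> D')) (chart_change (D, c) (D', c'))"
  proof -
    have "\<forall>C\<in>atlas M. \<forall>C'\<in>atlas M. smooth_on (snd C ` (fst C \<inter> fst C')) (snd C' \<circ> chart_inv C)"
      using M unfolding smooth_manifold_def by blast
    from this[rule_format, OF C C'] show ?thesis by (simp add: chart_change_def)
  qed
  show "p \<in> D \<Longrightarrow> chart_change (D, c) (D', c') (c p) = c' p"
    using chart_inv_chart[OF f(5)] by (simp add: chart_change_def)
qed

lemma form_on_alternating: "form_on M k F \<Longrightarrow> (D, c) \<in> atlas M \<Longrightarrow> x \<in> c ` D \<Longrightarrow> alternating k (F (D, c) x)"
  unfolding form_on_def by fastforce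

lemma form_on_smooth: "form_on M k F \<Longrightarrow> (D, c) \<in> atlas M \<Longrightarrow> smooth_on (c ` D) (\<lambda>x. F (D, c) x v)"
  unfolding form_on_def by fastforce

lemma form_on_trans:
  assumes "form_on M k F" "(D, c) \<in> atlas M" "(D', c') \<in> atlas M" "p \<in> D" "p \<in> D'"
  shows "F (D, c) (c p) v
     = F (D', c') (c' p) (\<lambda>i. frechet_derivative (chart_change (D, c) (D', c')) (at (c p)) (v i))"
proof -
  have "\<forall>C\<in>atlas M. \<forall>C'\<in>atlas M. \<forall>p\<in>fst C \<inter> fst C'. \<forall>v.
        F C (snd C p) v = F C' (snd C' p) (\<lambda>i. tangent_map id C C' p (v i))"
    using assms(1) unfolding form_on_def by blast
  from this[rule_format, OF assms(2,3), of p v] show ?thesis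
    using assms(4,5) by (simp add: tangent_map_id)
qed

abbreviation onef :: "('a, 'e) form \<Rightarrow> ('a, 'e) chart \<Rightarrow> 'e \<Rightarrow> 'e \<Rightarrow> real" where
  "onef F C x w \<equiv> F C x (\<lambda>_. w)"

lemma alternating_1_eq: "alternating 1 F \<Longrightarrow> F v = F (\<lambda>_. v 0)"
  by (rule alternating_cong) auto

lemma alternating_1_linear:
  assumes "alternating 1 F" shows "linear (\<lambda>w. F (\<lambda>_. w))"
proof -
  have "linear (\<lambda>w. F ((\<lambda>_. 0)(0 := w)))" by (rule alternating_linear[OF assms]) simp
  moreover have "F ((\<lambda>_. 0)(0 := w)) = F (\<lambda>_. w)" for w
    by (rule alternating_cong[OF assms]) auto
  ultimately show ?thesis by simp
qed

lemma onef_facts: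
  assumes "form_on M 1 F" "(D, c) \<in> atlas M"
  shows "x \<in> c ` D \<Longrightarrow> F (D, c) x v = onef F (D, c) x (v 0)"
    "x \<in> c ` D \<Longrightarrow> linear (onef F (D, c) x)"
    "x \<in> c ` D \<Longrightarrow> (\<lambda>y. onef F (D, c) y w) differentiable (at x)"
proof -
  assume x: "x \<in> c ` D"
  show "F (D, c) x v = onef F (D, c) x (v 0)"
    by (rule alternating_1_eq[OF form_on_alternating[OF assms x]])
  show "linear (onef F (D, c) x)"
    by (rule alternating_1_linear[OF form_on_alternating[OF assms x]])
  show "(\<lambda>y. onef F (D, c) y w) differentiable (at x)"
    by (rule smooth_on_differentiable[OF form_on_smooth[OF assms] x])
qed

lemma ext_deriv_1_onef:
  assumes M: "smooth_manifold M" and F: "form_on M 1 F" and C: "(D, c) \<in> atlas M" and x: "x \<in> c ` D"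
  shows "ext_deriv 1 F (D, c) x v = d1 (onef F (D, c)) x (v 0) (v 1)"
  by (rule ext_deriv_1[OF chart_facts(3)[OF M C] x])
    (rule onef_facts[OF F C], assumption, rule onef_facts(3)[OF F C x])

text \<open>
  The exterior derivative does not depend on the chart, since transition maps pull it back.
\<close>

lemma d1_onef_trans:
  assumes M: "smooth_manifold M" and F: "form_on M 1 F"
    and C: "(D, c) \<in> atlas M" and C': "(D', c') \<in> atlas M" and p: "p \<in> D" "p \<in> D'"
  shows "d1 (onef F (D, c)) (c p) v w = d1 (onef F (D', c')) (c' p)
     (frechet_derivative (chart_change (D, c) (D', c')) (at (c p)) v)
     (frechet_derivative (chart_change (D, c) (D', c')) (at (c p)) w)"
proof -
  note t = chart_change_facts[OF M C C'] and f' = chart_facts[OF M C'] and f = chart_facts[OF M C]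
  let ?t = "chart_change (D, c) (D', c')"
  have V: "c p \<in> c ` (D \<inter> D')" using p by blast
  have tp: "?t (c p) = c' p" using t(3) p by blast
  have U: "?t (c p) \<in> c' ` D'" using tp p by auto
  have "d1 (onef F (D', c')) (?t (c p)) (frechet_derivative ?t (at (c p)) v) (frechet_derivative ?t (at (c p)) w)
     = d1 (\<lambda>y u. onef F (D', c') (?t y) (frechet_derivative ?t (at y) u)) (c p) v w"
    by (rule d1_pullback[where A = "onef F (D', c')", OF t(1) V t(2) f'(3) U])
      (rule onef_facts(2)[OF F C'], assumption, rule onef_facts(3)[OF F C' U])
  moreover have "d1 (\<lambda>y u. onef F (D', c') (?t y) (frechet_derivative ?t (at y) u)) (c p) = d1 (onef F (D, c)) (c p)"
  proof (rule d1_cong[OF t(1) V])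
    fix y u assume "y \<in> c ` (D \<inter> D')"
    then obtain q where q: "y = c q" "q \<in> D" "q \<in> D'" by blast
    show "onef F (D', c') (?t y) (frechet_derivative ?t (at y) u) = onef F (D, c) y u"
      using form_on_trans[OF F C C' q(2,3)] t(3)[OF q(2)] q(1) by simp
  next
    fix u show "(\<lambda>y. onef F (D, c) y u) differentiable at (c p)"
      using onef_facts(3)[OF F C] p by blast
  qed
  ultimately show ?thesis using tp by simp
qed

lemma fun_trans:
  assumes M: "smooth_manifold M" and C: "(D, c) \<in> atlas M" and C': "(D', c') \<in> atlas M" and p: "p \<in> D" "p \<in> D'"
    and d: "(f \<circ> chart_inv (D', c')) differentiable (at (c' p))"
  shows "frechet_derivative (f \<circ> chart_inv (D, c)) (at (c p)) v
     = frechet_derivative (f \<circ> chart_inv (D', c')) (at (c' p)) (frechet_derivative (chart_change (D, c) (D', c')) (at (c p)) v)"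
proof -
  note t = chart_change_facts[OF M C C'] and f' = chart_facts[OF M C'] and f = chart_facts[OF M C]
  let ?t = "chart_change (D, c) (D', c')"
  have V: "c p \<in> c ` (D \<inter> D')" using p by blast
  have tp: "?t (c p) = c' p" using t(3) p by blast
  have dt: "?t differentiable (at (c p))" by (rule smooth_on_differentiable[OF t(2) V])
  have eq: "(f \<circ> chart_inv (D, c)) y = ((f \<circ> chart_inv (D', c')) \<circ> ?t) y" if "y \<in> c ` (D \<inter> D')" for y
    using that t(3) chart_inv_chart[OF f(5)] chart_inv_chart[OF f'(5)] by auto
  have h: "(((f \<circ> chart_inv (D', c')) \<circ> ?t) has_derivative
     (frechet_derivative (f \<circ> chart_inv (D', c')) (at (c' p)) \<circ> frechet_derivative ?t (at (c p)))) (at (c p))"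
    using diff_chain_at[OF frechet_derivative_has[OF dt], of "f \<circ> chart_inv (D', c')"] frechet_derivative_has[OF d] tp by simp
  show ?thesis using frechet_derivative_eq_on(1)[OF t(1) V eq h] by (simp add: o_def)
qed

unbundle no cross3_syntax

section \<open>The torus action in charts\<close>

lemma torus_exp_inj: "inj_on torus_exp (box u (u + 1))"
proof (rule inj_onI)
  fix x y :: "real^3" assume x: "x \<in> box u (u + 1)" and y: "y \<in> box u (u + 1)" and eq: "torus_exp x = torus_exp y"
  show "x = y"
  proof (simp only: vec_eq_iff, intro allI)
    fix k
    have "cis (2 * pi * x $ k) = cis (2 * pi * y $ k)"
      using arg_cong[OF eq, of "\<lambda>z. z $ k"] by (simp add: torus_exp_def)
    then obtain n :: int where "2 * pi * x $ k = 2 * pi * y $ k + 2 * pi * n"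
      using sin_cos_eq_iff[of "2 * pi * x $ k" "2 * pi * y $ k"] by (auto simp: complex_eq_iff)
    then have "2 * pi * (x $ k - y $ k) = 2 * pi * n" by (simp add: algebra_simps)
    then have n: "x $ k - y $ k = of_int n" by simp
    moreover have "\<bar>x $ k - y $ k\<bar> < 1"
      using x y unfolding mem_box_cart by (auto simp: abs_less_iff) (smt (verit))+
    ultimately have "\<bar>real_of_int n\<bar> < 1" by simp
    then have "n = 0" by linarith
    then show "x $ k = y $ k" using n by simp
  qed
qed

lemma torus_exp_in: "torus_exp \<xi> \<in> torus"
  by (simp add: torus_exp_def torus_def)

lemma torus_exp_0: "torus_exp 0 = 1"
  by (simp add: torus_exp_def vec_eq_iff)

lemma continuous_torus_exp: "continuous_on S torus_exp"
  unfolding torus_exp_def cis_conv_exp by (intro continuous_intros)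

text \<open>
  A box of side \<open>1\<close> around \<open>0\<close>, on which the exponential map is a torus chart covering a neighbourhood
  of the identity.
\<close>

definition tbox :: "(real^3) set" where "tbox = box (\<chi> i. - 1 / 2) ((\<chi> i. - 1 / 2) + 1)"

lemma open_tbox: "open tbox" by (simp add: tbox_def open_box)

lemma inj_on_tbox: "inj_on torus_exp tbox" unfolding tbox_def by (rule torus_exp_inj)

lemma torus_chart: "(torus_exp ` tbox, inv_into tbox torus_exp) \<in> atlas torus_mfd"
  unfolding torus_mfd_def tbox_def by auto

lemma zero_in_tbox: "0 \<in> tbox" by (simp add: tbox_def mem_box_cart)

lemma torus_chart_exp: "\<zeta> \<in> tbox \<Longrightarrow> inv_into tbox torus_exp (torus_exp \<zeta>) = \<zeta>"
  by (rule inv_into_f_f[OF inj_on_tbox])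

text \<open>
  The action near the identity is studied through \<open>flow\<close>, the map \<open>(x, \<zeta>) \<mapsto> x \<cdot> exp \<zeta>\<close> written in one
  chart of \<open>P\<close>.  Its derivative in \<open>\<zeta>\<close> at \<open>0\<close> is given by the fundamental vector fields.
\<close>

locale T3_bundle =
  fixes P :: "('p, real^6) mfd" and M :: "('m, real^3) mfd"
    and pr :: "'p \<Rightarrow> 'm" and act :: "'p \<Rightarrow> complex^3 \<Rightarrow> 'p"
  assumes principal: "principal_T3_bundle P M pr act"
begin

lemma smooth_P: "smooth_manifold P" and smooth_M: "smooth_manifold M"
  and smooth_pr: "smooth_map P M pr"
  and smooth_act: "smooth_map (prod_mfd P torus_mfd) P (\<lambda>(p, g). act p g)"
  and act_1: "p \<in> points P \<Longrightarrow> act p 1 = p"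
  using principal unfolding principal_T3_bundle_def by blast+

lemma act_in: "p \<in> points P \<Longrightarrow> g \<in> torus \<Longrightarrow> act p g \<in> points P"
proof -
  assume "p \<in> points P" "g \<in> torus"
  then have mem: "(p, g) \<in> topspace (prod_topology (mtop P) (top_of_set torus))" by simp
  have cont: "continuous_map (prod_topology (mtop P) (top_of_set torus)) (mtop P) (\<lambda>(p, g). act p g)"
    using smooth_act unfolding smooth_map_def prod_mfd_def torus_mfd_def by simp
  from funcset_mem[OF continuous_map_funspace[OF cont] mem] show "act p g \<in> points P" by simp
qed

definition flow :: "('p, real^6) chart \<Rightarrow> (real^6) \<times> (real^3) \<Rightarrow> real^6" where
  "flow C y = snd C (act (chart_inv C (fst y)) (torus_exp (snd y)))"

text \<open>
  The points where the flow stays in the chart.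
\<close>

definition flow_dom :: "('p, real^6) chart \<Rightarrow> ((real^6) \<times> (real^3)) set" where
  "flow_dom C = {y \<in> (snd C ` fst C) \<times> tbox. act (chart_inv C (fst y)) (torus_exp (snd y)) \<in> fst C}"

context
  fixes D c assumes C: "(D, c) \<in> atlas P"
begin

lemmas chart_P = chart_facts[OF smooth_P C]

lemma flow_continuous:
  "continuous_map (top_of_set ((c ` D) \<times> tbox)) (mtop P) (\<lambda>y. act (chart_inv (D, c) (fst y)) (torus_exp (snd y)))"
proof -
  let ?X = "top_of_set ((c ` D) \<times> tbox)"
  have X: "?X = prod_topology (top_of_set (c ` D)) (top_of_set tbox)" by simp
  have 1: "continuous_map ?X (mtop P) (\<lambda>y. chart_inv (D, c) (fst y))"
  proof -
    have "continuous_map (prod_topology (top_of_set (c ` D)) (top_of_set tbox)) (mtop P) (chart_inv (D, c) \<circ> fst)"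
      by (rule continuous_map_compose[OF continuous_map_fst chart_inv_continuous[OF smooth_P C]])
    then show ?thesis unfolding X by (simp only: o_def)
  qed
  have 2: "continuous_map ?X (top_of_set torus) (\<lambda>y. torus_exp (snd y))"
  proof -
    have "continuous_map (top_of_set tbox) (top_of_set torus) torus_exp"
      by (simp add: continuous_torus_exp torus_exp_in image_subset_iff)
    then have "continuous_map (prod_topology (top_of_set (c ` D)) (top_of_set tbox)) (top_of_set torus) (torus_exp \<circ> snd)"
      by (rule continuous_map_compose[OF continuous_map_snd])
    then show ?thesis unfolding X by (simp only: o_def)
  qed
  have 3: "continuous_map (prod_topology (mtop P) (top_of_set torus)) (mtop P) (\<lambda>(p, g). act p g)"
    using smooth_act unfolding smooth_map_def prod_mfd_def torus_mfd_def by simp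
  show ?thesis
    using continuous_map_compose[OF continuous_map_pairedI[OF 1 2] 3] by (simp add: o_def)
qed

lemma flow_dom_open: "open (flow_dom (D, c))"
proof -
  have "openin (top_of_set ((c ` D) \<times> tbox)) (flow_dom (D, c))"
    using openin_continuous_map_preimage[OF flow_continuous chart_P(1)]
    by (simp add: flow_dom_def)
  moreover have "open ((c ` D) \<times> tbox)" by (intro open_Times chart_P(3) open_tbox)
  ultimately show ?thesis using openin_open_trans by blast
qed

lemma flow_smooth: "smooth_on (flow_dom (D, c)) (flow (D, c))"
proof -
  let ?T = "torus_exp ` tbox" and ?l = "inv_into tbox torus_exp"
  let ?C1 = "(D \<times> ?T, map_prod c ?l)"
  have inj: "inj_on (map_prod c ?l) (D \<times> ?T)"
    by (intro map_prod_inj_on chart_P(5) inj_on_inv_into) simp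
  have "?C1 \<in> atlas (prod_mfd P torus_mfd)"
    using C torus_chart unfolding prod_mfd_def by auto
  moreover have "\<forall>C1\<in>atlas (prod_mfd P torus_mfd). \<forall>C'\<in>atlas P. smooth_on (snd C1 ` {q \<in> fst C1. (\<lambda>(p, g). act p g) q \<in> fst C'})
      (snd C' \<circ> (\<lambda>(p, g). act p g) \<circ> chart_inv C1)"
    using smooth_act unfolding smooth_map_def by blast
  ultimately have sm: "smooth_on (map_prod c ?l ` {q \<in> D \<times> ?T. (\<lambda>(p, g). act p g) q \<in> D})
      (c \<circ> (\<lambda>(p, g). act p g) \<circ> chart_inv ?C1)"
    using C by fastforce
  have inv: "chart_inv ?C1 y = (chart_inv (D, c) (fst y), torus_exp (snd y))"
    if "y \<in> (c ` D) \<times> tbox" for y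
    using that by (intro chart_inv_eq[OF inj])
      (auto simp: chart_inv_in chart_chart_inv torus_chart_exp prod_eq_iff chart_inv_chart[OF chart_P(5)])
  have set: "map_prod c ?l ` {q \<in> D \<times> ?T. (\<lambda>(p, g). act p g) q \<in> D} = flow_dom (D, c)" (is "?A = ?B")
  proof
    show "?A \<subseteq> ?B"
      by (auto simp: flow_dom_def torus_chart_exp chart_inv_chart[OF chart_P(5)])
    show "?B \<subseteq> ?A"
    proof
      fix y assume y: "y \<in> ?B"
      then have "y = map_prod c ?l (chart_inv (D, c) (fst y), torus_exp (snd y))"
        by (auto simp: flow_dom_def torus_chart_exp chart_chart_inv prod_eq_iff chart_inv_chart[OF chart_P(5)])
      moreover have "(chart_inv (D, c) (fst y), torus_exp (snd y)) \<in> {q \<in> D \<times> ?T. (\<lambda>(p, g). act p g) q \<in> D}"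
        using y by (auto simp: flow_dom_def chart_inv_chart[OF chart_P(5)])
      ultimately show "y \<in> ?A" by (rule image_eqI)
    qed
  qed
  show ?thesis
  proof (rule smooth_on_cong[OF flow_dom_open _ sm[unfolded set]])
    fix y assume "y \<in> flow_dom (D, c)"
    then show "(c \<circ> (\<lambda>(p, g). act p g) \<circ> chart_inv ?C1) y = flow (D, c) y"
      using inv[of y] by (auto simp: flow_dom_def flow_def)
  qed
qed

lemma flow_0: "p \<in> D \<Longrightarrow> flow (D, c) (c p, 0) = c p" "p \<in> D \<Longrightarrow> (c p, 0) \<in> flow_dom (D, c)"
proof -
  assume p: "p \<in> D"
  then have "act p 1 = p" using act_1 chart_P(2) by blast
  then show "flow (D, c) (c p, 0) = c p" "(c p, 0) \<in> flow_dom (D, c)"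
    using p chart_inv_chart[OF chart_P(5) p] zero_in_tbox by (auto simp: flow_def flow_dom_def torus_exp_0)
qed

definition dflow where "dflow y = frechet_derivative (flow (D, c)) (at y)"

lemma dflow: "y \<in> flow_dom (D, c) \<Longrightarrow> (flow (D, c) has_derivative dflow y) (at y)"
  unfolding dflow_def by (rule smooth_on_has_derivative[OF flow_smooth])

lemma flow_line: assumes p: "p \<in> D"
  shows "((\<lambda>s. flow (D, c) (c p, s *\<^sub>R \<xi>)) has_vector_derivative dflow (c p, 0) (0, \<xi>)) (at 0)"
proof -
  have "((\<lambda>s. (c p, s *\<^sub>R \<xi>)) has_derivative (\<lambda>r. (0, r *\<^sub>R \<xi>))) (at 0)"
    by (auto intro!: derivative_eq_intros)
  moreover have "(flow (D, c) has_derivative dflow (c p, 0)) (at (c p, 0 *\<^sub>R \<xi>))"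
    using dflow[OF flow_0(2)[OF p]] by simp
  ultimately have "((\<lambda>s. flow (D, c) (c p, s *\<^sub>R \<xi>)) has_derivative (\<lambda>r. dflow (c p, 0) (0, r *\<^sub>R \<xi>))) (at 0)"
    by (rule has_derivative_compose)
  moreover have "dflow (c p, 0) (0, r *\<^sub>R \<xi>) = r *\<^sub>R dflow (c p, 0) (0, \<xi>)" for r
    using linear_scale[OF has_derivative_linear[OF dflow[OF flow_0(2)[OF p]]], of r "(0, \<xi>)"] by simp
  ultimately show ?thesis by (simp add: has_vector_derivative_def)
qed

lemma fundamental_vector_eq: "p \<in> D \<Longrightarrow> fundamental_vector act \<xi> (D, c) p = dflow (c p, 0) (0, \<xi>)"
proof -
  assume p: "p \<in> D"
  have "(\<lambda>s. flow (D, c) (c p, s *\<^sub>R \<xi>)) = (\<lambda>s. c (act p (torus_exp (s *\<^sub>R \<xi>))))"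
    using chart_inv_chart[OF chart_P(5) p] by (simp add: flow_def)
  then show ?thesis
    using vector_derivative_at[OF flow_line[OF p, of \<xi>]] by (simp add: fundamental_vector_def)
qed

lemma dflow_horizontal: assumes p: "p \<in> D" shows "dflow (c p, 0) (w, 0) = w"
proof -
  have "open {x. (x, 0) \<in> flow_dom (D, c)}"
  proof -
    have "open ((\<lambda>x. (x, 0 :: real^3)) -` flow_dom (D, c))"
      by (intro open_vimage flow_dom_open continuous_intros)
    then show ?thesis by (simp add: vimage_def)
  qed
  moreover have "c p \<in> {x. (x, 0) \<in> flow_dom (D, c)}" using flow_0[OF p] by simp
  moreover have "x = flow (D, c) (x, 0)" if "x \<in> {x. (x, 0) \<in> flow_dom (D, c)}" for x
    using that flow_0(1) by (auto simp: flow_dom_def)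
  moreover have "((\<lambda>x. flow (D, c) (x, 0)) has_derivative (\<lambda>w. dflow (c p, 0) (w, 0))) (at (c p))"
  proof -
    have a: "((\<lambda>x. (x, 0 :: real^3)) has_derivative (\<lambda>x. (x, 0))) (at (c p))"
      by (auto intro!: derivative_eq_intros)
    have b: "(flow (D, c) has_derivative dflow (c p, 0)) (at ((\<lambda>x. (x, 0)) (c p)))"
      using dflow[OF flow_0(2)[OF p]] by simp
    show ?thesis using has_derivative_compose[OF a b] by simp
  qed
  ultimately have "frechet_derivative (\<lambda>x. x) (at (c p)) = (\<lambda>w. dflow (c p, 0) (w, 0))"
    by (rule frechet_derivative_eq_on(1))
  then show ?thesis by (metis frechet_derivative_ident)
qed

text \<open>
  In a local trivialisation the action moves points along the fibres.  The projection is thus constant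
  on the orbit near \<open>s = 0\<close>, and its derivative there vanishes.
\<close>

lemma fundamental_vector_vertical: assumes p: "p \<in> D"
  shows "vertical M pr (D, c) p (fundamental_vector act \<xi> (D, c) p)"
  unfolding vertical_def
proof (intro ballI impI)
  fix C' assume C': "C' \<in> atlas M" "pr p \<in> fst C'"
  obtain D' c' where C'eq: "C' = (D', c')" by (cases C')
  have pP: "p \<in> points P" using p chart_P(2) by blast
  have contpr: "continuous_map (mtop P) (mtop M) pr" using smooth_pr by (simp add: smooth_map_def)
  have "pr p \<in> points M" using contpr pP unfolding continuous_map_def by auto
  moreover have "\<forall>m\<in>points M. \<exists>U h. openin (mtop M) U \<and> m \<in> U \<and>
        diffeomorphism (open_submfd P {p \<in> points P. pr p \<in> U})
          (prod_mfd (open_submfd M U) torus_mfd) h \<and>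
        (\<forall>p\<in>points P. pr p \<in> U \<longrightarrow>
           fst (h p) = pr p \<and> (\<forall>g\<in>torus. h (act p g) = (pr p, snd (h p) * g)))"
    using principal unfolding principal_T3_bundle_def by (elim conjE)
  ultimately obtain U h where U: "openin (mtop M) U" "pr p \<in> U"
    and h: "\<forall>p\<in>points P. pr p \<in> U \<longrightarrow> fst (h p) = pr p \<and> (\<forall>g\<in>torus. h (act p g) = (pr p, snd (h p) * g))"
    by (elim ballE[of _ _ "pr p"] exE conjE) auto
  (* The trivialisation speaks about \<open>act p g\<close> only if its projection lies in \<open>U\<close>, which holds for small \<open>s\<close>. *)
  have pract: "pr (act p g) = pr p" if "g \<in> torus" "pr (act p g) \<in> U" for g
    using h[rule_format, OF pP U(2)] h[rule_format, OF act_in[OF pP that(1)] that(2)] that(1) by auto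
  let ?V = "{q \<in> D. pr q \<in> U \<inter> D'}"
  have openV: "open (c ` ?V)"
  proof (rule chart_image_open[OF smooth_P C])
    have "openin (mtop M) (U \<inter> D')" using U(1) chart_facts(1)[OF smooth_M] C' C'eq by (intro openin_Int) auto
    then show "openin (mtop P) ?V"
      using openin_continuous_map_preimage_gen[OF contpr chart_P(1)] by blast
  qed auto
  let ?f = "c' \<circ> pr \<circ> chart_inv (D, c)"
  have "\<forall>C\<in>atlas P. \<forall>C'\<in>atlas M. smooth_on (snd C ` {p \<in> fst C. pr p \<in> fst C'}) (snd C' \<circ> pr \<circ> chart_inv C)"
    using smooth_pr unfolding smooth_map_def by blast
  from this[rule_format, OF C C'(1)] have "smooth_on (c ` {p \<in> D. pr p \<in> D'}) ?f" by (simp add: C'eq)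
  then have df: "(?f has_derivative frechet_derivative ?f (at (c p))) (at (c p))"
    using p C' C'eq by (intro smooth_on_has_derivative) auto
  let ?X = "dflow (c p, 0) (0, \<xi>)"
  let ?l = "\<lambda>s. flow (D, c) (c p, s *\<^sub>R \<xi>)"
  have l0: "?l 0 = c p" using flow_0[OF p] by simp
  have "(?l has_derivative (\<lambda>r. r *\<^sub>R ?X)) (at 0)"
    using flow_line[OF p] by (simp add: has_vector_derivative_def)
  then have comp: "((\<lambda>s. ?f (?l s)) has_derivative (\<lambda>r. frechet_derivative ?f (at (c p)) (r *\<^sub>R ?X))) (at 0)"
    by (rule has_derivative_compose) (use df l0 in \<open>simp add: o_def\<close>)
  have "isCont ?l 0" using has_vector_derivative_continuous[OF flow_line[OF p]] .
  then have "\<forall>t. open t \<and> ?l 0 \<in> t \<longrightarrow> (\<exists>s. open s \<and> 0 \<in> s \<and> (\<forall>x'\<in>s. ?l x' \<in> t))"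
    unfolding continuous_at_open .
  moreover have "?l 0 \<in> c ` ?V" using l0 p U C' C'eq by auto
  ultimately have "\<exists>s. open s \<and> 0 \<in> s \<and> (\<forall>x'\<in>s. ?l x' \<in> c ` ?V)" using openV by blast
  then obtain W where W: "open W" "0 \<in> W" "\<And>s. s \<in> W \<Longrightarrow> ?l s \<in> c ` ?V" by blast
  let ?W = "W \<inter> (\<lambda>s. (c p, s *\<^sub>R \<xi>)) -` flow_dom (D, c)"
  have openW: "open ?W" by (intro open_Int W open_vimage flow_dom_open continuous_intros)
  have const: "?f (?l s) = c' (pr p)" if "s \<in> ?W" for s
  proof -
    let ?q = "act p (torus_exp (s *\<^sub>R \<xi>))"
    have q: "?q \<in> D" using that chart_inv_chart[OF chart_P(5) p] by (auto simp: flow_dom_def)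
    have l: "?l s = c ?q" using chart_inv_chart[OF chart_P(5) p] by (simp add: flow_def)
    moreover have "?l s \<in> c ` ?V" by (rule W(3)) (use that in blast)
    ultimately have "c ?q \<in> c ` ?V" by metis
    then have "?q \<in> ?V" using q chart_P(5) by (auto simp: inj_on_def)
    then have "pr ?q = pr p" using pract torus_exp_in by blast
    then show ?thesis using l chart_inv_chart[OF chart_P(5) q] by simp
  qed
  have "((\<lambda>s. c' (pr p)) has_derivative (\<lambda>r. 0)) (at 0)" by simp
  then have "((\<lambda>s. ?f (?l s)) has_derivative (\<lambda>r. 0)) (at (0::real))"
    by (rule has_derivative_transform_within_open[OF _ openW])
      (use const W(2) flow_0[OF p] in auto)
  from has_derivative_unique[OF comp this] have "frechet_derivative ?f (at (c p)) (1 *\<^sub>R ?X) = 0" by meson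
  then show "tangent_map pr (D, c) C' p (fundamental_vector act \<xi> (D, c) p) = 0"
    using fundamental_vector_eq[OF p] by (simp add: tangent_map_def C'eq)
qed

text \<open>
  Invariance is stated with the pullback, which uses an arbitrary chart \<open>C''\<close> at the image point; the
  transformation law returns to the chart in which the flow is written.
\<close>

lemma invariant_flow:
  assumes F: "form_on P k F" and inv: "invariant_form P act F"
    and y: "(x, \<zeta>) \<in> flow_dom (D, c)"
  shows "F (D, c) (flow (D, c) (x, \<zeta>)) (\<lambda>i. dflow (x, \<zeta>) (v i, 0)) = F (D, c) x v"
proof -
  let ?p = "chart_inv (D, c) x" and ?g = "torus_exp \<zeta>"
  let ?q = "act ?p ?g"
  have x: "x \<in> c ` D" and q: "?q \<in> D" using y by (auto simp: flow_dom_def)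
  have p: "?p \<in> D" "c ?p = x" using chart_inv_in[OF x] chart_chart_inv[OF x] by auto
  define C'' where "C'' = (SOME C'. C' \<in> atlas P \<and> ?q \<in> fst C')"
  have "\<exists>C'. C' \<in> atlas P \<and> ?q \<in> fst C'" using C q by force
  then have C'': "C'' \<in> atlas P" "?q \<in> fst C''" unfolding C''_def by (metis (mono_tags, lifting) someI_ex)+
  obtain D' c' where C''eq: "C'' = (D', c')" by (cases C'')
  have C': "(D', c') \<in> atlas P" "?q \<in> D'" using C'' C''eq by auto
  have "pullback P (\<lambda>p. act p ?g) F (D, c) (c ?p) v = F (D, c) (c ?p) v"
    using inv torus_exp_in C p unfolding invariant_form_def form_eq_def by fastforce
  then have pb: "F (D', c') (c' ?q) (\<lambda>i. tangent_map (\<lambda>p. act p ?g) (D, c) (D', c') ?p (v i)) = F (D, c) x v"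
    unfolding pullback_def Let_def chart_inv_chart[OF chart_P(5) p(1)] C''_def[symmetric] C''eq p by simp
  note t = chart_change_facts[OF smooth_P C C'(1)]
  let ?t = "chart_change (D, c) (D', c')"
  have fl: "flow (D, c) (x, \<zeta>) = c ?q" by (simp add: flow_def)
  have cq: "c ?q \<in> c ` (D \<inter> D')" using q C' by blast
  have dt: "(?t has_derivative frechet_derivative ?t (at (c ?q))) (at (c ?q))"
    by (rule smooth_on_has_derivative[OF t(2) cq])
  have dfl: "((\<lambda>x. flow (D, c) (x, \<zeta>)) has_derivative (\<lambda>w. dflow (x, \<zeta>) (w, 0))) (at x)"
  proof -
    have a: "((\<lambda>x. (x, \<zeta>)) has_derivative (\<lambda>x. (x, 0))) (at x)"
      by (auto intro!: derivative_eq_intros)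
    have b: "(flow (D, c) has_derivative dflow (x, \<zeta>)) (at ((\<lambda>x. (x, \<zeta>)) x))"
      using dflow[OF y] by simp
    show ?thesis using has_derivative_compose[OF a b] by simp
  qed
  have comp: "((\<lambda>x. ?t (flow (D, c) (x, \<zeta>))) has_derivative
      (\<lambda>w. frechet_derivative ?t (at (c ?q)) (dflow (x, \<zeta>) (w, 0)))) (at x)"
    by (rule has_derivative_compose[OF dfl]) (use dt fl in simp)
  have openW: "open ((\<lambda>x. (x, \<zeta>)) -` flow_dom (D, c))"
    by (intro open_vimage flow_dom_open continuous_intros)
  have "(c' \<circ> (\<lambda>p. act p ?g) \<circ> chart_inv (D, c)) z = ?t (flow (D, c) (z, \<zeta>))"
    if "z \<in> (\<lambda>x. (x, \<zeta>)) -` flow_dom (D, c)" for z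
    using that t(3) by (auto simp: flow_dom_def flow_def)
  from frechet_derivative_eq_on(1)[OF openW _ this comp] y
  have tm: "tangent_map (\<lambda>p. act p ?g) (D, c) (D', c') ?p w = frechet_derivative ?t (at (c ?q)) (dflow (x, \<zeta>) (w, 0))" for w
    by (simp add: tangent_map_def p(2) o_def)
  have "F (D, c) (c ?q) (\<lambda>i. dflow (x, \<zeta>) (v i, 0))
      = F (D', c') (c' ?q) (\<lambda>i. frechet_derivative ?t (at (c ?q)) (dflow (x, \<zeta>) (v i, 0)))"
    by (rule form_on_trans[OF F C C'(1) q C'(2)])
  also have "\<dots> = F (D, c) x v" using pb unfolding tm .
  finally show ?thesis by (simp only: fl)
qed

text \<open>
  An instance of Cartan's formula \<open>\<iota>\<^sub>X dF = L\<^sub>X F - d(F X)\<close>.  Pull \<open>F\<close> back along the flow.  For an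
  argument \<open>(w, 0)\<close> the pulled back form is constant along \<open>\<zeta> = s \<xi>\<close> by invariance, and for \<open>(0, \<xi>)\<close>
  it is constant along \<open>x + s w\<close> because \<open>F\<close> is constant on the fundamental field; both terms of the
  exterior derivative at \<open>((0, \<xi>), (w, 0))\<close> therefore vanish.
\<close>

lemma d1_fundamental:
  assumes F: "form_on P 1 F" and inv: "invariant_form P act F"
    and const: "\<And>q. q \<in> D \<Longrightarrow> onef F (D, c) (c q) (fundamental_vector act \<xi> (D, c) q) = \<kappa>"
    and p: "p \<in> D"
  shows "d1 (onef F (D, c)) (c p) (fundamental_vector act \<xi> (D, c) p) w = 0"
proof -
  let ?\<rho> = "flow (D, c)" and ?y = "(c p, 0 :: real^3)"
  let ?A = "onef F (D, c)"
  let ?B = "\<lambda>y u. ?A (?\<rho> y) (frechet_derivative ?\<rho> (at y) u)"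
  have y: "?y \<in> flow_dom (D, c)" and \<rho>y: "?\<rho> ?y = c p" using flow_0[OF p] by auto
  have U: "?\<rho> ?y \<in> c ` D" using \<rho>y p by auto
  have "d1 ?A (?\<rho> ?y) (frechet_derivative ?\<rho> (at ?y) (0, \<xi>)) (frechet_derivative ?\<rho> (at ?y) (w, 0))
     = d1 ?B ?y (0, \<xi>) (w, 0)"
    by (rule d1_pullback[where A = ?A, OF flow_dom_open y flow_smooth chart_P(3) U])
      (rule onef_facts(2)[OF F C], assumption, rule onef_facts(3)[OF F C U])
  then have eq: "d1 ?A (c p) (fundamental_vector act \<xi> (D, c) p) w = d1 ?B ?y (0, \<xi>) (w, 0)"
    using fundamental_vector_eq[OF p] dflow_horizontal[OF p] \<rho>y by (simp add: dflow_def)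
  have Bdiff: "(\<lambda>y. ?B y u) differentiable (at ?y)" for u
  proof -
    have "((\<lambda>y. ?A (?\<rho> y) (frechet_derivative ?\<rho> (at y) u)) has_derivative
     (\<lambda>w. ?A (?\<rho> ?y) (frechet_derivative (\<lambda>y. frechet_derivative ?\<rho> (at y) u) (at ?y) w)
       + frechet_derivative (\<lambda>z. ?A z (frechet_derivative ?\<rho> (at ?y) u)) (at (?\<rho> ?y)) (frechet_derivative ?\<rho> (at ?y) w))) (at ?y)"
      by (rule has_derivative_oneform_apply[where A = ?A and \<rho> = ?\<rho> and U = "c ` D", OF chart_P(3) U
            onef_facts(2)[OF F C] onef_facts(3)[OF F C U]
            smooth_on_has_derivative[OF flow_smooth y] smooth_on_has_derivative[OF smooth_on_frechet[OF flow_smooth] y]])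
    then show ?thesis unfolding differentiable_def by blast
  qed
  have along: "frechet_derivative f (at ?y) u = 0"
    if "f differentiable (at ?y)" "open W" "0 \<in> W" "\<And>s. s \<in> W \<Longrightarrow> f (?y + s *\<^sub>R u) = \<kappa>'"
    for f :: "_ \<Rightarrow> real" and u W \<kappa>'
  proof -
    have "((\<lambda>s. ?y + s *\<^sub>R u) has_derivative (\<lambda>r. r *\<^sub>R u)) (at 0)"
      by (auto intro!: derivative_eq_intros)
    then have "((\<lambda>s. f (?y + s *\<^sub>R u)) has_derivative (\<lambda>r. frechet_derivative f (at ?y) (r *\<^sub>R u))) (at 0)"
      by (rule has_derivative_compose) (use frechet_derivative_has[OF that(1)] in simp)
    moreover have "((\<lambda>s. f (?y + s *\<^sub>R u)) has_derivative (\<lambda>r. 0)) (at 0)"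
      by (rule has_derivative_transform_within_open[OF _ that(2,3), of "\<lambda>_. \<kappa>'"]) (use that(4) in auto)
    ultimately have "(\<lambda>r. frechet_derivative f (at ?y) (r *\<^sub>R u)) = (\<lambda>r. 0)" by (rule has_derivative_unique)
    then have "frechet_derivative f (at ?y) (1 *\<^sub>R u) = 0" by meson
    then show ?thesis by simp
  qed
  have openW: "open ((\<lambda>s::real. ?y + s *\<^sub>R u) -` flow_dom (D, c))" for u
    by (intro open_vimage flow_dom_open continuous_intros)
  have "frechet_derivative (\<lambda>y. ?B y (w, 0)) (at ?y) (0, \<xi>) = 0"
  proof (rule along[OF Bdiff openW[of "(0, \<xi>)"]])
    fix s assume "s \<in> (\<lambda>s::real. ?y + s *\<^sub>R (0, \<xi>)) -` flow_dom (D, c)"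
    then show "?B (?y + s *\<^sub>R (0, \<xi>)) (w, 0) = ?A (c p) w"
      using invariant_flow[OF F inv, of "c p" "s *\<^sub>R \<xi>" "\<lambda>_. w"] by (simp add: dflow_def)
  qed (use y in simp)
  moreover have "frechet_derivative (\<lambda>y. ?B y (0, \<xi>)) (at ?y) (w, 0) = 0"
  proof (rule along[OF Bdiff openW[of "(w, 0)"]])
    fix s assume "s \<in> (\<lambda>s::real. ?y + s *\<^sub>R (w, 0)) -` flow_dom (D, c)"
    then have "c p + s *\<^sub>R w \<in> c ` D" by (auto simp: flow_dom_def)
    then obtain q where q: "q \<in> D" "c p + s *\<^sub>R w = c q" by auto
    then show "?B (?y + s *\<^sub>R (w, 0)) (0, \<xi>) = \<kappa>"
      using const[OF q(1)] flow_0[OF q(1)] fundamental_vector_eq[OF q(1)] by (simp add: dflow_def)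
  qed (use y in simp)
  ultimately show ?thesis unfolding eq by (simp add: d1_def)
qed

lemma invariant_fun_fundamental:
  assumes inv: "invariant_fun P act f" and p: "p \<in> D"
    and d: "(f \<circ> chart_inv (D, c)) differentiable (at (c p))"
  shows "frechet_derivative (f \<circ> chart_inv (D, c)) (at (c p)) (fundamental_vector act \<xi> (D, c) p) = 0"
proof -
  let ?f = "f \<circ> chart_inv (D, c)"
  let ?l = "\<lambda>s. flow (D, c) (c p, s *\<^sub>R \<xi>)"
  let ?X = "dflow (c p, 0) (0, \<xi>)"
  have l0: "?l 0 = c p" using flow_0[OF p] by simp
  have "(?l has_derivative (\<lambda>r. r *\<^sub>R ?X)) (at 0)"
    using flow_line[OF p] by (simp add: has_vector_derivative_def)
  then have comp: "((\<lambda>s. ?f (?l s)) has_derivative (\<lambda>r. frechet_derivative ?f (at (c p)) (r *\<^sub>R ?X))) (at 0)"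
    by (rule has_derivative_compose) (use frechet_derivative_has[OF d] l0 in \<open>simp add: o_def\<close>)
  let ?W = "(\<lambda>s::real. (c p, s *\<^sub>R \<xi>)) -` flow_dom (D, c)"
  have openW: "open ?W" by (intro open_vimage flow_dom_open continuous_intros)
  have const: "?f (?l s) = f p" if "s \<in> ?W" for s
  proof -
    have q: "act p (torus_exp (s *\<^sub>R \<xi>)) \<in> D" using that chart_inv_chart[OF chart_P(5) p] by (auto simp: flow_dom_def)
    then have "?f (?l s) = f (act p (torus_exp (s *\<^sub>R \<xi>)))"
      using chart_inv_chart[OF chart_P(5)] p by (simp add: flow_def)
    then show ?thesis using inv torus_exp_in p chart_P(2) unfolding invariant_fun_def by auto
  qed
  have "((\<lambda>s. ?f (?l s)) has_derivative (\<lambda>r. 0)) (at (0::real))"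
    by (rule has_derivative_transform_within_open[OF _ openW, of "\<lambda>_. f p"])
      (use const flow_0[OF p] in auto)
  from has_derivative_unique[OF comp this] have "frechet_derivative ?f (at (c p)) (1 *\<^sub>R ?X) = 0" by meson
  then show ?thesis using fundamental_vector_eq[OF p] by simp
qed

end

end

section \<open>Adapted coframes\<close>

lemma cramer_3: "(a \<bullet> cross3 b c) *\<^sub>R y = (y \<bullet> cross3 b c) *\<^sub>R a + (a \<bullet> cross3 y c) *\<^sub>R b + (a \<bullet> cross3 b y) *\<^sub>R c"
  by (simp add: vec_eq_iff forall_3 inner_vec_def sum_3 cross3_def vector_3 algebra_simps)

text \<open>
  The pointwise situation on \<open>P\<close>: \<open>\<epsilon>\<close> is a solder form, \<open>\<alpha>\<close> a connection form and \<open>vert\<close> assigns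
  fundamental vectors.  By dimension, \<open>(\<epsilon>, \<alpha>)\<close> is an isomorphism and the kernel of \<open>\<epsilon>\<close> consists of
  fundamental vectors.
\<close>

locale coframe =
  fixes \<epsilon> \<alpha> :: "real^6 \<Rightarrow> real^3" and vert :: "real^3 \<Rightarrow> real^6"
  assumes lin_e: "linear \<epsilon>" and lin_a: "linear \<alpha>"
    and e_vert: "\<epsilon> (vert \<xi>) = 0" and a_vert: "\<exists>\<xi>. \<alpha> (vert \<xi>) = y"
    and surj_e: "\<exists>v. \<epsilon> v = y"
begin

definition K :: "real^6 \<Rightarrow> (real^3) \<times> (real^3)" where "K v = (\<epsilon> v, \<alpha> v)"

lemma linear_K: "linear K"
  by (rule linearI) (simp_all add: K_def linear_add[OF lin_e] linear_add[OF lin_a] linear_scale[OF lin_e] linear_scale[OF lin_a])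

lemma surj_K: "surj K"
  unfolding surj_def
proof
  fix y :: "(real^3) \<times> (real^3)"
  obtain v where v: "\<epsilon> v = fst y" using surj_e by blast
  obtain \<xi> where "\<alpha> (vert \<xi>) = snd y - \<alpha> v" using a_vert by blast
  then have "K (v + vert \<xi>) = y"
    by (simp add: K_def linear_add[OF lin_e] linear_add[OF lin_a] v e_vert prod_eq_iff)
  then show "\<exists>x. y = K x" by blast
qed

lemma inj_K: "inj K"
  by (rule linear_surjective_imp_injective[OF linear_K surj_K]) (simp add: dim_UNIV)

text \<open>
  The horizontal vectors dual to the components of \<open>\<epsilon>\<close>.
\<close>

definition lift :: "3 \<Rightarrow> real^6" where "lift k = inv K (axis k 1, 0)"

lemma e_lift: "\<epsilon> (lift k) = axis k 1"
proof -
  have "K (lift k) = (axis k 1, 0)" unfolding lift_def by (rule surj_f_inv_f[OF surj_K])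
  then show ?thesis by (simp add: K_def)
qed

lemma kernel_e: assumes "\<epsilon> v = 0" obtains \<xi> where "v = vert \<xi>"
proof -
  obtain \<xi> where "\<alpha> (vert \<xi>) = \<alpha> v" using a_vert by blast
  then have "K v = K (vert \<xi>)" using assms e_vert by (simp add: K_def)
  then have "v = vert \<xi>" using inj_K by (simp add: inj_eq)
  then show thesis by (rule that)
qed

text \<open>
  The difference of \<open>v\<close> and its horizontal part lies in the kernel of \<open>\<epsilon>\<close>, where \<open>\<beta>\<close> vanishes.
\<close>

lemma horizontal_expand:
  fixes \<beta> :: "real^6 \<Rightarrow> 'b::real_vector"
  assumes \<beta>: "linear \<beta>" and h: "\<And>\<xi>. \<beta> (vert \<xi>) = 0"
  shows "\<beta> v = (\<Sum>k\<in>UNIV. (\<epsilon> v $ k) *\<^sub>R \<beta> (lift k))"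
proof -
  let ?w = "v - (\<Sum>k\<in>UNIV. (\<epsilon> v $ k) *\<^sub>R lift k)"
  have "\<epsilon> ?w = \<epsilon> v - (\<Sum>k\<in>UNIV. (\<epsilon> v $ k) *\<^sub>R axis k 1)"
    by (simp add: linear_diff[OF lin_e] linear_sum[OF lin_e] linear_scale[OF lin_e] e_lift)
  also have "\<dots> = 0" by (simp add: vec_eq_iff axis_def if_distrib cong: if_cong)
  finally obtain \<xi> where "?w = vert \<xi>" by (rule kernel_e)
  then have "\<beta> ?w = 0" using h by simp
  then show ?thesis by (simp add: linear_diff[OF \<beta>] linear_sum[OF \<beta>] linear_scale[OF \<beta>])
qed

text \<open>
  The coefficients of a horizontal 2-form with respect to \<open>^e\<^sup>1, ^e\<^sup>2, ^e\<^sup>3\<close>.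
\<close>

definition dual2 :: "(real^6 \<Rightarrow> real^6 \<Rightarrow> real) \<Rightarrow> real^3" where
  "dual2 \<beta> = vector [\<beta> (lift 2) (lift 3), \<beta> (lift 3) (lift 1), \<beta> (lift 1) (lift 2)]"

lemma horizontal_2form_expand:
  assumes lin: "\<And>v. linear (\<beta> v)" and skew: "\<And>v w. \<beta> w v = - \<beta> v w"
    and h: "\<And>\<xi> w. \<beta> (vert \<xi>) w = 0"
  shows "\<beta> v w = dual2 \<beta> \<bullet> cross3 (\<epsilon> v) (\<epsilon> w)"
proof -
  have lin': "linear (\<lambda>v. \<beta> v w)" for w
  proof -
    have "(\<lambda>v. \<beta> v w) = (\<lambda>v. - \<beta> w v)" using skew by blast
    then show ?thesis using linear_compose_neg[OF lin] by simp
  qed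
  have "\<beta> v w = (\<Sum>k\<in>UNIV. \<Sum>l\<in>UNIV. \<epsilon> v $ k * (\<epsilon> w $ l * \<beta> (lift k) (lift l)))"
  proof -
    have "\<beta> v w = (\<Sum>k\<in>UNIV. (\<epsilon> v $ k) *\<^sub>R \<beta> (lift k) w)"
      by (rule horizontal_expand[OF lin' h])
    also have "\<dots> = (\<Sum>k\<in>UNIV. (\<epsilon> v $ k) *\<^sub>R (\<Sum>l\<in>UNIV. (\<epsilon> w $ l) *\<^sub>R \<beta> (lift k) (lift l)))"
    proof (intro sum.cong refl arg_cong[where f = "\<lambda>z. _ *\<^sub>R z"])
      fix k show "\<beta> (lift k) w = (\<Sum>l\<in>UNIV. (\<epsilon> w $ l) *\<^sub>R \<beta> (lift k) (lift l))"
        by (rule horizontal_expand[OF lin]) (use skew h in \<open>metis minus_zero\<close>)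
    qed
    finally show ?thesis by (simp add: sum_distrib_left)
  qed
  moreover have "\<beta> (lift k) (lift k) = 0" for k using skew[of "lift k" "lift k"] by simp
  moreover have "\<beta> (lift 2) (lift 1) = - \<beta> (lift 1) (lift 2)" "\<beta> (lift 3) (lift 2) = - \<beta> (lift 2) (lift 3)"
     "\<beta> (lift 1) (lift 3) = - \<beta> (lift 3) (lift 1)" by (rule skew)+
  ultimately show ?thesis
    by (simp add: sum_3 inner_vec_def dual2_def vector_3 cross3_def algebra_simps)
qed

lemma dual2_eq:
  assumes "\<And>v w. \<beta> v w = T \<bullet> cross3 (\<epsilon> v) (\<epsilon> w)" shows "dual2 \<beta> = T"
  by (simp add: dual2_def assms e_lift vec_eq_iff forall_3 vector_3 inner_vec_def sum_3 cross3_def axis_def)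

end

section \<open>Derivatives of families\<close>

text \<open>
  Derivatives on the product with an interval split into the derivative at fixed \<open>t\<close> and the time
  derivative.
\<close>

lemma frechet_family:
  fixes f :: "'a::real_normed_vector \<times> real \<Rightarrow> 'b::real_normed_vector"
  assumes "f differentiable (at (x, t))"
  shows "frechet_derivative f (at (x, t)) (w, s)
      = frechet_derivative (\<lambda>x. f (x, t)) (at x) w + s *\<^sub>R vector_derivative (\<lambda>s. f (x, s)) (at t)"
    "(\<lambda>x. f (x, t)) differentiable (at x)" "(\<lambda>s. f (x, s)) differentiable (at t)"
proof -
  let ?D = "frechet_derivative f (at (x, t))"
  have D: "(f has_derivative ?D) (at (x, t))" by (rule frechet_derivative_has[OF assms])
  have l: "linear ?D" by (rule has_derivative_linear[OF D])
  have 1: "((\<lambda>x. f (x, t)) has_derivative (\<lambda>w. ?D (w, 0))) (at x)"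
  proof -
    have "((\<lambda>x. (x, t)) has_derivative (\<lambda>w. (w, 0))) (at x)" by (auto intro!: derivative_eq_intros)
    from has_derivative_compose[OF this, of f ?D] D show ?thesis by simp
  qed
  have 2: "((\<lambda>s. f (x, s)) has_derivative (\<lambda>s. ?D (0, s))) (at t)"
  proof -
    have "((\<lambda>s. (x, s)) has_derivative (\<lambda>w. (0, w))) (at t)" by (auto intro!: derivative_eq_intros)
    from has_derivative_compose[OF this, of f ?D] D show ?thesis by simp
  qed
  have sc: "?D (0, s) = s *\<^sub>R ?D (0, 1)" for s using linear_scale[OF l, of s "(0, 1)"] by simp
  have "((\<lambda>s. f (x, s)) has_vector_derivative ?D (0, 1)) (at t)"
    unfolding has_vector_derivative_def by (rule has_derivative_eq_rhs[OF 2]) (rule ext, rule sc)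
  then have v: "vector_derivative (\<lambda>s. f (x, s)) (at t) = ?D (0, 1)" by (rule vector_derivative_at)
  have "?D (w, s) = ?D (w, 0) + ?D (0, s)" using linear_add[OF l, of "(w, 0)" "(0, s)"] by simp
  then show "?D (w, s) = frechet_derivative (\<lambda>x. f (x, t)) (at x) w + s *\<^sub>R vector_derivative (\<lambda>s. f (x, s)) (at t)"
    unfolding frechet_derivative_at[OF 1, symmetric] v using sc[of s] by simp
  show "(\<lambda>x. f (x, t)) differentiable (at x)" "(\<lambda>s. f (x, s)) differentiable (at t)"
    using 1 2 unfolding differentiable_def by blast+
qed

lemma linear_frechet_param:
  fixes A :: "'a::real_normed_vector \<Rightarrow> 'v::real_vector \<Rightarrow> real"
  assumes U: "open U" "y \<in> U" and lin: "\<And>z. z \<in> U \<Longrightarrow> linear (A z)"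
    and A: "\<And>v. (\<lambda>z. A z v) differentiable (at y)"
  shows "linear (\<lambda>v. frechet_derivative (\<lambda>z. A z v) (at y) w)"
proof (rule linearI)
  fix u v
  have "frechet_derivative (\<lambda>z. A z (u + v)) (at y) = (\<lambda>w. frechet_derivative (\<lambda>z. A z u) (at y) w + frechet_derivative (\<lambda>z. A z v) (at y) w)"
    by (rule frechet_derivative_eq_on(1)[OF U _ has_derivative_add[OF frechet_derivative_has[OF A] frechet_derivative_has[OF A]]])
      (rule linear_add[OF lin])
  then show "frechet_derivative (\<lambda>z. A z (u + v)) (at y) w = frechet_derivative (\<lambda>z. A z u) (at y) w + frechet_derivative (\<lambda>z. A z v) (at y) w"
    by simp
next
  fix r v
  have "frechet_derivative (\<lambda>z. A z (r *\<^sub>R v)) (at y) = (\<lambda>w. r *\<^sub>R frechet_derivative (\<lambda>z. A z v) (at y) w)"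
    by (rule frechet_derivative_eq_on(1)[OF U _ has_derivative_scaleR_right[OF frechet_derivative_has[OF A]]])
      (rule linear_scale[OF lin])
  then show "frechet_derivative (\<lambda>z. A z (r *\<^sub>R v)) (at y) w = r *\<^sub>R frechet_derivative (\<lambda>z. A z v) (at y) w"
    by simp
qed

lemma d1_bilinear:
  assumes U: "open U" "x \<in> U" and lin: "\<And>z. z \<in> U \<Longrightarrow> linear (A z)"
    and A: "\<And>v. (\<lambda>z. A z v) differentiable (at x)"
  shows "linear (d1 A x v)" "d1 A x w v = - d1 A x v w"
proof -
  show "linear (d1 A x v)"
    unfolding d1_def[abs_def]
    by (intro linear_ops linear_frechet_param[OF U lin A] linear_frechet_derivative A)
  show "d1 A x w v = - d1 A x v w" by (simp add: d1_def)
qed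

lemma has_derivative_vec:
  fixes f :: "'a::real_normed_vector \<Rightarrow> 'n::finite \<Rightarrow> real"
  assumes "\<And>i. ((\<lambda>z. f z i) has_derivative f' i) (at y)"
  shows "((\<lambda>z. \<chi> i. f z i) has_derivative (\<lambda>w. \<chi> i. f' i w)) (at y)"
proof -
  have eq: "(\<chi> i. g i) = (\<Sum>i\<in>UNIV. g i *\<^sub>R axis i 1)" for g :: "'n \<Rightarrow> real"
    by (simp add: vec_eq_iff axis_def if_distrib cong: if_cong)
  show ?thesis unfolding eq
    by (intro has_derivative_sum has_derivative_scaleR_left assms)
qed

section \<open>Families of triples\<close>

text \<open>
  The hypotheses on the triples, with an arbitrary open set of times.
\<close>

locale T3_triples = T3_bundle P M pr act
  for P :: "('p, real^6) mfd" and M :: "('m, real^3) mfd" and pr :: "'p \<Rightarrow> 'm" and act :: "'p \<Rightarrow> complex^3 \<Rightarrow> 'p" +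
  fixes X :: "3 \<Rightarrow> real^3" and I :: "real set"
    and e a :: "real \<Rightarrow> 3 \<Rightarrow> ('p, real^6) form" and S :: "real \<Rightarrow> 'p \<Rightarrow> real^3^3"
  assumes basis: "inj X" "independent (range X)"
    and open_I: "open I"
    and smooth_e: "\<And>i. smooth_form_family P I 1 (\<lambda>t. e t i)"
    and smooth_a: "\<And>i. smooth_form_family P I 1 (\<lambda>t. a t i)"
    and smooth_S: "smooth_fun_family P I S"
    and solder: "\<And>t. t \<in> I \<Longrightarrow> solder_form P M pr act (e t)"
    and connection: "\<And>t. t \<in> I \<Longrightarrow> connection_form P act X (a t)"
    and S_invariant: "\<And>t. t \<in> I \<Longrightarrow> invariant_fun P act (S t)"
    and S_posdef: "\<And>t p. t \<in> I \<Longrightarrow> p \<in> points P \<Longrightarrow> posdef_symmetric (S t p)"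
begin

definition ev :: "real \<Rightarrow> ('p, real^6) chart \<Rightarrow> real^6 \<Rightarrow> real^6 \<Rightarrow> real^3" where
  "ev t C x v = (\<chi> i. onef (e t i) C x v)"

definition av :: "real \<Rightarrow> ('p, real^6) chart \<Rightarrow> real^6 \<Rightarrow> real^6 \<Rightarrow> real^3" where
  "av t C x v = (\<chi> i. onef (a t i) C x v)"

lemma coeff_unique:
  assumes "(\<Sum>k\<in>UNIV. u $ k *\<^sub>R X k) = (\<Sum>k\<in>UNIV. w $ k *\<^sub>R X k)" shows "u = w"
proof -
  have "(\<Sum>v\<in>range X. (u - w) $ inv X v *\<^sub>R v) = (\<Sum>k\<in>UNIV. (u - w) $ k *\<^sub>R X k)"
    by (subst sum.reindex[OF basis(1)]) (simp add: basis(1))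
  also have "\<dots> = 0" using assms by (simp add: scaleR_diff_left sum_subtractf)
  finally have z: "(\<Sum>v\<in>range X. (u - w) $ inv X v *\<^sub>R v) = 0" .
  have "(u - w) $ inv X (X k) = 0" for k
    by (rule independentD[OF basis(2) _ _ z]) auto
  then show ?thesis by (simp add: basis(1) vec_eq_iff)
qed

text \<open>
  The components of an element of the Lie algebra in the basis \<open>X\<close>.
\<close>

definition acoef :: "real^3 \<Rightarrow> real^3" where
  "acoef \<xi> = (THE u. (\<Sum>k\<in>UNIV. u $ k *\<^sub>R X k) = \<xi>)"

lemma acoef_eq: "(\<Sum>k\<in>UNIV. u $ k *\<^sub>R X k) = \<xi> \<Longrightarrow> acoef \<xi> = u"
  unfolding acoef_def by (rule the_equality) (auto intro: coeff_unique)

definition S_chart :: "('p, real^6) chart \<Rightarrow> (real^6) \<times> real \<Rightarrow> real^3^3" where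
  "S_chart C z = S (snd z) (chart_inv C (fst z))"

text \<open>
  The coframe \<open>(dt, e, a)\<close> of \<open>P \<times> I\<close> in a chart.
\<close>

definition theta :: "('p, real^6) chart \<Rightarrow> (real^6) \<times> real \<Rightarrow> (real^6) \<times> real \<Rightarrow> r7" where
  "theta C z v = (snd v, ev (snd z) C (fst z) (fst v), av (snd z) C (fst z) (fst v))"

text \<open>
  The derivative of the coframe at \<open>y\<close> in the direction \<open>w\<close>, evaluated on a constant vector \<open>v\<close>.
\<close>

definition dtheta :: "('p, real^6) chart \<Rightarrow> (real^6) \<times> real \<Rightarrow> (real^6) \<times> real \<Rightarrow> (real^6) \<times> real \<Rightarrow> r7" where
  "dtheta C y w v = (0, \<chi> i. frechet_derivative (\<lambda>z. onef (e (snd z) i) C (fst z) (fst v)) (at y) w,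
     \<chi> i. frechet_derivative (\<lambda>z. onef (a (snd z) i) C (fst z) (fst v)) (at y) w)"

lemma form_e: "t \<in> I \<Longrightarrow> form_on P 1 (e t i)" and form_a: "t \<in> I \<Longrightarrow> form_on P 1 (a t i)"
  using smooth_e smooth_a unfolding smooth_form_family_def by blast+

lemma invariant_e: "t \<in> I \<Longrightarrow> invariant_form P act (e t i)"
  using solder unfolding solder_form_def by blast

lemma invariant_a: "t \<in> I \<Longrightarrow> invariant_form P act (a t i)"
  using connection unfolding connection_form_def by blast

definition lift :: "real \<Rightarrow> ('p, real^6) chart \<Rightarrow> 'p \<Rightarrow> 3 \<Rightarrow> real^6" where
  "lift t C p = coframe.lift (ev t C (snd C p)) (av t C (snd C p))"

text \<open>
  The matrices in the differentials of the coframe: \<open>Tm\<close> and \<open>Om\<close> hold the coefficients of \<open>de\<^sup>i\<close> and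
  \<open>da\<^sup>i\<close> with respect to \<open>^e\<^sup>j\<close>, and \<open>Pm\<close> and \<open>Qm\<close> those of \<open>\<partial>e\<^sup>i/\<partial>t\<close> and \<open>\<partial>a\<^sup>i/\<partial>t\<close> with respect to
  \<open>e\<^sup>k\<close>.  That these forms are horizontal is proved below.
\<close>

definition Tm :: "real \<Rightarrow> ('p, real^6) chart \<Rightarrow> 'p \<Rightarrow> real^3^3" where
  "Tm t C p = (\<chi> i. coframe.dual2 (ev t C (snd C p)) (av t C (snd C p)) (d1 (onef (e t i) C) (snd C p)))"

definition Om :: "real \<Rightarrow> ('p, real^6) chart \<Rightarrow> 'p \<Rightarrow> real^3^3" where
  "Om t C p = (\<chi> i. coframe.dual2 (ev t C (snd C p)) (av t C (snd C p)) (d1 (onef (a t i) C) (snd C p)))"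

definition Pm :: "real \<Rightarrow> ('p, real^6) chart \<Rightarrow> 'p \<Rightarrow> real^3^3" where
  "Pm t C p = (\<chi> i k. onef (form_dt (\<lambda>s. e s i) t) C (snd C p) (lift t C p k))"

definition Qm :: "real \<Rightarrow> ('p, real^6) chart \<Rightarrow> 'p \<Rightarrow> real^3^3" where
  "Qm t C p = (\<chi> i k. onef (form_dt (\<lambda>s. a s i) t) C (snd C p) (lift t C p k))"

text \<open>
  The frame derivatives \<open>S\<^sub>,\<^sub>k\<close>, and below the time derivative of \<open>S\<close>.
\<close>

definition Sk :: "real \<Rightarrow> ('p, real^6) chart \<Rightarrow> 'p \<Rightarrow> 3 \<Rightarrow> real^3^3" where
  "Sk t C p k = frechet_derivative (\<lambda>x. S t (chart_inv C x)) (at (snd C p)) (lift t C p k)"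

definition S0 :: "real \<Rightarrow> 'p \<Rightarrow> real^3^3" where
  "S0 t p = vector_derivative (\<lambda>s. S s p) (at t)"

context
  fixes D c assumes C: "(D, c) \<in> atlas P"
begin

lemmas chart_P = chart_facts[OF smooth_P C]

lemma open_Y: "open ((c ` D) \<times> I)" by (intro open_Times chart_P open_I)

lemma smooth_family_onef:
  assumes "smooth_form_family P I 1 F"
  shows "smooth_on ((c ` D) \<times> I) (\<lambda>z. onef (F (snd z)) (D, c) (fst z) v)"
proof -
  have "\<forall>C\<in>atlas P. \<forall>v. smooth_on ((snd C ` fst C) \<times> I) (\<lambda>(x, t). F t C x v)"
    using assms unfolding smooth_form_family_def by blast
  from this[rule_format, OF C, of "\<lambda>_. v"] show ?thesis by (simp add: case_prod_beta')
qed

lemma smooth_S_chart: "smooth_on ((c ` D) \<times> I) (S_chart (D, c))"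
proof -
  have "\<forall>C\<in>atlas P. smooth_on ((snd C ` fst C) \<times> I) (\<lambda>(x, t). S t (chart_inv C x))"
    using smooth_S unfolding smooth_fun_family_def by blast
  from this[rule_format, OF C] show ?thesis by (simp add: case_prod_beta' S_chart_def[abs_def])
qed

context
  fixes p t assumes p: "p \<in> D" and t: "t \<in> I"
begin

abbreviation "vert \<equiv> (\<lambda>\<xi>. fundamental_vector act \<xi> (D, c) p)"

lemma y_in: "(c p, t) \<in> (c ` D) \<times> I" and x_in: "c p \<in> c ` D"
  using p t by auto

lemma e_vert: "onef (e t i) (D, c) (c p) (vert \<xi>) = 0"
proof -
  have "vanishes_on_fibres P M pr 1 (e t i)"
    using solder[OF t] unfolding solder_form_def horizontal_1form_def by blast
  then have "\<forall>C\<in>atlas P. \<forall>p\<in>fst C. \<forall>v. (\<forall>i<1. vertical M pr C p (v i)) \<longrightarrow> e t i C (snd C p) v = 0"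
    unfolding vanishes_on_fibres_def .
  from this[rule_format, OF C, of p "\<lambda>_. vert \<xi>"] show ?thesis
    using p fundamental_vector_vertical[OF C p] by simp
qed

lemma a_vert: "av t (D, c) (c p) (vert \<xi>) = acoef \<xi>"
proof -
  have "\<forall>C\<in>atlas P. \<forall>p\<in>fst C. \<forall>\<xi>. (\<Sum>k\<in>UNIV. onef (a t k) C (snd C p) (fundamental_vector act \<xi> C p) *\<^sub>R X k) = \<xi>"
    using connection[OF t] unfolding connection_form_def by blast
  from this[rule_format, OF C, of p \<xi>] p
  have "(\<Sum>k\<in>UNIV. onef (a t k) (D, c) (c p) (vert \<xi>) *\<^sub>R X k) = \<xi>" by simp
  then show ?thesis by (intro acoef_eq[symmetric]) (simp add: av_def)
qed

lemma linear_ev: "linear (ev t (D, c) (c p))" and linear_av: "linear (av t (D, c) (c p))"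
proof -
  note l = onef_facts(2)[OF form_e[OF t] C x_in] onef_facts(2)[OF form_a[OF t] C x_in]
  show "linear (ev t (D, c) (c p))" "linear (av t (D, c) (c p))"
    by (rule linearI; simp add: ev_def av_def vec_eq_iff linear_add[OF l(1)] linear_scale[OF l(1)]
      linear_add[OF l(2)] linear_scale[OF l(2)])+
qed

lemma coframe: "coframe (ev t (D, c) (c p)) (av t (D, c) (c p)) vert"
  unfolding coframe_def
proof (intro conjI allI)
  show "linear (ev t (D, c) (c p))" by (rule linear_ev)
  show "linear (av t (D, c) (c p))" by (rule linear_av)
  show "ev t (D, c) (c p) (vert \<xi>) = 0" for \<xi> by (simp add: ev_def e_vert vec_eq_iff)
  show "\<exists>\<xi>. av t (D, c) (c p) (vert \<xi>) = y" for y
    using a_vert[of "\<Sum>k\<in>UNIV. y $ k *\<^sub>R X k"] acoef_eq[OF refl, of y] by metis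
  show "\<exists>v. ev t (D, c) (c p) v = y" for y
  proof -
    let ?E = "ev t (D, c) (c p)"
    have "\<forall>C\<in>atlas P. \<forall>p\<in>fst C. \<exists>v. wedge_list [e t 1 C (snd C p), e t 2 C (snd C p), e t 3 C (snd C p)] v \<noteq> 0"
      using solder[OF t] unfolding solder_form_def by blast
    from this[rule_format, OF C, of p] p obtain v where
      v: "wedge_list [e t 1 (D, c) (c p), e t 2 (D, c) (c p), e t 3 (D, c) (c p)] v \<noteq> 0" by auto
    have "wedge_list [e t 1 (D, c) (c p), e t 2 (D, c) (c p), e t 3 (D, c) (c p)] v
       = ?E (v 0) \<bullet> cross3 (?E (v 1)) (?E (v 2))"
    proof -
      note one = onef_facts(1)[OF form_e[OF t] C x_in]
      show ?thesis
        unfolding wedge_list_3[where \<alpha> = "e t 1 (D, c) (c p)" and \<beta> = "e t 2 (D, c) (c p)"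
            and \<gamma> = "e t 3 (D, c) (c p)" and A = "onef (e t 1) (D, c) (c p)" and B = "onef (e t 2) (D, c) (c p)"
            and C = "onef (e t 3) (D, c) (c p)", OF one one one]
        by (simp add: ev_def inner_vec_def sum_3 cross3_def vector_3 algebra_simps)
    qed
    with v have nz: "?E (v 0) \<bullet> cross3 (?E (v 1)) (?E (v 2)) \<noteq> 0" (is "?d \<noteq> 0") by simp
    let ?u = "(y \<bullet> cross3 (?E (v 1)) (?E (v 2))) *\<^sub>R v 0 + (?E (v 0) \<bullet> cross3 y (?E (v 2))) *\<^sub>R v 1
       + (?E (v 0) \<bullet> cross3 (?E (v 1)) y) *\<^sub>R v 2"
    have "?E ?u = ?d *\<^sub>R y"
      unfolding linear_add[OF linear_ev] linear_scale[OF linear_ev] by (rule cramer_3[symmetric])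
    then have "?E ((1 / ?d) *\<^sub>R ?u) = y" using nz by (simp add: linear_scale[OF linear_ev])
    then show ?thesis by blast
  qed
qed

interpretation F: coframe "ev t (D, c) (c p)" "av t (D, c) (c p)" vert by (rule coframe)

lemma lift_eq: "lift t (D, c) p = F.lift" by (simp add: lift_def)

lemma ev_lift: "ev t (D, c) (c p) (lift t (D, c) p k) = axis k 1"
  by (simp add: lift_eq F.e_lift)

lemma theta_bij: "linear (theta (D, c) (c p, t))" "bij (theta (D, c) (c p, t))"
proof -
  show lin: "linear (theta (D, c) (c p, t))"
    by (rule linearI) (simp_all add: theta_def linear_add[OF linear_ev] linear_scale[OF linear_ev]
      linear_add[OF linear_av] linear_scale[OF linear_av])
  have "surj (theta (D, c) (c p, t))"
    unfolding surj_def
  proof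
    fix u :: r7
    obtain v where "F.K v = snd u" using F.surj_K by (metis surjD)
    then have "u = theta (D, c) (c p, t) (v, fst u)" by (simp add: theta_def F.K_def prod_eq_iff)
    then show "\<exists>v. u = theta (D, c) (c p, t) v" by blast
  qed
  moreover have "inj (theta (D, c) (c p, t))"
  proof (rule injI)
    fix v w assume "theta (D, c) (c p, t) v = theta (D, c) (c p, t) w"
    then have "snd v = snd w" "F.K (fst v) = F.K (fst w)" by (auto simp: theta_def F.K_def)
    then show "v = w" using injD[OF F.inj_K, of "fst v" "fst w"] by (intro prod_eqI)
  qed
  ultimately show "bij (theta (D, c) (c p, t))" by (simp add: bij_def)
qed

lemma d1_e: "d1 (onef (e t i) (D, c)) (c p) v w = Tm t (D, c) p $ i \<bullet> cross3 (ev t (D, c) (c p) v) (ev t (D, c) (c p) w)"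
proof -
  note b = d1_bilinear[OF chart_P(3) x_in onef_facts(2)[OF form_e[OF t] C] onef_facts(3)[OF form_e[OF t] C x_in]]
  have "onef (e t i) (D, c) (c q) (fundamental_vector act \<xi> (D, c) q) = 0" if "q \<in> D" for q \<xi>
  proof -
    have "vanishes_on_fibres P M pr 1 (e t i)"
      using solder[OF t] unfolding solder_form_def horizontal_1form_def by blast
    then have "\<forall>C\<in>atlas P. \<forall>p\<in>fst C. \<forall>v. (\<forall>i<1. vertical M pr C p (v i)) \<longrightarrow> e t i C (snd C p) v = 0"
      unfolding vanishes_on_fibres_def .
    from this[rule_format, OF C, of q "\<lambda>_. fundamental_vector act \<xi> (D, c) q"] show ?thesis
      using that fundamental_vector_vertical[OF C that] by simp
  qed
  from F.horizontal_2form_expand[OF b d1_fundamental[OF C form_e[OF t] invariant_e[OF t] this p]]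
  show ?thesis unfolding Tm_def snd_conv vec_lambda_beta .
qed

end

lemma av_fundamental: "q \<in> D \<Longrightarrow> s \<in> I \<Longrightarrow> onef (a s i) (D, c) (c q) (fundamental_vector act \<xi> (D, c) q) = acoef \<xi> $ i"
  using a_vert[of q s \<xi>] by (simp add: av_def vec_eq_iff)

context
  fixes p t assumes p: "p \<in> D" and t: "t \<in> I"
begin

interpretation F: coframe "ev t (D, c) (c p)" "av t (D, c) (c p)" "\<lambda>\<xi>. fundamental_vector act \<xi> (D, c) p"
  by (rule coframe[OF p t])

lemma d1_a: "d1 (onef (a t i) (D, c)) (c p) v w = Om t (D, c) p $ i \<bullet> cross3 (ev t (D, c) (c p) v) (ev t (D, c) (c p) w)"
proof -
  note b = d1_bilinear[OF chart_P(3) x_in[OF p t] onef_facts(2)[OF form_a[OF t] C] onef_facts(3)[OF form_a[OF t] C x_in[OF p t]]]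
  from F.horizontal_2form_expand[OF b d1_fundamental[OF C form_a[OF t] invariant_a[OF t] av_fundamental[OF _ t] p]]
  show ?thesis unfolding Om_def snd_conv vec_lambda_beta .
qed

lemma form_dt_linear:
  assumes Fs: "smooth_form_family P I 1 G"
  shows "linear (onef (form_dt G t) (D, c) (c p))"
proof -
  have "onef (form_dt G t) (D, c) (c p) = (\<lambda>v. frechet_derivative (\<lambda>z. onef (G (snd z)) (D, c) (fst z) v) (at (c p, t)) (0, 1))"
  proof
    fix v
    have d: "(\<lambda>z. onef (G (snd z)) (D, c) (fst z) v) differentiable (at (c p, t))"
      by (rule smooth_on_differentiable[OF smooth_family_onef[OF Fs] y_in[OF p t]])
    from frechet_family(2)[OF this] have "linear (frechet_derivative (\<lambda>x. onef (G t) (D, c) x v) (at (c p)))"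
      by (intro linear_frechet_derivative) simp
    then show "onef (form_dt G t) (D, c) (c p) v = frechet_derivative (\<lambda>z. onef (G (snd z)) (D, c) (fst z) v) (at (c p, t)) (0, 1)"
      using frechet_family(1)[OF d, of 0 1] by (simp add: form_dt_def linear_0)
  qed
  moreover have "linear (\<lambda>v. frechet_derivative (\<lambda>z. onef (G (snd z)) (D, c) (fst z) v) (at (c p, t)) (0, 1))"
  proof (rule linear_frechet_param[OF open_Y y_in[OF p t]])
    fix z assume "z \<in> (c ` D) \<times> I"
    then show "linear (\<lambda>v. onef (G (snd z)) (D, c) (fst z) v)"
      using onef_facts(2)[of P "G (snd z)" D c "fst z"] Fs C unfolding smooth_form_family_def by auto
  qed (rule smooth_on_differentiable[OF smooth_family_onef[OF Fs] y_in[OF p t]])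
  ultimately show ?thesis by simp
qed

text \<open>
  The value on a fundamental vector is the same at all times, so the time derivatives of \<open>e\<close> and \<open>a\<close>
  are horizontal.
\<close>

lemma form_dt_const:
  assumes "\<And>s. s \<in> I \<Longrightarrow> onef (G s) (D, c) (c p) v = \<kappa>"
  shows "onef (form_dt G t) (D, c) (c p) v = 0"
proof -
  have "((\<lambda>s. onef (G s) (D, c) (c p) v) has_vector_derivative 0) (at t)"
    by (rule has_vector_derivative_transform_within_open[OF has_vector_derivative_const[of \<kappa>] open_I t])
      (simp add: assms)
  then show ?thesis unfolding form_dt_def by (rule vector_derivative_at)
qed

lemma dt_e: "onef (form_dt (\<lambda>s. e s i) t) (D, c) (c p) v = (\<Sum>k\<in>UNIV. Pm t (D, c) p $ i $ k * ev t (D, c) (c p) v $ k)"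
proof -
  have "onef (form_dt (\<lambda>s. e s i) t) (D, c) (c p) (fundamental_vector act \<xi> (D, c) p) = 0" for \<xi>
    by (rule form_dt_const) (rule e_vert[OF p])
  from F.horizontal_expand[OF form_dt_linear[OF smooth_e] this, of v]
  show ?thesis by (simp add: Pm_def lift_eq[OF p t] mult.commute)
qed

lemma dt_a: "onef (form_dt (\<lambda>s. a s i) t) (D, c) (c p) v = (\<Sum>k\<in>UNIV. Qm t (D, c) p $ i $ k * ev t (D, c) (c p) v $ k)"
proof -
  have "onef (form_dt (\<lambda>s. a s i) t) (D, c) (c p) (fundamental_vector act \<xi> (D, c) p) = 0" for \<xi>
    by (rule form_dt_const) (rule av_fundamental[OF p])
  from F.horizontal_expand[OF form_dt_linear[OF smooth_a] this, of v]
  show ?thesis by (simp add: Qm_def lift_eq[OF p t] mult.commute)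
qed

lemma Sf_deriv: "(S_chart (D, c) has_derivative frechet_derivative (S_chart (D, c)) (at (c p, t))) (at (c p, t))"
  by (rule smooth_on_has_derivative[OF smooth_S_chart y_in[OF p t]])

lemma Sf_component_differentiable: "((\<lambda>q. S t q $ i $ j) \<circ> chart_inv (D, c)) differentiable (at (c p))"
  "(\<lambda>x. S t (chart_inv (D, c) x)) differentiable (at (c p))"
  "frechet_derivative ((\<lambda>q. S t q $ i $ j) \<circ> chart_inv (D, c)) (at (c p)) v
     = frechet_derivative (\<lambda>x. S t (chart_inv (D, c) x)) (at (c p)) v $ i $ j"
proof -
  show d: "(\<lambda>x. S t (chart_inv (D, c) x)) differentiable (at (c p))"
    using frechet_family(2)[OF smooth_on_differentiable[OF smooth_S_chart y_in[OF p t]]] by (simp add: S_chart_def)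
  have h: "(((\<lambda>q. S t q $ i $ j) \<circ> chart_inv (D, c)) has_derivative
     (\<lambda>v. frechet_derivative (\<lambda>x. S t (chart_inv (D, c) x)) (at (c p)) v $ i $ j)) (at (c p))"
    unfolding o_def
    by (intro bounded_linear.has_derivative[OF bounded_linear_vec_nth] frechet_derivative_has d)
  show "((\<lambda>q. S t q $ i $ j) \<circ> chart_inv (D, c)) differentiable (at (c p))"
    using h unfolding differentiable_def by blast
  show "frechet_derivative ((\<lambda>q. S t q $ i $ j) \<circ> chart_inv (D, c)) (at (c p)) v
     = frechet_derivative (\<lambda>x. S t (chart_inv (D, c) x)) (at (c p)) v $ i $ j"
    unfolding frechet_derivative_at[OF h, symmetric] ..
qed

lemma d_S: "frechet_derivative (\<lambda>x. S t (chart_inv (D, c) x)) (at (c p)) v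
   = (\<Sum>k\<in>UNIV. ev t (D, c) (c p) v $ k *\<^sub>R Sk t (D, c) p k)"
proof -
  have "frechet_derivative (\<lambda>x. S t (chart_inv (D, c) x)) (at (c p)) (fundamental_vector act \<xi> (D, c) p) $ i $ j = 0" for \<xi> i j
    unfolding Sf_component_differentiable(3)[symmetric]
    by (rule invariant_fun_fundamental[OF C _ p Sf_component_differentiable(1)])
      (use S_invariant[OF t] in \<open>simp add: invariant_fun_def\<close>)
  then have "frechet_derivative (\<lambda>x. S t (chart_inv (D, c) x)) (at (c p)) (fundamental_vector act \<xi> (D, c) p) = 0" for \<xi>
    by (simp add: vec_eq_iff)
  from F.horizontal_expand[OF linear_frechet_derivative[OF Sf_component_differentiable(2)] this]
  show ?thesis unfolding Sk_def snd_conv lift_eq[OF p t] .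
qed

lemma Sf_deriv_eq: "frechet_derivative (S_chart (D, c)) (at (c p, t)) v
   = d_coeff (S0 t p) (Sk t (D, c) p) (theta (D, c) (c p, t) v)"
proof -
  have "frechet_derivative (S_chart (D, c)) (at (c p, t)) (fst v, snd v)
    = frechet_derivative (\<lambda>x. S t (chart_inv (D, c) x)) (at (c p)) (fst v)
      + snd v *\<^sub>R vector_derivative (\<lambda>s. S s p) (at t)"
    using frechet_family(1)[OF smooth_on_differentiable[OF smooth_S_chart y_in[OF p t]], of "fst v" "snd v"]
      chart_inv_chart[OF chart_P(5) p] by (simp add: S_chart_def)
  then show ?thesis by (simp add: d_coeff_def theta_def d_S S0_def)
qed

lemma symmetric_Sk: "transpose (Sk t (D, c) p k) = Sk t (D, c) p k"
proof -
  have eq: "frechet_derivative ((\<lambda>q. S t q $ i $ j) \<circ> chart_inv (D, c)) (at (c p))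
      = frechet_derivative ((\<lambda>q. S t q $ j $ i) \<circ> chart_inv (D, c)) (at (c p))" for i j
  proof (rule frechet_derivative_transform_within_open[OF Sf_component_differentiable(1) chart_P(3) x_in[OF p t]])
    fix x assume "x \<in> c ` D"
    then have "chart_inv (D, c) x \<in> points P" using chart_inv_in[of x c D] chart_P(2) by blast
    from S_posdef[OF t this] have "transpose (S t (chart_inv (D, c) x)) = S t (chart_inv (D, c) x)"
      unfolding posdef_symmetric_def by simp
    then have "transpose (S t (chart_inv (D, c) x)) $ j $ i = S t (chart_inv (D, c) x) $ j $ i" by simp
    then show "((\<lambda>q. S t q $ i $ j) \<circ> chart_inv (D, c)) x = ((\<lambda>q. S t q $ j $ i) \<circ> chart_inv (D, c)) x"
      by (simp add: transpose_def)
  qed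
  have "Sk t (D, c) p k $ i $ j = Sk t (D, c) p k $ j $ i" for i j
    unfolding Sk_def snd_conv Sf_component_differentiable(3)[symmetric] by (rule fun_cong[OF eq])
  then show ?thesis unfolding transpose_def vec_eq_iff vec_lambda_beta by blast
qed

lemma theta_deriv: "((\<lambda>z. theta (D, c) z v) has_derivative (\<lambda>w. dtheta (D, c) (c p, t) w v)) (at (c p, t))"
  unfolding theta_def dtheta_def ev_def av_def
  by (intro has_derivative_Pair has_derivative_const has_derivative_vec
     smooth_on_has_derivative[OF smooth_family_onef[OF smooth_e] y_in[OF p t]]
     smooth_on_has_derivative[OF smooth_family_onef[OF smooth_a] y_in[OF p t]])

lemma dtheta_skew: "dtheta (D, c) (c p, t) v w - dtheta (D, c) (c p, t) w v
   = d_coframe (Tm t (D, c) p) (Pm t (D, c) p) (Om t (D, c) p) (Qm t (D, c) p) (theta (D, c) (c p, t) v) (theta (D, c) (c p, t) w)"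
proof -
  have fam: "frechet_derivative (\<lambda>z. onef (G (snd z)) (D, c) (fst z) u) (at (c p, t)) (w, s)
     = frechet_derivative (\<lambda>x. onef (G t) (D, c) x u) (at (c p)) w + s * onef (form_dt G t) (D, c) (c p) u"
    if "smooth_form_family P I 1 G" for G u w s
    using frechet_family(1)[OF smooth_on_differentiable[OF smooth_family_onef[OF that] y_in[OF p t]]]
    by (simp add: form_dt_def)
  have comp: "frechet_derivative (\<lambda>z. onef (G (snd z)) (D, c) (fst z) (fst w)) (at (c p, t)) v
     - frechet_derivative (\<lambda>z. onef (G (snd z)) (D, c) (fst z) (fst v)) (at (c p, t)) w
     = d1 (onef (G t) (D, c)) (c p) (fst v) (fst w) + snd v * onef (form_dt G t) (D, c) (c p) (fst w)
        - snd w * onef (form_dt G t) (D, c) (c p) (fst v)"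
    if "smooth_form_family P I 1 G" for G
    using fam[OF that, of "fst w" "fst v" "snd v"] fam[OF that, of "fst v" "fst w" "snd w"]
    by (simp add: d1_def)
  show ?thesis
    by (simp add: dtheta_def d_coframe_def theta_def vec_eq_iff comp[OF smooth_e] comp[OF smooth_a]
      d1_e[OF p t] d1_a dt_e dt_a matrix_vector_mult_def inner_vec_def sum_distrib_left sum_subtractf algebra_simps)
qed

text \<open>
  Since \<open>theta\<close> is onto at the point, vanishing of the exterior derivatives on all tangent vectors is
  vanishing of \<open>ext4\<close> and \<open>ext5\<close> on all arguments.
\<close>

theorem torsion_free_at_point:
  assumes F3: "\<And>z v. z \<in> (c ` D) \<times> I \<Longrightarrow> F3 Ch z v =
      Phi3 (det (S_chart (D, c) z)) (tilde (S_chart (D, c) z)) (theta (D, c) z (v 0)) (theta (D, c) z (v 1)) (theta (D, c) z (v 2))"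
    and F4: "\<And>z v. z \<in> (c ` D) \<times> I \<Longrightarrow> F4 Ch z v =
      Psi4 (det (S_chart (D, c) z)) (S_chart (D, c) z) (theta (D, c) z (v 0)) (theta (D, c) z (v 1)) (theta (D, c) z (v 2)) (theta (D, c) z (v 3))"
  shows "(\<forall>v. ext_deriv 3 F3 Ch (c p, t) v = 0) \<and> (\<forall>v. ext_deriv 4 F4 Ch (c p, t) v = 0) \<longleftrightarrow>
    Tm t (D, c) p = 0 \<and> (\<forall>i j. Om t (D, c) p $ i $ j = Om t (D, c) p $ j $ i)
    \<and> (\<forall>i. (\<Sum>\<alpha>\<in>UNIV. Sk t (D, c) p \<alpha> $ i $ \<alpha>) = 0) \<and> Pm t (D, c) p = 0
    \<and> (\<forall>i k. Qm t (D, c) p $ i $ k = - (\<Sum>\<alpha>\<in>UNIV. \<Sum>\<beta>\<in>UNIV. levi_civita i \<alpha> \<beta> * dadj (S t p) (Sk t (D, c) p \<beta>) $ k $ \<alpha>))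
    \<and> (\<forall>i j. S0 t p $ i $ j = - Om t (D, c) p $ i $ j)"
proof -
  let ?y = "(c p, t)" and ?\<theta> = "theta (D, c)" and ?S = "S_chart (D, c)"
  let ?T = "Tm t (D, c) p" and ?P = "Pm t (D, c) p" and ?O = "Om t (D, c) p" and ?Q = "Qm t (D, c) p"
  let ?Sk = "Sk t (D, c) p" and ?dS = "S0 t p"
  have Sy: "?S ?y = S t p" using chart_inv_chart[OF chart_P(5) p] by (simp add: S_chart_def)
  have F3': "F3 Ch z v = Phi3 (det (?S z)) (adj3 (?S z)) (?\<theta> z (v 0)) (?\<theta> z (v 1)) (?\<theta> z (v 2))"
    if "z \<in> (c ` D) \<times> I" for z v
  proof -
    have "posdef_symmetric (?S z)"
      using that S_posdef chart_inv_in[of "fst z" c D] chart_P(2) by (auto simp: S_chart_def)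
    then have "det (?S z) \<noteq> 0" using posdef_det_pos by fastforce
    then show ?thesis using F3[OF that] tilde_adj3 by simp
  qed
  have e3: "ext_deriv 3 F3 Ch ?y v = ext4 (coeff3 (S t p) ?dS ?Sk) (frame3 (S t p) ?T ?P ?O ?Q)
      (?\<theta> ?y (v 0)) (?\<theta> ?y (v 1)) (?\<theta> ?y (v 2)) (?\<theta> ?y (v 3))" for v
  proof -
    have "ext_deriv 3 F3 Ch ?y v = ext4 (\<lambda>x p q r. Phi3_lin (ddet (?S ?y) (frechet_derivative ?S (at ?y) x)) (dadj (?S ?y) (frechet_derivative ?S (at ?y) x)) (?\<theta> ?y p) (?\<theta> ?y q) (?\<theta> ?y r))
       (\<lambda>x q r s. Phi3 (det (?S ?y)) (adj3 (?S ?y)) (dtheta (D, c) ?y x q - dtheta (D, c) ?y q x) (?\<theta> ?y r) (?\<theta> ?y s)) (v 0) (v 1) (v 2) (v 3)"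
      by (rule ext_deriv_Phi3[where \<theta>' = "dtheta (D, c) ?y", OF open_Y y_in[OF p t]])
        (rule F3' has_derivative_det3[OF Sf_deriv] has_derivative_adj3[OF Sf_deriv] theta_deriv, assumption?)+
    then show ?thesis unfolding ext4_def coeff3_def frame3_def dtheta_skew Sf_deriv_eq Sy .
  qed
  have e4: "ext_deriv 4 F4 Ch ?y v = ext5 (coeff4 (S t p) ?dS ?Sk) (frame4 (S t p) ?T ?P ?O ?Q)
      (?\<theta> ?y (v 0)) (?\<theta> ?y (v 1)) (?\<theta> ?y (v 2)) (?\<theta> ?y (v 3)) (?\<theta> ?y (v 4))" for v
  proof -
    have "ext_deriv 4 F4 Ch ?y v = ext5 (\<lambda>x p q r s. Psi4_lin (ddet (?S ?y) (frechet_derivative ?S (at ?y) x)) (frechet_derivative ?S (at ?y) x) (?\<theta> ?y p) (?\<theta> ?y q) (?\<theta> ?y r) (?\<theta> ?y s))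
       (\<lambda>x q r s u. Psi4 (det (?S ?y)) (?S ?y) (dtheta (D, c) ?y x q - dtheta (D, c) ?y q x) (?\<theta> ?y r) (?\<theta> ?y s) (?\<theta> ?y u)) (v 0) (v 1) (v 2) (v 3) (v 4)"
      by (rule ext_deriv_Psi4[where \<theta>' = "dtheta (D, c) ?y", OF open_Y y_in[OF p t]])
        (rule F4 has_derivative_det3[OF Sf_deriv] Sf_deriv theta_deriv, assumption?)+
    then show ?thesis unfolding ext5_def coeff4_def frame4_def dtheta_skew Sf_deriv_eq Sy .
  qed
  have surj: "?\<theta> ?y (inv (?\<theta> ?y) u) = u" for u
    using theta_bij(2)[OF p t] by (simp add: bij_is_surj surj_f_inv_f)
  have "(\<forall>v. ext_deriv 3 F3 Ch ?y v = 0) \<longleftrightarrow> (\<forall>x y z w. ext4 (coeff3 (S t p) ?dS ?Sk) (frame3 (S t p) ?T ?P ?O ?Q) x y z w = 0)"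
  proof (intro iffI allI)
    fix x y z w assume "\<forall>v. ext_deriv 3 F3 Ch ?y v = 0"
    from this[rule_format, of "\<lambda>i. inv (?\<theta> ?y) ([x, y, z, w] ! i)"]
    show "ext4 (coeff3 (S t p) ?dS ?Sk) (frame3 (S t p) ?T ?P ?O ?Q) x y z w = 0"
      unfolding e3 surj by (simp add: numeral_nat)
  qed (unfold e3, blast)
  moreover have "(\<forall>v. ext_deriv 4 F4 Ch ?y v = 0) \<longleftrightarrow> (\<forall>x y z w s. ext5 (coeff4 (S t p) ?dS ?Sk) (frame4 (S t p) ?T ?P ?O ?Q) x y z w s = 0)"
  proof (intro iffI allI)
    fix x y z w s assume "\<forall>v. ext_deriv 4 F4 Ch ?y v = 0"
    from this[rule_format, of "\<lambda>i. inv (?\<theta> ?y) ([x, y, z, w, s] ! i)"]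
    show "ext5 (coeff4 (S t p) ?dS ?Sk) (frame4 (S t p) ?T ?P ?O ?Q) x y z w s = 0"
      unfolding e4 surj by (simp add: numeral_nat)
  qed (unfold e4, blast)
  moreover have "transpose (S t p) = S t p"
    using S_posdef[OF t] p chart_P(2) unfolding posdef_symmetric_def by blast
  ultimately show ?thesis
    using structure_equations_iff[OF _ symmetric_Sk] by simp
qed

end

end

end

section \<open>Smoothness of the coefficients\<close>

text \<open>
  Polynomial expressions are written as iterated sums, so that smoothness follows from closure under
  sums and products.
\<close>

lemma inner_cross_levi_civita: "x \<bullet> cross3 y z = (\<Sum>i\<in>UNIV. \<Sum>j\<in>UNIV. \<Sum>k\<in>UNIV. levi_civita i j k * (x $ i * (y $ j * z $ k)))"
  by (simp add: inner_vec_def sum_3 cross3_def vector_3 levi_civita_def algebra_simps)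

lemma det_levi_civita: "det A = (\<Sum>i\<in>UNIV. \<Sum>j\<in>UNIV. \<Sum>k\<in>UNIV. levi_civita i j k * (A $ 1 $ i * (A $ 2 $ j * A $ 3 $ k)))"
  for A :: "real^3^3"
  by (simp add: det_3 sum_3 levi_civita_def algebra_simps)

lemma mixed2_sum: "mixed2 A u v = (\<Sum>i\<in>UNIV. \<Sum>j\<in>UNIV. A $ i $ j * (ac u $ i * ec v $ j)) - (\<Sum>i\<in>UNIV. \<Sum>j\<in>UNIV. A $ i $ j * (ac v $ i * ec u $ j))"
  by (simp add: mixed2_def inner_vec_def matrix_vector_mult_def sum_distrib_left algebra_simps)

lemma smooth_on_adj3:
  fixes f :: "'a::real_normed_vector \<Rightarrow> real^3^3"
  assumes "open U" "\<And>i j. smooth_on U (\<lambda>z. f z $ i $ j)"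
  shows "smooth_on U (\<lambda>z. adj3 (f z) $ i $ j)"
proof -
  have "\<forall>i j. smooth_on U (\<lambda>z. adj3 (f z) $ i $ j)"
    unfolding forall_3 adj3_def vector_3
    by (intro conjI smooth_on_diff smooth_on_mult assms)
  then show ?thesis by blast
qed

lemma smooth_on_Phi3:
  fixes p q r :: "'a::real_normed_vector \<Rightarrow> r7"
  assumes U: "open U" and D: "smooth_on U D" and A: "\<And>i j. smooth_on U (\<lambda>z. A z $ i $ j)"
    and p: "smooth_on U (\<lambda>z. tc (p z))" "\<And>i. smooth_on U (\<lambda>z. ec (p z) $ i)" "\<And>i. smooth_on U (\<lambda>z. ac (p z) $ i)"
    and q: "smooth_on U (\<lambda>z. tc (q z))" "\<And>i. smooth_on U (\<lambda>z. ec (q z) $ i)" "\<And>i. smooth_on U (\<lambda>z. ac (q z) $ i)"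
    and r: "smooth_on U (\<lambda>z. tc (r z))" "\<And>i. smooth_on U (\<lambda>z. ec (r z) $ i)" "\<And>i. smooth_on U (\<lambda>z. ac (r z) $ i)"
  shows "smooth_on U (\<lambda>z. Phi3 (D z) (A z) (p z) (q z) (r z))"
  unfolding Phi3_def mixed2_sum inner_cross_levi_civita
  by (intro smooth_on_add[OF U] smooth_on_diff[OF U] smooth_on_mult[OF U] smooth_on_sum[OF U] smooth_on_const assms)

section \<open>Forms on the product with an interval\<close>

lemma hat_eq:
  assumes "\<And>k. alternating 1 (c k)"
  shows "hat c i v = cross3 (\<chi> k. c k (\<lambda>_. v 0)) (\<chi> k. c k (\<lambda>_. v 1)) $ i"
proof -
  have w: "wedge 1 1 (c j) (c k) v = c j (\<lambda>_. v 0) * c k (\<lambda>_. v 1) - c j (\<lambda>_. v 1) * c k (\<lambda>_. v 0)" for j k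
    by (rule wedge_1_1) (rule alternating_1_eq[OF assms])+
  have "\<forall>i. hat c i v = cross3 (\<chi> k. c k (\<lambda>_. v 0)) (\<chi> k. c k (\<lambda>_. v 1)) $ i"
    unfolding forall_3 hat_def w
    by (simp add: sum_3 levi_civita_def cross3_def vector_3)
  then show ?thesis by blast
qed

lemma prod_atlas: "atlas (prod_mfd P (euclidean_open_mfd I)) = {(D \<times> I, map_prod c id) | D c. (D, c) \<in> atlas P}"
  unfolding prod_mfd_def euclidean_open_mfd_def by auto

context
  fixes P :: "('p, real^6) mfd" and D c and I :: "real set"
  assumes P: "smooth_manifold P" and C: "(D, c) \<in> atlas P" and I: "open I"
begin

abbreviation "Ch \<equiv> (D \<times> I, map_prod c id)"

lemma prod_chart_inv:
  assumes "z \<in> (c ` D) \<times> I" shows "chart_inv Ch z = (chart_inv (D, c) (fst z), snd z)"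
proof (rule chart_inv_eq)
  show "inj_on (map_prod c id) (D \<times> I)"
    by (intro map_prod_inj_on chart_facts(5)[OF P C]) simp
qed (use assms chart_chart_inv[of "fst z" c D] chart_inv_in[of "fst z" c D] in \<open>auto simp: prod_eq_iff\<close>)

lemma open_prod: "open ((c ` D) \<times> I)" by (intro open_Times chart_facts(3)[OF P C] I)

lemma prod_change:
  assumes C': "(D', c') \<in> atlas P" and p: "p \<in> D" "p \<in> D'" and t: "t \<in> I"
  shows "((\<lambda>y. c' (fst (chart_inv Ch y))) has_derivative
      (\<lambda>v. frechet_derivative (chart_change (D, c) (D', c')) (at (c p)) (fst v))) (at (c p, t))"
proof -
  note ch = chart_change_facts[OF P C C']
  have cp: "c p \<in> c ` (D \<inter> D')" using p by blast
  have "((\<lambda>y. chart_change (D, c) (D', c') (fst y)) has_derivative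
      (\<lambda>v. frechet_derivative (chart_change (D, c) (D', c')) (at (c p)) (fst v))) (at (c p, t))"
  proof -
    have a: "((\<lambda>y. fst y) has_derivative (\<lambda>v. fst v)) (at (c p, t))" by (auto intro!: derivative_eq_intros)
    have b: "(chart_change (D, c) (D', c') has_derivative frechet_derivative (chart_change (D, c) (D', c')) (at (c p)))
       (at (fst (c p, t)))" using smooth_on_has_derivative[OF ch(2) cp] by simp
    show ?thesis by (rule has_derivative_compose[OF a b])
  qed
  then show ?thesis
  proof (rule has_derivative_transform_within_open[OF _ open_Times[OF ch(1) I]])
    show "(c p, t) \<in> (c ` (D \<inter> D')) \<times> I" using cp t by simp
    fix y assume "y \<in> (c ` (D \<inter> D')) \<times> I"
    then have "y \<in> (c ` D) \<times> I" by auto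
    then show "chart_change (D, c) (D', c') (fst y) = c' (fst (chart_inv Ch y))"
      by (simp add: prod_chart_inv chart_change_def)
  qed
qed

text \<open>
  The pullback along the projection uses an arbitrary chart of \<open>P\<close>; the transformation law of forms
  returns to the chart \<open>c\<close>.
\<close>

lemma family_form_eq:
  assumes F: "\<And>t. t \<in> I \<Longrightarrow> form_on P k (F t)" and z: "z \<in> (c ` D) \<times> I"
  shows "family_form P F Ch z v = F (snd z) (D, c) (fst z) (\<lambda>i. fst (v i))"
proof -
  obtain p t where p: "p \<in> D" "fst z = c p" and t: "t \<in> I" "snd z = t" using z by auto
  have zeq: "z = (c p, t)" using p t by (simp add: prod_eq_iff)
  have inv: "chart_inv Ch z = (p, t)"
    using prod_chart_inv[OF z] p t chart_inv_chart[OF chart_facts(5)[OF P C] p(1)] by simp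
  define C' where "C' = (SOME C'. C' \<in> atlas P \<and> p \<in> fst C')"
  have "\<exists>C'. C' \<in> atlas P \<and> p \<in> fst C'" using C p by force
  then have "C' \<in> atlas P \<and> p \<in> fst C'" unfolding C'_def by (rule someI_ex)
  moreover obtain D' c' where C'eq: "C' = (D', c')" by (cases C')
  ultimately have C': "(D', c') \<in> atlas P" "p \<in> D'" by auto
  have tm: "tangent_map fst Ch (D', c') (p, t) w = frechet_derivative (chart_change (D, c) (D', c')) (at (c p)) (fst w)" for w
    using frechet_derivative_at[OF prod_change[OF C'(1) p(1) C'(2) t(1)], symmetric]
    by (simp add: tangent_map_def o_def)
  have "family_form P F Ch z v = F t (D', c') (c' p) (\<lambda>i. tangent_map fst Ch (D', c') (p, t) (v i))"
    unfolding family_form_def pullback_def Let_def inv fst_conv snd_conv C'_def[symmetric] C'eq ..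
  also have "\<dots> = F t (D, c) (c p) (\<lambda>i. fst (v i))"
    unfolding tm by (rule form_on_trans[OF F[OF t(1)] C C'(1) p(1) C'(2), symmetric])
  finally show ?thesis by (simp add: p t)
qed

lemma dt_form_eq: assumes z: "z \<in> (c ` D) \<times> I" shows "dt_form Ch z u = snd (u 0)"
proof -
  have "frechet_derivative (\<lambda>y. snd (chart_inv Ch y)) (at z) = (\<lambda>v. snd v)"
  proof (rule frechet_derivative_eq_on(1)[OF open_prod z])
    show "((\<lambda>y. snd y) has_derivative (\<lambda>v. snd v)) (at z)" by (auto intro!: derivative_eq_intros)
  qed (simp add: prod_chart_inv)
  then show ?thesis by (simp add: dt_form_def ext_deriv_def fun_form_def)
qed

end

context T3_triples
begin

context
  fixes D c \<omega> \<psi> assumes C: "(D, c) \<in> atlas P"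
    and \<omega>: "\<And>t. t \<in> I \<Longrightarrow> form_on P 2 (\<omega> t)" and \<psi>: "\<And>t. t \<in> I \<Longrightarrow> form_on P 3 (\<psi> t)"
    and corr: "\<And>t. t \<in> I \<Longrightarrow> triple_corresponds P (e t) (a t) (S t) (\<omega> t) (\<psi> t)"
begin

lemma Sf_posdef: "z \<in> (c ` D) \<times> I \<Longrightarrow> posdef_symmetric (S_chart (D, c) z)"
  using S_posdef chart_inv_in[of "fst z" c D] chart_facts(2)[OF smooth_P C] by (auto simp: S_chart_def)

lemma omega_eq:
  assumes z: "z \<in> (c ` D) \<times> I"
  shows "\<omega> (snd z) (D, c) (fst z) (\<lambda>i. fst (v i))
    = det (S_chart (D, c) z) powr (- 1 / 2) * mixed2 (tilde (S_chart (D, c) z)) (theta (D, c) z (v 0)) (theta (D, c) z (v 1))"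
proof -
  obtain p where p: "p \<in> D" "fst z = c p" and t: "snd z \<in> I" using z by auto
  then have x: "c p \<in> c ` D" by simp
  let ?t = "snd z"
  have w: "wedge 1 1 (a ?t i (D, c) (c p)) (e ?t j (D, c) (c p)) u
     = onef (a ?t i) (D, c) (c p) (u 0) * onef (e ?t j) (D, c) (c p) (u 1)
       - onef (a ?t i) (D, c) (c p) (u 1) * onef (e ?t j) (D, c) (c p) (u 0)" for i j u
    by (rule wedge_1_1) (rule onef_facts(1)[OF form_a[OF t] C x] onef_facts(1)[OF form_e[OF t] C x])+
  have "\<omega> ?t (D, c) (c p) u = (let A = S ?t (chart_inv (D, c) (c p)) in
       det A powr (- 1 / 2) *
       (\<Sum>i\<in>UNIV. \<Sum>j\<in>UNIV. tilde A $ i $ j * wedge 1 1 (a ?t i (D, c) (c p)) (e ?t j (D, c) (c p)) u))" for u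
    using corr[OF t] C p unfolding triple_corresponds_def form_eq_def by fastforce
  then show ?thesis
    unfolding w
    by (simp add: p(2) S_chart_def Let_def mixed2_sum theta_def ev_def av_def right_diff_distrib sum_subtractf)
qed

lemma psi_eq:
  assumes z: "z \<in> (c ` D) \<times> I"
  shows "\<psi> (snd z) (D, c) (fst z) (\<lambda>i. fst (v i)) =
     - det (S_chart (D, c) z) * (ec (theta (D, c) z (v 0)) \<bullet> cross3 (ec (theta (D, c) z (v 1))) (ec (theta (D, c) z (v 2))))
     + (ec (theta (D, c) z (v 0)) \<bullet> cross3 (ac (theta (D, c) z (v 1))) (ac (theta (D, c) z (v 2)))
      - ec (theta (D, c) z (v 1)) \<bullet> cross3 (ac (theta (D, c) z (v 0))) (ac (theta (D, c) z (v 2)))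
      + ec (theta (D, c) z (v 2)) \<bullet> cross3 (ac (theta (D, c) z (v 0))) (ac (theta (D, c) z (v 1))))"
proof -
  obtain p where p: "p \<in> D" "fst z = c p" and t: "snd z \<in> I" using z by auto
  then have x: "c p \<in> c ` D" by simp
  let ?t = "snd z"
  let ?e = "\<lambda>i. onef (e ?t i) (D, c) (c p)"
  note one_e = onef_facts(1)[OF form_e[OF t] C x]
  let ?u = "\<lambda>i. fst (v i)"
  have hat: "hat (\<lambda>i. a ?t i (D, c) (c p)) k u = cross3 (av ?t (D, c) (c p) (u 0)) (av ?t (D, c) (c p) (u 1)) $ k" for k u
    unfolding av_def by (rule hat_eq) (rule form_on_alternating[OF form_a[OF t] C x])
  have w3: "wedge_list [e ?t 1 (D, c) (c p), e ?t 2 (D, c) (c p), e ?t 3 (D, c) (c p)] ?u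
     = ?e 1 (?u 0) * (?e 2 (?u 1) * ?e 3 (?u 2) - ?e 2 (?u 2) * ?e 3 (?u 1))
    - ?e 1 (?u 1) * (?e 2 (?u 0) * ?e 3 (?u 2) - ?e 2 (?u 2) * ?e 3 (?u 0))
    + ?e 1 (?u 2) * (?e 2 (?u 0) * ?e 3 (?u 1) - ?e 2 (?u 1) * ?e 3 (?u 0))"
    by (rule wedge_list_3) (rule one_e)+
  have w12: "wedge 1 2 (e ?t k (D, c) (c p)) (hat (\<lambda>i. a ?t i (D, c) (c p)) k) ?u
     = ?e k (?u 0) * cross3 (av ?t (D, c) (c p) (?u 1)) (av ?t (D, c) (c p) (?u 2)) $ k
     - ?e k (?u 1) * cross3 (av ?t (D, c) (c p) (?u 0)) (av ?t (D, c) (c p) (?u 2)) $ k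
     + ?e k (?u 2) * cross3 (av ?t (D, c) (c p) (?u 0)) (av ?t (D, c) (c p) (?u 1)) $ k" for k
  proof (rule wedge_1_2[where B = "\<lambda>p' q'. cross3 (av ?t (D, c) (c p) p') (av ?t (D, c) (c p) q') $ k"])
    show "cross3 (av ?t (D, c) (c p) p') (av ?t (D, c) (c p) q') $ k = - cross3 (av ?t (D, c) (c p) q') (av ?t (D, c) (c p) p') $ k" for p' q'
      by (subst cross_skew) simp
  qed (rule one_e hat)+
  have "\<psi> ?t (D, c) (c p) ?u = (let A = S ?t (chart_inv (D, c) (c p)) in
       - det A * wedge_list [e ?t 1 (D, c) (c p), e ?t 2 (D, c) (c p), e ?t 3 (D, c) (c p)] ?u +
       (\<Sum>k\<in>UNIV. wedge 1 2 (e ?t k (D, c) (c p)) (hat (\<lambda>i. a ?t i (D, c) (c p)) k) ?u))"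
    using corr[OF t] C p unfolding triple_corresponds_def form_eq_def by fastforce
  also have "\<dots> = - det (S_chart (D, c) z) * (ev ?t (D, c) (c p) (?u 0) \<bullet> cross3 (ev ?t (D, c) (c p) (?u 1)) (ev ?t (D, c) (c p) (?u 2)))
     + (ev ?t (D, c) (c p) (?u 0) \<bullet> cross3 (av ?t (D, c) (c p) (?u 1)) (av ?t (D, c) (c p) (?u 2))
     - ev ?t (D, c) (c p) (?u 1) \<bullet> cross3 (av ?t (D, c) (c p) (?u 0)) (av ?t (D, c) (c p) (?u 2))
     + ev ?t (D, c) (c p) (?u 2) \<bullet> cross3 (av ?t (D, c) (c p) (?u 0)) (av ?t (D, c) (c p) (?u 1)))"
  proof -
    have 1: "wedge_list [e ?t 1 (D, c) (c p), e ?t 2 (D, c) (c p), e ?t 3 (D, c) (c p)] ?u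
      = ev ?t (D, c) (c p) (?u 0) \<bullet> cross3 (ev ?t (D, c) (c p) (?u 1)) (ev ?t (D, c) (c p) (?u 2))"
      unfolding w3 by (simp add: ev_def inner_vec_def sum_3 cross3_def vector_3 algebra_simps)
    show ?thesis unfolding 1 w12 Let_def S_chart_def p(2)
      by (simp add: inner_vec_def ev_def sum.distrib sum_subtractf)
  qed
  finally show ?thesis by (simp add: theta_def p(2))
qed

text \<open>
  The factors \<open>(det S)\<^sup>-\<^sup>1\<^sup>/\<^sup>2\<close> in \<open>\<omega>\<close> and \<open>(det S)\<^sup>1\<^sup>/\<^sup>2\<close> in front of \<open>dt\<close> cancel.
\<close>

lemma evolution_eq:
  assumes z: "z \<in> (c ` D) \<times> I"
  shows "evolution_3form P S \<omega> \<psi> (D \<times> I, map_prod c id) z v =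
      Phi3 (det (S_chart (D, c) z)) (tilde (S_chart (D, c) z)) (theta (D, c) z (v 0)) (theta (D, c) z (v 1)) (theta (D, c) z (v 2))"
proof -
  let ?Ch = "(D \<times> I, map_prod c id)" and ?d = "det (S_chart (D, c) z)"
  let ?m = "\<lambda>p q. mixed2 (tilde (S_chart (D, c) z)) (theta (D, c) z p) (theta (D, c) z q)"
  have inv: "chart_inv ?Ch z = (chart_inv (D, c) (fst z), snd z)"
    by (rule prod_chart_inv[OF smooth_P C open_I z])
  have d: "?d > 0" using posdef_det_pos[OF Sf_posdef[OF z]] .
  then have dd: "?d powr (- 1 / 2) * ?d powr (1 / 2) = 1"
    by (simp add: powr_add[symmetric])
  have "wedge 2 1 (family_form P \<omega> ?Ch z) (\<lambda>u. ?d powr (1 / 2) * dt_form ?Ch z u) v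
    = ?d powr (- 1 / 2) * ?m (v 0) (v 1) * (?d powr (1 / 2) * snd (v 2))
     - ?d powr (- 1 / 2) * ?m (v 0) (v 2) * (?d powr (1 / 2) * snd (v 1))
     + ?d powr (- 1 / 2) * ?m (v 1) (v 2) * (?d powr (1 / 2) * snd (v 0))"
  proof (rule wedge_2_1[where A = "\<lambda>p q. ?d powr (- 1 / 2) * ?m p q" and B = "\<lambda>p. ?d powr (1 / 2) * snd p"])
    show "?d powr (1 / 2) * dt_form ?Ch z u = ?d powr (1 / 2) * snd (u 0)" for u
      by (simp add: dt_form_eq[OF smooth_P C open_I z])
    show "family_form P \<omega> ?Ch z u = ?d powr (- 1 / 2) * ?m (u 0) (u 1)" for u
      by (rule trans[OF family_form_eq[where F = \<omega>, OF smooth_P C open_I \<omega> z] omega_eq[OF z]])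
    show "?d powr (- 1 / 2) * ?m p q = - (?d powr (- 1 / 2) * ?m q p)" for p q
      using mixed2_skew[of "tilde (S_chart (D, c) z)" "theta (D, c) z p" "theta (D, c) z q"] by simp
  qed
  also have "\<dots> = (?d powr (- 1 / 2) * ?d powr (1 / 2)) * (?m (v 0) (v 1) * snd (v 2) - ?m (v 0) (v 2) * snd (v 1) + ?m (v 1) (v 2) * snd (v 0))"
    by (simp add: algebra_simps)
  finally have w: "wedge 2 1 (family_form P \<omega> ?Ch z) (\<lambda>u. ?d powr (1 / 2) * dt_form ?Ch z u) v
     = ?m (v 0) (v 1) * snd (v 2) - ?m (v 0) (v 2) * snd (v 1) + ?m (v 1) (v 2) * snd (v 0)"
    unfolding dd by simp
  have "evolution_3form P S \<omega> \<psi> ?Ch z v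
    = wedge 2 1 (family_form P \<omega> ?Ch z) (\<lambda>u. ?d powr (1 / 2) * dt_form ?Ch z u) v + family_form P \<psi> ?Ch z v"
    unfolding evolution_3form_def inv Let_def prod.case S_chart_def ..
  with w trans[OF family_form_eq[where F = \<psi>, OF smooth_P C open_I \<psi> z] psi_eq[OF z], of v]
  show ?thesis by (simp add: Phi3_def theta_def)
qed

lemma star_evolution_eq:
  assumes z: "z \<in> (c ` D) \<times> I"
  obtains L where "g2_frame (evolution_3form P S \<omega> \<psi> (D \<times> I, map_prod c id) z) L"
    and "\<And>v. star_phi (evolution_3form P S \<omega> \<psi>) (D \<times> I, map_prod c id) z v =
      Psi4 (det (S_chart (D, c) z)) (S_chart (D, c) z) (theta (D, c) z (v 0)) (theta (D, c) z (v 1)) (theta (D, c) z (v 2)) (theta (D, c) z (v 3))"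
proof -
  obtain p where p: "p \<in> D" "fst z = c p" and t: "snd z \<in> I" using z by auto
  have zeq: "z = (c p, snd z)" using p by (simp add: prod_eq_iff)
  have b: "linear (theta (D, c) z)" "bij (theta (D, c) z)"
    using theta_bij[OF C p(1) t] zeq by simp_all
  obtain L where L: "g2_frame (evolution_3form P S \<omega> \<psi> (D \<times> I, map_prod c id) z) L"
    "\<And>v. star0 (L \<circ> v) = Psi4 (det (S_chart (D, c) z)) (S_chart (D, c) z) (theta (D, c) z (v 0)) (theta (D, c) z (v 1)) (theta (D, c) z (v 2)) (theta (D, c) z (v 3))"
    by (rule g2_frame_Phi3[OF Sf_posdef[OF z] b evolution_eq[OF z]]) blast
  show thesis
  proof (rule that[OF L(1)])
    fix v
    have "DIM((real^6) \<times> real) = 7" by simp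
    from hodge_star_frame[OF this L(1), of v]
    show "star_phi (evolution_3form P S \<omega> \<psi>) (D \<times> I, map_prod c id) z v =
      Psi4 (det (S_chart (D, c) z)) (S_chart (D, c) z) (theta (D, c) z (v 0)) (theta (D, c) z (v 1)) (theta (D, c) z (v 2)) (theta (D, c) z (v 3))"
      unfolding star_phi_def L(2) .
  qed
qed

text \<open>
  On positive definite matrices \<open>tilde\<close> is the adjugate, whose entries are polynomials.
\<close>

lemma evolution_smooth: "smooth_on ((c ` D) \<times> I) (\<lambda>z. evolution_3form P S \<omega> \<psi> (D \<times> I, map_prod c id) z v)"
proof -
  let ?Y = "(c ` D) \<times> I"
  note Y = open_Y[OF C]
  have S: "smooth_on ?Y (\<lambda>z. S_chart (D, c) z $ i $ j)" for i j
    by (intro smooth_on_bounded_linear[OF bounded_linear_vec_nth Y] smooth_S_chart[OF C])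
  have D: "smooth_on ?Y (\<lambda>z. det (S_chart (D, c) z))"
    unfolding det_levi_civita by (intro smooth_on_sum[OF Y] smooth_on_mult[OF Y] smooth_on_const S)
  have A: "smooth_on ?Y (\<lambda>z. adj3 (S_chart (D, c) z) $ i $ j)" for i j
    by (rule smooth_on_adj3[OF Y S])
  have comps: "smooth_on ?Y (\<lambda>z. tc (theta (D, c) z w))" "smooth_on ?Y (\<lambda>z. ec (theta (D, c) z w) $ i)"
    "smooth_on ?Y (\<lambda>z. ac (theta (D, c) z w) $ i)" for w i
    by (simp_all add: theta_def ev_def av_def smooth_on_const smooth_family_onef[OF C smooth_e] smooth_family_onef[OF C smooth_a])
  have sm: "smooth_on ?Y (\<lambda>z. Phi3 (det (S_chart (D, c) z)) (adj3 (S_chart (D, c) z)) (theta (D, c) z (v 0)) (theta (D, c) z (v 1)) (theta (D, c) z (v 2)))"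
    by (intro smooth_on_Phi3[OF Y] D A comps)
  show ?thesis
  proof (rule smooth_on_cong[OF Y _ sm])
    fix z assume z: "z \<in> ?Y"
    have "det (S_chart (D, c) z) \<noteq> 0" using posdef_det_pos[OF Sf_posdef[OF z]] by simp
    then show "Phi3 (det (S_chart (D, c) z)) (adj3 (S_chart (D, c) z)) (theta (D, c) z (v 0)) (theta (D, c) z (v 1)) (theta (D, c) z (v 2))
       = evolution_3form P S \<omega> \<psi> (D \<times> I, map_prod c id) z v"
      unfolding evolution_eq[OF z] by (simp add: tilde_adj3)
  qed
qed

lemma evolution_alternating:
  assumes z: "z \<in> (c ` D) \<times> I"
  shows "alternating 3 (evolution_3form P S \<omega> \<psi> (D \<times> I, map_prod c id) z)"
proof -
  obtain p where p: "p \<in> D" "fst z = c p" and t: "snd z \<in> I" using z by auto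
  have zeq: "z = (c p, snd z)" using p by (simp add: prod_eq_iff)
  have b: "linear (theta (D, c) z)" using theta_bij[OF C p(1) t] zeq by simp
  have eq: "evolution_3form P S \<omega> \<psi> (D \<times> I, map_prod c id) z = (\<lambda>v.
      Phi3 (det (S_chart (D, c) z)) (tilde (S_chart (D, c) z)) (theta (D, c) z (v 0)) (theta (D, c) z (v 1)) (theta (D, c) z (v 2)))"
    by (rule ext) (rule evolution_eq[OF z])
  show ?thesis unfolding eq
  proof (rule alternating_3)
    show "linear (\<lambda>x. Phi3 (det (S_chart (D, c) z)) (tilde (S_chart (D, c) z)) (theta (D, c) z x) (theta (D, c) z y) (theta (D, c) z w))" for y w
      using linear_compose[OF b Phi3_linear] by (simp add: o_def)
  qed (rule Phi3_skew)+
qed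

end

lemma ev_change:
  assumes C: "(D, c) \<in> atlas P" and C': "(D', c') \<in> atlas P" and p: "p \<in> D" "p \<in> D'" and t: "t \<in> I"
  shows "ev t (D', c') (c' p) (frechet_derivative (chart_change (D, c) (D', c')) (at (c p)) w) = ev t (D, c) (c p) w"
    "av t (D', c') (c' p) (frechet_derivative (chart_change (D, c) (D', c')) (at (c p)) w) = av t (D, c) (c p) w"
  using form_on_trans[OF form_e[OF t] C C' p, of _ "\<lambda>_. w"] form_on_trans[OF form_a[OF t] C C' p, of _ "\<lambda>_. w"]
  by (simp_all add: ev_def av_def)

theorem G2_structure_evolution:
  assumes \<omega>: "\<And>t. t \<in> I \<Longrightarrow> form_on P 2 (\<omega> t)" and \<psi>: "\<And>t. t \<in> I \<Longrightarrow> form_on P 3 (\<psi> t)"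
    and corr: "\<And>t. t \<in> I \<Longrightarrow> triple_corresponds P (e t) (a t) (S t) (\<omega> t) (\<psi> t)"
  shows "G2_structure (prod_mfd P (euclidean_open_mfd I)) (evolution_3form P S \<omega> \<psi>)"
  unfolding G2_structure_def
proof (intro conjI ballI)
  let ?N = "prod_mfd P (euclidean_open_mfd I)" and ?\<phi> = "evolution_3form P S \<omega> \<psi>"
  show "form_on ?N 3 ?\<phi>"
    unfolding form_on_def
  proof (intro conjI ballI allI)
    fix Ch assume "Ch \<in> atlas ?N"
    then obtain D c where Ch: "Ch = (D \<times> I, map_prod c id)" and C: "(D, c) \<in> atlas P"
      unfolding prod_atlas by blast
    have im: "snd Ch ` fst Ch = (c ` D) \<times> I" unfolding Ch by force
    show "alternating 3 (?\<phi> Ch z)" if "z \<in> snd Ch ` fst Ch" for z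
      using evolution_alternating[where \<omega> = \<omega> and \<psi> = \<psi>, OF C \<omega> \<psi> corr] that unfolding im unfolding Ch by blast
    show "smooth_on (snd Ch ` fst Ch) (\<lambda>z. ?\<phi> Ch z v)" for v
      using evolution_smooth[where \<omega> = \<omega> and \<psi> = \<psi>, OF C \<omega> \<psi> corr] unfolding im unfolding Ch by blast
    fix Ch' q v assume "Ch' \<in> atlas ?N" and q: "q \<in> fst Ch \<inter> fst Ch'"
    then obtain D' c' where Ch': "Ch' = (D' \<times> I, map_prod c' id)" and C': "(D', c') \<in> atlas P"
      unfolding prod_atlas by blast
    obtain p t where pt: "q = (p, t)" "p \<in> D" "p \<in> D'" "t \<in> I" using q by (auto simp: Ch Ch')
    let ?d = "frechet_derivative (chart_change (D, c) (D', c')) (at (c p))"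
    have z: "(c p, t) \<in> (c ` D) \<times> I" and z': "(c' p, t) \<in> (c' ` D') \<times> I" using pt by auto
    have tm: "tangent_map id Ch Ch' q w = (?d (fst w), snd w)" for w
    proof -
      have "((\<lambda>y. (c' (fst (chart_inv Ch y)), snd y)) has_derivative (\<lambda>w. (?d (fst w), snd w))) (at (c p, t))"
        unfolding Ch
        by (intro has_derivative_Pair prod_change[OF smooth_P C open_I C'] pt has_derivative_snd has_derivative_ident)
      from frechet_derivative_eq_on(1)[OF open_Y[OF C] z _ this, of "snd Ch' \<circ> id \<circ> chart_inv Ch"]
      have "frechet_derivative (snd Ch' \<circ> id \<circ> chart_inv Ch) (at (c p, t)) = (\<lambda>w. (?d (fst w), snd w))"
        using prod_chart_inv[OF smooth_P C open_I] by (simp add: Ch Ch')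
      then show ?thesis by (simp add: tangent_map_def Ch pt(1))
    qed
    have th: "theta (D', c') (c' p, t) (?d (fst w), snd w) = theta (D, c) (c p, t) w" for w
      by (simp add: theta_def ev_change[OF C C' pt(2,3,4)])
    have S_chart: "S_chart (D', c') (c' p, t) = S_chart (D, c) (c p, t)"
      using chart_inv_chart[OF chart_facts(5)[OF smooth_P C] pt(2)] chart_inv_chart[OF chart_facts(5)[OF smooth_P C'] pt(3)]
      by (simp add: S_chart_def)
    have "?\<phi> Ch (c p, t) v = ?\<phi> Ch' (c' p, t) (\<lambda>i. (?d (fst (v i)), snd (v i)))"
    proof -
      have 1: "?\<phi> (D \<times> I, map_prod c id) (c p, t) v = Phi3 (det (S_chart (D, c) (c p, t))) (tilde (S_chart (D, c) (c p, t)))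
          (theta (D, c) (c p, t) (v 0)) (theta (D, c) (c p, t) (v 1)) (theta (D, c) (c p, t) (v 2))"
        by (rule evolution_eq) (rule C z \<omega> \<psi> corr, assumption?)+
      have 2: "?\<phi> (D' \<times> I, map_prod c' id) (c' p, t) u = Phi3 (det (S_chart (D', c') (c' p, t))) (tilde (S_chart (D', c') (c' p, t)))
          (theta (D', c') (c' p, t) (u 0)) (theta (D', c') (c' p, t) (u 1)) (theta (D', c') (c' p, t) (u 2))" for u
        by (rule evolution_eq) (rule C' z' \<omega> \<psi> corr, assumption?)+
      show ?thesis unfolding Ch Ch' 1 2 th S_chart ..
    qed
    then show "?\<phi> Ch (snd Ch q) v = ?\<phi> Ch' (snd Ch' q) (\<lambda>i. tangent_map id Ch Ch' q (v i))"
      unfolding tm by (simp add: Ch Ch' pt(1))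
  qed
  fix Ch q assume "Ch \<in> atlas ?N" and q: "q \<in> fst Ch"
  then obtain D c where Ch: "Ch = (D \<times> I, map_prod c id)" and C: "(D, c) \<in> atlas P"
    unfolding prod_atlas by blast
  have "snd Ch q \<in> (c ` D) \<times> I" using q by (auto simp: Ch)
  from star_evolution_eq[where \<omega> = \<omega> and \<psi> = \<psi>, OF C \<omega> \<psi> corr this]
  show "\<exists>L. g2_frame (?\<phi> Ch (snd Ch q)) L" unfolding Ch by metis
qed

end

context T3_triples
begin

section \<open>Curvature and frame derivatives\<close>

lemma coframe_at: "(D, c) \<in> atlas P \<Longrightarrow> p \<in> D \<Longrightarrow> t \<in> I \<Longrightarrow>
    coframe (ev t (D, c) (c p)) (av t (D, c) (c p)) (\<lambda>\<xi>. fundamental_vector act \<xi> (D, c) p)"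
  by (rule coframe)

text \<open>
  The curvature coefficients are functions on \<open>P\<close>: both \<open>da\<^sup>i\<close> and \<open>e\<close> transform by the derivative of
  the transition map.
\<close>

lemma Om_change:
  assumes C: "(D, c) \<in> atlas P" and C': "(D', c') \<in> atlas P" and p: "p \<in> D" "p \<in> D'" and t: "t \<in> I"
  shows "Om t (D, c) p = Om t (D', c') p"
proof -
  interpret F: coframe "ev t (D, c) (c p)" "av t (D, c) (c p)" "\<lambda>\<xi>. fundamental_vector act \<xi> (D, c) p"
    by (rule coframe_at[OF C p(1) t])
  have "F.dual2 (d1 (onef (a t i) (D, c)) (c p)) = Om t (D', c') p $ i" for i
  proof (rule F.dual2_eq)
    fix v w
    show "d1 (onef (a t i) (D, c)) (c p) v w = Om t (D', c') p $ i \<bullet> cross3 (ev t (D, c) (c p) v) (ev t (D, c) (c p) w)"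
      unfolding d1_onef_trans[OF smooth_P form_a[OF t] C C' p] d1_a[OF C' p(2) t] ev_change[OF C C' p t] ..
  qed
  then show ?thesis by (simp add: Om_def vec_eq_iff)
qed

lemma ext_deriv_a:
  assumes C: "(D, c) \<in> atlas P" and p: "p \<in> D" and t: "t \<in> I"
  shows "ext_deriv 1 (a t i) (D, c) (c p) v = (\<Sum>j\<in>UNIV. Om t (D, c) p $ i $ j * hat (\<lambda>k. e t k (D, c) (c p)) j v)"
proof -
  have x: "c p \<in> c ` D" using p by blast
  have h: "hat (\<lambda>k. e t k (D, c) (c p)) j v = cross3 (ev t (D, c) (c p) (v 0)) (ev t (D, c) (c p) (v 1)) $ j" for j
    unfolding ev_def by (rule hat_eq) (rule form_on_alternating[OF form_e[OF t] C x])
  show ?thesis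
    unfolding ext_deriv_1_onef[OF smooth_P form_a[OF t] C x] d1_a[OF C p t] h by (simp add: inner_vec_def)
qed

text \<open>
  The definite description has the unique solution \<open>Om\<close>, since the 2-forms \<open>^e\<^sup>j\<close> are linearly
  independent.
\<close>

lemma curvature_coeff_eq:
  assumes C: "(D, c) \<in> atlas P" and p: "p \<in> D" and t: "t \<in> I"
  shows "curvature_coeff P (e t) (a t) p = Om t (D, c) p"
  unfolding curvature_coeff_def
proof (rule the_equality)
  show "\<forall>C'\<in>atlas P. p \<in> fst C' \<longrightarrow> (\<forall>i v. ext_deriv 1 (a t i) C' (snd C' p) v =
        (\<Sum>j\<in>UNIV. Om t (D, c) p $ i $ j * hat (\<lambda>k. e t k C' (snd C' p)) j v))"
  proof (intro ballI impI allI)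
    fix C' i v assume "C' \<in> atlas P" "p \<in> fst C'"
    moreover obtain D' c' where "C' = (D', c')" by (cases C')
    ultimately show "ext_deriv 1 (a t i) C' (snd C' p) v =
        (\<Sum>j\<in>UNIV. Om t (D, c) p $ i $ j * hat (\<lambda>k. e t k C' (snd C' p)) j v)"
      using ext_deriv_a[of D' c' p t i v] Om_change[OF C _ p _ t, of D' c'] t by simp
  qed
next
  fix W :: "real^3^3"
  assume "\<forall>C'\<in>atlas P. p \<in> fst C' \<longrightarrow> (\<forall>i v. ext_deriv 1 (a t i) C' (snd C' p) v =
        (\<Sum>j\<in>UNIV. W $ i $ j * hat (\<lambda>k. e t k C' (snd C' p)) j v))"
  from this[rule_format, OF C] p
  have W: "ext_deriv 1 (a t i) (D, c) (c p) v = (\<Sum>j\<in>UNIV. W $ i $ j * hat (\<lambda>k. e t k (D, c) (c p)) j v)" for i v by simp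
  interpret F: coframe "ev t (D, c) (c p)" "av t (D, c) (c p)" "\<lambda>\<xi>. fundamental_vector act \<xi> (D, c) p"
    by (rule coframe_at[OF C p t])
  have x: "c p \<in> c ` D" using p by blast
  have h: "hat (\<lambda>k. e t k (D, c) (c p)) j v = cross3 (ev t (D, c) (c p) (v 0)) (ev t (D, c) (c p) (v 1)) $ j" for j v
    unfolding ev_def by (rule hat_eq) (rule form_on_alternating[OF form_e[OF t] C x])
  have "F.dual2 (d1 (onef (a t i) (D, c)) (c p)) = W $ i" for i
  proof (rule F.dual2_eq)
    fix v w
    show "d1 (onef (a t i) (D, c)) (c p) v w = W $ i \<bullet> cross3 (ev t (D, c) (c p) v) (ev t (D, c) (c p) w)"
      using W[of i "case_nat v (\<lambda>_. w)"] unfolding ext_deriv_1_onef[OF smooth_P form_a[OF t] C x] h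
      by (simp add: inner_vec_def)
  qed
  then show "W = Om t (D, c) p" by (simp add: Om_def vec_eq_iff)
qed

text \<open>
  For an invariant function \<open>f\<close>, \<open>df\<close> is horizontal and is therefore determined by its values on the
  horizontal lifts.  These values agree in all charts, as the definite description requires.
\<close>

lemma frame_deriv_eq:
  assumes C: "(D, c) \<in> atlas P" and p: "p \<in> D" and t: "t \<in> I"
    and inv: "invariant_fun P act f"
    and diff: "\<And>D' c'. (D', c') \<in> atlas P \<Longrightarrow> p \<in> D' \<Longrightarrow> (f \<circ> chart_inv (D', c')) differentiable (at (c' p))"
  shows "frame_deriv P (e t) f k p = frechet_derivative (f \<circ> chart_inv (D, c)) (at (c p)) (lift t (D, c) p k)"
proof -
  let ?B = "\<lambda>D c. \<chi> l. frechet_derivative (f \<circ> chart_inv (D, c)) (at (c p)) (lift t (D, c) p l)"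
  have expand: "frechet_derivative (f \<circ> chart_inv (D', c')) (at (c' p)) v = (\<Sum>l\<in>UNIV. ?B D' c' $ l * onef (e t l) (D', c') (c' p) v)"
    if C': "(D', c') \<in> atlas P" and p': "p \<in> D'" for D' c' v
  proof -
    interpret F: coframe "ev t (D', c') (c' p)" "av t (D', c') (c' p)" "\<lambda>\<xi>. fundamental_vector act \<xi> (D', c') p"
      by (rule coframe_at[OF C' p' t])
    have "frechet_derivative (f \<circ> chart_inv (D', c')) (at (c' p)) v
       = (\<Sum>k\<in>UNIV. (ev t (D', c') (c' p) v $ k) *\<^sub>R frechet_derivative (f \<circ> chart_inv (D', c')) (at (c' p)) (F.lift k))"
      by (rule F.horizontal_expand[OF linear_frechet_derivative[OF diff[OF C' p']] invariant_fun_fundamental[OF C' inv p' diff[OF C' p']]])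
    then show ?thesis by (simp add: ev_def lift_def mult.commute)
  qed
  have same: "?B D' c' = ?B D c" if C': "(D', c') \<in> atlas P" and p': "p \<in> D'" for D' c'
  proof -
    have "?B D c $ l = ?B D' c' $ l" for l
    proof -
      let ?d = "frechet_derivative (chart_change (D, c) (D', c')) (at (c p))"
      have "?B D c $ l = frechet_derivative (f \<circ> chart_inv (D', c')) (at (c' p)) (?d (lift t (D, c) p l))"
        using fun_trans[OF smooth_P C C' p p' diff[OF C' p']] by simp
      also have "\<dots> = (\<Sum>m\<in>UNIV. ?B D' c' $ m * ev t (D', c') (c' p) (?d (lift t (D, c) p l)) $ m)"
        by (rule trans[OF expand[OF C' p']]) (simp add: ev_def)
      also have "\<dots> = (\<Sum>m\<in>UNIV. ?B D' c' $ m * axis l 1 $ m)"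
        unfolding ev_change[OF C C' p p' t] ev_lift[OF C p t] ..
      also have "\<dots> = ?B D' c' $ l" by (simp add: axis_def if_distrib cong: if_cong)
      finally show ?thesis .
    qed
    then show ?thesis by (simp add: vec_eq_iff)
  qed
  have ext: "ext_deriv 0 (fun_form f) (D', c') (c' p) v = frechet_derivative (f \<circ> chart_inv (D', c')) (at (c' p)) (v 0)" for D' c' v
    by (simp add: ext_deriv_def fun_form_def o_def)
  have "(THE B :: real^3. \<forall>C\<in>atlas P. p \<in> fst C \<longrightarrow> (\<forall>v.
        ext_deriv 0 (fun_form f) C (snd C p) v = (\<Sum>l\<in>UNIV. B $ l * e t l C (snd C p) v))) = ?B D c"
  proof (rule the_equality)
    show "\<forall>C\<in>atlas P. p \<in> fst C \<longrightarrow> (\<forall>v.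
        ext_deriv 0 (fun_form f) C (snd C p) v = (\<Sum>l\<in>UNIV. ?B D c $ l * e t l C (snd C p) v))"
    proof (intro ballI impI allI)
      fix C' v assume *: "C' \<in> atlas P" "p \<in> fst C'"
      obtain D' c' where C'eq: "C' = (D', c')" by (cases C')
      then have C': "(D', c') \<in> atlas P" "p \<in> D'" using * by auto
      have x: "c' p \<in> c' ` D'" using C' by blast
      show "ext_deriv 0 (fun_form f) C' (snd C' p) v = (\<Sum>l\<in>UNIV. ?B D c $ l * e t l C' (snd C' p) v)"
        using expand[OF C', of "v 0"]
        unfolding C'eq snd_conv ext same[OF C'] onef_facts(1)[OF form_e[OF t] C'(1) x, of _ v] .
    qed
  next
    fix B :: "real^3"
    assume "\<forall>C\<in>atlas P. p \<in> fst C \<longrightarrow> (\<forall>v.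
        ext_deriv 0 (fun_form f) C (snd C p) v = (\<Sum>l\<in>UNIV. B $ l * e t l C (snd C p) v))"
    from this[rule_format, OF C] p
    have B: "frechet_derivative (f \<circ> chart_inv (D, c)) (at (c p)) (v 0) = (\<Sum>l\<in>UNIV. B $ l * e t l (D, c) (c p) v)" for v
      by (simp add: ext)
    have "?B D c $ k = B $ k" for k
    proof -
      have "?B D c $ k = (\<Sum>l\<in>UNIV. B $ l * ev t (D, c) (c p) (lift t (D, c) p k) $ l)"
        using B[of "\<lambda>_. lift t (D, c) p k"] by (simp add: ev_def)
      also have "\<dots> = B $ k" unfolding ev_lift[OF C p t] by (simp add: axis_def if_distrib cong: if_cong)
      finally show ?thesis .
    qed
    then show "B = ?B D c" by (simp add: vec_eq_iff)
  qed
  then show ?thesis unfolding frame_deriv_def by simp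
qed

lemma frame_deriv_S:
  assumes C: "(D, c) \<in> atlas P" and p: "p \<in> D" and t: "t \<in> I"
  shows "frame_deriv P (e t) (\<lambda>q. S t q $ i $ j) k p = Sk t (D, c) p k $ i $ j"
proof -
  have "frame_deriv P (e t) (\<lambda>q. S t q $ i $ j) k p
      = frechet_derivative ((\<lambda>q. S t q $ i $ j) \<circ> chart_inv (D, c)) (at (c p)) (lift t (D, c) p k)"
    by (rule frame_deriv_eq[OF C p t])
      (use S_invariant[OF t] Sf_component_differentiable(1)[OF _ _ t] in \<open>auto simp: invariant_fun_def\<close>)
  then show ?thesis unfolding Sf_component_differentiable(3)[OF C p t] Sk_def snd_conv .
qed

lemma frame_deriv_tilde:
  assumes C: "(D, c) \<in> atlas P" and p: "p \<in> D" and t: "t \<in> I"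
  shows "frame_deriv P (e t) (\<lambda>q. tilde (S t q) $ i $ j) k p = dadj (S t p) (Sk t (D, c) p k) $ i $ j"
proof -
  have deriv: "(((\<lambda>q. tilde (S t q) $ i $ j) \<circ> chart_inv (D', c')) has_derivative
      (\<lambda>v. dadj (S t p) (frechet_derivative (\<lambda>x. S t (chart_inv (D', c') x)) (at (c' p)) v) $ i $ j)) (at (c' p))"
    if C': "(D', c') \<in> atlas P" and p': "p \<in> D'" for D' c'
  proof -
    note f = chart_facts[OF smooth_P C']
    have h: "((\<lambda>x. adj3 (S t (chart_inv (D', c') x)) $ i $ j) has_derivative
      (\<lambda>v. dadj (S t (chart_inv (D', c') (c' p))) (frechet_derivative (\<lambda>x. S t (chart_inv (D', c') x)) (at (c' p)) v) $ i $ j)) (at (c' p))"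
      by (intro bounded_linear.has_derivative[OF bounded_linear_vec_nth] has_derivative_adj3
        frechet_derivative_has Sf_component_differentiable(2)[OF C' p' t])
    have "c' p \<in> c' ` D'" using p' by blast
    note x = this
    have h': "((\<lambda>x. adj3 (S t (chart_inv (D', c') x)) $ i $ j) has_derivative
      (\<lambda>v. dadj (S t p) (frechet_derivative (\<lambda>x. S t (chart_inv (D', c') x)) (at (c' p)) v) $ i $ j)) (at (c' p))"
      using h unfolding chart_inv_chart[OF f(5) p'] .
    show ?thesis
    proof (rule has_derivative_transform_within_open[OF h' f(3) x])
      fix x assume "x \<in> c' ` D'"
      then have "chart_inv (D', c') x \<in> points P" using chart_inv_in[of x c' D'] f(2) by blast
      then have "det (S t (chart_inv (D', c') x)) \<noteq> 0" using posdef_det_pos[OF S_posdef[OF t]] by fastforce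
      then show "adj3 (S t (chart_inv (D', c') x)) $ i $ j = ((\<lambda>q. tilde (S t q) $ i $ j) \<circ> chart_inv (D', c')) x"
        by (simp add: tilde_adj3)
    qed
  qed
  have "frame_deriv P (e t) (\<lambda>q. tilde (S t q) $ i $ j) k p
      = frechet_derivative ((\<lambda>q. tilde (S t q) $ i $ j) \<circ> chart_inv (D, c)) (at (c p)) (lift t (D, c) p k)"
  proof (rule frame_deriv_eq[OF C p t])
    show "invariant_fun P act (\<lambda>q. tilde (S t q) $ i $ j)"
      using S_invariant[OF t] by (simp add: invariant_fun_def)
    show "((\<lambda>q. tilde (S t q) $ i $ j) \<circ> chart_inv (D', c')) differentiable (at (c' p))"
      if "(D', c') \<in> atlas P" "p \<in> D'" for D' c'
      using deriv[OF that] unfolding differentiable_def by blast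
  qed
  then show ?thesis unfolding frechet_derivative_at[OF deriv[OF C p], symmetric] Sk_def snd_conv .
qed

lemma dS_dt:
  assumes C: "(D, c) \<in> atlas P" and p: "p \<in> D" and t: "t \<in> I"
  shows "vector_derivative (\<lambda>s. S s p $ i $ j) (at t) = S0 t p $ i $ j"
proof -
  have "(\<lambda>s. S_chart (D, c) (c p, s)) differentiable (at t)"
    by (rule frechet_family(3)[OF smooth_on_differentiable[OF smooth_S_chart[OF C] y_in[OF C p t]]])
  moreover have "(\<lambda>s. S_chart (D, c) (c p, s)) = (\<lambda>s. S s p)"
    using chart_inv_chart[OF chart_facts(5)[OF smooth_P C] p] by (simp add: S_chart_def)
  ultimately have "((\<lambda>s. S s p) has_vector_derivative S0 t p) (at t)"
    by (simp add: S0_def vector_derivative_works)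
  then have "((\<lambda>s. S s p $ i $ j) has_vector_derivative S0 t p $ i $ j) (at t)"
    by (intro bounded_linear.has_vector_derivative[OF bounded_linear_vec_nth])
  then show ?thesis by (rule vector_derivative_at)
qed

lemma Tm_zero_iff:
  assumes C: "(D, c) \<in> atlas P" and p: "p \<in> D" and t: "t \<in> I"
  shows "Tm t (D, c) p = 0 \<longleftrightarrow> (\<forall>i v. ext_deriv 1 (e t i) (D, c) (c p) v = 0)"
proof -
  have x: "c p \<in> c ` D" using p by blast
  note ed = ext_deriv_1_onef[OF smooth_P form_e[OF t] C x]
  interpret F: coframe "ev t (D, c) (c p)" "av t (D, c) (c p)" "\<lambda>\<xi>. fundamental_vector act \<xi> (D, c) p"
    by (rule coframe_at[OF C p t])
  show ?thesis
  proof
    assume "Tm t (D, c) p = 0"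
    then show "\<forall>i v. ext_deriv 1 (e t i) (D, c) (c p) v = 0" unfolding ed d1_e[OF C p t] by simp
  next
    assume H: "\<forall>i v. ext_deriv 1 (e t i) (D, c) (c p) v = 0"
    have "F.dual2 (d1 (onef (e t i) (D, c)) (c p)) = 0" for i
    proof (rule F.dual2_eq)
      fix v w show "d1 (onef (e t i) (D, c)) (c p) v w = 0 \<bullet> cross3 (ev t (D, c) (c p) v) (ev t (D, c) (c p) w)"
        using H[rule_format, of i "case_nat v (\<lambda>_. w)"] unfolding ed by simp
    qed
    then show "Tm t (D, c) p = 0" by (simp add: Tm_def vec_eq_iff)
  qed
qed

lemma one_form_eq_iff:
  assumes C: "(D, c) \<in> atlas P" and p: "p \<in> D" and t: "t \<in> I"
  shows "(\<forall>w. (\<Sum>k\<in>UNIV. A $ k * ev t (D, c) (c p) w $ k) = (\<Sum>k\<in>UNIV. B k * ev t (D, c) (c p) w $ k)) \<longleftrightarrow> (\<forall>k. A $ k = B k)"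
proof
  assume H: "\<forall>w. (\<Sum>k\<in>UNIV. A $ k * ev t (D, c) (c p) w $ k) = (\<Sum>k\<in>UNIV. B k * ev t (D, c) (c p) w $ k)"
  show "\<forall>k. A $ k = B k"
  proof
    fix k show "A $ k = B k"
      using H[rule_format, of "lift t (D, c) p k"] unfolding ev_lift[OF C p t]
      by (simp add: axis_def if_distrib cong: if_cong)
  qed
qed simp

text \<open>
  Values of a one-form depend on the first argument only, and this passes to the time derivative
  because it holds for all times near \<open>t\<close>.
\<close>

lemma form_dt_onef:
  assumes G: "smooth_form_family P I 1 G" and C: "(D, c) \<in> atlas P" and p: "p \<in> D" and t: "t \<in> I"
  shows "form_dt G t (D, c) (c p) v = onef (form_dt G t) (D, c) (c p) (v 0)"
proof -
  have x: "c p \<in> c ` D" using p by blast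
  have eq: "G s (D, c) (c p) v = onef (G s) (D, c) (c p) (v 0)" if "s \<in> I" for s
    by (rule onef_facts(1)[OF _ C x]) (use G that in \<open>simp add: smooth_form_family_def\<close>)
  have "(\<lambda>s. onef (G s) (D, c) (c p) (v 0)) differentiable (at t)"
    using frechet_family(3)[OF smooth_on_differentiable[OF smooth_family_onef[OF C G] y_in[OF C p t]]] by simp
  then have "((\<lambda>s. onef (G s) (D, c) (c p) (v 0)) has_vector_derivative onef (form_dt G t) (D, c) (c p) (v 0)) (at t)"
    by (simp add: vector_derivative_works form_dt_def)
  then have "((\<lambda>s. G s (D, c) (c p) v) has_vector_derivative onef (form_dt G t) (D, c) (c p) (v 0)) (at t)"
    by (rule has_vector_derivative_transform_within_open[OF _ open_I t]) (simp add: eq)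
  then show ?thesis unfolding form_dt_def by (rule vector_derivative_at)
qed

lemma Pm_zero_iff:
  assumes C: "(D, c) \<in> atlas P" and p: "p \<in> D" and t: "t \<in> I"
  shows "Pm t (D, c) p = 0 \<longleftrightarrow> (\<forall>i v. form_dt (\<lambda>s. e s i) t (D, c) (c p) v = 0)"
proof -
  have eq: "form_dt (\<lambda>s. e s i) t (D, c) (c p) v = (\<Sum>k\<in>UNIV. Pm t (D, c) p $ i $ k * ev t (D, c) (c p) (v 0) $ k)" for i v
    by (rule trans[OF form_dt_onef[OF smooth_e C p t] dt_e[OF C p t]])
  have "(\<forall>v. form_dt (\<lambda>s. e s i) t (D, c) (c p) v = 0) \<longleftrightarrow> (\<forall>k. Pm t (D, c) p $ i $ k = 0)" for i
    using one_form_eq_iff[OF C p t, of "Pm t (D, c) p $ i" "\<lambda>_. 0"]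
    unfolding eq by (auto dest: spec[of _ "\<lambda>_. _"])
  then show ?thesis by (simp add: vec_eq_iff)
qed

lemma Qm_iff:
  assumes C: "(D, c) \<in> atlas P" and p: "p \<in> D" and t: "t \<in> I"
  shows "(\<forall>k. Qm t (D, c) p $ i $ k = - (\<Sum>\<alpha>\<in>UNIV. \<Sum>\<beta>\<in>UNIV. levi_civita i \<alpha> \<beta> * dadj (S t p) (Sk t (D, c) p \<beta>) $ k $ \<alpha>))
   \<longleftrightarrow> (\<forall>v. form_dt (\<lambda>s. a s i) t (D, c) (c p) v = - (\<Sum>\<alpha>\<in>UNIV. \<Sum>\<beta>\<in>UNIV. \<Sum>k\<in>UNIV.
             levi_civita i \<alpha> \<beta> *
             frame_deriv P (e t) (\<lambda>q. tilde (S t q) $ k $ \<alpha>) \<beta> (chart_inv (D, c) (c p)) * e t k (D, c) (c p) v))"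
proof -
  let ?A = "\<lambda>\<alpha> \<beta> k. dadj (S t p) (Sk t (D, c) p \<beta>) $ k $ \<alpha>"
  have x: "c p \<in> c ` D" using p by blast
  have rhs: "- (\<Sum>\<alpha>\<in>UNIV. \<Sum>\<beta>\<in>UNIV. \<Sum>k\<in>UNIV. levi_civita i \<alpha> \<beta> *
             frame_deriv P (e t) (\<lambda>q. tilde (S t q) $ k $ \<alpha>) \<beta> (chart_inv (D, c) (c p)) * e t k (D, c) (c p) v)
     = (\<Sum>k\<in>UNIV. (- (\<Sum>\<alpha>\<in>UNIV. \<Sum>\<beta>\<in>UNIV. levi_civita i \<alpha> \<beta> * ?A \<alpha> \<beta> k)) * ev t (D, c) (c p) (v 0) $ k)" for v
    unfolding chart_inv_chart[OF chart_facts(5)[OF smooth_P C] p] frame_deriv_tilde[OF C p t]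
      onef_facts(1)[OF form_e[OF t] C x, of _ v]
    by (simp add: ev_def sum_3 algebra_simps)
  have eq: "form_dt (\<lambda>s. a s i) t (D, c) (c p) v = (\<Sum>k\<in>UNIV. Qm t (D, c) p $ i $ k * ev t (D, c) (c p) (v 0) $ k)" for v
    by (rule trans[OF form_dt_onef[OF smooth_a C p t] dt_a[OF C p t]])
  have const: "(\<forall>v. Q (v 0)) \<longleftrightarrow> (\<forall>w. Q w)" for Q :: "real^6 \<Rightarrow> bool"
    by (auto dest: spec[of _ "\<lambda>_. _"])
  show ?thesis
    unfolding rhs eq const[of "\<lambda>w. (\<Sum>k\<in>UNIV. Qm t (D, c) p $ i $ k * ev t (D, c) (c p) w $ k)
       = (\<Sum>k\<in>UNIV. (- (\<Sum>\<alpha>\<in>UNIV. \<Sum>\<beta>\<in>UNIV. levi_civita i \<alpha> \<beta> * ?A \<alpha> \<beta> k)) * ev t (D, c) (c p) w $ k)"]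
    by (rule one_form_eq_iff[OF C p t, symmetric])
qed

end

section \<open>Torsion-freeness\<close>

lemma form_eq_iff:
  "form_eq M F G \<longleftrightarrow> (\<forall>D c p. (D, c) \<in> atlas M \<longrightarrow> p \<in> D \<longrightarrow> (\<forall>v. F (D, c) (c p) v = G (D, c) (c p) v))"
  unfolding form_eq_def by force

lemma form_eq_prod_iff:
  "form_eq (prod_mfd P (euclidean_open_mfd I)) F G \<longleftrightarrow>
    (\<forall>D c p t. (D, c) \<in> atlas P \<longrightarrow> p \<in> D \<longrightarrow> t \<in> I \<longrightarrow>
       (\<forall>v. F (D \<times> I, map_prod c id) (c p, t) v = G (D \<times> I, map_prod c id) (c p, t) v))"
    (is "form_eq ?N F G \<longleftrightarrow> ?R")
proof
  assume F: "form_eq ?N F G"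
  show ?R
  proof (intro allI impI)
    fix D c p t v assume C: "(D, c) \<in> atlas P" and p: "p \<in> D" "t \<in> I"
    have "(D \<times> I, map_prod c id) \<in> atlas ?N" using C unfolding prod_atlas by blast
    from F[unfolded form_eq_def, rule_format, OF this, of "(p, t)" v]
    show "F (D \<times> I, map_prod c id) (c p, t) v = G (D \<times> I, map_prod c id) (c p, t) v" using p by simp
  qed
next
  assume R: ?R
  show "form_eq ?N F G"
    unfolding form_eq_def
  proof (intro ballI allI)
    fix Ch q v assume "Ch \<in> atlas ?N" and q: "q \<in> fst Ch"
    then obtain D c where "Ch = (D \<times> I, map_prod c id)" "(D, c) \<in> atlas P"
      unfolding prod_atlas by blast
    then show "F Ch (snd Ch q) v = G Ch (snd Ch q) v" using R q by (cases q) simp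
  qed
qed

context T3_triples
begin

text \<open>
  The charts of the product are those of \<open>P\<close> times the interval, so the pointwise criterion applies at
  every point.
\<close>

lemma torsion_free_evolution_iff:
  assumes \<omega>: "\<And>t. t \<in> I \<Longrightarrow> form_on P 2 (\<omega> t)" and \<psi>: "\<And>t. t \<in> I \<Longrightarrow> form_on P 3 (\<psi> t)"
    and corr: "\<And>t. t \<in> I \<Longrightarrow> triple_corresponds P (e t) (a t) (S t) (\<omega> t) (\<psi> t)"
  shows "torsion_free (prod_mfd P (euclidean_open_mfd I)) (evolution_3form P S \<omega> \<psi>) \<longleftrightarrow>
     (\<forall>D c p t. (D, c) \<in> atlas P \<longrightarrow> p \<in> D \<longrightarrow> t \<in> I \<longrightarrow>
        Tm t (D, c) p = 0 \<and> (\<forall>i j. Om t (D, c) p $ i $ j = Om t (D, c) p $ j $ i)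
        \<and> (\<forall>i. (\<Sum>\<alpha>\<in>UNIV. Sk t (D, c) p \<alpha> $ i $ \<alpha>) = 0) \<and> Pm t (D, c) p = 0
        \<and> (\<forall>i k. Qm t (D, c) p $ i $ k = - (\<Sum>\<alpha>\<in>UNIV. \<Sum>\<beta>\<in>UNIV. levi_civita i \<alpha> \<beta> * dadj (S t p) (Sk t (D, c) p \<beta>) $ k $ \<alpha>))
        \<and> (\<forall>i j. S0 t p $ i $ j = - Om t (D, c) p $ i $ j))"
    (is "torsion_free ?N ?\<phi> \<longleftrightarrow> (\<forall>D c p t. _ \<longrightarrow> _ \<longrightarrow> _ \<longrightarrow> ?E D c p t)")
proof -
  have pointwise: "(\<forall>v. ext_deriv 3 ?\<phi> (D \<times> I, map_prod c id) (c p, t) v = 0) \<and>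
      (\<forall>v. ext_deriv 4 (star_phi ?\<phi>) (D \<times> I, map_prod c id) (c p, t) v = 0) \<longleftrightarrow> ?E D c p t"
    if C: "(D, c) \<in> atlas P" and p: "p \<in> D" and t: "t \<in> I" for D c p t
  proof (rule torsion_free_at_point[OF C p t])
    fix z v assume z: "z \<in> (c ` D) \<times> I"
    show "?\<phi> (D \<times> I, map_prod c id) z v =
      Phi3 (det (S_chart (D, c) z)) (tilde (S_chart (D, c) z)) (theta (D, c) z (v 0)) (theta (D, c) z (v 1)) (theta (D, c) z (v 2))"
      by (rule evolution_eq) (rule C z \<omega> \<psi> corr, assumption?)+
    show "star_phi ?\<phi> (D \<times> I, map_prod c id) z v =
      Psi4 (det (S_chart (D, c) z)) (S_chart (D, c) z) (theta (D, c) z (v 0)) (theta (D, c) z (v 1)) (theta (D, c) z (v 2)) (theta (D, c) z (v 3))"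
      using star_evolution_eq[where \<omega> = \<omega> and \<psi> = \<psi>, OF C \<omega> \<psi> corr z] by metis
  qed
  have "torsion_free ?N ?\<phi> \<longleftrightarrow> (\<forall>D c p t. (D, c) \<in> atlas P \<longrightarrow> p \<in> D \<longrightarrow> t \<in> I \<longrightarrow>
      (\<forall>v. ext_deriv 3 ?\<phi> (D \<times> I, map_prod c id) (c p, t) v = 0) \<and>
      (\<forall>v. ext_deriv 4 (star_phi ?\<phi>) (D \<times> I, map_prod c id) (c p, t) v = 0))"
    unfolding torsion_free_def form_eq_prod_iff by blast
  then show ?thesis using pointwise by simp
qed

text \<open>
  Each matrix equation at the points of the charts is one of the invariant equations.
\<close>

lemma equations_in_charts_iff:
  "(\<forall>D c p t. (D, c) \<in> atlas P \<longrightarrow> p \<in> D \<longrightarrow> t \<in> I \<longrightarrow>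
        Tm t (D, c) p = 0 \<and> (\<forall>i j. Om t (D, c) p $ i $ j = Om t (D, c) p $ j $ i)
        \<and> (\<forall>i. (\<Sum>\<alpha>\<in>UNIV. Sk t (D, c) p \<alpha> $ i $ \<alpha>) = 0) \<and> Pm t (D, c) p = 0
        \<and> (\<forall>i k. Qm t (D, c) p $ i $ k = - (\<Sum>\<alpha>\<in>UNIV. \<Sum>\<beta>\<in>UNIV. levi_civita i \<alpha> \<beta> * dadj (S t p) (Sk t (D, c) p \<beta>) $ k $ \<alpha>))
        \<and> (\<forall>i j. S0 t p $ i $ j = - Om t (D, c) p $ i $ j)) \<longleftrightarrow>
     (\<forall>t \<in> I. \<forall>i j.
        form_eq P (ext_deriv 1 (e t i)) zero_form \<and>
        (\<forall>p \<in> points P. curvature_coeff P (e t) (a t) p $ i $ j = curvature_coeff P (e t) (a t) p $ j $ i) \<and>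
        (\<forall>p \<in> points P. (\<Sum>\<alpha>\<in>UNIV. frame_deriv P (e t) (\<lambda>q. S t q $ i $ \<alpha>) \<alpha> p) = 0) \<and>
        form_eq P (form_dt (\<lambda>s. e s i) t) zero_form \<and>
        form_eq P (form_dt (\<lambda>s. a s i) t)
          (\<lambda>C x v. - (\<Sum>\<alpha>\<in>UNIV. \<Sum>\<beta>\<in>UNIV. \<Sum>k\<in>UNIV.
             levi_civita i \<alpha> \<beta> *
             frame_deriv P (e t) (\<lambda>q. tilde (S t q) $ k $ \<alpha>) \<beta> (chart_inv C x) * e t k C x v)) \<and>
        (\<forall>p \<in> points P. vector_derivative (\<lambda>s. S s p $ i $ j) (at t) =
           - curvature_coeff P (e t) (a t) p $ i $ j))"
    (is "(\<forall>D c p t. _ \<longrightarrow> _ \<longrightarrow> _ \<longrightarrow> ?E D c p t) \<longleftrightarrow> ?R")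
proof -
  let ?R' = "\<lambda>D c p t. (\<forall>i v. ext_deriv 1 (e t i) (D, c) (c p) v = 0) \<and>
      (\<forall>i j. curvature_coeff P (e t) (a t) p $ i $ j = curvature_coeff P (e t) (a t) p $ j $ i) \<and>
      (\<forall>i. (\<Sum>\<alpha>\<in>UNIV. frame_deriv P (e t) (\<lambda>q. S t q $ i $ \<alpha>) \<alpha> p) = 0) \<and>
      (\<forall>i v. form_dt (\<lambda>s. e s i) t (D, c) (c p) v = 0) \<and>
      (\<forall>i v. form_dt (\<lambda>s. a s i) t (D, c) (c p) v = - (\<Sum>\<alpha>\<in>UNIV. \<Sum>\<beta>\<in>UNIV. \<Sum>k\<in>UNIV.
             levi_civita i \<alpha> \<beta> *
             frame_deriv P (e t) (\<lambda>q. tilde (S t q) $ k $ \<alpha>) \<beta> (chart_inv (D, c) (c p)) * e t k (D, c) (c p) v)) \<and>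
      (\<forall>i j. vector_derivative (\<lambda>s. S s p $ i $ j) (at t) = - curvature_coeff P (e t) (a t) p $ i $ j)"
  have pointwise: "?E D c p t \<longleftrightarrow> ?R' D c p t" if C: "(D, c) \<in> atlas P" and p: "p \<in> D" and t: "t \<in> I" for D c p t
    unfolding Tm_zero_iff[OF C p t] Pm_zero_iff[OF C p t] Qm_iff[OF C p t] curvature_coeff_eq[OF C p t]
      frame_deriv_S[OF C p t] dS_dt[OF C p t] ..
  have points: "(\<forall>p\<in>points P. Q p) \<longleftrightarrow> (\<forall>D c p. (D, c) \<in> atlas P \<longrightarrow> p \<in> D \<longrightarrow> Q p)" for Q
    using chart_cover[OF smooth_P] chart_facts(2)[OF smooth_P] by fastforce
  have regroup: "(\<forall>t\<in>I. \<forall>i j. (\<forall>D c p. (D, c) \<in> atlas P \<longrightarrow> p \<in> D \<longrightarrow> (\<forall>v. B1 t i D c p v)) \<and> (\<forall>D c p. (D, c) \<in> atlas P \<longrightarrow> p \<in> D \<longrightarrow> B2 t i j p) \<and>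
       (\<forall>D c p. (D, c) \<in> atlas P \<longrightarrow> p \<in> D \<longrightarrow> B3 t i p) \<and> (\<forall>D c p. (D, c) \<in> atlas P \<longrightarrow> p \<in> D \<longrightarrow> (\<forall>v. B4 t i D c p v)) \<and>
       (\<forall>D c p. (D, c) \<in> atlas P \<longrightarrow> p \<in> D \<longrightarrow> (\<forall>v. B5 t i D c p v)) \<and> (\<forall>D c p. (D, c) \<in> atlas P \<longrightarrow> p \<in> D \<longrightarrow> B6 t i j p)) \<longleftrightarrow>
     (\<forall>D c p t. (D, c) \<in> atlas P \<longrightarrow> p \<in> D \<longrightarrow> t \<in> I \<longrightarrow>
       (\<forall>i v. B1 t i D c p v) \<and> (\<forall>i j. B2 t i j p) \<and> (\<forall>i. B3 t i p) \<and>
       (\<forall>i v. B4 t i D c p v) \<and> (\<forall>i v. B5 t i D c p v) \<and> (\<forall>i j. B6 t i j p))"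
    for B1 B4 B5 :: "real \<Rightarrow> 3 \<Rightarrow> 'p set \<Rightarrow> ('p \<Rightarrow> real^6) \<Rightarrow> 'p \<Rightarrow> (nat \<Rightarrow> real^6) \<Rightarrow> bool"
      and B2 B6 :: "real \<Rightarrow> 3 \<Rightarrow> 3 \<Rightarrow> 'p \<Rightarrow> bool" and B3 :: "real \<Rightarrow> 3 \<Rightarrow> 'p \<Rightarrow> bool"
    by (intro iffI allI impI ballI conjI) metis+
  have "?R \<longleftrightarrow> (\<forall>D c p t. (D, c) \<in> atlas P \<longrightarrow> p \<in> D \<longrightarrow> t \<in> I \<longrightarrow> ?R' D c p t)"
    unfolding form_eq_iff points by (rule regroup)
  then show ?thesis using pointwise by simp
qed

end

theorem theorem1p1:
  fixes P :: "('p, real^6) mfd" and M :: "('m, real^3) mfd"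
    and pr :: "'p \<Rightarrow> 'm" and act :: "'p \<Rightarrow> complex^3 \<Rightarrow> 'p"
    and X :: "3 \<Rightarrow> real^3"
    and t1 t2 :: ereal
    and \<omega> \<psi> :: "real \<Rightarrow> ('p, real^6) form"
    and e a :: "real \<Rightarrow> 3 \<Rightarrow> ('p, real^6) form"
    and S :: "real \<Rightarrow> 'p \<Rightarrow> real^3^3"
  assumes principal: "principal_T3_bundle P M pr act"
    and basis: "inj X" "independent (range X)"
    and interval: "t1 < t2"
    and smooth_SU3: "smooth_form_family P (einterval t1 t2) 2 \<omega>"
      "smooth_form_family P (einterval t1 t2) 3 \<psi>"
    and SU3: "\<And>t. t \<in> einterval t1 t2 \<Longrightarrow> invariant_sLag_SU3_structure P M pr act (\<omega> t) (\<psi> t)"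
    and smooth_triple: "\<And>i. smooth_form_family P (einterval t1 t2) 1 (\<lambda>t. e t i)"
      "\<And>i. smooth_form_family P (einterval t1 t2) 1 (\<lambda>t. a t i)"
      "smooth_fun_family P (einterval t1 t2) S"
    and solder: "\<And>t. t \<in> einterval t1 t2 \<Longrightarrow> solder_form P M pr act (e t)"
    and connection: "\<And>t. t \<in> einterval t1 t2 \<Longrightarrow> connection_form P act X (a t)"
    and S_invariant: "\<And>t. t \<in> einterval t1 t2 \<Longrightarrow> invariant_fun P act (S t)"
    and S_posdef: "\<And>t p. t \<in> einterval t1 t2 \<Longrightarrow> p \<in> points P \<Longrightarrow> posdef_symmetric (S t p)"
    and corresponds:
      "\<And>t. t \<in> einterval t1 t2 \<Longrightarrow> triple_corresponds P (e t) (a t) (S t) (\<omega> t) (\<psi> t)"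
  shows "G2_structure (prod_mfd P (euclidean_open_mfd (einterval t1 t2))) (evolution_3form P S \<omega> \<psi>) \<and>
    (torsion_free (prod_mfd P (euclidean_open_mfd (einterval t1 t2))) (evolution_3form P S \<omega> \<psi>) \<longleftrightarrow>
     (\<forall>t \<in> einterval t1 t2. \<forall>i j.
        form_eq P (ext_deriv 1 (e t i)) zero_form \<and>
        (\<forall>p \<in> points P. curvature_coeff P (e t) (a t) p $ i $ j = curvature_coeff P (e t) (a t) p $ j $ i) \<and>
        (\<forall>p \<in> points P. (\<Sum>\<alpha>\<in>UNIV. frame_deriv P (e t) (\<lambda>q. S t q $ i $ \<alpha>) \<alpha> p) = 0) \<and>
        form_eq P (form_dt (\<lambda>s. e s i) t) zero_form \<and>
        form_eq P (form_dt (\<lambda>s. a s i) t)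
          (\<lambda>C x v. - (\<Sum>\<alpha>\<in>UNIV. \<Sum>\<beta>\<in>UNIV. \<Sum>k\<in>UNIV.
             levi_civita i \<alpha> \<beta> *
             frame_deriv P (e t) (\<lambda>q. tilde (S t q) $ k $ \<alpha>) \<beta> (chart_inv C x) * e t k C x v)) \<and>
        (\<forall>p \<in> points P. vector_derivative (\<lambda>s. S s p $ i $ j) (at t) =
           - curvature_coeff P (e t) (a t) p $ i $ j)))"
proof -
  interpret T3_triples P M pr act X "einterval t1 t2" e a S
    by unfold_locales (fact open_einterval principal basis smooth_triple solder connection S_invariant S_posdef)+
  have forms: "form_on P 2 (\<omega> t)" "form_on P 3 (\<psi> t)" if "t \<in> einterval t1 t2" for t
    using smooth_SU3 that unfolding smooth_form_family_def by blast+
  note h = forms corresponds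
  show ?thesis
    by (rule conjI[OF G2_structure_evolution trans[OF torsion_free_evolution_iff equations_in_charts_iff]])
      (rule h, assumption)+
qed

end
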